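(* Let $L,M>0$. There exists $\bar\kappa>0$ depending only on $L,M$ such that for every $\kappa_0\in(0,\bar\kappa]$ there are tuning constants $c_{\mathsf{srs},1}>0$ and $\alpha>0$ depending only on $L,M,\kappa_0$ for which the following holds. Let $\gamma>0$ and $\delta\in(0,1)$. Then there exist $C_\delta>0$ and an integer $N_0$, both depending only on $L,M,\kappa_0,\delta,\gamma$, such that for all $N=3n\ge N_0$, all $p\ge2$ with $p\ge\gamma n$ and all $1\le s\le\sqrt p$ with $s\log(ep/s)/N\le\kappa_0$, if the $\xi_i$ are $L$-subGaussian and the $X_{ij}$ are $M$-subGaussian, then, writing $\psi=\frac{s\log(1+\sqrt p/s)}N$: (a) the estimator $\hat\Lambda_S^{HD}$ satisfies $$\sup_{\sigma>0}\sup_{\boldsymbol\theta\in B_0(s)}\mathbf P_{\boldsymbol\theta,\sigma}\Big(\big|\hat\Lambda_S^{HD}-\|\boldsymbol\theta\|_2\big|>C_\delta\sigma\sqrt{\psi}\Big)\le\delta;$$ (b) the estimator $\hat Q_S^{HD}$ satisfies $$\sup_{\sigma>0}\sup_{\boldsymbol\theta\in B_0(s)}\mathbf P_{\boldsymbol\theta,\sigma}\Big(\big|\hat Q_S^{HD}-\|\boldsymbol\theta\|_2^2\big|>C_\delta\Big(\sigma^2\psi+\sigma\frac{\|\boldsymbol\theta\|_2}{\sqrt N}\Big)\Big)\le\delta;$$ (c) the minimax scaling satisfies $q^*_{\boldsymbol\theta}\le\min\big(C_\delta(\sigma^2\psi+\sigma\frac{\|\boldsymbol\theta\|_2}{\sqrt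 N}),\|\boldsymbol\theta\|_2^2\big)$, i.e. $$\inf_{\hat T}\sup_{\sigma>0}\sup_{\boldsymbol\theta\in B_0(s)}\mathbf P_{\boldsymbol\theta,\sigma}\Big(\big|\hat T-\|\boldsymbol\theta\|_2^2\big|>\min\Big(C_\delta\Big(\sigma^2\psi+\sigma\frac{\|\boldsymbol\theta\|_2}{\sqrt N}\Big),\|\boldsymbol\theta\|_2^2\Big)\Big)\le\delta;$$ (d) for every $\kappa>0$, $q^*_{s,\kappa}\le\min\big(C_\delta(\sigma^2\psi+\sigma\frac{\kappa}{\sqrt N}),\kappa^2\big)$, i.e. $$\inf_{\hat T}\sup_{\sigma>0}\ \sup_{\boldsymbol\theta\in B_0(s),\,\|\boldsymbol\theta\|_2\le\kappa}\mathbf P_{\boldsymbol\theta,\sigma}\Big(\big|\hat T-\|\boldsymbol\theta\|_2^2\big|>\min\Big(C_\delta\Big(\sigma^2\psi+\sigma\frac{\kappa}{\sqrt N}\Big),\kappa^2\Big)\Big)\le\delta.$$ Here $\inf_{\hat T}$ is the infimum over all estimators.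
   Context: Model: one observes $(\mathbb X,\mathbf Y)$ with $\mathbf Y=\mathbb X\boldsymbol\theta+\sigma\boldsymbol\xi$, where $\mathbb X=(X_{ij})$ is a random $N\times p$ matrix, $\boldsymbol\theta\in\mathbb R^p$, $\boldsymbol\xi=(\xi_1,\dots,\xi_N)\in\mathbb R^N$ is random noise and $\sigma>0$. The $N(p+1)$ random variables $X_{ij},\xi_i$ are jointly independent, with zero mean and variance $1$. $\mathbf P_{\boldsymbol\theta,\sigma}$ is the law of $(\mathbb X,\mathbf Y)$. $B_0(s)$ is the set of vectors in $\mathbb R^p$ with at most $s$ nonzero components. A random variable $Z$ is $L$-subGaussian if $\mathbf E\exp(tZ)\le\exp(L^2t^2/2)$ for all $t\in\mathbb R$. An estimator is a measurable function of $(\mathbb X,\mathbf Y)$ (not depending on $\boldsymbol\theta,\sigma$; it may depend on $p,N,s,\kappa,\delta$ and the constants). The sample is split (by rows) into three disjoint subsamples $(\mathbb X_i,\mathbf Y_i)$, $i=1,2,3$, each of size $n$. The Square-Root Slope estimator is $$\hat{\boldsymbol\theta}_{\mathsf{srs}}\in\arg\min_{\mathbf t\in\mathbb R^p}\Big\{\tfrac1{\sqrt n}\|\mathbf Y_1-\mathbb X_1\mathbf t\|_2+\|\mathbf t\|_*\Big\},\quad\|\mathbf t\|_*=\sum_{i=1}^p\lambda_i|t|_{(p-i+1)},\quad\lambda_j=c_{\mathsf{srs},1}\sqrt{\frac{\log(2p/j)}n},$$ where $|t|_{(1)}\le\dots\le|t|_{(p)}$ are the order statistics of $|t_1|,\dots,|t_p|$.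 Set $$\hat\sigma_{\mathsf{srs}}=\frac{\|\mathbf Y_1-\mathbb X_1\hat{\boldsymbol\theta}_{\mathsf{srs}}\|_2}{\sqrt n},\qquad\tilde{\boldsymbol\theta}_{\mathsf{srs}}=\hat{\boldsymbol\theta}_{\mathsf{srs}}+\frac1n\mathbb X_3^T(\mathbf Y_3-\mathbb X_3\hat{\boldsymbol\theta}_{\mathsf{srs}}).$$ For an estimator $\hat{\boldsymbol\theta}=(\hat\theta_1,\dots,\hat\theta_p)$ based on $(\mathbb X_1,\mathbf Y_1)$ define $$a_j(\hat{\boldsymbol\theta})=\hat\theta_j^2+\frac{2\hat\theta_j}{n}\mathbf X_{2,j}^T(\mathbf Y_2-\mathbb X_2\hat{\boldsymbol\theta})+\frac1{n(n-1)}\sum_{k\ne l}X_{2,kj}X_{2,lj}\big(Y_{2,k}-\mathbf X_2^k\hat{\boldsymbol\theta}\big)\big(Y_{2,l}-\mathbf X_2^l\hat{\boldsymbol\theta}\big),$$ where $\mathbf X_{2,j}$, $\mathbf X_2^k$ and $X_{2,kj}$ are the $j$th column, the $k$th row and the $(k,j)$ entry of $\mathbb X_2$, and $Y_{2,k}$ is the $k$th entry of $\mathbf Y_2$. With the convention used in the analysis, where the threshold is $\alpha\sqrt2\,\hat\sigma_{\mathsf{srs}}\sqrt{\log(1+p/s^2)/n}$, set $$\hat Q_S^{HD}=\sum_{j=1}^pa_j(\hat{\boldsymbol\theta}_{\mathsf{srs}})\,\mathbf 1\Big\{|\tilde\theta_{\mathsf{srs},j}|>\alpha\hat\sigma_{\mathsf{srs}}\sqrt{\tfrac{2\log(1+p/s^2)}{n}}\Big\},\qquad\hat\Lambda_S^{HD}=|\hat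 Q_S^{HD}|^{1/2}.$$ The minimax scaling $q^*_{\boldsymbol\theta}$ (depending on $\boldsymbol\theta$ only through $\|\boldsymbol\theta\|_2$ and $\|\boldsymbol\theta\|_0$) is understood as in (c), and $q^*_{s,\kappa}=\max\{q^*_{\boldsymbol\theta}:\|\boldsymbol\theta\|_0\le s,\|\boldsymbol\theta\|_2\le\kappa\}$ is the corresponding rate on $B_0(s)\cap\{\|\boldsymbol\theta\|_2\le\kappa\}$, understood as in (d). *)

theory Defs
  imports "HOL-Probability.Probability"
begin

text \<open>
  Since the dimensions vary inside the statement, $\mathbb{R}^p$ and $\mathbb{R}^{N\times p}$
  are represented by the extensional functions on index sets \<open>{..<p}\<close> and
  \<open>{..<N} \<times> {..<p}\<close>. All matrix and vector indices start at 0.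
\<close>

type_synonym vec = "nat \<Rightarrow> real"
type_synonym mtx = "nat \<times> nat \<Rightarrow> real"

definition vec_space :: "nat \<Rightarrow> vec measure" where
  "vec_space p = (\<Pi>\<^sub>M j\<in>{..<p}. borel)"

definition mtx_space :: "nat \<Rightarrow> nat \<Rightarrow> mtx measure" where
  "mtx_space N p = (\<Pi>\<^sub>M ij\<in>{..<N} \<times> {..<p}. borel)"

text \<open>The space of the pairs $(\mathbb{X}, \mathbf{Y})$, and also of the pairs $(\mathbb{X}, \xi)$.\<close>

definition sample_space :: "nat \<Rightarrow> nat \<Rightarrow> (mtx \<times> vec) measure" where
  "sample_space N p = mtx_space N p \<Otimes>\<^sub>M vec_space N"

definition B0 :: "nat \<Rightarrow> nat \<Rightarrow> vec set" where
  "B0 p s = {\<theta> \<in> {..<p} \<rightarrow>\<^sub>E UNIV. card {j \<in> {..<p}. \<theta> j \<noteq> 0} \<le> s}"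

text \<open>
  The nonnegative integral is used because the Bochner integral of a non-integrable function is 0.
\<close>

definition subgaussian :: "'a measure \<Rightarrow> real \<Rightarrow> ('a \<Rightarrow> real) \<Rightarrow> bool" where
  "subgaussian R L Z \<longleftrightarrow>
     (\<forall>t::real. (\<integral>\<^sup>+\<omega>. ennreal (exp (t * Z \<omega>)) \<partial>R) \<le> ennreal (exp (L\<^sup>2 * t\<^sup>2 / 2)))"

text \<open>
  The entries $X_{ij}$ (left summand) and $\xi_i$ (right summand) as random variables on the
  canonical space of pairs $(\mathbb{X}, \xi)$.
\<close>

fun model_var :: "(nat \<times> nat) + nat \<Rightarrow> mtx \<times> vec \<Rightarrow> real" where
  "model_var (Inl ij) \<omega> = fst \<omega> ij"
| "model_var (Inr i) \<omega> = snd \<omega> i"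

text \<open>
  \<open>R\<close> is the joint law of $(\mathbb{X}, \xi)$. Working with this law instead of an arbitrary
  underlying probability space loses nothing, and it permits quantifying over the model
  after the constants.
\<close>

definition model_law :: "nat \<Rightarrow> nat \<Rightarrow> (mtx \<times> vec) measure \<Rightarrow> bool" where
  "model_law N p R \<longleftrightarrow>
     prob_space R \<and> sets R = sets (sample_space N p) \<and>
     prob_space.indep_vars R (\<lambda>_. borel) model_var (({..<N} \<times> {..<p}) <+> {..<N}) \<and>
     (\<forall>v \<in> ({..<N} \<times> {..<p}) <+> {..<N}.
        integrable R (model_var v) \<and>
        prob_space.expectation R (model_var v) = 0 \<and>
        prob_space.variance R (model_var v) = 1)"

definition observe :: "nat \<Rightarrow> nat \<Rightarrow> vec \<Rightarrow> real \<Rightarrow> mtx \<times> vec \<Rightarrow> mtx \<times> vec" where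
  "observe N p \<theta> \<sigma> = (\<lambda>(X, \<xi>). (X, \<lambda>i\<in>{..<N}. (\<Sum>j<p. X (i, j) * \<theta> j) + \<sigma> * \<xi> i))"

text \<open>The law $\mathbf{P}_{\theta,\sigma}$ of $(\mathbb{X}, \mathbf{Y})$.\<close>

definition data_law ::
  "nat \<Rightarrow> nat \<Rightarrow> (mtx \<times> vec) measure \<Rightarrow> vec \<Rightarrow> real \<Rightarrow> (mtx \<times> vec) measure" where
  "data_law N p R \<theta> \<sigma> = distr R (sample_space N p) (observe N p \<theta> \<sigma>)"

definition estimators :: "nat \<Rightarrow> nat \<Rightarrow> (mtx \<times> vec \<Rightarrow> real) set" where
  "estimators N p = borel_measurable (sample_space N p)"

text \<open>
  Rows \<open>b * n, \<dots>, b * n + n - 1\<close> of the data; the three subsamples are \<open>b = 0, 1, 2\<close>.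
\<close>

definition subsample :: "nat \<Rightarrow> nat \<Rightarrow> nat \<Rightarrow> mtx \<times> vec \<Rightarrow> mtx \<times> vec" where
  "subsample n p b D =
     (\<lambda>(k, j)\<in>{..<n} \<times> {..<p}. fst D (b * n + k, j), \<lambda>k\<in>{..<n}. snd D (b * n + k))"

definition resid :: "nat \<Rightarrow> mtx \<times> vec \<Rightarrow> vec \<Rightarrow> vec" where
  "resid p D t k = snd D k - (\<Sum>j<p. fst D (k, j) * t j)"

text \<open>$|t|_{(k)}$ for $1 \le k \le p$, in increasing order.\<close>

definition abs_order_stat :: "nat \<Rightarrow> vec \<Rightarrow> nat \<Rightarrow> real" where
  "abs_order_stat p t k = sort (map (\<lambda>j. \<bar>t j\<bar>) [0..<p]) ! (k - 1)"

definition slope_weight :: "nat \<Rightarrow> nat \<Rightarrow> real \<Rightarrow> nat \<Rightarrow> real" where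
  "slope_weight n p c j = c * sqrt (ln (2 * real p / real j) / real n)"

definition slope_norm :: "nat \<Rightarrow> nat \<Rightarrow> real \<Rightarrow> vec \<Rightarrow> real" where
  "slope_norm n p c t = (\<Sum>i=1..p. slope_weight n p c i * abs_order_stat p t (p - i + 1))"

definition srs_objective :: "nat \<Rightarrow> nat \<Rightarrow> real \<Rightarrow> mtx \<times> vec \<Rightarrow> vec \<Rightarrow> real" where
  "srs_objective n p c D t = L2_set (resid p D t) {..<n} / sqrt (real n) + slope_norm n p c t"

text \<open>
  The minimizer need not be unique: a Square-Root Slope estimator is any measurable selection of
  minimizers, as a function of one subsample of size \<open>n\<close>.
\<close>

definition srs_estimator :: "nat \<Rightarrow> nat \<Rightarrow> real \<Rightarrow> (mtx \<times> vec \<Rightarrow> vec) \<Rightarrow> bool" where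
  "srs_estimator n p c th \<longleftrightarrow>
     th \<in> sample_space n p \<rightarrow>\<^sub>M vec_space p \<and>
     (\<forall>D \<in> space (sample_space n p).
        is_arg_min (srs_objective n p c D) (\<lambda>t. t \<in> {..<p} \<rightarrow>\<^sub>E UNIV) (th D))"

definition theta_srs :: "nat \<Rightarrow> nat \<Rightarrow> (mtx \<times> vec \<Rightarrow> vec) \<Rightarrow> mtx \<times> vec \<Rightarrow> vec" where
  "theta_srs n p th D = th (subsample n p 0 D)"

definition sigma_srs :: "nat \<Rightarrow> nat \<Rightarrow> (mtx \<times> vec \<Rightarrow> vec) \<Rightarrow> mtx \<times> vec \<Rightarrow> real" where
  "sigma_srs n p th D =
     L2_set (resid p (subsample n p 0 D) (theta_srs n p th D)) {..<n} / sqrt (real n)"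

definition theta_debiased :: "nat \<Rightarrow> nat \<Rightarrow> (mtx \<times> vec \<Rightarrow> vec) \<Rightarrow> mtx \<times> vec \<Rightarrow> vec" where
  "theta_debiased n p th D j =
     (let D3 = subsample n p 2 D; t = theta_srs n p th D
      in t j + (\<Sum>k<n. fst D3 (k, j) * resid p D3 t k) / real n)"

text \<open>$a_j$ as a function of the value \<open>t\<close> of the pilot estimator.\<close>

definition a_stat :: "nat \<Rightarrow> nat \<Rightarrow> mtx \<times> vec \<Rightarrow> vec \<Rightarrow> nat \<Rightarrow> real" where
  "a_stat n p D t j =
     (let D2 = subsample n p 1 D; X2 = fst D2; r = resid p D2 t
      in (t j)\<^sup>2 + 2 * t j / real n * (\<Sum>k<n. X2 (k, j) * r k)
         + 1 / (real n * (real n - 1)) *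
           (\<Sum>k<n. \<Sum>l\<in>{..<n} - {k}. X2 (k, j) * X2 (l, j) * r k * r l))"

definition Q_HD ::
  "nat \<Rightarrow> nat \<Rightarrow> nat \<Rightarrow> real \<Rightarrow> (mtx \<times> vec \<Rightarrow> vec) \<Rightarrow> mtx \<times> vec \<Rightarrow> real" where
  "Q_HD n p s \<alpha> th D =
     (\<Sum>j<p. a_stat n p D (theta_srs n p th D) j *
        of_bool (\<bar>theta_debiased n p th D j\<bar>
          > \<alpha> * sigma_srs n p th D * sqrt (2 * ln (1 + real p / (real s)\<^sup>2) / real n)))"

definition Lambda_HD ::
  "nat \<Rightarrow> nat \<Rightarrow> nat \<Rightarrow> real \<Rightarrow> (mtx \<times> vec \<Rightarrow> vec) \<Rightarrow> mtx \<times> vec \<Rightarrow> real" where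
  "Lambda_HD n p s \<alpha> th D = sqrt \<bar>Q_HD n p s \<alpha> th D\<bar>"

end

theory Submission
  imports Defs
begin

text \<open>
  The pilot estimator is only needed up to constants: with high probability its error is at most a
  multiple of $\sigma$ and its residual norm is comparable to $\sigma$. Both follow from a lower bound
  for $\|\mathbb{X}v+\tau\xi\|_2$ on a cone of vectors $(v,\tau)$, the noise being treated as one more
  column of the design. This lower bound is proved by a PAC-Bayes argument: randomized rounding to a
  weighted grid turns an exponential moment bound for fixed vectors into a uniform one, and the sparsity
  of the cone makes the entropy of the rounding at most a small multiple of $n$.

  Given the pilot, the debiased coordinates have Bernstein tails on the third subsample, so that the
  expected number of coordinates selected outside the support is at most of order $s^2$. On the second
  subsample, conditionally on the first and the third,
  $a_j-\theta_j^2$ is the sum of a centred linear term and a degenerate U-statistic; their variances summed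
  over the selected coordinates are of order $\sigma^2\|\theta\|_2^2/n$ and $\sigma^4s^2/n^2$. The
  coordinates of the support that are missed are below the threshold, up to the noise.

  For the minimax bounds the estimator of the quadratic functional is set to 0 below a multiple of
  $\hat\sigma^2\psi$. Its pilot is an approximate square-root Lasso estimator over rational vectors, because
  the Slope estimator is only given as a measurable selection that might not exist.
\<close>

section \<open>SubGaussian moments\<close>

text \<open>The step sqrt(l/n) of the rounding grid ties the entropy to the penalty. A coordinate
  v_j below its step b gets a nonzero code with probability |v_j|/b at a cost of order l, and
  l*|v_j|/b = n*b*|v_j|. So the total entropy is n times the weighted l1 norm that the cone bounds,
  and the rounding variances add up to the same norm. Rounding is unbiased and independent over
  coordinates, so it changes the mean of the quadratic form only through column norms; the operator
  norm of the design, too large for p far above n, never appears. Only a lower tail is treated,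
  where exp(-x) is at most 1 - x + x^2/2, so fourth moments suffice.

  The pilot error is only known to be of order \<sigma>, hence it must not multiply the linear term
  of a_j: centring turns the coefficient of that term into the true coordinate. About s^2 false
  selections are affordable because the variance of the U-statistic grows linearly, not
  quadratically, with the number of selected coordinates. This permits the threshold log(1+p/s^2) in
  place of log p.\<close>

lemma power_div_fact_le_exp:
  fixes x :: real
  assumes "x \<ge> 0"
  shows "x ^ n / fact n \<le> exp x"
proof -
  have "(\<Sum>k\<in>{n}. x ^ k /\<^sub>R fact k) \<le> (\<Sum>k. x ^ k /\<^sub>R fact k)"
    by (rule sum_le_suminf[OF summable_exp_generic]) (simp_all add: assms)
  then show ?thesis
    by (simp add: exp_def divide_inverse mult.commute)
qed

lemma square_le_exp:
  fixes x :: real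
  assumes "x \<ge> 0"
  shows "x\<^sup>2 \<le> 2 * exp x"
  using power_div_fact_le_exp[OF assms, of 2] by (simp add: eval_nat_numeral)

lemma exp_le_quadratic_remainder:
  fixes x :: real
  shows "exp x \<le> 1 + x + x\<^sup>2 * exp \<bar>x\<bar> / 2"
proof (cases "x = 0")
  case False
  obtain t where t: "\<bar>t\<bar> \<le> \<bar>x\<bar>" and e: "exp x = (\<Sum>m<2. x ^ m / fact m) + exp t / fact 2 * x ^ 2"
    using Maclaurin_exp_le[of x 2] by auto
  have "exp t \<le> exp \<bar>x\<bar>" using t by simp
  then have "exp t / 2 * x\<^sup>2 \<le> exp \<bar>x\<bar> / 2 * x\<^sup>2" by (intro mult_right_mono) auto
  then show ?thesis using e by (simp add: eval_nat_numeral field_simps)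
qed simp

text \<open>The third-order remainder is nonpositive here, so the bound carries no exponential
  factor. It serves the lower tail of sums of squares.\<close>

lemma exp_neg_le_quadratic:
  fixes x :: real
  assumes "x \<ge> 0"
  shows "exp (- x) \<le> 1 - x + x\<^sup>2 / 2"
proof -
  obtain t where t: "\<bar>t\<bar> \<le> \<bar>- x\<bar>" and e: "exp (- x) = (\<Sum>m<3. (- x) ^ m / fact m) + exp t / fact 3 * (- x) ^ 3"
    using Maclaurin_exp_le[of "- x" 3] by auto
  have "exp t / fact 3 * (- x) ^ 3 \<le> 0"
    using assms by (simp add: power3_eq_cube mult_nonneg_nonneg)
  then show ?thesis using e by (simp add: eval_nat_numeral field_simps)
qed

text \<open>The common bound for $\mathbf E\exp(Z^2/(8K^2))$ over all $K$-subGaussian $Z$.\<close>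

definition Csq :: real where "Csq = 2 * exp (1/4) / (1 - exp (-1/4))"

lemma Csq_gt: "Csq > 2"
proof -
  have "exp (1/4 :: real) > 1" "1 - exp (-1/4 :: real) < 1" "1 - exp (-1/4 :: real) > 0" by auto
  then have "2 * (1 - exp (-1/4)) < 2 * exp (1/4 :: real)" by (intro mult_strict_left_mono) linarith+
  then show ?thesis unfolding Csq_def using \<open>1 - exp (-1/4 :: real) > 0\<close> by (simp add: field_simps)
qed

text \<open>For m <= |y| < m+1 one has y^2 <= 2*m^2 + 2 and m^2 <= m*|y|. The exponential of a
  square is thus dominated by countably many exponentials at integer points, a discrete substitute
  for integrating against a Gaussian density.\<close>

lemma exp_square_le_cosh_sum:
  fixes y :: real
  defines "m \<equiv> nat \<lfloor>\<bar>y\<bar>\<rfloor>"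
  shows "exp (y\<^sup>2 / 8) \<le> exp (1/4) * exp (- (3/4) * (real m)\<^sup>2) * (exp (real m * y) + exp (- real m * y))"
proof -
  have m: "real m \<le> \<bar>y\<bar>" "\<bar>y\<bar> < real m + 1" unfolding m_def by auto
  have "y\<^sup>2 \<le> (real m + 1)\<^sup>2" using m by (metis abs_ge_zero less_eq_real_def power2_abs power_mono)
  also have "\<dots> \<le> 2 * (real m)\<^sup>2 + 2"
    using zero_le_power2[of "real m - 1"] by (simp add: power2_eq_square algebra_simps)
  finally have "y\<^sup>2 / 8 \<le> 1/4 - (3/4) * (real m)\<^sup>2 + (real m)\<^sup>2" by simp
  moreover have "(real m)\<^sup>2 \<le> real m * \<bar>y\<bar>" using m by (simp add: power2_eq_square mult_left_mono)
  ultimately have "exp (y\<^sup>2/8) \<le> exp (1/4 + - (3/4) * (real m)\<^sup>2 + real m * \<bar>y\<bar>)" by simp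
  also have "\<dots> = exp (1/4) * exp (- (3/4) * (real m)\<^sup>2) * exp (real m * \<bar>y\<bar>)"
    by (simp only: exp_add)
  also have "\<dots> \<le> exp (1/4) * exp (- (3/4) * (real m)\<^sup>2) * (exp (real m * y) + exp (- real m * y))"
    by (intro mult_left_mono) (auto simp: abs_if)
  finally show ?thesis .
qed

text \<open>The m-th term has the factor exp(-3*m^2/4) against the subGaussian bound exp(m^2/2),
  which leaves exp(-m^2/4) <= exp(-m/4). The resulting geometric series sums to
  \<open>Csq\<close>.\<close>

lemma subgaussian_exp_square:
  assumes "prob_space M" and [measurable]: "Z \<in> borel_measurable M"
    and "subgaussian M K Z" and "K > 0"
  shows "(\<integral>\<^sup>+\<omega>. ennreal (exp ((Z \<omega>)\<^sup>2 / (8 * K\<^sup>2))) \<partial>M) \<le> ennreal Csq"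
proof -
  let ?r = "exp (-1/4) :: real"
  define f where "f m y = exp (1/4) * exp (- (3/4) * (real m)\<^sup>2) * (exp (real m * y) + exp (- real m * y))" for m :: nat and y :: real
  have f0: "f m y \<ge> 0" for m y unfolding f_def by (auto simp: add_nonneg_nonneg)
  have mgf: "(\<integral>\<^sup>+\<omega>. ennreal (exp (t / K * Z \<omega>)) \<partial>M) \<le> ennreal (exp (t\<^sup>2 / 2))" for t
  proof -
    have "(\<integral>\<^sup>+\<omega>. ennreal (exp (t / K * Z \<omega>)) \<partial>M) \<le> ennreal (exp (K\<^sup>2 * (t/K)\<^sup>2 / 2))"
      using assms(3) unfolding subgaussian_def by blast
    also have "K\<^sup>2 * (t/K)\<^sup>2 / 2 = t\<^sup>2 / 2" using \<open>K > 0\<close> by (simp add: power_divide)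
    finally show ?thesis .
  qed
  have trm: "(\<integral>\<^sup>+\<omega>. ennreal (f m (Z \<omega> / K)) \<partial>M) \<le> ennreal (2 * exp (1/4) * ?r ^ m)" for m
  proof -
    let ?c = "exp (1/4) * exp (- (3/4) * (real m)\<^sup>2)"
    have "(\<integral>\<^sup>+\<omega>. ennreal (f m (Z \<omega> / K)) \<partial>M)
        = (\<integral>\<^sup>+\<omega>. ennreal ?c * (ennreal (exp (real m / K * Z \<omega>)) + ennreal (exp (- real m / K * Z \<omega>))) \<partial>M)"
      unfolding f_def by (intro nn_integral_cong) (simp add: ennreal_mult' flip: ennreal_plus)
    also have "\<dots> = ennreal ?c * ((\<integral>\<^sup>+\<omega>. ennreal (exp (real m / K * Z \<omega>)) \<partial>M) + (\<integral>\<^sup>+\<omega>. ennreal (exp (- real m / K * Z \<omega>)) \<partial>M))"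
      by (subst nn_integral_cmult) (auto simp: nn_integral_add)
    also have "\<dots> \<le> ennreal ?c * (ennreal (exp ((real m)\<^sup>2 / 2)) + ennreal (exp ((- real m)\<^sup>2 / 2)))"
      using mgf[of "real m"] mgf[of "- real m"] by (intro mult_left_mono add_mono) auto
    also have "\<dots> = ennreal (?c * (2 * exp ((real m)\<^sup>2 / 2)))"
      by (simp add: ennreal_mult' flip: ennreal_plus)
    also have "\<dots> \<le> ennreal (2 * exp (1/4) * ?r ^ m)"
    proof (rule ennreal_leI)
      have "real m \<le> (real m)\<^sup>2" by (cases m) (auto simp: power2_eq_square)
      then have "exp (- (3/4) * (real m)\<^sup>2 + (real m)\<^sup>2 / 2) \<le> exp (real m * (-1/4))" by simp
      then have *: "exp (- (3/4) * (real m)\<^sup>2) * exp ((real m)\<^sup>2 / 2) \<le> ?r ^ m"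
        by (simp only: exp_add exp_of_nat_mult)
      have "?c * (2 * exp ((real m)\<^sup>2 / 2)) = 2 * exp (1/4) * (exp (- (3/4) * (real m)\<^sup>2) * exp ((real m)\<^sup>2 / 2))"
        by (simp only: mult_ac)
      also have "\<dots> \<le> 2 * exp (1/4) * ?r ^ m"
        using * by (intro mult_left_mono) auto
      finally show "?c * (2 * exp ((real m)\<^sup>2 / 2)) \<le> 2 * exp (1/4) * ?r ^ m" .
    qed
    finally show ?thesis .
  qed
  have "(\<integral>\<^sup>+\<omega>. ennreal (exp ((Z \<omega>)\<^sup>2 / (8 * K\<^sup>2))) \<partial>M) \<le> (\<integral>\<^sup>+\<omega>. (\<Sum>m. ennreal (f m (Z \<omega> / K))) \<partial>M)"
  proof (rule nn_integral_mono)
    fix \<omega>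
    let ?m = "nat \<lfloor>\<bar>Z \<omega> / K\<bar>\<rfloor>"
    have "exp ((Z \<omega>)\<^sup>2 / (8 * K\<^sup>2)) = exp ((Z \<omega> / K)\<^sup>2 / 8)" by (simp add: power_divide)
    also have "\<dots> \<le> f ?m (Z \<omega> / K)" unfolding f_def by (rule exp_square_le_cosh_sum)
    finally have "ennreal (exp ((Z \<omega>)\<^sup>2 / (8 * K\<^sup>2))) \<le> (\<Sum>m\<in>{?m}. ennreal (f m (Z \<omega> / K)))"
      by (simp add: ennreal_leI)
    also have "\<dots> \<le> (\<Sum>m. ennreal (f m (Z \<omega> / K)))" by (rule sum_le_suminf) auto
    finally show "ennreal (exp ((Z \<omega>)\<^sup>2 / (8 * K\<^sup>2))) \<le> (\<Sum>m. ennreal (f m (Z \<omega> / K)))" .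
  qed
  also have "\<dots> = (\<Sum>m. \<integral>\<^sup>+\<omega>. ennreal (f m (Z \<omega> / K)) \<partial>M)"
    unfolding f_def by (rule nn_integral_suminf) simp
  also have "\<dots> \<le> (\<Sum>m. ennreal (2 * exp (1/4) * ?r ^ m))"
    by (rule suminf_le[OF trm]) auto
  also have "\<dots> = ennreal (\<Sum>m. 2 * exp (1/4) * ?r ^ m)"
    by (rule suminf_ennreal2) (auto intro!: summable_mult summable_geometric)
  also have "(\<Sum>m. 2 * exp (1/4) * ?r ^ m) = Csq"
    by (subst suminf_mult) (auto simp: summable_geometric suminf_geometric Csq_def)
  finally show ?thesis .
qed

lemma integrable_nonneg_bounded:
  assumes [measurable]: "f \<in> borel_measurable M" and "\<And>x. f x \<ge> (0::real)"
    and le: "(\<integral>\<^sup>+x. ennreal (f x) \<partial>M) \<le> ennreal c" and "c \<ge> 0"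
  shows "integrable M f" and "(\<integral>x. f x \<partial>M) \<le> c"
proof -
  show i: "integrable M f"
    using le assms(2) by (intro integrableI_bounded) (auto simp: le_less_trans)
  have "ennreal (\<integral>x. f x \<partial>M) \<le> ennreal c"
    using le assms(2) by (subst nn_integral_eq_integral[symmetric, OF i]) auto
  then show "(\<integral>x. f x \<partial>M) \<le> c" using \<open>c \<ge> 0\<close> by simp
qed

lemma subgaussian_mono:
  assumes "subgaussian M K Z" "K\<^sup>2 \<le> K'\<^sup>2"
  shows "subgaussian M K' Z"
  unfolding subgaussian_def
proof
  fix t :: real
  have "K\<^sup>2 * t\<^sup>2 / 2 \<le> K'\<^sup>2 * t\<^sup>2 / 2"
    using assms(2) by (intro divide_right_mono mult_right_mono) auto
  then show "(\<integral>\<^sup>+\<omega>. ennreal (exp (t * Z \<omega>)) \<partial>M) \<le> ennreal (exp (K'\<^sup>2 * t\<^sup>2 / 2))"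
    using assms(1) unfolding subgaussian_def by (meson ennreal_leI exp_le_cancel_iff order_trans)
qed

text \<open>The quadratic Taylor bound, integrated. For |l| <= 1/(2*a), half of the exponent |y|/a
  absorbs y^2 and the other half absorbs exp |l*y|. The mean is removed only at the end, because Y
  itself need not be centred.\<close>

lemma mgf_of_exp_moment:
  fixes a l c :: real
  assumes "prob_space M" and [measurable]: "Y \<in> borel_measurable M"
    and int: "integrable M (\<lambda>\<omega>. exp (\<bar>Y \<omega>\<bar> / a))" and le: "(\<integral>\<omega>. exp (\<bar>Y \<omega>\<bar> / a) \<partial>M) \<le> c"
    and "a > 0" and lam: "\<bar>l\<bar> \<le> 1 / (2 * a)"
  shows "integrable M Y" and "integrable M (\<lambda>\<omega>. exp (l * (Y \<omega> - (\<integral>\<omega>. Y \<omega> \<partial>M))))"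
    and "(\<integral>\<omega>. exp (l * (Y \<omega> - (\<integral>\<omega>. Y \<omega> \<partial>M))) \<partial>M) \<le> exp (4 * l\<^sup>2 * a\<^sup>2 * c)"
proof -
  interpret prob_space M by fact
  show iY: "integrable M Y"
  proof (rule Bochner_Integration.integrable_bound[OF integrable_mult_right[OF int, of a]])
    show "AE x in M. norm (Y x) \<le> norm (a * exp (\<bar>Y x\<bar> / a))"
    proof (rule AE_I2)
      fix x
      have "\<bar>Y x\<bar> / a \<le> exp (\<bar>Y x\<bar> / a)" using exp_ge_add_one_self[of "\<bar>Y x\<bar> / a"] by linarith
      then show "norm (Y x) \<le> norm (a * exp (\<bar>Y x\<bar> / a))" using \<open>a > 0\<close> by (simp add: field_simps)
    qed
  qed simp
  let ?m = "\<integral>\<omega>. Y \<omega> \<partial>M"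
  have pt: "exp (l * y) \<le> 1 + l * y + 4 * l\<^sup>2 * a\<^sup>2 * exp (\<bar>y\<bar> / a)" for y
  proof -
    let ?z = "\<bar>y\<bar> / a"
    have z: "?z \<ge> 0" using \<open>a > 0\<close> by simp
    have ly: "\<bar>l * y\<bar> \<le> ?z / 2"
      using mult_right_mono[OF lam, of "\<bar>y\<bar>"] \<open>a > 0\<close> by (simp add: abs_mult field_simps)
    have "(?z/2)\<^sup>2 \<le> 2 * exp (?z/2)" using z by (intro square_le_exp) simp
    then have z2: "?z\<^sup>2 \<le> 8 * exp (?z/2)" by (simp add: power_divide)
    have "(l*y)\<^sup>2 = l\<^sup>2 * a\<^sup>2 * ?z\<^sup>2" using \<open>a > 0\<close> by (simp add: power_mult_distrib power_divide)
    also have "\<dots> \<le> l\<^sup>2 * a\<^sup>2 * (8 * exp (?z/2))" using z2 by (intro mult_left_mono) auto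
    finally have "(l*y)\<^sup>2 * exp \<bar>l*y\<bar> \<le> l\<^sup>2 * a\<^sup>2 * (8 * exp (?z/2)) * exp (?z/2)"
      using ly by (intro mult_mono) auto
    also have "\<dots> = 8 * (l\<^sup>2 * a\<^sup>2 * exp ?z)"
      using exp_add[of "?z/2" "?z/2"] by (simp add: mult_ac)
    finally show ?thesis using exp_le_quadratic_remainder[of "l*y"] by (simp add: mult_ac)
  qed
  have ie: "integrable M (\<lambda>\<omega>. exp (l * Y \<omega>))"
  proof (rule Bochner_Integration.integrable_bound[OF int])
    show "AE x in M. norm (exp (l * Y x)) \<le> norm (exp (\<bar>Y x\<bar> / a))"
    proof (rule AE_I2)
      fix x
      have "l * Y x \<le> \<bar>l\<bar> * \<bar>Y x\<bar>" by (metis abs_ge_self abs_mult)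
      also have "\<dots> \<le> 1/(2*a) * \<bar>Y x\<bar>" using lam by (intro mult_right_mono) auto
      also have "\<dots> \<le> \<bar>Y x\<bar>/a" using \<open>a > 0\<close> by (simp add: field_simps)
      finally show "norm (exp (l * Y x)) \<le> norm (exp (\<bar>Y x\<bar> / a))" by simp
    qed
  qed simp
  have eq: "exp (l * (Y \<omega> - ?m)) = exp (- l * ?m) * exp (l * Y \<omega>)" for \<omega>
    by (simp add: algebra_simps flip: exp_add)
  show "integrable M (\<lambda>\<omega>. exp (l * (Y \<omega> - ?m)))" unfolding eq using ie by simp
  have "(\<integral>\<omega>. exp (l * Y \<omega>) \<partial>M) \<le> (\<integral>\<omega>. 1 + l * Y \<omega> + 4 * l\<^sup>2 * a\<^sup>2 * exp (\<bar>Y \<omega>\<bar> / a) \<partial>M)"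
    using ie iY int pt by (intro integral_mono) auto
  also have "\<dots> = 1 + l * ?m + 4 * l\<^sup>2 * a\<^sup>2 * (\<integral>\<omega>. exp (\<bar>Y \<omega>\<bar> / a) \<partial>M)"
    using iY int by (simp add: prob_space)
  also have "\<dots> \<le> 1 + l * ?m + 4 * l\<^sup>2 * a\<^sup>2 * c"
    using le by (intro add_left_mono mult_left_mono) auto
  also have "\<dots> \<le> exp (l * ?m + 4 * l\<^sup>2 * a\<^sup>2 * c)"
    using exp_ge_add_one_self[of "l * ?m + 4 * l\<^sup>2 * a\<^sup>2 * c"] by linarith
  finally have *: "(\<integral>\<omega>. exp (l * Y \<omega>) \<partial>M) \<le> exp (l * ?m + 4 * l\<^sup>2 * a\<^sup>2 * c)" .
  have "(\<integral>\<omega>. exp (l * (Y \<omega> - ?m)) \<partial>M) = exp (- l * ?m) * (\<integral>\<omega>. exp (l * Y \<omega>) \<partial>M)"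
    unfolding eq by simp
  also have "\<dots> \<le> exp (- l * ?m) * exp (l * ?m + 4 * l\<^sup>2 * a\<^sup>2 * c)"
    using * by (intro mult_left_mono) auto
  also have "\<dots> = exp (4 * l\<^sup>2 * a\<^sup>2 * c)" by (simp flip: exp_add)
  finally show "(\<integral>\<omega>. exp (l * (Y \<omega> - ?m)) \<partial>M) \<le> exp (4 * l\<^sup>2 * a\<^sup>2 * c)" .
qed

lemma power4_le_exp_square:
  fixes y a :: real
  assumes "a > 0"
  shows "y ^ 4 \<le> 2 * a\<^sup>2 * exp (y\<^sup>2 / a)"
proof -
  have "(y\<^sup>2 / a)\<^sup>2 \<le> 2 * exp (y\<^sup>2 / a)" using assms by (intro square_le_exp) simp
  then have "a\<^sup>2 * (y\<^sup>2 / a)\<^sup>2 \<le> a\<^sup>2 * (2 * exp (y\<^sup>2 / a))" by (intro mult_left_mono) auto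
  moreover have "a\<^sup>2 * (y\<^sup>2 / a)\<^sup>2 = y ^ 4" using assms by (simp add: power_divide flip: power_mult)
  ultimately show ?thesis by (simp add: mult_ac)
qed

lemma prod_mono_ennreal:
  fixes f g :: "'b \<Rightarrow> ennreal"
  assumes "\<And>i. i \<in> A \<Longrightarrow> f i \<le> g i"
  shows "(\<Prod>i\<in>A. f i) \<le> (\<Prod>i\<in>A. g i)"
  using assms by (induction A rule: infinite_finite_induct) (auto intro: mult_mono)

lemma exp_half_add_le:
  fixes a b :: real
  shows "exp ((a + b) / 2) \<le> (exp a + exp b) / 2"
proof -
  have "0 \<le> (exp (a/2) - exp (b/2))\<^sup>2" by simp
  also have "\<dots> = exp a + exp b - 2 * exp ((a + b) / 2)"
    by (simp add: power2_eq_square algebra_simps add_divide_distrib flip: exp_add)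
  finally show ?thesis by simp
qed

definition dot :: "nat \<Rightarrow> vec \<Rightarrow> vec \<Rightarrow> real" where
  "dot P u v = (\<Sum>j<P. u j * v j)"

lemma dot_self_nonneg: "dot P v v \<ge> 0"
  unfolding dot_def by (intro sum_nonneg) auto

lemma dot_measurable [measurable]:
  "dot P v \<in> borel_measurable (vec_space P)"
  unfolding dot_def vec_space_def by measurable

section \<open>Arrays of independent subGaussian variables\<close>

text \<open>One constant K serves all entries, so that the noise can be a column like the others; P
  will be one more than the number of covariates.\<close>

locale subg_array = prob_space M for M :: "'a measure" +
  fixes n P :: nat and K :: real and Z :: "nat \<times> nat \<Rightarrow> 'a \<Rightarrow> real"
  assumes K_pos: "K > 0"
    and indep: "indep_vars (\<lambda>_. borel) Z ({..<n} \<times> {..<P})"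
    and mean0: "i \<in> {..<n} \<times> {..<P} \<Longrightarrow> expectation (Z i) = 0"
    and var1: "i \<in> {..<n} \<times> {..<P} \<Longrightarrow> variance (Z i) = 1"
    and subg: "i \<in> {..<n} \<times> {..<P} \<Longrightarrow> subgaussian M K (Z i)"
begin

definition row :: "nat \<Rightarrow> 'a \<Rightarrow> vec" where
  "row k \<omega> = (\<lambda>j\<in>{..<P}. Z (k, j) \<omega>)"

definition lin :: "vec \<Rightarrow> nat \<Rightarrow> 'a \<Rightarrow> real" where
  "lin v k \<omega> = dot P v (row k \<omega>)"

lemma lin_eq: "lin v k \<omega> = (\<Sum>j<P. v j * Z (k, j) \<omega>)"
  unfolding lin_def dot_def row_def by simp

lemma Z_measurable [measurable]: "i \<in> {..<n} \<times> {..<P} \<Longrightarrow> Z i \<in> borel_measurable M"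
  using indep unfolding indep_vars_def by auto

lemma row_indep: "indep_vars (\<lambda>_. vec_space P) row {..<n}"
proof -
  have "indep_vars (\<lambda>k. PiM ({k} \<times> {..<P}) (\<lambda>_. borel)) (\<lambda>k \<omega>. restrict (\<lambda>i. Z i \<omega>) ({k} \<times> {..<P})) {..<n}"
    by (rule indep_vars_restrict[OF indep]) (auto simp: disjoint_family_on_def)
  then have "indep_vars (\<lambda>_. vec_space P) (\<lambda>k \<omega>. (\<lambda>f. \<lambda>j\<in>{..<P}. f (k, j)) (restrict (\<lambda>i. Z i \<omega>) ({k} \<times> {..<P}))) {..<n}"
    by (rule indep_vars_compose2, unfold vec_space_def, intro measurable_restrict measurable_component_singleton) auto
  then show ?thesis
    by (rule indep_vars_cong[THEN iffD1, rotated -1]) (auto simp: row_def fun_eq_iff)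
qed

lemma row_measurable [measurable]: "k < n \<Longrightarrow> row k \<in> M \<rightarrow>\<^sub>M vec_space P"
  using row_indep unfolding indep_vars_def by auto

lemma lin_measurable [measurable]: "k < n \<Longrightarrow> lin v k \<in> borel_measurable M"
  unfolding lin_def by measurable

lemma row_fun_indep:
  assumes "\<And>k. k < n \<Longrightarrow> g k \<in> borel_measurable (vec_space P)"
  shows "indep_vars (\<lambda>_. borel) (\<lambda>k \<omega>. g k (row k \<omega>)) {..<n}"
  by (rule indep_vars_compose2[OF row_indep]) (use assms in auto)

lemma lin_subgaussian:
  assumes "k < n"
  shows "subgaussian M (K * sqrt (dot P v v)) (lin v k)"
  unfolding subgaussian_def
proof
  fix t :: real
  have ind: "indep_vars (\<lambda>_. borel) (\<lambda>i \<omega>. exp (t * v (snd i) * Z i \<omega>)) ({k} \<times> {..<P})"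
    by (rule indep_vars_compose2[OF indep_vars_subset[OF indep]]) (use assms in auto)
  have "exp (t * lin v k \<omega>) = (\<Prod>i\<in>{k} \<times> {..<P}. exp (t * v (snd i) * Z i \<omega>))" for \<omega>
  proof -
    have "(\<Prod>i\<in>{k} \<times> {..<P}. exp (t * v (snd i) * Z i \<omega>)) = exp (\<Sum>i\<in>{k} \<times> {..<P}. t * v (snd i) * Z i \<omega>)"
      by (simp add: exp_sum)
    also have "(\<Sum>i\<in>{k} \<times> {..<P}. t * v (snd i) * Z i \<omega>) = (\<Sum>j<P. t * v j * Z (k, j) \<omega>)"
      by (rule sum.reindex_bij_witness[of _ "Pair k" snd]) auto
    finally show ?thesis by (simp add: lin_eq sum_distrib_left mult.assoc)
  qed
  then have "(\<integral>\<^sup>+\<omega>. ennreal (exp (t * lin v k \<omega>)) \<partial>M)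
      = (\<integral>\<^sup>+\<omega>. (\<Prod>i\<in>{k} \<times> {..<P}. ennreal (exp (t * v (snd i) * Z i \<omega>))) \<partial>M)"
    by (simp add: prod_ennreal)
  also have "\<dots> = (\<Prod>i\<in>{k} \<times> {..<P}. \<integral>\<^sup>+\<omega>. ennreal (exp (t * v (snd i) * Z i \<omega>)) \<partial>M)"
  proof -
    have "indep_vars (\<lambda>_. borel) (\<lambda>i \<omega>. ennreal (exp (t * v (snd i) * Z i \<omega>))) ({k} \<times> {..<P})"
      by (rule indep_vars_compose2[OF ind]) auto
    then show ?thesis by (intro indep_vars_nn_integral) auto
  qed
  also have "\<dots> \<le> (\<Prod>i\<in>{k} \<times> {..<P}. ennreal (exp (K\<^sup>2 * (t * v (snd i))\<^sup>2 / 2)))"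
    using subg assms unfolding subgaussian_def by (intro prod_mono_ennreal) auto
  also have "\<dots> = ennreal (exp (\<Sum>i\<in>{k} \<times> {..<P}. K\<^sup>2 * (t * v (snd i))\<^sup>2 / 2))"
    by (simp add: prod_ennreal exp_sum)
  also have "(\<Sum>i\<in>{k} \<times> {..<P}. K\<^sup>2 * (t * v (snd i))\<^sup>2 / 2) = (\<Sum>j<P. K\<^sup>2 * (t * v j)\<^sup>2 / 2)"
    by (rule sum.reindex_bij_witness[of _ "Pair k" snd]) auto
  also have "\<dots> = (\<Sum>j<P. (K\<^sup>2 * t\<^sup>2 / 2) * (v j * v j))"
    by (intro sum.cong refl) (simp add: power2_eq_square)
  also have "\<dots> = (K\<^sup>2 * t\<^sup>2 / 2) * dot P v v"
    unfolding dot_def by (rule sum_distrib_left[symmetric])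
  also have "\<dots> = (K * sqrt (dot P v v))\<^sup>2 * t\<^sup>2 / 2"
    using dot_self_nonneg[of P v] by (simp add: power_mult_distrib)
  finally show "(\<integral>\<^sup>+\<omega>. ennreal (exp (t * lin v k \<omega>)) \<partial>M) \<le> ennreal (exp ((K * sqrt (dot P v v))\<^sup>2 * t\<^sup>2 / 2))" .
qed

lemma lin_exp_square:
  assumes "k < n" "dot P v v > 0"
  shows "integrable M (\<lambda>\<omega>. exp ((lin v k \<omega>)\<^sup>2 / (8 * K\<^sup>2 * dot P v v)))"
    and "expectation (\<lambda>\<omega>. exp ((lin v k \<omega>)\<^sup>2 / (8 * K\<^sup>2 * dot P v v))) \<le> Csq"
proof -
  have "(\<integral>\<^sup>+\<omega>. ennreal (exp ((lin v k \<omega>)\<^sup>2 / (8 * (K * sqrt (dot P v v))\<^sup>2))) \<partial>M) \<le> ennreal Csq"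
    using assms K_pos prob_space_axioms lin_subgaussian[of k v] by (intro subgaussian_exp_square) auto
  also have "8 * (K * sqrt (dot P v v))\<^sup>2 = 8 * K\<^sup>2 * dot P v v"
    using assms(2) by (simp add: power_mult_distrib)
  finally show "integrable M (\<lambda>\<omega>. exp ((lin v k \<omega>)\<^sup>2 / (8 * K\<^sup>2 * dot P v v)))"
    and "expectation (\<lambda>\<omega>. exp ((lin v k \<omega>)\<^sup>2 / (8 * K\<^sup>2 * dot P v v))) \<le> Csq"
    using assms(1) Csq_gt by (auto intro!: integrable_nonneg_bounded[where c = Csq])
qed

text \<open>From \<open>power4_le_exp_square\<close> at the scale 8*K^2*dot P v v: the factor is
  2*8^2 = 128.\<close>

definition B4 :: real where "B4 = 128 * K ^ 4 * Csq"

lemma lin_zero: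
  assumes "dot P v v = 0"
  shows "lin v k \<omega> = 0"
proof -
  have "v j = 0" if "j < P" for j
    using assms that by (simp add: dot_def sum_nonneg_eq_0_iff)
  then show ?thesis by (simp add: lin_eq)
qed

lemma B4_pos: "B4 > 0" using K_pos Csq_gt by (simp add: B4_def)

lemma lin_fourth:
  assumes "k < n"
  shows "integrable M (\<lambda>\<omega>. (lin v k \<omega>) ^ 4)"
    and "expectation (\<lambda>\<omega>. (lin v k \<omega>) ^ 4) \<le> B4 * (dot P v v)\<^sup>2"
proof -
  have "integrable M (\<lambda>\<omega>. (lin v k \<omega>) ^ 4) \<and> expectation (\<lambda>\<omega>. (lin v k \<omega>) ^ 4) \<le> B4 * (dot P v v)\<^sup>2"
  proof (cases "dot P v v = 0")
    case False
    then have pos: "dot P v v > 0" using dot_self_nonneg[of P v] by simp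
    let ?a = "8 * K\<^sup>2 * dot P v v"
    have a: "?a > 0" using pos K_pos by simp
    note e = lin_exp_square[OF assms pos]
    have int: "integrable M (\<lambda>\<omega>. (lin v k \<omega>) ^ 4)"
    proof (rule Bochner_Integration.integrable_bound[OF integrable_mult_right[OF e(1), of "2 * ?a\<^sup>2"]])
      show "AE \<omega> in M. norm ((lin v k \<omega>) ^ 4) \<le> norm (2 * ?a\<^sup>2 * exp ((lin v k \<omega>)\<^sup>2 / ?a))"
        using power4_le_exp_square[OF a] by simp
    qed (use assms in measurable)
    have "expectation (\<lambda>\<omega>. (lin v k \<omega>) ^ 4) \<le> expectation (\<lambda>\<omega>. 2 * ?a\<^sup>2 * exp ((lin v k \<omega>)\<^sup>2 / ?a))"
      by (intro integral_mono int integrable_mult_right[OF e(1)] power4_le_exp_square[OF a])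
    also have "\<dots> \<le> 2 * ?a\<^sup>2 * Csq"
      using e(2) by (simp add: mult_left_mono)
    also have "\<dots> = B4 * (dot P v v)\<^sup>2"
      by (simp add: B4_def power_mult_distrib flip: power_mult)
    finally show ?thesis using int by simp
  qed (simp add: lin_zero)
  then show "integrable M (\<lambda>\<omega>. (lin v k \<omega>) ^ 4)"
    and "expectation (\<lambda>\<omega>. (lin v k \<omega>) ^ 4) \<le> B4 * (dot P v v)\<^sup>2" by auto
qed

text \<open>AM-GM with a weight replaces Cauchy-Schwarz. The weight dot P v v / dot P u u balances
  the two fourth moments and produces the product of the norms.\<close>

lemma lin_square_prod:
  assumes "k < n"
  shows "integrable M (\<lambda>\<omega>. (lin u k \<omega>)\<^sup>2 * (lin v k \<omega>)\<^sup>2)"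
    and "expectation (\<lambda>\<omega>. (lin u k \<omega>)\<^sup>2 * (lin v k \<omega>)\<^sup>2) \<le> B4 * dot P u u * dot P v v"
proof -
  note u = lin_fourth[OF assms, of u] and v = lin_fourth[OF assms, of v]
  have am: "x\<^sup>2 * y\<^sup>2 \<le> (x ^ 4 * c + y ^ 4 / c) / 2" if "c > 0" for x y c :: real
  proof -
    have "0 \<le> (x\<^sup>2 * c - y\<^sup>2)\<^sup>2 / c" using that by simp
    also have "\<dots> = x ^ 4 * c + y ^ 4 / c - 2 * (x\<^sup>2 * y\<^sup>2)"
      using that by (simp add: power2_eq_square power4_eq_xxxx field_simps)
    finally show ?thesis by simp
  qed
  have half: "0 \<le> x \<Longrightarrow> x \<le> y / 2 \<Longrightarrow> x \<le> y" for x y :: real by simp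
  show int: "integrable M (\<lambda>\<omega>. (lin u k \<omega>)\<^sup>2 * (lin v k \<omega>)\<^sup>2)"
  proof (rule Bochner_Integration.integrable_bound[OF Bochner_Integration.integrable_add[OF u(1) v(1)]])
    show "AE \<omega> in M. norm ((lin u k \<omega>)\<^sup>2 * (lin v k \<omega>)\<^sup>2) \<le> norm (lin u k \<omega> ^ 4 + lin v k \<omega> ^ 4)"
    proof (rule AE_I2)
      fix \<omega>
      have "(lin u k \<omega>)\<^sup>2 * (lin v k \<omega>)\<^sup>2 \<le> (lin u k \<omega> ^ 4 + lin v k \<omega> ^ 4) / 2"
        using am[of 1 "lin u k \<omega>" "lin v k \<omega>"] by simp
      moreover have "0 \<le> (lin u k \<omega>)\<^sup>2 * (lin v k \<omega>)\<^sup>2" by simp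
      ultimately have "(lin u k \<omega>)\<^sup>2 * (lin v k \<omega>)\<^sup>2 \<le> lin u k \<omega> ^ 4 + lin v k \<omega> ^ 4"
        by (rule half[rotated])
      then show "norm ((lin u k \<omega>)\<^sup>2 * (lin v k \<omega>)\<^sup>2) \<le> norm (lin u k \<omega> ^ 4 + lin v k \<omega> ^ 4)"
        by simp
    qed
  qed (use assms in measurable)
  show "expectation (\<lambda>\<omega>. (lin u k \<omega>)\<^sup>2 * (lin v k \<omega>)\<^sup>2) \<le> B4 * dot P u u * dot P v v"
  proof (cases "dot P u u = 0 \<or> dot P v v = 0")
    case False
    then have pos: "dot P u u > 0" "dot P v v > 0"
      by (simp_all add: less_le dot_self_nonneg)
    let ?c = "dot P v v / dot P u u"
    have c: "?c > 0" using pos by simp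
    have "expectation (\<lambda>\<omega>. (lin u k \<omega>)\<^sup>2 * (lin v k \<omega>)\<^sup>2)
        \<le> expectation (\<lambda>\<omega>. (lin u k \<omega> ^ 4 * ?c + lin v k \<omega> ^ 4 / ?c) / 2)"
      by (intro integral_mono int am c Bochner_Integration.integrable_divide Bochner_Integration.integrable_add integrable_mult_left u(1) v(1))
    also have "\<dots> = (expectation (\<lambda>\<omega>. lin u k \<omega> ^ 4) * ?c + expectation (\<lambda>\<omega>. lin v k \<omega> ^ 4) / ?c) / 2"
      using u(1) v(1) by simp
    also have "\<dots> \<le> (B4 * (dot P u u)\<^sup>2 * ?c + B4 * (dot P v v)\<^sup>2 / ?c) / 2"
      using u(2) v(2) c by (intro divide_right_mono add_mono mult_right_mono) auto
    also have "\<dots> = B4 * dot P u u * dot P v v"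
      using pos by (simp add: power2_eq_square)
    finally show ?thesis .
  qed (auto simp: lin_zero)
qed

lemma integrable_of_square:
  assumes [measurable]: "f \<in> borel_measurable M" and "integrable M (\<lambda>\<omega>. (f \<omega>)\<^sup>2 :: real)"
  shows "integrable M f"
proof (rule Bochner_Integration.integrable_bound[of _ "\<lambda>\<omega>. (f \<omega>)\<^sup>2 + 1"])
  have "\<bar>x\<bar> \<le> x\<^sup>2 + 1" for x :: real
  proof -
    have "0 \<le> (\<bar>x\<bar> - 1)\<^sup>2" by simp
    also have "\<dots> = x\<^sup>2 + 1 - 2 * \<bar>x\<bar>" by (simp add: power2_eq_square algebra_simps)
    finally show ?thesis by linarith
  qed
  then show "AE x in M. norm (f x) \<le> norm ((f x)\<^sup>2 + 1)" by simp
qed (use assms in auto)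

lemma integrable_prod_of_squares:
  assumes [measurable]: "f \<in> borel_measurable M" "g \<in> borel_measurable M"
    and "integrable M (\<lambda>\<omega>. (f \<omega>)\<^sup>2 :: real)" "integrable M (\<lambda>\<omega>. (g \<omega>)\<^sup>2 :: real)"
  shows "integrable M (\<lambda>\<omega>. f \<omega> * g \<omega>)"
proof (rule Bochner_Integration.integrable_bound[OF Bochner_Integration.integrable_add[OF assms(3,4)]])
  have "\<bar>x * y\<bar> \<le> x\<^sup>2 + y\<^sup>2" for x y :: real
  proof -
    have "0 \<le> (\<bar>x\<bar> - \<bar>y\<bar>)\<^sup>2" by simp
    then have "2 * \<bar>x * y\<bar> \<le> x\<^sup>2 + y\<^sup>2" by (simp add: power2_diff abs_mult)
    then show ?thesis using abs_ge_zero[of "x * y"] by linarith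
  qed
  then show "AE x in M. norm (f x * g x) \<le> norm ((f x)\<^sup>2 + (g x)\<^sup>2)" by simp
qed simp

lemma lin_unit:
  assumes "j < P"
  shows "lin (\<lambda>i. of_bool (i = j)) k \<omega> = Z (k, j) \<omega>"
proof -
  have "lin (\<lambda>i. of_bool (i = j)) k \<omega> = (\<Sum>i<P. if i = j then Z (k, i) \<omega> else 0)"
    unfolding lin_eq by (intro sum.cong) auto
  then show ?thesis using assms by simp
qed

lemma dot_unit:
  assumes "j < P"
  shows "dot P (\<lambda>i. of_bool (i = j)) v = v j"
proof -
  have "dot P (\<lambda>i. of_bool (i = j)) v = (\<Sum>i<P. if i = j then v i else 0)"
    unfolding dot_def by (intro sum.cong) auto
  then show ?thesis using assms by simp
qed

lemma lin_square_integrable: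
  assumes "k < n"
  shows "integrable M (\<lambda>\<omega>. (lin v k \<omega>)\<^sup>2)"
proof (rule integrable_of_square)
  have "(\<lambda>\<omega>. ((lin v k \<omega>)\<^sup>2)\<^sup>2) = (\<lambda>\<omega>. (lin v k \<omega>) ^ 4)"
    by (simp flip: power_mult)
  then show "integrable M (\<lambda>\<omega>. ((lin v k \<omega>)\<^sup>2)\<^sup>2)" using lin_fourth(1)[OF assms] by simp
qed (use assms in measurable)

lemma Z_integrable:
  assumes "k < n" "j < P"
  shows "integrable M (\<lambda>\<omega>. (Z (k, j) \<omega>)\<^sup>2)" "integrable M (\<lambda>\<omega>. Z (k, j) \<omega>)"
proof -
  show 1: "integrable M (\<lambda>\<omega>. (Z (k, j) \<omega>)\<^sup>2)"
    using lin_square_integrable[OF assms(1), of "\<lambda>i. of_bool (i = j)"] assms(2) by (simp add: lin_unit)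
  show "integrable M (\<lambda>\<omega>. Z (k, j) \<omega>)"
    by (rule integrable_of_square[OF _ 1]) (use assms in auto)
qed

lemma Z_cov:
  assumes "k < n" "i < P" "j < P"
  shows "expectation (\<lambda>\<omega>. Z (k, i) \<omega> * Z (k, j) \<omega>) = of_bool (i = j)"
proof (cases "i = j")
  case True
  have "variance (Z (k, j)) = expectation (\<lambda>\<omega>. (Z (k, j) \<omega>)\<^sup>2)"
    using mean0[of "(k, j)"] assms by simp
  then show ?thesis using True var1[of "(k, j)"] assms by (simp add: power2_eq_square)
next
  case False
  have "indep_var borel (Z (k, i)) borel (Z (k, j))"
  proof -
    have "indep_var (PiM {(k,i)} (\<lambda>_. borel)) (\<lambda>\<omega>. restrict (\<lambda>i. Z i \<omega>) {(k,i)}) (PiM {(k,j)} (\<lambda>_. borel)) (\<lambda>\<omega>. restrict (\<lambda>i. Z i \<omega>) {(k,j)})"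
      by (rule indep_var_restrict[OF indep]) (use assms False in auto)
    then have "indep_var borel ((\<lambda>f. f (k,i)) \<circ> (\<lambda>\<omega>. restrict (\<lambda>i. Z i \<omega>) {(k,i)})) borel ((\<lambda>f. f (k,j)) \<circ> (\<lambda>\<omega>. restrict (\<lambda>i. Z i \<omega>) {(k,j)}))"
      by (rule indep_var_compose) auto
    then show ?thesis by (simp add: comp_def)
  qed
  then show ?thesis
    using False mean0 assms Z_integrable by (subst indep_var_lebesgue_integral) auto
qed

lemma lin_cov:
  assumes "k < n"
  shows "expectation (\<lambda>\<omega>. lin u k \<omega> * lin v k \<omega>) = dot P u v"
proof -
  have int: "integrable M (\<lambda>\<omega>. Z (k, i) \<omega> * Z (k, j) \<omega>)" if "i < P" "j < P" for i j
    using that assms by (intro integrable_prod_of_squares Z_integrable) auto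
  have "(a * b) * (c * d) = a * c * (b * d)" for a b c d :: real by simp
  then have "expectation (\<lambda>\<omega>. lin u k \<omega> * lin v k \<omega>)
      = expectation (\<lambda>\<omega>. \<Sum>i<P. \<Sum>j<P. u i * v j * (Z (k, i) \<omega> * Z (k, j) \<omega>))"
    by (simp only: lin_eq sum_product)
  also have "\<dots> = (\<Sum>i<P. \<Sum>j<P. u i * v j * expectation (\<lambda>\<omega>. Z (k, i) \<omega> * Z (k, j) \<omega>))"
  proof -
    have "expectation (\<lambda>\<omega>. \<Sum>i<P. \<Sum>j<P. u i * v j * (Z (k, i) \<omega> * Z (k, j) \<omega>))
        = (\<Sum>i<P. expectation (\<lambda>\<omega>. \<Sum>j<P. u i * v j * (Z (k, i) \<omega> * Z (k, j) \<omega>)))"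
      by (rule Bochner_Integration.integral_sum) (auto intro!: Bochner_Integration.integrable_sum integrable_mult_right int)
    also have "\<dots> = (\<Sum>i<P. \<Sum>j<P. expectation (\<lambda>\<omega>. u i * v j * (Z (k, i) \<omega> * Z (k, j) \<omega>)))"
      by (intro sum.cong refl Bochner_Integration.integral_sum integrable_mult_right int) auto
    finally show ?thesis by simp
  qed
  also have "\<dots> = (\<Sum>i<P. \<Sum>j<P. if i = j then u i * v j else 0)"
    using assms by (intro sum.cong refl) (auto simp: Z_cov)
  also have "\<dots> = dot P u v" by (simp add: dot_def)
  finally show ?thesis .
qed

end

section \<open>Randomized rounding and the restricted eigenvalue property\<close>

text \<open>Expectation under the product of the weights \<mu> j, written as a finite sum: the
  randomness of the rounding stays separate from the probability space of the data.\<close>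

definition pexp :: "nat set \<Rightarrow> 'c set \<Rightarrow> (nat \<Rightarrow> 'c \<Rightarrow> real) \<Rightarrow> ((nat \<Rightarrow> 'c) \<Rightarrow> real) \<Rightarrow> real" where
  "pexp I C \<mu> f = (\<Sum>c\<in>I \<rightarrow>\<^sub>E C. (\<Prod>j\<in>I. \<mu> j (c j)) * f c)"

lemma pexp_prod:
  assumes "finite I" "finite C"
  shows "pexp I C \<mu> (\<lambda>c. \<Prod>j\<in>I. g j (c j)) = (\<Prod>j\<in>I. \<Sum>a\<in>C. \<mu> j a * g j a)"
  unfolding pexp_def using assms by (subst prod_sum_PiE) (auto simp: prod.distrib)

lemma pexp_add: "pexp I C \<mu> (\<lambda>c. f c + g c) = pexp I C \<mu> f + pexp I C \<mu> g"
  unfolding pexp_def by (simp add: distrib_left sum.distrib)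

lemma pexp_cmult: "pexp I C \<mu> (\<lambda>c. a * f c) = a * pexp I C \<mu> f"
  unfolding pexp_def sum_distrib_left by (intro sum.cong) auto

lemma pexp_sum: "pexp I C \<mu> (\<lambda>c. \<Sum>i\<in>A. f i c) = (\<Sum>i\<in>A. pexp I C \<mu> (f i))"
  unfolding pexp_def sum_distrib_left by (rule sum.swap)

lemma pexp_one:
  assumes "finite I" "finite C" "\<And>j. j \<in> I \<Longrightarrow> (\<Sum>a\<in>C. \<mu> j a) = 1" "i \<in> I"
  shows "pexp I C \<mu> (\<lambda>c. g (c i)) = (\<Sum>a\<in>C. \<mu> i a * g a)"
proof -
  have "pexp I C \<mu> (\<lambda>c. g (c i)) = pexp I C \<mu> (\<lambda>c. \<Prod>j\<in>I. if j = i then g (c j) else 1)"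
    using assms by (simp add: prod.delta)
  also have "\<dots> = (\<Prod>j\<in>I. \<Sum>a\<in>C. \<mu> j a * (if j = i then g a else 1))"
    by (subst pexp_prod[OF assms(1,2)]) simp
  also have "\<dots> = (\<Prod>j\<in>I. if j = i then (\<Sum>a\<in>C. \<mu> j a * g a) else 1)"
    using assms(3) by (intro prod.cong) auto
  finally show ?thesis using assms by (simp add: prod.delta)
qed

lemma pexp_two:
  assumes "finite I" "finite C" "\<And>j. j \<in> I \<Longrightarrow> (\<Sum>a\<in>C. \<mu> j a) = 1" "i \<in> I" "k \<in> I" "i \<noteq> k"
  shows "pexp I C \<mu> (\<lambda>c. g (c i) * h (c k)) = (\<Sum>a\<in>C. \<mu> i a * g a) * (\<Sum>a\<in>C. \<mu> k a * h a)"
proof -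
  have two: "(\<Prod>j\<in>I. (if j = i then x j else 1) * (if j = k then y j else 1)) = x i * y k"
    for x y :: "nat \<Rightarrow> real"
    using assms by (simp add: prod.distrib prod.delta)
  have "pexp I C \<mu> (\<lambda>c. g (c i) * h (c k))
      = pexp I C \<mu> (\<lambda>c. \<Prod>j\<in>I. (if j = i then g (c j) else 1) * (if j = k then h (c j) else 1))"
    by (simp add: two)
  also have "\<dots> = (\<Prod>j\<in>I. \<Sum>a\<in>C. \<mu> j a * ((if j = i then g a else 1) * (if j = k then h a else 1)))"
    by (subst pexp_prod[OF assms(1,2)]) simp
  also have "\<dots> = (\<Prod>j\<in>I. (if j = i then (\<Sum>a\<in>C. \<mu> j a * g a) else 1) * (if j = k then (\<Sum>a\<in>C. \<mu> j a * h a) else 1))"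
    using assms(3,6) by (intro prod.cong) auto
  finally show ?thesis by (simp add: two)
qed

text \<open>Squared mean plus the sum of the variances. It is applied both to a design row acting on
  the rounded vector and to the squared norm of that vector.\<close>

lemma pexp_square_of_sum:
  fixes X :: "nat \<Rightarrow> 'c \<Rightarrow> real"
  assumes "finite I" "finite C" and mu: "\<And>j. j \<in> I \<Longrightarrow> (\<Sum>a\<in>C. \<mu> j a) = 1"
  defines "m \<equiv> \<lambda>j. \<Sum>a\<in>C. \<mu> j a * X j a"
  shows "pexp I C \<mu> (\<lambda>c. (\<Sum>j\<in>I. X j (c j))\<^sup>2)
    = (\<Sum>j\<in>I. m j)\<^sup>2 + (\<Sum>j\<in>I. (\<Sum>a\<in>C. \<mu> j a * (X j a)\<^sup>2) - (m j)\<^sup>2)"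
proof -
  let ?s = "\<lambda>j. \<Sum>a\<in>C. \<mu> j a * (X j a)\<^sup>2"
  have "pexp I C \<mu> (\<lambda>c. (\<Sum>j\<in>I. X j (c j))\<^sup>2)
      = (\<Sum>i\<in>I. \<Sum>k\<in>I. pexp I C \<mu> (\<lambda>c. X i (c i) * X k (c k)))"
    by (simp add: power2_eq_square sum_product pexp_sum)
  also have "\<dots> = (\<Sum>i\<in>I. \<Sum>k\<in>I. m i * m k + (if k = i then ?s i - (m i)\<^sup>2 else 0))"
  proof (intro sum.cong refl)
    fix i k assume ik: "i \<in> I" "k \<in> I"
    show "pexp I C \<mu> (\<lambda>c. X i (c i) * X k (c k)) = m i * m k + (if k = i then ?s i - (m i)\<^sup>2 else 0)"
    proof (cases "k = i")
      case True
      then show ?thesis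
        using pexp_one[OF assms(1,2) mu ik(1), where g = "\<lambda>a. X i a * X i a"] by (simp add: power2_eq_square)
    next
      case False
      then show ?thesis
        using pexp_two[OF assms(1,2) mu ik, where g = "X i" and h = "X k"] by (simp add: m_def)
    qed
  qed
  also have "\<dots> = (\<Sum>i\<in>I. \<Sum>k\<in>I. m i * m k) + (\<Sum>i\<in>I. ?s i - (m i)\<^sup>2)"
    using assms(1) by (simp add: sum.distrib)
  also have "(\<Sum>i\<in>I. \<Sum>k\<in>I. m i * m k) = (\<Sum>j\<in>I. m j)\<^sup>2"
    by (simp add: power2_eq_square sum_product)
  finally show ?thesis .
qed

lemma pexp_sum_one:
  assumes "finite I" "finite C" "\<And>j. j \<in> I \<Longrightarrow> (\<Sum>a\<in>C. \<mu> j a) = 1"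
  shows "pexp I C \<mu> (\<lambda>c. \<Sum>j\<in>I. X j (c j)) = (\<Sum>j\<in>I. \<Sum>a\<in>C. \<mu> j a * X j a)"
  unfolding pexp_sum by (intro sum.cong refl pexp_one assms)

lemma exp_pexp_le:
  assumes "finite I" "finite C" "\<And>j. j \<in> I \<Longrightarrow> (\<Sum>a\<in>C. \<mu> j a) = 1"
    and nn: "\<And>j a. j \<in> I \<Longrightarrow> a \<in> C \<Longrightarrow> \<mu> j a \<ge> 0"
  shows "exp (pexp I C \<mu> f) \<le> pexp I C \<mu> (\<lambda>c. exp (f c))"
proof -
  have "pexp I C \<mu> (\<lambda>c. \<Prod>j\<in>I. 1) = 1"
    by (subst pexp_prod) (auto simp: assms)
  then have "(\<Sum>c\<in>I \<rightarrow>\<^sub>E C. \<Prod>j\<in>I. \<mu> j (c j)) = 1" by (simp add: pexp_def)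
  moreover from this have "I \<rightarrow>\<^sub>E C \<noteq> {}" by auto
  ultimately have "exp (\<Sum>c\<in>I \<rightarrow>\<^sub>E C. (\<Prod>j\<in>I. \<mu> j (c j)) *\<^sub>R f c) \<le> (\<Sum>c\<in>I \<rightarrow>\<^sub>E C. (\<Prod>j\<in>I. \<mu> j (c j)) * exp (f c))"
    using assms by (intro convex_on_sum[OF _ _ exp_convex]) (auto intro!: prod_nonneg finite_PiE simp: PiE_mem)
  then show ?thesis by (simp add: pexp_def)
qed

text \<open>
  A coordinate of a rounded vector is coded by a pair \<open>(l, z)\<close> standing for $z\sqrt{l/n}$; the
  pair \<open>(0, 0)\<close> is the only code of 0.
\<close>

definition codes :: "nat \<Rightarrow> (nat \<times> int) set" where
  "codes n = insert (0, 0) ({1..n} \<times> ({- (int n + 1)..int n + 1} - {0}))"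

definition code_val :: "nat \<Rightarrow> nat \<times> int \<Rightarrow> real" where
  "code_val n a = real_of_int (snd a) * sqrt (real (fst a) / real n)"

text \<open>Unnormalized prior weights: 0 has weight 1, every other code decays geometrically in its
  level and its size. The factor q is the price of a nonzero coordinate.\<close>

definition code_wt :: "real \<Rightarrow> nat \<times> int \<Rightarrow> real" where
  "code_wt q a = (if snd a = 0 then 1 else q * (1/2) ^ (fst a + nat \<bar>snd a\<bar>))"

lemma finite_codes: "finite (codes n)"
  unfolding codes_def by auto

lemma sum_half_powers_le: "(\<Sum>i=1..m. (1/2 :: real) ^ i) \<le> 1"
proof -
  have "(\<Sum>i=1..m. (1/2 :: real) ^ i) = 1 - (1/2) ^ m"
    by (induction m) (auto simp: field_simps)
  then show ?thesis by simp
qed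

text \<open>The levels contribute at most 1 and the signed sizes at most 2. Over P coordinates the
  prior mass is then at most exp(2*q*P), which is harmless once q is a small multiple of
  n/P.\<close>

lemma sum_code_wt_le:
  assumes "q \<ge> 0"
  shows "(\<Sum>a\<in>codes n. code_wt q a) \<le> 1 + 2 * q"
proof -
  let ?Z = "{- (int n + 1)..int n + 1} - {0}"
  have "(\<Sum>a\<in>codes n. code_wt q a) = 1 + (\<Sum>a\<in>{1..n} \<times> ?Z. code_wt q a)"
    unfolding codes_def by (subst sum.insert) (auto simp: code_wt_def)
  also have "(\<Sum>a\<in>{1..n} \<times> ?Z. code_wt q a) = q * ((\<Sum>l=1..n. (1/2) ^ l) * (\<Sum>z\<in>?Z. (1/2) ^ nat \<bar>z\<bar>))"
  proof -
    have "(\<Sum>a\<in>{1..n} \<times> ?Z. code_wt q a) = (\<Sum>(l, z)\<in>{1..n} \<times> ?Z. q * ((1/2) ^ l * (1/2) ^ nat \<bar>z\<bar>))"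
      by (intro sum.cong refl) (auto simp: code_wt_def power_add)
    also have "\<dots> = (\<Sum>l=1..n. \<Sum>z\<in>?Z. q * ((1/2) ^ l * (1/2) ^ nat \<bar>z\<bar>))"
      by (rule sum.cartesian_product[symmetric])
    also have "\<dots> = q * (\<Sum>l=1..n. \<Sum>z\<in>?Z. (1/2) ^ l * (1/2) ^ nat \<bar>z\<bar>)"
      by (simp only: sum_distrib_left)
    also have "\<dots> = q * ((\<Sum>l=1..n. (1/2) ^ l) * (\<Sum>z\<in>?Z. (1/2) ^ nat \<bar>z\<bar>))"
      by (subst sum_product) (rule refl)
    finally show ?thesis .
  qed
  finally have eq: "(\<Sum>a\<in>codes n. code_wt q a)
      = 1 + q * ((\<Sum>l=1..n. (1/2) ^ l) * (\<Sum>z\<in>?Z. (1/2) ^ nat \<bar>z\<bar>))" .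
  have "?Z = {1..int n + 1} \<union> {- (int n + 1)..-1}" by auto
  then have "(\<Sum>z\<in>?Z. (1/2 :: real) ^ nat \<bar>z\<bar>)
      = (\<Sum>z\<in>{1..int n + 1} \<union> {- (int n + 1)..-1}. (1/2) ^ nat \<bar>z\<bar>)" by (simp only:)
  also have "\<dots> = (\<Sum>z\<in>{1..int n + 1}. (1/2) ^ nat \<bar>z\<bar>) + (\<Sum>z\<in>{- (int n + 1)..-1}. (1/2) ^ nat \<bar>z\<bar>)"
    by (rule sum.union_disjoint) auto
  also have "(\<Sum>z\<in>{1..int n + 1}. (1/2 :: real) ^ nat \<bar>z\<bar>) = (\<Sum>i=1..n+1. (1/2) ^ i)"
    by (rule sum.reindex_bij_witness[of _ int nat]) auto
  also have "(\<Sum>z\<in>{- (int n + 1)..-1}. (1/2 :: real) ^ nat \<bar>z\<bar>) = (\<Sum>i=1..n+1. (1/2) ^ i)"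
    by (rule sum.reindex_bij_witness[of _ "\<lambda>i. - int i" "\<lambda>z. nat (- z)"]) auto
  finally have "(\<Sum>z\<in>?Z. (1/2 :: real) ^ nat \<bar>z\<bar>) \<le> 2"
    using sum_half_powers_le[of "n+1"] by linarith
  then have "(\<Sum>l=1..n. (1/2 :: real) ^ l) * (\<Sum>z\<in>?Z. (1/2) ^ nat \<bar>z\<bar>) \<le> 1 * 2"
    by (intro mult_mono sum_half_powers_le sum_nonneg) auto
  then have "q * ((\<Sum>l=1..n. (1/2) ^ l) * (\<Sum>z\<in>?Z. (1/2) ^ nat \<bar>z\<bar>)) \<le> q * (1 * 2)"
    using assms by (rule mult_left_mono)
  then show ?thesis unfolding eq by linarith
qed

text \<open>
  Randomized rounding of one coordinate to the grid of step $b=\sqrt{l/n}$: the value is \<open>hi\<close> with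
  probability \<open>x\<close> and \<open>lo\<close> otherwise. The entropy term \<open>x * ln (1 / x)\<close> is retained in \<open>kh\<close> only.
\<close>

lemma code_rounding:
  fixes v q C0 :: real and n l :: nat
  assumes n: "n \<ge> 1" and l: "1 \<le> l" "l \<le> n" and v: "\<bar>v\<bar> \<le> 1" and q: "0 < q" "q \<le> 1" and "C0 \<ge> 0"
  defines "b \<equiv> sqrt (real l / real n)"
  assumes sp: "min 1 (\<bar>v\<bar> / b) \<le> q * exp (C0 * real l)"
  obtains lo hi x kl kh where "lo \<in> codes n" "hi \<in> codes n" "lo \<noteq> hi" "0 \<le> x" "x \<le> 1"
    "(1 - x) * code_val n lo + x * code_val n hi = v"
    "(1 - x) * (code_val n lo)\<^sup>2 + x * (code_val n hi)\<^sup>2 - v\<^sup>2 \<in> {0..b * \<bar>v\<bar>}"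
    "(1 - x) * (code_val n lo) ^ 4 + x * (code_val n hi) ^ 4
       - ((1 - x) * (code_val n lo)\<^sup>2 + x * (code_val n hi)\<^sup>2)\<^sup>2 \<le> 9 * (b * \<bar>v\<bar>)"
    "(1 - x) * exp kl \<le> code_wt q lo" "x * exp kh \<le> code_wt q hi"
    "(1 - x) * kl + x * kh \<ge> - ((C0 + 3) * (real l * (\<bar>v\<bar> / b)))"
proof -
  have b: "0 < b" "b \<le> 1" unfolding b_def using l n by auto
  define y where "y = \<bar>v\<bar> / b"
  have y0: "y \<ge> 0" and vy: "\<bar>v\<bar> = b * y" unfolding y_def using b by auto
  define f where "f = nat \<lfloor>y\<rfloor>"
  define x where "x = y - real f"
  have f: "real f \<le> y" "y < real f + 1" unfolding f_def using y0 by auto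
  have x: "0 \<le> x" "x < 1" unfolding x_def using f by auto
  define e where "e = (if v < 0 then - 1 else 1 :: int)"
  have ve: "v = of_int e * (b * y)" "\<bar>e\<bar> = 1" "e \<noteq> 0" using vy unfolding e_def by auto
  have e2: "(of_int e :: real)\<^sup>2 = 1" unfolding e_def by auto
  define lo where "lo = (if f = 0 then (0, 0) else (l, e * int f))"
  define hi where "hi = (l, e * (int f + 1))"
  have lov: "code_val n lo = of_int e * (b * real f)"
    by (simp add: lo_def code_val_def b_def)
  have hiv: "code_val n hi = of_int e * (b * (real f + 1))"
    by (simp add: hi_def code_val_def b_def)
  \<comment> \<open>From 1/n <= b^2 <= b and b*y <= 1 the quotient y is at most n; as the upper code
    has size f + 1, the codes must reach n + 1.\<close>
  have fn: "f \<le> n"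
  proof -
    have "1 / real n \<le> real l / real n" using l n by (simp add: field_simps)
    also have "\<dots> = b\<^sup>2" unfolding b_def by simp
    also have "\<dots> \<le> b" using b by (simp add: power2_eq_square mult_left_le)
    finally have "1 \<le> real n * b" using n by (simp add: field_simps)
    moreover have "y * b \<le> 1" using vy v by (simp add: mult.commute)
    ultimately have "y * b \<le> real n * b" by linarith
    then have "y \<le> real n" using b by simp
    then show ?thesis using f by linarith
  qed
  have em: "\<bar>e * int f\<bar> = int f" "\<bar>e * (int f + 1)\<bar> = int f + 1" using ve by (auto simp: abs_mult)
  have "e * int f \<in> {- (int n + 1)..int n + 1}" "e * (int f + 1) \<in> {- (int n + 1)..int n + 1}"
    using em fn by (auto simp: abs_le_iff)
  then have mem: "lo \<in> codes n" "hi \<in> codes n"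
    using l ve by (auto simp: lo_def hi_def codes_def)
  have ne: "lo \<noteq> hi" using l ve by (auto simp: lo_def hi_def)
  have m1: "(1 - x) * code_val n lo + x * code_val n hi = v"
    unfolding lov hiv ve(1) x_def by (simp add: algebra_simps)
  have los: "(code_val n lo)\<^sup>2 = b\<^sup>2 * (real f)\<^sup>2" and his: "(code_val n hi)\<^sup>2 = b\<^sup>2 * (real f + 1)\<^sup>2"
    unfolding lov hiv by (simp_all add: power_mult_distrib e2)
  have vs: "v\<^sup>2 = b\<^sup>2 * y\<^sup>2" unfolding ve(1) by (simp add: power_mult_distrib e2)
  have yx: "y = real f + x" unfolding x_def by simp
  have var: "(1 - x) * (code_val n lo)\<^sup>2 + x * (code_val n hi)\<^sup>2 - v\<^sup>2 = b\<^sup>2 * (x * (1 - x))"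
    unfolding los his vs yx by (simp add: power2_eq_square algebra_simps)
  have xx: "0 \<le> x * (1 - x)" "x * (1 - x) \<le> x" using x by (auto simp: mult_left_le)
  have "b\<^sup>2 * (x * (1 - x)) \<le> b\<^sup>2 * y"
    using xx yx by (intro mult_left_mono) auto
  also have "\<dots> = b * \<bar>v\<bar>" unfolding vy by (simp add: power2_eq_square)
  finally have m2: "(1 - x) * (code_val n lo)\<^sup>2 + x * (code_val n hi)\<^sup>2 - v\<^sup>2 \<in> {0..b * \<bar>v\<bar>}"
    unfolding var using xx by auto
  have p4: "z ^ 4 = (z\<^sup>2)\<^sup>2" for z :: real by simp
  \<comment> \<open>Variance of the squared code, which takes two values at distance b^2*(2*f +
    1).\<close>
  have "(1 - x) * (code_val n lo) ^ 4 + x * (code_val n hi) ^ 4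
       - ((1 - x) * (code_val n lo)\<^sup>2 + x * (code_val n hi)\<^sup>2)\<^sup>2 = b ^ 4 * (2 * real f + 1)\<^sup>2 * (x * (1 - x))"
    unfolding p4 los his by (simp add: power2_eq_square algebra_simps)
  also have "\<dots> \<le> 9 * (b * \<bar>v\<bar>)"
  proof (cases "f = 0")
    case True
    have "b ^ 4 * (2 * real f + 1)\<^sup>2 * (x * (1 - x)) \<le> b\<^sup>2 * y"
      using True b xx yx power_decreasing[of 2 4 b] by (intro mult_mono) auto
    also have "\<dots> \<le> 9 * (b * \<bar>v\<bar>)" unfolding vy using y0 b by (simp add: power2_eq_square zero_le_mult_iff)
    finally show ?thesis .
  next
    case False
    have by1: "b * y \<le> 1" using vy v by simp
    have "b * (2 * real f + 1) \<le> b * (3 * y)" using b f False by (intro mult_left_mono) auto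
    then have "(b * (2 * real f + 1))\<^sup>2 \<le> (b * (3 * y))\<^sup>2" using b by (intro power_mono) auto
    then have "b\<^sup>2 * (b * (2 * real f + 1))\<^sup>2 * (x * (1 - x)) \<le> b\<^sup>2 * (b * (3 * y))\<^sup>2 * 1"
      using xx x by (intro mult_mono) auto
    also have "\<dots> = 9 * ((b * y) * (b * y) * (b * b))" by (simp add: power2_eq_square)
    also have "\<dots> \<le> 9 * ((b * y) * 1 * (b * 1))"
      using by1 b y0 by (intro mult_left_mono mult_mono) auto
    also have "\<dots> = 9 * (b * \<bar>v\<bar>)" unfolding vy by simp
    finally show ?thesis by (simp add: power_mult_distrib mult_ac power4_eq_xxxx power2_eq_square)
  qed
  finally have m4: "(1 - x) * (code_val n lo) ^ 4 + x * (code_val n hi) ^ 4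
       - ((1 - x) * (code_val n lo)\<^sup>2 + x * (code_val n hi)\<^sup>2)\<^sup>2 \<le> 9 * (b * \<bar>v\<bar>)" .
  have whi: "code_wt q hi = q * (1/2) ^ (l + f + 1)"
    using ve em by (simp add: hi_def code_wt_def nat_add_distrib)
  have lnhalf: "ln (q * (1/2) ^ m) \<ge> ln q - real m" for m
  proof -
    have "ln (q * (1/2) ^ m) = ln q - real m * ln 2"
      using q by (simp add: ln_mult ln_realpow ln_div)
    moreover have "real m * ln 2 \<le> real m * 1" using ln_2_less_1 by (intro mult_left_mono) auto
    ultimately show ?thesis by simp
  qed
  have ly: "real l * y \<ge> 0" "real l * y \<ge> y" using y0 l by (auto simp: mult_right_mono[of 1 "real l" y, simplified])
  show thesis
  proof (cases "f = 0")
    case True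
    have xy: "x = y" using True by (simp add: x_def)
    have sp': "y \<le> q * exp (C0 * real l)" using sp f True unfolding y_def by simp
    \<comment> \<open>Logarithm of the prior weight of \<open>hi\<close> over its rounding
      probability. For x = 0 the code \<open>hi\<close> is never drawn and the value 0 is a mere
      default; \<open>lo\<close> is the code of 0, of prior weight 1, so 0 is a valid exponent for
      it.\<close>
    define kh where "kh = (if x = 0 then 0 else ln (code_wt q hi / x))"
    have "x * exp kh \<le> code_wt q hi" using x q by (simp add: kh_def whi)
    moreover have "x * kh \<ge> - ((C0 + 3) * (real l * y))"
    proof (cases "x = 0")
      case False
      then have xp: "x > 0" using x by simp
      have "ln x \<le> ln (q * exp (C0 * real l))" using sp' xp xy q by (subst ln_le_cancel_iff) auto
      then have "ln x \<le> ln q + C0 * real l" using q by (simp add: ln_mult)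
      then have "kh \<ge> - (C0 * real l) - (real l + 1)"
      proof -
        have "code_wt q hi > 0" unfolding whi using q by simp
        then have "kh = ln (code_wt q hi) - ln x" using False xp by (simp add: kh_def ln_div)
        then show ?thesis
          using lnhalf[of "l + f + 1"] True \<open>ln x \<le> ln q + C0 * real l\<close> unfolding whi by simp
      qed
      moreover have "(C0 + 3) * real l \<ge> C0 * real l + (real l + 1)" using l by (simp add: algebra_simps)
      ultimately have "kh \<ge> - ((C0 + 3) * real l)" by linarith
      then have "x * kh \<ge> x * - ((C0 + 3) * real l)" using x by (intro mult_left_mono) auto
      then show ?thesis by (simp add: xy mult_ac)
    qed (simp add: kh_def xy)
    moreover have "(1 - x) * exp 0 \<le> code_wt q lo" using x True by (simp add: lo_def code_wt_def)
    ultimately show thesis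
      using that[OF mem ne _ _ m1 m2 m4, of 0 kh] x unfolding y_def by auto
  next
    case False
    then have y1: "y \<ge> 1" using f by linarith
    have sp': "1 \<le> q * exp (C0 * real l)" using sp y1 unfolding y_def by simp
    then have "ln 1 \<le> ln (q * exp (C0 * real l))" using q by (subst ln_le_cancel_iff) auto
    then have lq: "ln q \<ge> - (C0 * real l)" using q by (simp add: ln_mult)
    have wl: "code_wt q hi \<le> code_wt q lo"
    proof -
      have "code_wt q lo = q * (1/2) ^ (l + f)"
        using False ve em by (simp add: lo_def code_wt_def)
      then show ?thesis unfolding whi using q by simp
    qed
    have wp: "code_wt q hi > 0" unfolding whi using q by simp
    \<comment> \<open>Now both codes are nonzero. The smaller of their prior weights serves for
      both, and the rounding probabilities are dropped since they are at most 1.\<close>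
    let ?k = "ln (code_wt q hi)"
    have "(1 - x) * exp ?k \<le> 1 * code_wt q hi" "x * exp ?k \<le> 1 * code_wt q hi"
      using x wp by (auto simp: mult_right_mono)
    then have k1: "(1 - x) * exp ?k \<le> code_wt q lo" "x * exp ?k \<le> code_wt q hi" using wl by auto
    have "?k \<ge> - (C0 * real l) - real (l + f + 1)"
      using lnhalf[of "l + f + 1"] lq unfolding whi by linarith
    moreover have "C0 * real l * 1 \<le> C0 * real l * y"
      using y1 \<open>C0 \<ge> 0\<close> by (intro mult_left_mono) auto
    moreover have "real l * 1 \<le> real l * y" using y1 by (intro mult_left_mono) auto
    moreover have "(C0 + 3) * (real l * y) = C0 * real l * y + real l * y + real l * y + real l * y"
      by algebra
    moreover have "real (l + f + 1) = real l + real f + 1" by simp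
    ultimately have "?k \<ge> - ((C0 + 3) * (real l * y))"
      using f ly y1 by linarith
    then have "(1 - x) * ?k + x * ?k \<ge> - ((C0 + 3) * (real l * y))" by (simp add: algebra_simps)
    then show thesis
      using that[OF mem ne _ _ m1 m2 m4 k1] x unfolding y_def by auto
  qed
qed

section \<open>The PAC-Bayes bound for quadratic forms\<close>

definition quad_form :: "nat \<Rightarrow> nat \<Rightarrow> (nat \<Rightarrow> nat \<Rightarrow> real) \<Rightarrow> vec \<Rightarrow> real" where
  "quad_form n P z w = (\<Sum>k<n. (\<Sum>j<P. z k j * w j)\<^sup>2)"

text \<open>
  Over a random design \<open>z\<close> each exponential has expectation at most 1. Hence this mixture over the
  coded vectors is bounded with high probability, which controls all of them at once.
\<close>

definition pac_sum :: "nat \<Rightarrow> nat \<Rightarrow> real \<Rightarrow> real \<Rightarrow> real \<Rightarrow> (nat \<Rightarrow> nat \<Rightarrow> real) \<Rightarrow> real" where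
  "pac_sum n P q t B z = (\<Sum>c\<in>{..<P} \<rightarrow>\<^sub>E codes n. (\<Prod>j<P. code_wt q (c j)) *
     exp (- t * quad_form n P z (\<lambda>j. code_val n (c j))
          + real n * t * (\<Sum>j<P. (code_val n (c j))\<^sup>2)
          - real n * t\<^sup>2 * B / 2 * (\<Sum>j<P. (code_val n (c j))\<^sup>2)\<^sup>2))"

text \<open>Gibbs variational principle: by Jensen, the mixture is at least the exponential of the
  mean exponent under the rounding law minus the relative entropy of that law to the prior. The
  single quantity G controls the rounding variance, the spread of the squared norm and, multiplied
  by n, the entropy.\<close>

lemma pac_sum_lower_bound:
  fixes v :: vec and l :: "nat \<Rightarrow> nat" and b :: "nat \<Rightarrow> real"
  assumes n: "n \<ge> 1" and l: "\<And>j. j < P \<Longrightarrow> 1 \<le> l j \<and> l j \<le> n" and v1: "dot P v v = 1"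
    and q: "0 < q" "q \<le> 1" and "C0 \<ge> 0" and t: "t > 0" and B: "B \<ge> 0"
    and b_def: "\<And>j. b j = sqrt (real (l j) / real n)"
    and sp: "\<And>j. j < P \<Longrightarrow> min 1 (\<bar>v j\<bar> / b j) \<le> q * exp (C0 * real (l j))"
    and col: "\<And>j. j < P \<Longrightarrow> (\<Sum>k<n. (z k j)\<^sup>2) \<le> B' * real n" and B': "B' \<ge> 0"
  defines "G \<equiv> \<Sum>j<P. b j * \<bar>v j\<bar>"
  shows "exp (real n * t - t * (quad_form n P z v + B' * real n * G)
      - real n * t\<^sup>2 * B / 2 * ((1 + G)\<^sup>2 + 9 * G) - (C0 + 3) * (real n * G)) \<le> pac_sum n P q t B z"
proof -
  let ?I = "{..<P}" and ?C = "codes n"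
  have G0: "G \<ge> 0" unfolding G_def b_def by (intro sum_nonneg) auto
  have vle: "\<bar>v j\<bar> \<le> 1" if "j < P" for j
  proof -
    have "v j * v j \<le> (\<Sum>j<P. v j * v j)" using that by (intro member_le_sum) auto
    then have "(v j)\<^sup>2 \<le> 1" using v1 by (simp add: dot_def power2_eq_square)
    then show ?thesis by (simp add: abs_square_le_1)
  qed
  define R where "R j r \<longleftrightarrow> (case r of (lo, hi, x, kl, kh) \<Rightarrow> lo \<in> ?C \<and> hi \<in> ?C \<and> lo \<noteq> hi \<and> 0 \<le> x \<and> x \<le> 1 \<and>
    (1 - x) * code_val n lo + x * code_val n hi = v j \<and>
    (1 - x) * (code_val n lo)\<^sup>2 + x * (code_val n hi)\<^sup>2 - (v j)\<^sup>2 \<in> {0..b j * \<bar>v j\<bar>} \<and>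
    (1 - x) * (code_val n lo) ^ 4 + x * (code_val n hi) ^ 4
       - ((1 - x) * (code_val n lo)\<^sup>2 + x * (code_val n hi)\<^sup>2)\<^sup>2 \<le> 9 * (b j * \<bar>v j\<bar>) \<and>
    (1 - x) * exp kl \<le> code_wt q lo \<and> x * exp kh \<le> code_wt q hi \<and>
    (1 - x) * kl + x * kh \<ge> - ((C0 + 3) * (real (l j) * (\<bar>v j\<bar> / b j))))" for j r
  have "\<exists>r. R j r" if j: "j < P" for j
  proof -
    obtain lo hi x kl kh where "R j (lo, hi, x, kl, kh)"
      unfolding R_def b_def split
      by (rule code_rounding[OF n conjunct1[OF l[OF j]] conjunct2[OF l[OF j]] vle[OF j] q \<open>C0 \<ge> 0\<close> sp[OF j, unfolded b_def]]) blast
    then show ?thesis ..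
  qed
  then have "\<exists>r. \<forall>j. j < P \<longrightarrow> R j (r j)" by (intro choice) blast
  then obtain r where r: "R j (r j)" if "j < P" for j by blast
  define lo hi x kl kh where "lo j = fst (r j)" and "hi j = fst (snd (r j))" and "x j = fst (snd (snd (r j)))"
    and "kl j = fst (snd (snd (snd (r j))))" and "kh j = snd (snd (snd (snd (r j))))" for j
  note r' = r[unfolded R_def split_beta, folded lo_def hi_def x_def kl_def kh_def]
  have mem: "lo j \<in> ?C" "hi j \<in> ?C" "lo j \<noteq> hi j" and x: "0 \<le> x j" "x j \<le> 1"
    and m1: "(1 - x j) * code_val n (lo j) + x j * code_val n (hi j) = v j"
    and m2: "(1 - x j) * (code_val n (lo j))\<^sup>2 + x j * (code_val n (hi j))\<^sup>2 - (v j)\<^sup>2 \<in> {0..b j * \<bar>v j\<bar>}"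
    and m4: "(1 - x j) * (code_val n (lo j)) ^ 4 + x j * (code_val n (hi j)) ^ 4
       - ((1 - x j) * (code_val n (lo j))\<^sup>2 + x j * (code_val n (hi j))\<^sup>2)\<^sup>2 \<le> 9 * (b j * \<bar>v j\<bar>)"
    and k1: "(1 - x j) * exp (kl j) \<le> code_wt q (lo j)"
    and k2: "x j * exp (kh j) \<le> code_wt q (hi j)"
    and k3: "(1 - x j) * kl j + x j * kh j \<ge> - ((C0 + 3) * (real (l j) * (\<bar>v j\<bar> / b j)))"
    if "j < P" for j
    using r'[OF that] by blast+
  \<comment> \<open>The rounding law of coordinate j. The next function \<kappa> bounds the
    logarithm of prior over rounding law from below: \<mu> j a * exp (\<kappa> j a) never exceeds
    the prior weight of a.\<close>
  define \<mu> where "\<mu> j a = (if a = lo j then 1 - x j else if a = hi j then x j else 0)" for j a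
  define \<kappa> where "\<kappa> j a = (if a = lo j then kl j else kh j)" for j a
  have mean: "(\<Sum>a\<in>?C. \<mu> j a * g a) = (1 - x j) * g (lo j) + x j * g (hi j)" if j: "j < P" for j g
  proof -
    have "(\<Sum>a\<in>?C. \<mu> j a * g a) = (\<Sum>a\<in>?C. (if a = lo j then (1 - x j) * g a else 0) + (if a = hi j then x j * g a else 0))"
      using mem(3)[OF j] unfolding \<mu>_def by (intro sum.cong) auto
    then show ?thesis using mem[OF j] by (simp add: sum.distrib finite_codes)
  qed
  have mu1: "(\<Sum>a\<in>?C. \<mu> j a) = 1" if "j \<in> ?I" for j
    using mean[of j "\<lambda>_. 1"] that by simp
  have mu0: "\<mu> j a \<ge> 0" if "j \<in> ?I" for j a
    using x[of j] that unfolding \<mu>_def by auto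
  let ?E = "pexp ?I ?C \<mu>"
  let ?w = "\<lambda>c j. code_val n (c j)"
  note fin = finite_lessThan[of P] finite_codes[of n]
  define s where "s j = (\<Sum>a\<in>?C. \<mu> j a * (code_val n a)\<^sup>2)" for j
  have s: "(v j)\<^sup>2 \<le> s j" "s j \<le> (v j)\<^sup>2 + b j * \<bar>v j\<bar>" if "j < P" for j
    using m2[OF that] mean[OF that, of "\<lambda>a. (code_val n a)\<^sup>2"] unfolding s_def by auto
  have v2: "(\<Sum>j<P. (v j)\<^sup>2) = 1" using v1 by (simp add: dot_def power2_eq_square)
  \<comment> \<open>Rounding errors are centred and independent, so only their variances remain,
    each multiplied by the squared norm of its column.\<close>
  have quad: "?E (\<lambda>c. quad_form n P z (?w c)) \<le> quad_form n P z v + B' * real n * G"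
  proof -
    have "?E (\<lambda>c. (\<Sum>j<P. z k j * ?w c j)\<^sup>2) = (\<Sum>j<P. z k j * v j)\<^sup>2 + (\<Sum>j<P. (z k j)\<^sup>2 * (s j - (v j)\<^sup>2))" for k
    proof -
      have "(\<Sum>a\<in>?C. \<mu> j a * (z k j * code_val n a)) = z k j * v j" if "j < P" for j
      proof -
        have "(\<Sum>a\<in>?C. \<mu> j a * (z k j * code_val n a))
            = (1 - x j) * (z k j * code_val n (lo j)) + x j * (z k j * code_val n (hi j))"
          by (rule mean[OF that])
        also have "\<dots> = z k j * ((1 - x j) * code_val n (lo j) + x j * code_val n (hi j))" by algebra
        finally show ?thesis by (simp only: m1[OF that])
      qed
      moreover have "(\<Sum>a\<in>?C. \<mu> j a * (z k j * code_val n a)\<^sup>2) = (z k j)\<^sup>2 * s j" for j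
        unfolding s_def sum_distrib_left by (intro sum.cong refl) (simp add: power_mult_distrib)
      ultimately show ?thesis
        by (subst pexp_square_of_sum[OF fin mu1]) (simp_all add: power_mult_distrib right_diff_distrib)
    qed
    then have "?E (\<lambda>c. quad_form n P z (?w c)) = quad_form n P z v + (\<Sum>k<n. \<Sum>j<P. (z k j)\<^sup>2 * (s j - (v j)\<^sup>2))"
      unfolding quad_form_def pexp_sum by (simp add: sum.distrib)
    also have "(\<Sum>k<n. \<Sum>j<P. (z k j)\<^sup>2 * (s j - (v j)\<^sup>2)) = (\<Sum>j<P. (\<Sum>k<n. (z k j)\<^sup>2) * (s j - (v j)\<^sup>2))"
      unfolding sum_distrib_right by (rule sum.swap)
    also have "\<dots> \<le> (\<Sum>j<P. B' * real n * (b j * \<bar>v j\<bar>))"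
    proof (intro sum_mono mult_mono)
      fix j assume "j \<in> {..<P}"
      then show "(\<Sum>k<n. (z k j)\<^sup>2) \<le> B' * real n" "s j - (v j)\<^sup>2 \<le> b j * \<bar>v j\<bar>" "0 \<le> s j - (v j)\<^sup>2" "0 \<le> B' * real n"
        using col s B' by (auto simp: algebra_simps)
    qed
    also have "\<dots> = B' * real n * G" unfolding G_def sum_distrib_left ..
    finally show ?thesis by simp
  qed
  have nrm1: "?E (\<lambda>c. \<Sum>j<P. (?w c j)\<^sup>2) = (\<Sum>j<P. s j)"
    unfolding s_def by (rule pexp_sum_one[OF fin mu1])
  have sb: "1 \<le> (\<Sum>j<P. s j)" "(\<Sum>j<P. s j) \<le> 1 + G"
  proof -
    show "1 \<le> (\<Sum>j<P. s j)" unfolding v2[symmetric] using s(1) by (intro sum_mono) auto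
    show "(\<Sum>j<P. s j) \<le> 1 + G"
      unfolding v2[symmetric] G_def sum.distrib[symmetric] using s(2) by (intro sum_mono) auto
  qed
  have nrm2: "?E (\<lambda>c. (\<Sum>j<P. (?w c j)\<^sup>2)\<^sup>2) \<le> (1 + G)\<^sup>2 + 9 * G"
  proof -
    have "?E (\<lambda>c. (\<Sum>j<P. (?w c j)\<^sup>2)\<^sup>2) = (\<Sum>j<P. s j)\<^sup>2 + (\<Sum>j<P. (\<Sum>a\<in>?C. \<mu> j a * ((code_val n a)\<^sup>2)\<^sup>2) - (s j)\<^sup>2)"
      unfolding s_def by (rule pexp_square_of_sum[OF fin mu1])
    also have "\<dots> \<le> (1 + G)\<^sup>2 + (\<Sum>j<P. 9 * (b j * \<bar>v j\<bar>))"
    proof (intro add_mono power_mono sum_mono)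
      fix j assume j: "j \<in> {..<P}"
      have "(\<Sum>a\<in>?C. \<mu> j a * ((code_val n a)\<^sup>2)\<^sup>2) = (1 - x j) * code_val n (lo j) ^ 4 + x j * code_val n (hi j) ^ 4"
        using mean[of j "\<lambda>a. ((code_val n a)\<^sup>2)\<^sup>2"] j by simp
      moreover have "s j = (1 - x j) * (code_val n (lo j))\<^sup>2 + x j * (code_val n (hi j))\<^sup>2"
        using mean[of j "\<lambda>a. (code_val n a)\<^sup>2"] j unfolding s_def by simp
      ultimately show "(\<Sum>a\<in>?C. \<mu> j a * ((code_val n a)\<^sup>2)\<^sup>2) - (s j)\<^sup>2 \<le> 9 * (b j * \<bar>v j\<bar>)"
        using m4[of j] j by simp
    qed (use sb in auto)
    also have "\<dots> = (1 + G)\<^sup>2 + 9 * G" unfolding G_def sum_distrib_left ..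
    finally show ?thesis .
  qed
  have ent: "?E (\<lambda>c. \<Sum>j<P. \<kappa> j (c j)) \<ge> - ((C0 + 3) * (real n * G))"
  proof -
    have "- ((C0 + 3) * (real n * G)) = (\<Sum>j<P. - ((C0 + 3) * (real n * (b j * \<bar>v j\<bar>))))"
      unfolding G_def sum_distrib_left sum_negf ..
    also have "\<dots> \<le> (\<Sum>j<P. \<Sum>a\<in>?C. \<mu> j a * \<kappa> j a)"
    proof (intro sum_mono)
      fix j assume "j \<in> {..<P}"
      then have j: "j < P" by simp
      have bj: "b j > 0" "real n * (b j)\<^sup>2 = real (l j)" unfolding b_def using l[OF j] n by auto
      \<comment> \<open>With n*b^2 = l, the expected code length l*|v|/b becomes n*b*|v|, the
        summand of n*G.\<close>
      have "real (l j) * (\<bar>v j\<bar> / b j) = real n * (b j * \<bar>v j\<bar>)"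
        using bj(1) unfolding bj(2)[symmetric] by (simp add: power2_eq_square)
      then show "- ((C0 + 3) * (real n * (b j * \<bar>v j\<bar>))) \<le> (\<Sum>a\<in>?C. \<mu> j a * \<kappa> j a)"
        using k3[OF j] mem(3)[OF j] by (subst mean[OF j]) (simp add: \<kappa>_def)
    qed
    also have "\<dots> = ?E (\<lambda>c. \<Sum>j<P. \<kappa> j (c j))"
      by (rule pexp_sum_one[symmetric, OF fin mu1])
    finally show ?thesis .
  qed
  define \<psi> where "\<psi> c = - t * quad_form n P z (?w c) + real n * t * (\<Sum>j<P. (?w c j)\<^sup>2)
    - real n * t\<^sup>2 * B / 2 * (\<Sum>j<P. (?w c j)\<^sup>2)\<^sup>2" for c
  have "?E \<psi> = (- t) * ?E (\<lambda>c. quad_form n P z (?w c)) + real n * t * (\<Sum>j<P. s j)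
      + - (real n * t\<^sup>2 * B / 2) * ?E (\<lambda>c. (\<Sum>j<P. (?w c j)\<^sup>2)\<^sup>2)"
    unfolding \<psi>_def nrm1[symmetric] pexp_cmult[symmetric] pexp_add[symmetric] by simp
  moreover have "(- t) * ?E (\<lambda>c. quad_form n P z (?w c)) \<ge> (- t) * (quad_form n P z v + B' * real n * G)"
    using quad t by (intro mult_left_mono_neg) auto
  moreover have "real n * t * (\<Sum>j<P. s j) \<ge> real n * t * 1"
    using sb(1) t by (intro mult_left_mono) auto
  moreover have "- (real n * t\<^sup>2 * B / 2) * ?E (\<lambda>c. (\<Sum>j<P. (?w c j)\<^sup>2)\<^sup>2) \<ge> - (real n * t\<^sup>2 * B / 2) * ((1 + G)\<^sup>2 + 9 * G)"
    using nrm2 B by (intro mult_left_mono_neg) auto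
  ultimately have "real n * t - t * (quad_form n P z v + B' * real n * G)
      - real n * t\<^sup>2 * B / 2 * ((1 + G)\<^sup>2 + 9 * G) \<le> ?E \<psi>" by linarith
  then have "exp (real n * t - t * (quad_form n P z v + B' * real n * G)
      - real n * t\<^sup>2 * B / 2 * ((1 + G)\<^sup>2 + 9 * G) - (C0 + 3) * (real n * G))
      \<le> exp (?E \<psi> + ?E (\<lambda>c. \<Sum>j<P. \<kappa> j (c j)))"
    using ent by simp
  also have "\<dots> = exp (?E (\<lambda>c. \<psi> c + (\<Sum>j<P. \<kappa> j (c j))))" unfolding pexp_add ..
  also have "\<dots> \<le> ?E (\<lambda>c. exp (\<psi> c + (\<Sum>j<P. \<kappa> j (c j))))"
    by (rule exp_pexp_le[OF fin mu1 mu0])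
  also have "\<dots> \<le> pac_sum n P q t B z"
    unfolding pexp_def pac_sum_def
  proof (rule sum_mono)
    fix c assume c: "c \<in> ?I \<rightarrow>\<^sub>E ?C"
    have "(\<Prod>j<P. \<mu> j (c j)) * exp (\<psi> c + (\<Sum>j<P. \<kappa> j (c j))) = (\<Prod>j<P. \<mu> j (c j) * exp (\<kappa> j (c j))) * exp (\<psi> c)"
      by (simp add: exp_add exp_sum prod.distrib)
    also have "\<dots> \<le> (\<Prod>j<P. code_wt q (c j)) * exp (\<psi> c)"
    proof (intro mult_right_mono prod_mono conjI)
      fix j assume "j \<in> ?I"
      then have j: "j < P" by simp
      show "0 \<le> \<mu> j (c j) * exp (\<kappa> j (c j))" using mu0[of j] j by simp
      have "code_wt q (c j) \<ge> 0" using q unfolding code_wt_def by auto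
      then show "\<mu> j (c j) * exp (\<kappa> j (c j)) \<le> code_wt q (c j)"
        using k1[OF j] k2[OF j] unfolding \<mu>_def \<kappa>_def by auto
    qed auto
    finally show "(\<Prod>j\<in>?I. \<mu> j (c j)) * exp (\<psi> c + (\<Sum>j<P. \<kappa> j (c j))) \<le> (\<Prod>j<P. code_wt q (c j)) *
        exp (- t * quad_form n P z (?w c) + real n * t * (\<Sum>j<P. (?w c j)\<^sup>2)
          - real n * t\<^sup>2 * B / 2 * (\<Sum>j<P. (?w c j)\<^sup>2)\<^sup>2)" unfolding \<psi>_def by simp
  qed
  finally show ?thesis .
qed

text \<open>The product with the fourth moment constant is 1/80, so that the second-order term of
  the exponent takes only a fortieth of the leading term n*t.\<close>

definition re_step :: "real \<Rightarrow> real" where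
  "re_step K = 1 / (80 * (128 * K ^ 4 * Csq))"

text \<open>Chernoff level at which one column fails with probability exp(-2*n); half of this
  exponent is spent on a union over at most exp(n) columns.\<close>

definition col_bound :: "real \<Rightarrow> real" where
  "col_bound K = 8 * K\<^sup>2 * (ln Csq + 2)"

text \<open>Passing from the sparsity factor 8*n/P to the prior factor t*n/(64*P) loses a ratio
  512/t. It is absorbed into a larger exponential rate, which works because every level is at least
  1.\<close>

definition re_rate :: "real \<Rightarrow> real" where
  "re_rate K = 1 + ln (max 1 (512 / re_step K))"

text \<open>Small enough that the variance and the entropy of the rounding together take at most a
  quarter of n*t.\<close>

definition cone_bound :: "real \<Rightarrow> real" where
  "cone_bound K = 1 / (10 + 4 * (col_bound K + (re_rate K + 3) / re_step K))"

lemma re_constants_pos: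
  assumes "K > 0"
  shows "re_step K > 0" "col_bound K > 0" "re_rate K \<ge> 1" "0 < cone_bound K" "cone_bound K \<le> 1/10"
    "(col_bound K + (re_rate K + 3) / re_step K) * cone_bound K \<le> 1/4"
proof -
  show t: "re_step K > 0" using assms Csq_gt unfolding re_step_def by simp
  have "ln Csq > 0" using Csq_gt by simp
  then show c: "col_bound K > 0" using assms unfolding col_bound_def by simp
  show r: "re_rate K \<ge> 1" unfolding re_rate_def by simp
  define x where "x = col_bound K + (re_rate K + 3) / re_step K"
  have x: "x \<ge> 0" unfolding x_def using t c r by simp
  show "0 < cone_bound K" "cone_bound K \<le> 1/10"
    using x unfolding cone_bound_def x_def[symmetric] by (auto simp: field_simps)
  show "(col_bound K + (re_rate K + 3) / re_step K) * cone_bound K \<le> 1/4"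
    using x unfolding cone_bound_def x_def[symmetric] by (simp add: field_simps)
qed

text \<open>
  The restricted eigenvalue property: \<open>l\<close> assigns to each coordinate the level of its penalty
  weight $\sqrt{l_j/n}$, and the cone is given by the weighted $\ell_1$ norm.
\<close>

definition regular_design :: "nat \<Rightarrow> nat \<Rightarrow> real \<Rightarrow> (nat \<Rightarrow> nat \<Rightarrow> real) \<Rightarrow> bool" where
  "regular_design n P K z \<longleftrightarrow>
     (\<forall>j<P. (\<Sum>k<n. (z k j)\<^sup>2) \<le> col_bound K * real n) \<and>
     (\<forall>v l. dot P v v = 1 \<longrightarrow> (\<forall>j<P. 1 \<le> l j \<and> l j \<le> n) \<longrightarrow>
        (\<forall>j<P. min 1 (\<bar>v j\<bar> * sqrt (real n)) \<le> 8 * real n / real P * exp (real (l j))) \<longrightarrow>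
        (\<Sum>j<P. sqrt (real (l j) / real n) * \<bar>v j\<bar>) \<le> cone_bound K \<longrightarrow>
        real n / 2 \<le> quad_form n P z v)"

text \<open>Compares the exponents of the two bounds on \<open>pac_sum\<close>. Relative to n*t the
  losses are 1/40 (second order), 1/4 (rounding) and twice 1/32 (prior mass and confidence), which
  leaves 53/80 > 1/2.\<close>

lemma regular_designI:
  assumes n: "n \<ge> 1" and P: "P \<ge> 1" and K: "K > 0" and "\<delta> > 0"
  defines "q \<equiv> min 1 (re_step K * real n / (64 * real P))"
  assumes col: "\<And>j. j < P \<Longrightarrow> (\<Sum>k<n. (z k j)\<^sup>2) \<le> col_bound K * real n"
    and pac: "pac_sum n P q (re_step K) (128 * K ^ 4 * Csq) z \<le> (1 + 2 * q) ^ P / \<delta>"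
    and d: "ln (1 / \<delta>) \<le> re_step K * real n / 32"
  shows "regular_design n P K z"
  unfolding regular_design_def
proof (intro conjI allI impI)
  fix j assume "j < P" then show "(\<Sum>k<n. (z k j)\<^sup>2) \<le> col_bound K * real n" by (rule col)
next
  fix v :: vec and l :: "nat \<Rightarrow> nat"
  assume v1: "dot P v v = 1" and l: "\<forall>j<P. 1 \<le> l j \<and> l j \<le> n"
    and sp: "\<forall>j<P. min 1 (\<bar>v j\<bar> * sqrt (real n)) \<le> 8 * real n / real P * exp (real (l j))"
    and G: "(\<Sum>j<P. sqrt (real (l j) / real n) * \<bar>v j\<bar>) \<le> cone_bound K"
  note c = re_constants_pos[OF K]
  let ?t = "re_step K" and ?B = "128 * K ^ 4 * Csq" and ?C0 = "re_rate K" and ?B' = "col_bound K"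
  let ?b = "\<lambda>j. sqrt (real (l j) / real n)"
  define g where "g = (\<Sum>j<P. ?b j * \<bar>v j\<bar>)"
  have g: "0 \<le> g" "g \<le> cone_bound K" unfolding g_def using G by (auto intro!: sum_nonneg)
  have q: "0 < q" "q \<le> 1" unfolding q_def using c n P by auto
  have B: "?B > 0" using K Csq_gt by simp
  have tB: "?t * ?B = 1 / 80" unfolding re_step_def using K Csq_gt by simp
  \<comment> \<open>A level of at least 1 means a step of at least 1/sqrt n, so a bound on |v|*sqrt
    n also bounds the rounding probability. For q = 1 the claim is trivial, the left side being at
    most 1.\<close>
  have sp': "min 1 (\<bar>v j\<bar> / ?b j) \<le> q * exp (?C0 * real (l j))" if j: "j < P" for j
  proof -
    have lj: "1 \<le> real (l j)" using l j by auto
    have C0l: "?C0 * real (l j) \<ge> real (l j) + ln (max 1 (512 / ?t))"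
    proof -
      have "ln (max 1 (512 / ?t)) * 1 \<le> ln (max 1 (512 / ?t)) * real (l j)"
        using lj by (intro mult_left_mono) auto
      then show ?thesis unfolding re_rate_def by (simp add: distrib_right)
    qed
    show ?thesis
    proof (cases "q = 1")
      case True
      have "0 \<le> ?C0 * real (l j)" using c(3) by simp
      then show ?thesis using True by (simp add: min_le_iff_disj)
    next
      case False
      then have qe: "q = ?t * real n / (64 * real P)" unfolding q_def by (simp add: min_def split: if_splits)
      have "\<bar>v j\<bar> / ?b j \<le> \<bar>v j\<bar> * sqrt (real n)"
      proof -
        have "?b j \<ge> 1 / sqrt (real n)" unfolding real_sqrt_divide using lj by (intro divide_right_mono) auto
        then have "\<bar>v j\<bar> / ?b j \<le> \<bar>v j\<bar> / (1 / sqrt (real n))"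
          using n lj by (intro divide_left_mono) auto
        then show ?thesis by simp
      qed
      then have "min 1 (\<bar>v j\<bar> / ?b j) \<le> min 1 (\<bar>v j\<bar> * sqrt (real n))" by auto
      also have "\<dots> \<le> 8 * real n / real P * exp (real (l j))" using sp j by blast
      also have "\<dots> = ?t * real n / (64 * real P) * (exp (real (l j)) * (512 / ?t))"
        using c(1) P by (simp add: field_simps)
      also have "\<dots> \<le> q * (exp (real (l j)) * max 1 (512 / ?t))"
        unfolding qe[symmetric] using q by (intro mult_left_mono) auto
      also have "exp (real (l j)) * max 1 (512 / ?t) = exp (real (l j) + ln (max 1 (512 / ?t)))"
        by (simp add: exp_add)
      finally have *: "min 1 (\<bar>v j\<bar> / ?b j) \<le> q * exp (real (l j) + ln (max 1 (512 / ?t)))" .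
      have "q * exp (real (l j) + ln (max 1 (512 / ?t))) \<le> q * exp (?C0 * real (l j))"
        using C0l q by (intro mult_left_mono) auto
      then show ?thesis using * by linarith
    qed
  qed
  have "exp (real n * ?t - ?t * (quad_form n P z v + ?B' * real n * g)
      - real n * ?t\<^sup>2 * ?B / 2 * ((1 + g)\<^sup>2 + 9 * g) - (?C0 + 3) * (real n * g)) \<le> pac_sum n P q ?t ?B z"
    unfolding g_def
    by (rule pac_sum_lower_bound[where l = l and b = ?b and B' = ?B'])
      (use n l v1 q c B sp' col in auto)
  also have "\<dots> \<le> (1 + 2 * q) ^ P / \<delta>" by (rule pac)
  also have "\<dots> \<le> exp (?t * real n / 32) * exp (?t * real n / 32)"
  proof -
    have "(1 + 2 * q) ^ P \<le> exp (2 * q) ^ P" using q exp_ge_add_one_self[of "2 * q"] by (intro power_mono) auto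
    also have "\<dots> = exp (real P * (2 * q))" by (simp add: exp_of_nat_mult)
    also have "\<dots> \<le> exp (?t * real n / 32)"
    proof -
      have "real P * (2 * q) \<le> real P * (2 * (?t * real n / (64 * real P)))"
        unfolding q_def by (intro mult_left_mono) auto
      then show ?thesis using P by (simp add: mult.commute)
    qed
    finally have 1: "(1 + 2 * q) ^ P \<le> exp (?t * real n / 32)" .
    have "1 / \<delta> = exp (ln (1 / \<delta>))" using \<open>\<delta> > 0\<close> by simp
    also have "\<dots> \<le> exp (?t * real n / 32)" using d by simp
    finally have 2: "1 / \<delta> \<le> exp (?t * real n / 32)" .
    have "(1 + 2 * q) ^ P * (1 / \<delta>) \<le> exp (?t * real n / 32) * exp (?t * real n / 32)"
      using 1 2 q \<open>\<delta> > 0\<close> by (intro mult_mono) auto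
    then show ?thesis by simp
  qed
  also have "\<dots> = exp (?t * real n / 16)" by (simp flip: exp_add)
  finally have main: "real n * ?t - ?t * (quad_form n P z v + ?B' * real n * g)
      - real n * ?t\<^sup>2 * ?B / 2 * ((1 + g)\<^sup>2 + 9 * g) - (?C0 + 3) * (real n * g) \<le> ?t * real n / 16"
    by simp
  have "real n * ?t\<^sup>2 * ?B / 2 * ((1 + g)\<^sup>2 + 9 * g) = (real n * ?t / 160) * ((1 + g)\<^sup>2 + 9 * g)"
  proof -
    have "real n * ?t\<^sup>2 * ?B / 2 = real n * ?t * (?t * ?B) / 2" by (simp only: power2_eq_square mult_ac)
    also have "\<dots> = real n * ?t / 160" unfolding tB by simp
    finally show ?thesis by (simp only:)
  qed
  also have "\<dots> \<le> (real n * ?t / 160) * 4"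
  proof (intro mult_left_mono)
    have "g \<le> 1/10" using g c(5) by linarith
    then have "(1 + g)\<^sup>2 \<le> (11/10)\<^sup>2" using g by (intro power_mono) auto
    then show "(1 + g)\<^sup>2 + 9 * g \<le> 4" using \<open>g \<le> 1/10\<close> by (simp add: power2_eq_square)
  qed (use c in auto)
  finally have quart: "real n * ?t\<^sup>2 * ?B / 2 * ((1 + g)\<^sup>2 + 9 * g) \<le> ?t * real n / 40"
    by (simp add: mult_ac)
  have "(?B' + (?C0 + 3) / ?t) * g \<le> (?B' + (?C0 + 3) / ?t) * cone_bound K"
    using g c by (intro mult_left_mono) auto
  also have "\<dots> \<le> 1/4" by (rule c(6))
  finally have "?t * real n * ((?B' + (?C0 + 3) / ?t) * g) \<le> ?t * real n * (1/4)"
    using c(1) by (intro mult_left_mono) auto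
  moreover have "?t * real n * ((?B' + (?C0 + 3) / ?t) * g) = ?t * (?B' * real n * g) + (?C0 + 3) * (real n * g)"
    using c(1) by (simp add: field_simps)
  ultimately have "?t * quad_form n P z v \<ge> ?t * real n - ?t * real n / 40 - ?t * real n / 16 - ?t * real n / 4"
    using main quart unfolding distrib_left[of ?t] mult.commute[of "real n" ?t] by linarith
  then have "?t * quad_form n P z v \<ge> (?t * real n) * (53/80)" by linarith
  then have "?t * (real n * (53/80)) \<le> ?t * quad_form n P z v" by (simp only: mult.assoc)
  then have "real n * (53/80) \<le> quad_form n P z v" using c(1) by simp
  then show "real n / 2 \<le> quad_form n P z v" by linarith
qed

section \<open>Regular designs have high probability\<close>

context subg_array
begin

text \<open>The quadratic bound for exp(-x) turns a second and a fourth moment into a bound of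
  Gaussian type for the lower tail, without exponential moments of the squares.\<close>

lemma exp_neg_lin_square:
  assumes "k < n" "t \<ge> 0"
  shows "expectation (\<lambda>\<omega>. exp (- t * (lin w k \<omega>)\<^sup>2)) \<le> exp (- t * dot P w w + t\<^sup>2 * B4 / 2 * (dot P w w)\<^sup>2)"
    and "integrable M (\<lambda>\<omega>. exp (- t * (lin w k \<omega>)\<^sup>2))"
proof -
  show int: "integrable M (\<lambda>\<omega>. exp (- t * (lin w k \<omega>)\<^sup>2))"
    using assms by (intro integrable_const_bound[where B = 1]) auto
  note i2 = lin_square_integrable[OF assms(1), of w] and i4 = lin_fourth[OF assms(1), of w]
  have "expectation (\<lambda>\<omega>. exp (- t * (lin w k \<omega>)\<^sup>2))
      \<le> expectation (\<lambda>\<omega>. 1 - t * (lin w k \<omega>)\<^sup>2 + t\<^sup>2 / 2 * (lin w k \<omega>) ^ 4)"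
  proof (intro integral_mono int)
    show "integrable M (\<lambda>\<omega>. 1 - t * (lin w k \<omega>)\<^sup>2 + t\<^sup>2 / 2 * (lin w k \<omega>) ^ 4)"
      using i2 i4(1) by simp
    fix \<omega>
    have "(t * (lin w k \<omega>)\<^sup>2)\<^sup>2 = t\<^sup>2 * (lin w k \<omega>) ^ 4" by (simp add: power_mult_distrib flip: power_mult)
    then show "exp (- t * (lin w k \<omega>)\<^sup>2) \<le> 1 - t * (lin w k \<omega>)\<^sup>2 + t\<^sup>2 / 2 * (lin w k \<omega>) ^ 4"
      using exp_neg_le_quadratic[of "t * (lin w k \<omega>)\<^sup>2"] assms(2) by simp
  qed
  also have "\<dots> = 1 - t * expectation (\<lambda>\<omega>. (lin w k \<omega>)\<^sup>2) + t\<^sup>2 / 2 * expectation (\<lambda>\<omega>. (lin w k \<omega>) ^ 4)"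
    using i2 i4(1) by (simp add: prob_space)
  also have "expectation (\<lambda>\<omega>. (lin w k \<omega>)\<^sup>2) = dot P w w"
    using lin_cov[OF assms(1), of w w] by (simp add: power2_eq_square)
  also have "1 - t * dot P w w + t\<^sup>2 / 2 * expectation (\<lambda>\<omega>. (lin w k \<omega>) ^ 4)
      \<le> 1 + (- t * dot P w w + t\<^sup>2 / 2 * (B4 * (dot P w w)\<^sup>2))"
    using mult_left_mono[OF i4(2), of "t\<^sup>2 / 2"] by simp
  also have "\<dots> \<le> exp (- t * dot P w w + t\<^sup>2 / 2 * (B4 * (dot P w w)\<^sup>2))"
    by (rule exp_ge_add_one_self)
  finally show "expectation (\<lambda>\<omega>. exp (- t * (lin w k \<omega>)\<^sup>2)) \<le> exp (- t * dot P w w + t\<^sup>2 * B4 / 2 * (dot P w w)\<^sup>2)"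
    by (simp add: mult_ac)
qed

lemma quad_form_eq: "quad_form n P (\<lambda>k j. Z (k, j) \<omega>) w = (\<Sum>k<n. (lin w k \<omega>)\<^sup>2)"
  unfolding quad_form_def lin_eq by (simp add: mult.commute)

lemma exp_quad_form_bound:
  assumes "t \<ge> 0"
  shows "integrable M (\<lambda>\<omega>. exp (- t * quad_form n P (\<lambda>k j. Z (k, j) \<omega>) w))"
    and "expectation (\<lambda>\<omega>. exp (- t * quad_form n P (\<lambda>k j. Z (k, j) \<omega>) w))
      \<le> exp (real n * (- t * dot P w w + t\<^sup>2 * B4 / 2 * (dot P w w)\<^sup>2))"
proof -
  have ind: "indep_vars (\<lambda>_. borel) (\<lambda>k \<omega>. exp (- t * (lin w k \<omega>)\<^sup>2)) {..<n}"
    unfolding lin_def by (rule row_fun_indep) measurable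
  have eq: "exp (- t * quad_form n P (\<lambda>k j. Z (k, j) \<omega>) w) = (\<Prod>k<n. exp (- t * (lin w k \<omega>)\<^sup>2))" for \<omega>
    unfolding quad_form_eq by (simp add: exp_sum sum_distrib_left)
  show "integrable M (\<lambda>\<omega>. exp (- t * quad_form n P (\<lambda>k j. Z (k, j) \<omega>) w))"
    unfolding eq using exp_neg_lin_square(2)[OF _ assms] by (intro indep_vars_integrable ind) auto
  have "expectation (\<lambda>\<omega>. exp (- t * quad_form n P (\<lambda>k j. Z (k, j) \<omega>) w))
      = (\<Prod>k<n. expectation (\<lambda>\<omega>. exp (- t * (lin w k \<omega>)\<^sup>2)))"
    unfolding eq using exp_neg_lin_square(2)[OF _ assms] by (intro indep_vars_lebesgue_integral ind) auto
  also have "\<dots> \<le> (\<Prod>k<n. exp (- t * dot P w w + t\<^sup>2 * B4 / 2 * (dot P w w)\<^sup>2))"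
    using exp_neg_lin_square(1)[OF _ assms] by (intro prod_mono) (auto intro!: integral_nonneg)
  also have "\<dots> = exp (real n * (- t * dot P w w + t\<^sup>2 * B4 / 2 * (dot P w w)\<^sup>2))"
    by (simp flip: exp_of_nat_mult)
  finally show "expectation (\<lambda>\<omega>. exp (- t * quad_form n P (\<lambda>k j. Z (k, j) \<omega>) w))
      \<le> exp (real n * (- t * dot P w w + t\<^sup>2 * B4 / 2 * (dot P w w)\<^sup>2))" .
qed

lemma expectation_pac_sum:
  assumes "t \<ge> 0" "q \<ge> 0"
  shows "integrable M (\<lambda>\<omega>. pac_sum n P q t B4 (\<lambda>k j. Z (k, j) \<omega>))"
    and "expectation (\<lambda>\<omega>. pac_sum n P q t B4 (\<lambda>k j. Z (k, j) \<omega>)) \<le> (1 + 2 * q) ^ P"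
proof -
  let ?D = "{..<P} \<rightarrow>\<^sub>E codes n"
  let ?N = "\<lambda>c. \<Sum>j<P. (code_val n (c j))\<^sup>2"
  let ?Q = "\<lambda>c \<omega>. exp (- t * quad_form n P (\<lambda>k j. Z (k, j) \<omega>) (\<lambda>j. code_val n (c j)))"
  let ?a = "\<lambda>c. (\<Prod>j<P. code_wt q (c j))" and ?e = "\<lambda>c. exp (real n * t * ?N c - real n * t\<^sup>2 * B4 / 2 * (?N c)\<^sup>2)"
  have eq: "pac_sum n P q t B4 (\<lambda>k j. Z (k, j) \<omega>) = (\<Sum>c\<in>?D. ?a c * ?e c * ?Q c \<omega>)" for \<omega>
    unfolding pac_sum_def by (intro sum.cong refl) (simp add: mult_ac diff_add_eq flip: exp_add)
  have i: "integrable M (?Q c)" for c by (rule exp_quad_form_bound(1)[OF assms(1)])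
  show "integrable M (\<lambda>\<omega>. pac_sum n P q t B4 (\<lambda>k j. Z (k, j) \<omega>))"
    unfolding eq using i by (intro Bochner_Integration.integrable_sum integrable_mult_right)
  have a0: "?a c \<ge> 0" for c using assms(2) unfolding code_wt_def by (intro prod_nonneg) auto
  have "expectation (\<lambda>\<omega>. pac_sum n P q t B4 (\<lambda>k j. Z (k, j) \<omega>)) = (\<Sum>c\<in>?D. expectation (\<lambda>\<omega>. ?a c * ?e c * ?Q c \<omega>))"
    unfolding eq using i by (intro Bochner_Integration.integral_sum integrable_mult_right)
  also have "\<dots> = (\<Sum>c\<in>?D. ?a c * ?e c * expectation (?Q c))" by simp
  also have "\<dots> \<le> (\<Sum>c\<in>?D. ?a c)"
  proof (rule sum_mono)
    fix c
    have N: "dot P (\<lambda>j. code_val n (c j)) (\<lambda>j. code_val n (c j)) = ?N c" unfolding dot_def by (simp add: power2_eq_square)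
    have "?e c * expectation (?Q c) \<le> ?e c * exp (real n * (- t * ?N c + t\<^sup>2 * B4 / 2 * (?N c)\<^sup>2))"
      using exp_quad_form_bound(2)[OF assms(1), of "\<lambda>j. code_val n (c j)"] unfolding N by (intro mult_left_mono) auto
    also have "\<dots> = 1" by (simp add: algebra_simps flip: exp_add)
    finally have "?a c * (?e c * expectation (?Q c)) \<le> ?a c * 1" using a0 by (intro mult_left_mono)
    then show "?a c * ?e c * expectation (?Q c) \<le> ?a c" by (simp only: mult.assoc mult_1_right)
  qed
  also have "\<dots> = (\<Prod>j<P. \<Sum>a\<in>codes n. code_wt q a)"
    by (subst prod_sum_PiE) (auto simp: finite_codes)
  also have "\<dots> \<le> (\<Prod>j<P. 1 + 2 * q)"
    using sum_code_wt_le[OF assms(2)] assms(2) by (intro prod_mono) (auto intro!: sum_nonneg simp: code_wt_def)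
  finally show "expectation (\<lambda>\<omega>. pac_sum n P q t B4 (\<lambda>k j. Z (k, j) \<omega>)) \<le> (1 + 2 * q) ^ P" by simp
qed

lemma column_norm_tail:
  assumes "j < P" "n \<ge> 1"
  shows "prob {\<omega> \<in> space M. (\<Sum>k<n. (Z (k, j) \<omega>)\<^sup>2) \<ge> col_bound K * real n} \<le> exp (- 2 * real n)"
proof -
  let ?u = "\<lambda>i. of_bool (i = j) :: real" and ?a = "8 * K\<^sup>2"
  have d: "dot P ?u ?u = 1" using dot_unit[OF assms(1), of ?u] by simp
  have a: "?a > 0" using K_pos by simp
  let ?f = "\<lambda>k \<omega>. exp ((Z (k, j) \<omega>)\<^sup>2 / ?a)"
  have f: "integrable M (?f k)" "expectation (?f k) \<le> Csq" if "k < n" for k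
    using lin_exp_square[OF that, of ?u] lin_unit[OF assms(1), of k] by (auto simp: d)
  have "indep_vars (\<lambda>_. borel) (\<lambda>k \<omega>. exp ((row k \<omega> j)\<^sup>2 / ?a)) {..<n}"
  proof (rule row_fun_indep)
    have "(\<lambda>x. x j) \<in> borel_measurable (vec_space P)"
      using assms(1) unfolding vec_space_def by (intro measurable_component_singleton) auto
    then show "(\<lambda>x. exp ((x j)\<^sup>2 / ?a)) \<in> borel_measurable (vec_space P)" by measurable
  qed
  then have ind: "indep_vars (\<lambda>_. borel) ?f {..<n}" using assms(1) by (simp add: row_def)
  have eq: "exp ((\<Sum>k<n. (Z (k, j) \<omega>)\<^sup>2) / ?a) = (\<Prod>k<n. ?f k \<omega>)" for \<omega>
    by (simp add: exp_sum sum_divide_distrib)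
  have int: "integrable M (\<lambda>\<omega>. exp ((\<Sum>k<n. (Z (k, j) \<omega>)\<^sup>2) / ?a))"
    unfolding eq using f by (intro indep_vars_integrable ind) auto
  have "expectation (\<lambda>\<omega>. exp ((\<Sum>k<n. (Z (k, j) \<omega>)\<^sup>2) / ?a)) = (\<Prod>k<n. expectation (?f k))"
    unfolding eq using f by (intro indep_vars_lebesgue_integral ind) auto
  also have "\<dots> \<le> (\<Prod>k<n. Csq)" using f by (intro prod_mono) (auto intro!: integral_nonneg)
  also have "\<dots> = exp (real n * ln Csq)" using Csq_gt by (simp add: exp_of_nat_mult)
  finally have E: "expectation (\<lambda>\<omega>. exp ((\<Sum>k<n. (Z (k, j) \<omega>)\<^sup>2) / ?a)) \<le> exp (real n * ln Csq)" .
  let ?c = "exp (real n * (ln Csq + 2))"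
  have "{\<omega> \<in> space M. (\<Sum>k<n. (Z (k, j) \<omega>)\<^sup>2) \<ge> col_bound K * real n}
      = {\<omega> \<in> space M. exp ((\<Sum>k<n. (Z (k, j) \<omega>)\<^sup>2) / ?a) \<ge> ?c}"
    using a unfolding col_bound_def by (auto simp: field_simps)
  then have "prob {\<omega> \<in> space M. (\<Sum>k<n. (Z (k, j) \<omega>)\<^sup>2) \<ge> col_bound K * real n}
      = prob {\<omega> \<in> space M. exp ((\<Sum>k<n. (Z (k, j) \<omega>)\<^sup>2) / ?a) \<ge> ?c}" by simp
  also have "\<dots> \<le> expectation (\<lambda>\<omega>. exp ((\<Sum>k<n. (Z (k, j) \<omega>)\<^sup>2) / ?a)) / ?c"
    by (rule integral_Markov_inequality_measure[where A = "{}", OF int]) auto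
  also have "\<dots> \<le> exp (real n * ln Csq) / ?c" using E by (intro divide_right_mono) auto
  also have "\<dots> = exp (- 2 * real n)" by (simp add: algebra_simps flip: exp_diff)
  finally show ?thesis .
qed

text \<open>Half of \<delta> pays for Markov's inequality applied to the mixture, half for the union
  over the column norms.\<close>

theorem regular_design_prob:
  assumes n: "n \<ge> 1" and P: "P \<ge> 1" "real P \<le> exp (real n)" and d: "0 < \<delta>" "\<delta> < 1"
    and n1: "ln (2 / \<delta>) \<le> re_step K * real n / 32" and n2: "ln (2 / \<delta>) \<le> real n"
  shows "\<exists>E\<in>events. prob E \<ge> 1 - \<delta> \<and> (\<forall>\<omega>\<in>E. regular_design n P K (\<lambda>k j. Z (k, j) \<omega>))"
proof -
  let ?q = "min 1 (re_step K * real n / (64 * real P))" and ?t = "re_step K"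
  let ?W = "\<lambda>\<omega>. pac_sum n P ?q ?t B4 (\<lambda>k j. Z (k, j) \<omega>)"
  note c = re_constants_pos[OF K_pos]
  have q: "?q > 0" using c n P by auto
  have [measurable]: "?W \<in> borel_measurable M"
    using expectation_pac_sum(1)[of ?t ?q] c q by (intro borel_measurable_integrable) auto
  have [measurable]: "(\<lambda>\<omega>. \<Sum>k<n. (Z (k, j) \<omega>)\<^sup>2) \<in> borel_measurable M" if "j < P" for j
    using that by (intro borel_measurable_sum borel_measurable_power Z_measurable) auto
  define F1 where "F1 = {\<omega> \<in> space M. ?W \<omega> \<ge> (1 + 2 * ?q) ^ P * (2 / \<delta>)}"
  define F2 where "F2 j = {\<omega> \<in> space M. (\<Sum>k<n. (Z (k, j) \<omega>)\<^sup>2) \<ge> col_bound K * real n}" for j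
  have [measurable]: "F1 \<in> events" unfolding F1_def by measurable
  have F2m: "F2 j \<in> events" if "j < P" for j unfolding F2_def using that by measurable
  have W0: "?W \<omega> \<ge> 0" for \<omega>
    unfolding pac_sum_def code_wt_def using q by (intro sum_nonneg mult_nonneg_nonneg prod_nonneg) auto
  have pos: "(1 + 2 * ?q) ^ P > 0" using q by (intro zero_less_power) linarith
  have "prob F1 \<le> expectation ?W / ((1 + 2 * ?q) ^ P * (2 / \<delta>))"
    unfolding F1_def using c q d pos W0
    by (intro integral_Markov_inequality_measure[where A = "{}"] expectation_pac_sum(1)) auto
  also have "\<dots> \<le> (1 + 2 * ?q) ^ P / ((1 + 2 * ?q) ^ P * (2 / \<delta>))"
    using c q d pos by (intro divide_right_mono expectation_pac_sum(2)) auto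
  also have "\<dots> = \<delta> / 2"
  proof -
    have "a > 0 \<Longrightarrow> a / (a * (2 / \<delta>)) = \<delta> / 2" for a :: real by simp
    then show ?thesis using pos .
  qed
  finally have p1: "prob F1 \<le> \<delta> / 2" .
  have "prob (\<Union>j<P. F2 j) \<le> (\<Sum>j<P. prob (F2 j))"
    using F2m by (intro finite_measure_subadditive_finite) auto
  also have "\<dots> \<le> (\<Sum>j<P. exp (- 2 * real n))"
    unfolding F2_def using n by (intro sum_mono column_norm_tail) auto
  also have "\<dots> = real P * exp (- 2 * real n)" by simp
  also have "\<dots> \<le> exp (real n) * exp (- 2 * real n)" using P by (intro mult_right_mono) auto
  also have "\<dots> = exp (- real n)" by (simp flip: exp_add)
  also have "\<dots> \<le> exp (- ln (2 / \<delta>))" using n2 by simp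
  also have "\<dots> = \<delta> / 2" using d by (simp add: exp_minus)
  finally have p2: "prob (\<Union>j<P. F2 j) \<le> \<delta> / 2" .
  define E where "E = space M - (F1 \<union> (\<Union>j<P. F2 j))"
  have UF: "(\<Union>j<P. F2 j) \<in> events" using F2m by auto
  have E: "E \<in> events" unfolding E_def using UF by measurable
  have "prob (F1 \<union> (\<Union>j<P. F2 j)) \<le> prob F1 + prob (\<Union>j<P. F2 j)"
    using UF by (intro measure_Un_le) auto
  then have "prob E \<ge> 1 - \<delta>"
    unfolding E_def using p1 p2 UF by (subst prob_compl) auto
  moreover have "regular_design n P K (\<lambda>k j. Z (k, j) \<omega>)" if w: "\<omega> \<in> E" for \<omega>
  proof (rule regular_designI[OF n P(1) K_pos, of "\<delta> / 2"])
    show "(\<Sum>k<n. (Z (k, j) \<omega>)\<^sup>2) \<le> col_bound K * real n" if "j < P" for j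
      using w that unfolding E_def F2_def by force
    have "?W \<omega> \<le> (1 + 2 * ?q) ^ P * (2 / \<delta>)" using w unfolding E_def F1_def by auto
    then show "pac_sum n P ?q ?t (128 * K ^ 4 * Csq) (\<lambda>k j. Z (k, j) \<omega>) \<le> (1 + 2 * ?q) ^ P / (\<delta> / 2)"
      unfolding B4_def by simp
    show "ln (1 / (\<delta> / 2)) \<le> ?t * real n / 32" using n1 by simp
  qed (use d in auto)
  ultimately show ?thesis using E by blast
qed

end

section \<open>Products of two linear forms\<close>

context subg_array
begin

text \<open>
  For \<open>v\<close> the vector of the errors $(\theta-\hat\theta,\sigma)$, \<open>lin v\<close> is the residual and
  \<open>uprod (\<lambda>i. of_bool (i = j)) v k\<close> is the centred summand of $a_j$ for the row \<open>k\<close>.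
\<close>

definition ufun :: "vec \<Rightarrow> vec \<Rightarrow> vec \<Rightarrow> real" where
  "ufun a v x = dot P a x * dot P v x - dot P a v"

definition uprod :: "vec \<Rightarrow> vec \<Rightarrow> nat \<Rightarrow> 'a \<Rightarrow> real" where
  "uprod a v k \<omega> = ufun a v (row k \<omega>)"

lemma uprod_eq: "uprod a v k \<omega> = lin a k \<omega> * lin v k \<omega> - dot P a v"
  unfolding uprod_def ufun_def lin_def ..

lemma ufun_measurable [measurable]: "ufun a v \<in> borel_measurable (vec_space P)"
  unfolding ufun_def by measurable

lemma uprod_measurable [measurable]: "k < n \<Longrightarrow> uprod a v k \<in> borel_measurable M"
  unfolding uprod_def by measurable

lemma lin_prod_integrable:
  assumes "k < n"
  shows "integrable M (\<lambda>\<omega>. lin a k \<omega> * lin v k \<omega>)"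
  using assms by (intro integrable_prod_of_squares lin_square_integrable) auto

lemma uprod_integrable:
  assumes "k < n"
  shows "integrable M (uprod a v k)" and "expectation (uprod a v k) = 0"
  unfolding uprod_eq[abs_def] using lin_prod_integrable[OF assms] lin_cov[OF assms] by (simp_all add: prob_space)

lemma uprod_square:
  assumes "k < n"
  shows "integrable M (\<lambda>\<omega>. (uprod a v k \<omega>)\<^sup>2)"
    and "expectation (\<lambda>\<omega>. (uprod a v k \<omega>)\<^sup>2) \<le> B4 * dot P a a * dot P v v"
proof -
  let ?d = "dot P a v"
  note sq = lin_square_prod[OF assms, of a v] and i = lin_prod_integrable[OF assms, of a v]
  have eq: "(uprod a v k \<omega>)\<^sup>2 = (lin a k \<omega>)\<^sup>2 * (lin v k \<omega>)\<^sup>2 - 2 * ?d * (lin a k \<omega> * lin v k \<omega>) + ?d\<^sup>2" for \<omega>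
    unfolding uprod_eq by (simp add: power2_eq_square algebra_simps)
  show "integrable M (\<lambda>\<omega>. (uprod a v k \<omega>)\<^sup>2)"
    unfolding eq using sq(1) i by simp
  have "expectation (\<lambda>\<omega>. (uprod a v k \<omega>)\<^sup>2)
      = expectation (\<lambda>\<omega>. (lin a k \<omega>)\<^sup>2 * (lin v k \<omega>)\<^sup>2) - 2 * ?d * expectation (\<lambda>\<omega>. lin a k \<omega> * lin v k \<omega>) + ?d\<^sup>2"
    unfolding eq using sq(1) i by (simp add: prob_space)
  also have "\<dots> = expectation (\<lambda>\<omega>. (lin a k \<omega>)\<^sup>2 * (lin v k \<omega>)\<^sup>2) - ?d\<^sup>2"
    unfolding lin_cov[OF assms] by (simp add: power2_eq_square)
  also have "\<dots> \<le> expectation (\<lambda>\<omega>. (lin a k \<omega>)\<^sup>2 * (lin v k \<omega>)\<^sup>2)" by simp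
  finally show "expectation (\<lambda>\<omega>. (uprod a v k \<omega>)\<^sup>2) \<le> B4 * dot P a a * dot P v v"
    using sq(2) by linarith
qed

text \<open>A substitute for a filtration: row m is independent of any function of the earlier rows,
  and sums over rows are treated as martingales by induction on the number of rows.\<close>

lemma past_indep:
  assumes "m < n" and [measurable]: "F \<in> borel_measurable (PiM {..<m} (\<lambda>_. vec_space P))" "g \<in> borel_measurable (vec_space P)"
  shows "indep_var borel (\<lambda>\<omega>. F (\<lambda>k\<in>{..<m}. row k \<omega>)) borel (\<lambda>\<omega>. g (row m \<omega>))"
proof -
  have "indep_var (PiM {..<m} (\<lambda>_. vec_space P)) (\<lambda>\<omega>. \<lambda>k\<in>{..<m}. row k \<omega>) (PiM {m} (\<lambda>_. vec_space P)) (\<lambda>\<omega>. \<lambda>k\<in>{m}. row k \<omega>)"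
    by (rule indep_var_restrict[OF row_indep]) (use assms(1) in auto)
  then have "indep_var borel (F \<circ> (\<lambda>\<omega>. \<lambda>k\<in>{..<m}. row k \<omega>)) borel ((\<lambda>f. g (f m)) \<circ> (\<lambda>\<omega>. \<lambda>k\<in>{m}. row k \<omega>))"
    by (rule indep_var_compose) auto
  then show ?thesis by (simp add: comp_def)
qed

lemma integrable_square_add:
  assumes [measurable]: "f \<in> borel_measurable M" "g \<in> borel_measurable M"
    and "integrable M (\<lambda>\<omega>. (f \<omega>)\<^sup>2 :: real)" "integrable M (\<lambda>\<omega>. (g \<omega>)\<^sup>2 :: real)"
  shows "integrable M (\<lambda>\<omega>. (f \<omega> + g \<omega>)\<^sup>2)"
proof -
  have "integrable M (\<lambda>\<omega>. (f \<omega>)\<^sup>2 + (g \<omega>)\<^sup>2 + 2 * (f \<omega> * g \<omega>))"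
    using assms integrable_prod_of_squares[OF assms] by simp
  then show ?thesis by (simp add: power2_sum mult.assoc)
qed

lemma integrable_square_sum:
  assumes "finite A" "\<And>i. i \<in> A \<Longrightarrow> f i \<in> borel_measurable M"
    and "\<And>i. i \<in> A \<Longrightarrow> integrable M (\<lambda>\<omega>. (f i \<omega>)\<^sup>2 :: real)"
  shows "integrable M (\<lambda>\<omega>. (\<Sum>i\<in>A. f i \<omega>)\<^sup>2)"
  using assms
proof (induction A rule: finite_induct)
  case (insert i A)
  then show ?case
    by (simp add: integrable_square_add borel_measurable_sum)
qed simp

definition usum :: "vec \<Rightarrow> vec \<Rightarrow> nat \<Rightarrow> 'a \<Rightarrow> real" where
  "usum a v m \<omega> = (\<Sum>k<m. uprod a v k \<omega>)"

lemma usum_measurable [measurable]: "m \<le> n \<Longrightarrow> usum a v m \<in> borel_measurable M"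
  unfolding usum_def by measurable

lemma usum_past: "usum a v m \<omega> = (\<lambda>f. \<Sum>k<m. ufun a v (f k)) (\<lambda>k\<in>{..<m}. row k \<omega>)"
  unfolding usum_def uprod_def by simp

lemma usum_fun_measurable [measurable]:
  "(\<lambda>f. \<Sum>k<m. ufun a v (f k)) \<in> borel_measurable (PiM {..<m} (\<lambda>_. vec_space P))"
  by (intro borel_measurable_sum measurable_compose[where N = "vec_space P", OF _ ufun_measurable]
      measurable_component_singleton) auto

lemma usum_step_indep: assumes "m < n"
  shows "indep_var borel (usum a v m) borel (uprod a v m)"
proof -
  let ?F = "\<lambda>f. \<Sum>k<m. ufun a v (f k)"
  have "indep_var borel (\<lambda>\<omega>. ?F (\<lambda>k\<in>{..<m}. row k \<omega>)) borel (\<lambda>\<omega>. ufun a v (row m \<omega>))"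
    by (rule past_indep[OF assms, where F = ?F and g = "ufun a v"]) (rule usum_fun_measurable, rule ufun_measurable)
  moreover have "(\<lambda>\<omega>. ?F (\<lambda>k\<in>{..<m}. row k \<omega>)) = usum a v m"
    by (rule ext) (simp only: usum_past)
  moreover have "(\<lambda>\<omega>. ufun a v (row m \<omega>)) = uprod a v m"
    by (rule ext) (simp only: uprod_def)
  ultimately show ?thesis by (simp only:)
qed

lemma usum_square_integrable:
  assumes "m \<le> n"
  shows "integrable M (\<lambda>\<omega>. (usum a v m \<omega>)\<^sup>2)"
  unfolding usum_def using assms by (intro integrable_square_sum uprod_square(1)) auto

lemma usum_integrable:
  assumes "m \<le> n"
  shows "integrable M (usum a v m)"
  by (rule integrable_of_square[OF usum_measurable[OF assms] usum_square_integrable[OF assms]])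

text \<open>The increments are orthogonal, so the variances add up.\<close>

lemma usum_square:
  assumes "m \<le> n"
  shows "expectation (\<lambda>\<omega>. (usum a v m \<omega>)\<^sup>2) \<le> real m * (B4 * dot P a a * dot P v v)"
  using assms
proof (induction m)
  case (Suc m)
  then have m: "m < n" "m \<le> n" by auto
  have ci: "integrable M (\<lambda>\<omega>. usum a v m \<omega> * uprod a v m \<omega>)"
    using m by (intro indep_var_integrable[OF usum_step_indep] usum_integrable uprod_integrable) auto
  have c0: "expectation (\<lambda>\<omega>. usum a v m \<omega> * uprod a v m \<omega>) = 0"
  proof -
    have "expectation (\<lambda>\<omega>. usum a v m \<omega> * uprod a v m \<omega>) = expectation (usum a v m) * expectation (uprod a v m)"
      using m by (intro indep_var_lebesgue_integral[OF usum_step_indep] usum_integrable uprod_integrable) auto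
    then show ?thesis using uprod_integrable(2)[OF m(1), of a v] by simp
  qed
  have eq: "(usum a v (Suc m) \<omega>)\<^sup>2 = (usum a v m \<omega>)\<^sup>2 + (uprod a v m \<omega>)\<^sup>2 + 2 * (usum a v m \<omega> * uprod a v m \<omega>)" for \<omega>
    unfolding usum_def sum.lessThan_Suc by (simp only: power2_sum mult.assoc)
  have "expectation (\<lambda>\<omega>. (usum a v (Suc m) \<omega>)\<^sup>2)
      = expectation (\<lambda>\<omega>. (usum a v m \<omega>)\<^sup>2) + expectation (\<lambda>\<omega>. (uprod a v m \<omega>)\<^sup>2)"
    unfolding eq using usum_square_integrable[OF m(2), of a v] uprod_square(1)[OF m(1), of a v] ci c0 by simp
  also have "\<dots> \<le> real m * (B4 * dot P a a * dot P v v) + B4 * dot P a a * dot P v v"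
    by (intro add_mono Suc.IH[OF m(2)] uprod_square(2)[OF m(1)])
  finally show ?case by (simp add: distrib_right)
qed (simp add: usum_def)

text \<open>Half of the off-diagonal double sum. The pairs are ordered, k < l, so that the increment
  at l pairs centred functions of the new row with coefficients from the past. A will be the set of
  selected coordinates.\<close>

definition ustat :: "nat set \<Rightarrow> vec \<Rightarrow> nat \<Rightarrow> 'a \<Rightarrow> real" where
  "ustat A v m \<omega> = (\<Sum>l<m. \<Sum>j\<in>A. uprod (\<lambda>i. of_bool (i = j)) v l \<omega> * usum (\<lambda>i. of_bool (i = j)) v l \<omega>)"

text \<open>Linearity of \<open>uprod\<close> in its direction: a combination over many coordinates
  is again a single product, and its variance involves the Euclidean norm of the coefficients, not
  their l1 norm.\<close>

lemma sum_uprod_unit: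
  assumes "A \<subseteq> {..<P}"
  shows "(\<Sum>j\<in>A. s j * uprod (\<lambda>i. of_bool (i = j)) v k \<omega>) = uprod (\<lambda>j. if j \<in> A then s j else 0) v k \<omega>"
proof -
  let ?a = "\<lambda>j. if j \<in> A then s j else 0"
  have "uprod (\<lambda>i. of_bool (i = j)) v k \<omega> = Z (k, j) \<omega> * lin v k \<omega> - v j" if "j \<in> A" for j
    using that assms lin_unit dot_unit unfolding uprod_eq by auto
  then have "(\<Sum>j\<in>A. s j * uprod (\<lambda>i. of_bool (i = j)) v k \<omega>) = (\<Sum>j\<in>A. ?a j * (Z (k, j) \<omega> * lin v k \<omega> - v j))"
    by (intro sum.cong) auto
  also have "\<dots> = (\<Sum>j<P. ?a j * (Z (k, j) \<omega> * lin v k \<omega> - v j))"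
    using assms by (intro sum.mono_neutral_left) auto
  also have "\<dots> = (\<Sum>j<P. ?a j * Z (k, j) \<omega>) * lin v k \<omega> - (\<Sum>j<P. ?a j * v j)"
    unfolding sum_distrib_right sum_subtractf[symmetric] by (intro sum.cong refl) (simp add: algebra_simps)
  also have "\<dots> = uprod ?a v k \<omega>" unfolding uprod_eq lin_eq[of ?a] dot_def[of P ?a] ..
  finally show ?thesis .
qed

lemma sum_of_bool_mult:
  assumes "A \<subseteq> {..<P}"
  shows "dot P (\<lambda>j. if j \<in> A then s j else 0) (\<lambda>j. if j \<in> A then s j else 0) = (\<Sum>j\<in>A. (s j)\<^sup>2)"
proof -
  have "(\<Sum>j\<in>A. (s j)\<^sup>2) = (\<Sum>j\<in>A. (if j \<in> A then s j else 0) * (if j \<in> A then s j else 0))"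
    by (intro sum.cong) (auto simp: power2_eq_square)
  also have "\<dots> = (\<Sum>j<P. (if j \<in> A then s j else 0) * (if j \<in> A then s j else 0))"
    using assms by (intro sum.mono_neutral_left) auto
  finally show ?thesis unfolding dot_def by simp
qed

text \<open>The second moment is the mean of a quadratic form in the past sums S_j, with the
  covariance matrix of the u_j. By \<open>sum_uprod_unit\<close> this matrix has operator norm at
  most B4 * dot P v v, so the bound is linear in the size of A; bounding all pairs separately would
  make it quadratic.\<close>

lemma ustat_increment_square:
  fixes v :: vec
  assumes A: "A \<subseteq> {..<P}" and m: "m < n"
  defines "u \<equiv> \<lambda>j. uprod (\<lambda>i. of_bool (i = j)) v" and "S \<equiv> \<lambda>j. usum (\<lambda>i. of_bool (i = j)) v"
  shows "integrable M (\<lambda>\<omega>. (\<Sum>j\<in>A. u j m \<omega> * S j m \<omega>)\<^sup>2)"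
    and "expectation (\<lambda>\<omega>. (\<Sum>j\<in>A. u j m \<omega> * S j m \<omega>)\<^sup>2) \<le> (B4 * dot P v v)\<^sup>2 * real (card A) * real m"
proof -
  let ?b = "B4 * dot P v v"
  have b0: "?b \<ge> 0" using B4_pos dot_self_nonneg[of P v] by simp
  have fA: "finite A" using A finite_subset by blast
  have [measurable]: "u j m \<in> borel_measurable M" "S j m \<in> borel_measurable M" for j
    unfolding u_def S_def using m by auto
  have S2: "integrable M (\<lambda>\<omega>. (S j m \<omega>)\<^sup>2)" "integrable M (\<lambda>\<omega>. S i m \<omega> * S j m \<omega>)" for i j
    unfolding S_def using m by (auto intro!: usum_square_integrable integrable_prod_of_squares)
  have u2: "integrable M (\<lambda>\<omega>. u i m \<omega> * u j m \<omega>)" for i j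
    unfolding u_def using m by (intro integrable_prod_of_squares uprod_square(1)) auto
  have ind: "indep_var borel (\<lambda>\<omega>. S i m \<omega> * S j m \<omega>) borel (\<lambda>\<omega>. u i m \<omega> * u j m \<omega>)" for i j
  proof -
    have "indep_var borel (\<lambda>\<omega>. (\<lambda>f. (\<Sum>k<m. ufun (\<lambda>l. of_bool (l = i)) v (f k)) * (\<Sum>k<m. ufun (\<lambda>l. of_bool (l = j)) v (f k))) (\<lambda>k\<in>{..<m}. row k \<omega>))
      borel (\<lambda>\<omega>. (\<lambda>x. ufun (\<lambda>l. of_bool (l = i)) v x * ufun (\<lambda>l. of_bool (l = j)) v x) (row m \<omega>))"
      by (rule past_indep[OF m]) measurable
    then show ?thesis unfolding S_def u_def usum_past uprod_def .
  qed
  have int: "integrable M (\<lambda>\<omega>. (S i m \<omega> * S j m \<omega>) * (u i m \<omega> * u j m \<omega>))" for i j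
    by (rule indep_var_integrable[OF ind S2(2) u2])
  have E: "expectation (\<lambda>\<omega>. (S i m \<omega> * S j m \<omega>) * (u i m \<omega> * u j m \<omega>))
      = expectation (\<lambda>\<omega>. S i m \<omega> * S j m \<omega>) * expectation (\<lambda>\<omega>. u i m \<omega> * u j m \<omega>)" for i j
    by (rule indep_var_lebesgue_integral[OF ind S2(2) u2])
  have eq: "(\<Sum>j\<in>A. u j m \<omega> * S j m \<omega>)\<^sup>2 = (\<Sum>i\<in>A. \<Sum>j\<in>A. (S i m \<omega> * S j m \<omega>) * (u i m \<omega> * u j m \<omega>))" for \<omega>
    unfolding power2_eq_square sum_product by (intro sum.cong refl) simp
  show "integrable M (\<lambda>\<omega>. (\<Sum>j\<in>A. u j m \<omega> * S j m \<omega>)\<^sup>2)"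
    unfolding eq using int by (intro Bochner_Integration.integrable_sum)
  let ?C = "\<lambda>i j. expectation (\<lambda>\<omega>. u i m \<omega> * u j m \<omega>)"
  have C: "(\<Sum>i\<in>A. \<Sum>j\<in>A. (s i * s j) * ?C i j) \<le> ?b * (\<Sum>j\<in>A. (s j)\<^sup>2)" for s :: "nat \<Rightarrow> real"
  proof -
    have "(\<Sum>i\<in>A. \<Sum>j\<in>A. (s i * s j) * ?C i j) = expectation (\<lambda>\<omega>. \<Sum>i\<in>A. \<Sum>j\<in>A. (s i * s j) * (u i m \<omega> * u j m \<omega>))"
      using u2 by (simp add: Bochner_Integration.integral_sum)
    also have "\<dots> = expectation (\<lambda>\<omega>. (\<Sum>j\<in>A. s j * u j m \<omega>)\<^sup>2)"
      unfolding power2_eq_square sum_product by (simp add: mult_ac)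
    also have "\<dots> = expectation (\<lambda>\<omega>. (uprod (\<lambda>j. if j \<in> A then s j else 0) v m \<omega>)\<^sup>2)"
      unfolding u_def sum_uprod_unit[OF A] ..
    also have "\<dots> \<le> B4 * (\<Sum>j\<in>A. (s j)\<^sup>2) * dot P v v"
      using uprod_square(2)[OF m, of "\<lambda>j. if j \<in> A then s j else 0" v] unfolding sum_of_bool_mult[OF A] .
    finally show ?thesis by (simp add: mult_ac)
  qed
  have "expectation (\<lambda>\<omega>. (\<Sum>j\<in>A. u j m \<omega> * S j m \<omega>)\<^sup>2)
      = (\<Sum>i\<in>A. \<Sum>j\<in>A. expectation (\<lambda>\<omega>. (S i m \<omega> * S j m \<omega>) * (u i m \<omega> * u j m \<omega>)))"
    unfolding eq using int by (subst Bochner_Integration.integral_sum, auto intro!: Bochner_Integration.integrable_sum sum.cong Bochner_Integration.integral_sum)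
  also have "\<dots> = (\<Sum>i\<in>A. \<Sum>j\<in>A. expectation (\<lambda>\<omega>. (S i m \<omega> * S j m \<omega>) * ?C i j))"
    unfolding E by simp
  also have "\<dots> = expectation (\<lambda>\<omega>. \<Sum>i\<in>A. \<Sum>j\<in>A. (S i m \<omega> * S j m \<omega>) * ?C i j)"
    using S2 by (subst Bochner_Integration.integral_sum, auto intro!: Bochner_Integration.integrable_sum sum.cong Bochner_Integration.integral_sum[symmetric])
  also have "\<dots> \<le> expectation (\<lambda>\<omega>. ?b * (\<Sum>j\<in>A. (S j m \<omega>)\<^sup>2))"
    using S2 by (intro integral_mono C) auto
  also have "\<dots> = ?b * (\<Sum>j\<in>A. expectation (\<lambda>\<omega>. (S j m \<omega>)\<^sup>2))"
    using S2 by (simp add: Bochner_Integration.integral_sum)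
  also have "\<dots> \<le> ?b * (\<Sum>j\<in>A. real m * ?b)"
  proof (intro mult_left_mono sum_mono b0)
    fix j assume "j \<in> A"
    then have "dot P (\<lambda>i. of_bool (i = j)) (\<lambda>i. of_bool (i = j)) = (1 :: real)" using A by (subst dot_unit) auto
    then show "expectation (\<lambda>\<omega>. (S j m \<omega>)\<^sup>2) \<le> real m * ?b"
      using usum_square[of m "\<lambda>i. of_bool (i = j)" v] m unfolding S_def by simp
  qed
  also have "\<dots> = ?b\<^sup>2 * real (card A) * real m" by (simp add: power2_eq_square mult_ac)
  finally show "expectation (\<lambda>\<omega>. (\<Sum>j\<in>A. u j m \<omega> * S j m \<omega>)\<^sup>2) \<le> ?b\<^sup>2 * real (card A) * real m" .
qed

lemma ustat_measurable [measurable]: "m \<le> n \<Longrightarrow> ustat A v m \<in> borel_measurable M"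
  unfolding ustat_def by (intro borel_measurable_sum borel_measurable_times) auto

lemma ustat_past: "ustat A v m \<omega> = (\<lambda>f. \<Sum>l<m. \<Sum>j\<in>A. ufun (\<lambda>i. of_bool (i = j)) v (f l) *
    (\<Sum>k<l. ufun (\<lambda>i. of_bool (i = j)) v (f k))) (\<lambda>k\<in>{..<m}. row k \<omega>)"
  unfolding ustat_def usum_def uprod_def by (auto intro!: sum.cong arg_cong2[where f = "(*)"])

lemma ustat_square:
  assumes A: "A \<subseteq> {..<P}" and "m \<le> n"
  shows "integrable M (\<lambda>\<omega>. (ustat A v m \<omega>)\<^sup>2)
    \<and> expectation (\<lambda>\<omega>. (ustat A v m \<omega>)\<^sup>2) \<le> (B4 * dot P v v)\<^sup>2 * real (card A) * (real m * (real m - 1) / 2)"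
  using assms(2)
proof (induction m)
  case (Suc m)
  then have m: "m < n" "m \<le> n" by auto
  let ?u = "\<lambda>j. uprod (\<lambda>i. of_bool (i = j)) v m" and ?S = "\<lambda>j. usum (\<lambda>i. of_bool (i = j)) v m"
  let ?T = "\<lambda>\<omega>. \<Sum>j\<in>A. ?u j \<omega> * ?S j \<omega>" and ?D = "ustat A v m"
  have [measurable]: "?u j \<in> borel_measurable M" "?S j \<in> borel_measurable M" "?D \<in> borel_measurable M" for j
    using m by auto
  note IH = Suc.IH[OF m(2)] and T = ustat_increment_square[OF A m(1), of v]
  have eq: "ustat A v (Suc m) \<omega> = ?D \<omega> + ?T \<omega>" for \<omega> unfolding ustat_def by simp
  have DS: "integrable M (\<lambda>\<omega>. ?D \<omega> * ?S j \<omega>)" for j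
    using IH m by (intro integrable_prod_of_squares usum_square_integrable) auto
  \<comment> \<open>The cross term vanishes: \<open>ustat\<close> and \<open>usum\<close> at m use
    earlier rows only, while \<open>uprod\<close> of row m is centred.\<close>
  have ind: "indep_var borel (\<lambda>\<omega>. ?D \<omega> * ?S j \<omega>) borel (?u j)" for j
  proof -
    let ?F = "\<lambda>f. (\<Sum>l<m. \<Sum>j\<in>A. ufun (\<lambda>i. of_bool (i = j)) v (f l) * (\<Sum>k<l. ufun (\<lambda>i. of_bool (i = j)) v (f k)))
        * (\<Sum>k<m. ufun (\<lambda>i. of_bool (i = j)) v (f k))"
    have [measurable]: "(\<lambda>f. ufun a v (f k)) \<in> borel_measurable (PiM {..<m} (\<lambda>_. vec_space P))" if "k < m" for k a
      using that by (intro measurable_compose[where N = "vec_space P", OF _ ufun_measurable] measurable_component_singleton) auto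
    have "?F \<in> borel_measurable (PiM {..<m} (\<lambda>_. vec_space P))"
      by (intro borel_measurable_times borel_measurable_sum) auto
    from past_indep[OF m(1) this ufun_measurable[of "\<lambda>i. of_bool (i = j)" v]]
    show ?thesis unfolding ustat_past usum_past uprod_def .
  qed
  have cr: "integrable M (\<lambda>\<omega>. ?D \<omega> * ?S j \<omega> * ?u j \<omega>)" "expectation (\<lambda>\<omega>. ?D \<omega> * ?S j \<omega> * ?u j \<omega>) = 0" for j
    using indep_var_integrable[OF ind DS uprod_integrable(1)[OF m(1)]]
      indep_var_lebesgue_integral[OF ind DS uprod_integrable(1)[OF m(1)]] uprod_integrable(2)[OF m(1)] by auto
  have DT: "?D \<omega> * ?T \<omega> = (\<Sum>j\<in>A. ?D \<omega> * ?S j \<omega> * ?u j \<omega>)" for \<omega>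
    by (simp add: sum_distrib_left mult_ac)
  have cross: "integrable M (\<lambda>\<omega>. ?D \<omega> * ?T \<omega>)" "expectation (\<lambda>\<omega>. ?D \<omega> * ?T \<omega>) = 0"
    unfolding DT using cr by (auto simp: Bochner_Integration.integral_sum)
  have eq2: "(ustat A v (Suc m) \<omega>)\<^sup>2 = (?D \<omega>)\<^sup>2 + (?T \<omega>)\<^sup>2 + 2 * (?D \<omega> * ?T \<omega>)" for \<omega>
    unfolding eq by (simp add: power2_sum mult.assoc)
  have "expectation (\<lambda>\<omega>. (ustat A v (Suc m) \<omega>)\<^sup>2) = expectation (\<lambda>\<omega>. (?D \<omega>)\<^sup>2) + expectation (\<lambda>\<omega>. (?T \<omega>)\<^sup>2)"
    unfolding eq2 using IH T(1) cross by simp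
  also have "\<dots> \<le> (B4 * dot P v v)\<^sup>2 * real (card A) * (real m * (real m - 1) / 2) + (B4 * dot P v v)\<^sup>2 * real (card A) * real m"
    using IH T(2) by (intro add_mono) auto
  also have "\<dots> = (B4 * dot P v v)\<^sup>2 * real (card A) * (real (Suc m) * (real (Suc m) - 1) / 2)"
    by (simp add: field_simps)
  finally show ?case unfolding eq2 using IH T(1) cross by simp
qed (simp add: ustat_def)

lemma ustat_double_sum:
  "(\<Sum>k<m. \<Sum>l\<in>{..<m} - {k}. (\<Sum>j\<in>A. uprod (\<lambda>i. of_bool (i = j)) v k \<omega> * uprod (\<lambda>i. of_bool (i = j)) v l \<omega>)) = 2 * ustat A v m \<omega>"
proof (induction m)
  case (Suc m)
  let ?g = "\<lambda>k l. \<Sum>j\<in>A. uprod (\<lambda>i. of_bool (i = j)) v k \<omega> * uprod (\<lambda>i. of_bool (i = j)) v l \<omega>"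
  have sym: "?g k l = ?g l k" for k l by (simp add: mult.commute)
  have "(\<Sum>k<Suc m. \<Sum>l\<in>{..<Suc m} - {k}. ?g k l) = (\<Sum>k<m. \<Sum>l\<in>{..<Suc m} - {k}. ?g k l) + (\<Sum>l\<in>{..<Suc m} - {m}. ?g m l)"
    by simp
  also have "(\<Sum>k<m. \<Sum>l\<in>{..<Suc m} - {k}. ?g k l) = (\<Sum>k<m. (\<Sum>l\<in>{..<m} - {k}. ?g k l) + ?g k m)"
  proof (intro sum.cong refl)
    fix k assume "k \<in> {..<m}"
    then have "{..<Suc m} - {k} = insert m ({..<m} - {k})" by auto
    then show "(\<Sum>l\<in>{..<Suc m} - {k}. ?g k l) = (\<Sum>l\<in>{..<m} - {k}. ?g k l) + ?g k m" by simp
  qed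
  also have "{..<Suc m} - {m} = {..<m}" by auto
  also have "(\<Sum>k<m. (\<Sum>l\<in>{..<m} - {k}. ?g k l) + ?g k m) + (\<Sum>l<m. ?g m l) = 2 * ustat A v m \<omega> + 2 * (\<Sum>k<m. ?g m k)"
    unfolding sum.distrib Suc.IH using sym by simp
  also have "(\<Sum>k<m. ?g m k) = (\<Sum>j\<in>A. uprod (\<lambda>i. of_bool (i = j)) v m \<omega> * usum (\<lambda>i. of_bool (i = j)) v m \<omega>)"
    unfolding usum_def sum_distrib_left by (rule sum.swap)
  finally show ?case unfolding ustat_def by simp
qed (simp add: ustat_def)

text \<open>For dot P v v = 1, 16*K^2 is the inverse radius of the range in which the exponential
  moments of a product are controlled. These moments contribute exp(x*Csq), and Csq + 1 leaves
  exp(-x).\<close>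

definition tail_const :: real where "tail_const = 16 * K\<^sup>2 * (Csq + 1)"

text \<open>A product of two subGaussian variables is subexponential: after normalization it is at
  most half the sum of the two squares, and convexity of exp splits the exponential moment.\<close>

lemma uprod_exp:
  assumes "k < n" and a: "dot P a a = 1" and v: "dot P v v > 0" and l: "\<bar>l\<bar> \<le> 1 / (16 * K\<^sup>2 * sqrt (dot P v v))"
  shows "integrable M (\<lambda>\<omega>. exp (l * uprod a v k \<omega>))"
    and "expectation (\<lambda>\<omega>. exp (l * uprod a v k \<omega>)) \<le> exp (4 * l\<^sup>2 * (8 * K\<^sup>2 * sqrt (dot P v v))\<^sup>2 * Csq)"
proof -
  let ?Y = "\<lambda>\<omega>. lin a k \<omega> * lin v k \<omega>" and ?c = "8 * K\<^sup>2 * sqrt (dot P v v)" and ?K = "8 * K\<^sup>2"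
  have c: "?c > 0" using K_pos v by simp
  have ea: "integrable M (\<lambda>\<omega>. exp ((lin a k \<omega>)\<^sup>2 / ?K))" "expectation (\<lambda>\<omega>. exp ((lin a k \<omega>)\<^sup>2 / ?K)) \<le> Csq"
    using lin_exp_square[OF assms(1), of a] a by auto
  note ev = lin_exp_square[OF assms(1) v]
  have le: "exp (\<bar>?Y \<omega>\<bar> / ?c) \<le> (exp ((lin a k \<omega>)\<^sup>2 / ?K) + exp ((lin v k \<omega>)\<^sup>2 / (?K * dot P v v))) / 2" for \<omega>
  proof -
    define x y where "x = \<bar>lin a k \<omega>\<bar>" and "y = \<bar>lin v k \<omega>\<bar> / sqrt (dot P v v)"
    have "0 \<le> (x - y)\<^sup>2" by simp
    then have "x * y \<le> (x\<^sup>2 + y\<^sup>2) / 2" by (simp add: power2_diff)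
    then have "x * y / ?K \<le> (x\<^sup>2 + y\<^sup>2) / 2 / ?K" using K_pos by (intro divide_right_mono) auto
    moreover have "\<bar>?Y \<omega>\<bar> / ?c = x * y / ?K" by (simp add: x_def y_def abs_mult)
    moreover have "(x\<^sup>2 + y\<^sup>2) / 2 / ?K = ((lin a k \<omega>)\<^sup>2 / ?K + (lin v k \<omega>)\<^sup>2 / (?K * dot P v v)) / 2"
      using v K_pos by (simp add: x_def y_def power_divide field_simps)
    ultimately have "\<bar>?Y \<omega>\<bar> / ?c \<le> ((lin a k \<omega>)\<^sup>2 / ?K + (lin v k \<omega>)\<^sup>2 / (?K * dot P v v)) / 2"
      by linarith
    then have "exp (\<bar>?Y \<omega>\<bar> / ?c) \<le> exp (((lin a k \<omega>)\<^sup>2 / ?K + (lin v k \<omega>)\<^sup>2 / (?K * dot P v v)) / 2)" by simp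
    also have "\<dots> \<le> (exp ((lin a k \<omega>)\<^sup>2 / ?K) + exp ((lin v k \<omega>)\<^sup>2 / (?K * dot P v v))) / 2" by (rule exp_half_add_le)
    finally show ?thesis .
  qed
  have i: "integrable M (\<lambda>\<omega>. exp (\<bar>?Y \<omega>\<bar> / ?c))"
  proof (rule Bochner_Integration.integrable_bound)
    show "integrable M (\<lambda>\<omega>. (exp ((lin a k \<omega>)\<^sup>2 / ?K) + exp ((lin v k \<omega>)\<^sup>2 / (?K * dot P v v))) / 2)"
      using ea(1) ev(1) by simp
    show "AE \<omega> in M. norm (exp (\<bar>?Y \<omega>\<bar> / ?c)) \<le> norm ((exp ((lin a k \<omega>)\<^sup>2 / ?K) + exp ((lin v k \<omega>)\<^sup>2 / (?K * dot P v v))) / 2)"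
      using le by (auto intro!: AE_I2 order_trans[OF le abs_ge_self])
  qed (use assms(1) in measurable)
  have "expectation (\<lambda>\<omega>. exp (\<bar>?Y \<omega>\<bar> / ?c)) \<le> expectation (\<lambda>\<omega>. (exp ((lin a k \<omega>)\<^sup>2 / ?K) + exp ((lin v k \<omega>)\<^sup>2 / (?K * dot P v v))) / 2)"
    using ea(1) ev(1) by (intro integral_mono i le) auto
  also have "\<dots> \<le> Csq" using ea ev by simp
  finally have E: "expectation (\<lambda>\<omega>. exp (\<bar>?Y \<omega>\<bar> / ?c)) \<le> Csq" .
  have l': "\<bar>l\<bar> \<le> 1 / (2 * ?c)" using l by simp
  have Ym: "?Y \<in> borel_measurable M" using assms(1) by measurable
  note m = mgf_of_exp_moment[OF prob_space_axioms Ym i E c l']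
  show "integrable M (\<lambda>\<omega>. exp (l * uprod a v k \<omega>))"
    and "expectation (\<lambda>\<omega>. exp (l * uprod a v k \<omega>)) \<le> exp (4 * l\<^sup>2 * ?c\<^sup>2 * Csq)"
    using m(2,3) unfolding lin_cov[OF assms(1)] uprod_eq by simp_all
qed

text \<open>Chernoff's bound with a parameter proportional to sqrt(x/n). For x <= n the parameter
  stays in the admissible range, so only the Gaussian regime of Bernstein's inequality
  occurs.\<close>

lemma usum_tail:
  assumes n: "n \<ge> 1" and a: "dot P a a = 1" and v: "dot P v v > 0" and x: "0 \<le> x" "x \<le> real n"
  shows "prob {\<omega> \<in> space M. \<bar>usum a v n \<omega>\<bar> \<ge> tail_const * sqrt (dot P v v) * sqrt (x * real n)} \<le> 2 * exp (- x)"
proof -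
  let ?\<rho> = "sqrt (dot P v v)" and ?l = "sqrt (x / real n) / (16 * K\<^sup>2 * sqrt (dot P v v))"
  let ?\<tau> = "tail_const * ?\<rho> * sqrt (x * real n)"
  have \<rho>: "?\<rho> > 0" using v by simp
  have l0: "?l \<ge> 0" using x \<rho> by (intro divide_nonneg_nonneg) auto
  have "sqrt (x / real n) \<le> 1" using x n by simp
  then have l1: "?l \<le> 1 / (16 * K\<^sup>2 * ?\<rho>)" using K_pos \<rho> by (intro divide_right_mono) auto
  have half: "prob {\<omega> \<in> space M. s * usum a v n \<omega> \<ge> ?\<tau>} \<le> exp (- x)" if s: "s = 1 \<or> s = -1" for s :: real
  proof -
    have l: "\<bar>?l * s\<bar> \<le> 1 / (16 * K\<^sup>2 * ?\<rho>)" using s l0 l1 by auto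
    have s2: "(?l * s)\<^sup>2 = ?l\<^sup>2" using s by auto
    have ind: "indep_vars (\<lambda>_. borel) (\<lambda>k \<omega>. exp (?l * s * uprod a v k \<omega>)) {..<n}"
      unfolding uprod_def by (rule row_fun_indep) measurable
    note e = uprod_exp[OF _ a v l]
    have eq: "exp (?l * (s * usum a v n \<omega>)) = (\<Prod>k<n. exp (?l * s * uprod a v k \<omega>))" for \<omega>
      unfolding usum_def sum_distrib_left by (simp add: exp_sum mult.assoc)
    have int: "integrable M (\<lambda>\<omega>. exp (?l * (s * usum a v n \<omega>)))"
      unfolding eq using e(1) by (intro indep_vars_integrable ind) auto
    have "expectation (\<lambda>\<omega>. exp (?l * (s * usum a v n \<omega>))) = (\<Prod>k<n. expectation (\<lambda>\<omega>. exp (?l * s * uprod a v k \<omega>)))"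
      unfolding eq using e(1) by (intro indep_vars_lebesgue_integral ind) auto
    also have "\<dots> \<le> (\<Prod>k<n. exp (4 * ?l\<^sup>2 * (8 * K\<^sup>2 * ?\<rho>)\<^sup>2 * Csq))"
      using e(2) unfolding s2 by (intro prod_mono) (auto intro!: integral_nonneg)
    also have "\<dots> = exp (real n * (4 * ?l\<^sup>2 * (8 * K\<^sup>2 * ?\<rho>)\<^sup>2 * Csq))"
      by (simp flip: exp_of_nat_mult)
    also have "real n * (4 * ?l\<^sup>2 * (8 * K\<^sup>2 * ?\<rho>)\<^sup>2 * Csq) = x * Csq"
    proof -
      have "?l * (8 * K\<^sup>2 * ?\<rho>) = sqrt (x / real n) / 2" using K_pos \<rho> by (simp add: field_simps)
      then have "?l\<^sup>2 * (8 * K\<^sup>2 * ?\<rho>)\<^sup>2 = (sqrt (x / real n) / 2)\<^sup>2" by (metis power_mult_distrib)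
      also have "\<dots> = x / real n / 4" using x n by (simp add: power_divide)
      finally have "4 * ?l\<^sup>2 * (8 * K\<^sup>2 * ?\<rho>)\<^sup>2 = x / real n" by simp
      then show ?thesis using n by simp
    qed
    finally have E: "expectation (\<lambda>\<omega>. exp (?l * (s * usum a v n \<omega>))) \<le> exp (x * Csq)" .
    have lt: "?l * ?\<tau> = x * (Csq + 1)"
    proof -
      have "sqrt (x / real n) * sqrt (x * real n) = x"
        using x n by (simp add: real_sqrt_mult[symmetric] flip: power2_eq_square)
      moreover have "?l * ?\<tau> = (sqrt (x / real n) * sqrt (x * real n)) * (Csq + 1)"
        unfolding tail_const_def using K_pos \<rho> by (simp add: field_simps)
      ultimately show ?thesis by simp
    qed
    have "prob {\<omega> \<in> space M. s * usum a v n \<omega> \<ge> ?\<tau>} \<le> prob {\<omega> \<in> space M. exp (?l * (s * usum a v n \<omega>)) \<ge> exp (x * (Csq + 1))}"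
    proof (rule finite_measure_mono)
      show "{\<omega> \<in> space M. exp (?l * (s * usum a v n \<omega>)) \<ge> exp (x * (Csq + 1))} \<in> events" by measurable
      show "{\<omega> \<in> space M. s * usum a v n \<omega> \<ge> ?\<tau>} \<subseteq> {\<omega> \<in> space M. exp (?l * (s * usum a v n \<omega>)) \<ge> exp (x * (Csq + 1))}"
        unfolding lt[symmetric] exp_le_cancel_iff using mult_left_mono[OF _ l0] by blast
    qed
    also have "\<dots> \<le> expectation (\<lambda>\<omega>. exp (?l * (s * usum a v n \<omega>))) / exp (x * (Csq + 1))"
      by (rule integral_Markov_inequality_measure[where A = "{}", OF int]) auto
    also have "\<dots> \<le> exp (x * Csq) / exp (x * (Csq + 1))" using E by (intro divide_right_mono) auto
    also have "\<dots> = exp (- x)" by (simp add: algebra_simps flip: exp_diff)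
    finally show ?thesis .
  qed
  have "prob {\<omega> \<in> space M. \<bar>usum a v n \<omega>\<bar> \<ge> ?\<tau>}
      \<le> prob ({\<omega> \<in> space M. 1 * usum a v n \<omega> \<ge> ?\<tau>} \<union> {\<omega> \<in> space M. (-1) * usum a v n \<omega> \<ge> ?\<tau>})"
  proof (rule finite_measure_mono)
    show "{\<omega> \<in> space M. 1 * usum a v n \<omega> \<ge> ?\<tau>} \<union> {\<omega> \<in> space M. (-1) * usum a v n \<omega> \<ge> ?\<tau>} \<in> events" by measurable
  qed (auto simp: abs_if split: if_splits)
  also have "\<dots> \<le> prob {\<omega> \<in> space M. 1 * usum a v n \<omega> \<ge> ?\<tau>} + prob {\<omega> \<in> space M. (-1) * usum a v n \<omega> \<ge> ?\<tau>}"
    by (rule measure_Un_le) measurable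
  also have "\<dots> \<le> 2 * exp (- x)" using half[of 1] half[of "-1"] by linarith
  finally show ?thesis .
qed

end

section \<open>The Slope norm and the pilot error\<close>

lemma insort_desc_weighted_sum_ge:
  fixes lam :: "nat \<Rightarrow> real"
  assumes "antimono lam"
  shows "lam 0 * y + (\<Sum>i<length zs. lam (Suc i) * zs ! i)
    \<le> (\<Sum>i<Suc (length zs). lam i * insort_key uminus y zs ! i)"
  using assms
proof (induction zs arbitrary: lam)
  case (Cons z zs)
  show ?case
  proof (cases "- y \<le> - z")
    case False
    have "antimono (\<lambda>i. lam (Suc i))" using Cons.prems by (auto simp: antimono_def)
    from Cons.IH[OF this]
    have IH: "lam 1 * y + (\<Sum>i<length zs. lam (Suc (Suc i)) * zs ! i)
      \<le> (\<Sum>i<Suc (length zs). lam (Suc i) * insort_key uminus y zs ! i)" by simp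
    have "(lam 0 - lam 1) * (z - y) \<ge> 0"
      using False antimonoD[OF Cons.prems, of 0 1] by (intro mult_nonneg_nonneg) auto
    then have swap: "lam 0 * y + lam 1 * z \<le> lam 0 * z + lam 1 * y" by (simp add: algebra_simps)
    have "lam 0 * y + (\<Sum>i<length (z # zs). lam (Suc i) * (z # zs) ! i)
        = lam 0 * y + lam 1 * z + (\<Sum>i<length zs. lam (Suc (Suc i)) * zs ! i)"
      by (simp add: sum.lessThan_Suc_shift del: sum.lessThan_Suc)
    also have "\<dots> \<le> lam 0 * z + (\<Sum>i<Suc (length zs). lam (Suc i) * insort_key uminus y zs ! i)"
      using IH swap by linarith
    also have "\<dots> = (\<Sum>i<Suc (length (z # zs)). lam i * insort_key uminus y (z # zs) ! i)"
      using False by (subst (2) sum.lessThan_Suc_shift) simp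
    finally show ?thesis .
  qed (simp add: sum.lessThan_Suc_shift del: sum.lessThan_Suc)
qed simp

text \<open>Rearrangement inequality by insertion sort: moving one more entry to its place never
  decreases a sum with decreasing weights.\<close>

lemma weighted_sum_le_sort_desc:
  fixes lam :: "nat \<Rightarrow> real"
  assumes "antimono lam"
  shows "(\<Sum>i<length xs. lam i * xs ! i) \<le> (\<Sum>i<length xs. lam i * sort_key uminus xs ! i)"
  using assms
proof (induction xs arbitrary: lam)
  case (Cons x xs)
  have am: "antimono (\<lambda>i. lam (Suc i))" using Cons.prems by (auto simp: antimono_def)
  have "(\<Sum>i<length (x # xs). lam i * (x # xs) ! i) = lam 0 * x + (\<Sum>i<length xs. lam (Suc i) * xs ! i)"
    by (simp add: sum.lessThan_Suc_shift del: sum.lessThan_Suc)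
  also have "\<dots> \<le> lam 0 * x + (\<Sum>i<length (sort_key uminus xs). lam (Suc i) * sort_key uminus xs ! i)"
    using Cons.IH[OF am] by simp
  also have "\<dots> \<le> (\<Sum>i<Suc (length (sort_key uminus xs)). lam i * insort_key uminus x (sort_key uminus xs) ! i)"
    by (rule insort_desc_weighted_sum_ge[OF Cons.prems])
  finally show ?case by simp
qed simp

lemma sort_desc_eq:
  fixes xs ys :: "real list"
  assumes "mset ys = mset xs" "sorted_wrt (\<ge>) ys"
  shows "sort_key uminus xs = ys" and "rev (sort xs) = ys"
proof -
  have *: "rev (sort xs) = ys" if "mset ys = mset xs" "sorted_wrt (\<ge>) ys" for ys
  proof -
    have "sort xs = rev ys" by (rule properties_for_sort) (use that in \<open>auto simp: sorted_wrt_rev\<close>)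
    then show ?thesis by simp
  qed
  show "rev (sort xs) = ys" by (rule *[OF assms])
  moreover have "rev (sort xs) = sort_key uminus xs"
  proof (rule *)
    have "sorted (map uminus (sort_key uminus xs))" by simp
    then show "sorted_wrt (\<ge>) (sort_key uminus xs)" by (simp add: sorted_wrt_map)
  qed simp
  ultimately show "sort_key uminus xs = ys" by simp
qed

lemma slope_norm_eq:
  "slope_norm n p c t = (\<Sum>i<p. slope_weight n p c (Suc i) * sort_key uminus (map (\<lambda>j. \<bar>t j\<bar>) [0..<p]) ! i)"
proof -
  let ?xs = "map (\<lambda>j. \<bar>t j\<bar>) [0..<p]"
  have desc: "sort_key uminus ?xs = rev (sort ?xs)"
  proof (rule sort_desc_eq(1))
    show "sorted_wrt (\<ge>) (rev (sort ?xs))" by (simp add: sorted_wrt_rev)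
  qed simp
  have "slope_norm n p c t = (\<Sum>i<p. slope_weight n p c (Suc i) * abs_order_stat p t (p - Suc i + 1))"
    unfolding slope_norm_def by (rule sum.reindex_bij_witness[of _ Suc "\<lambda>i. i - 1"]) auto
  also have "\<dots> = (\<Sum>i<p. slope_weight n p c (Suc i) * rev (sort ?xs) ! i)"
    unfolding abs_order_stat_def by (intro sum.cong refl) (simp add: rev_nth)
  finally show ?thesis unfolding desc .
qed

lemma slope_weight_antimono:
  assumes "c \<ge> 0" "p \<ge> 1"
  shows "antimono (\<lambda>i. slope_weight n p c (Suc i))"
proof (rule antimonoI)
  fix i i' :: nat assume "i \<le> i'"
  then have "ln (2 * real p / real (Suc i')) \<le> ln (2 * real p / real (Suc i))"
    using assms by (intro ln_mono divide_left_mono) auto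
  then show "slope_weight n p c (Suc i') \<le> slope_weight n p c (Suc i)"
    unfolding slope_weight_def using assms(1)
    by (intro mult_left_mono real_sqrt_le_mono divide_right_mono) auto
qed

text \<open>Two orders in one list. On S the order is by decreasing |\<theta>|, so that the Slope
  norm of \<theta> is attained; after S it is by decreasing |h|, so that a late position forces a
  small error.\<close>

definition is_ranking :: "nat \<Rightarrow> nat set \<Rightarrow> vec \<Rightarrow> vec \<Rightarrow> nat list \<Rightarrow> bool" where
  "is_ranking p S \<theta> h js \<longleftrightarrow> distinct js \<and> set js = {..<p} \<and> length js = p \<and>
     (\<forall>i<p. js ! i \<in> S \<longleftrightarrow> i < card S) \<and>
     (\<forall>i i'. card S \<le> i \<longrightarrow> i \<le> i' \<longrightarrow> i' < p \<longrightarrow> \<bar>h (js ! i')\<bar> \<le> \<bar>h (js ! i)\<bar>) \<and>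
     sorted_wrt (\<ge>) (map (\<lambda>j. \<bar>\<theta> j\<bar>) js)"

text \<open>The two orders do not conflict: \<theta> vanishes outside S, so |\<theta>| decreases
  along the list however the tail is arranged.\<close>

lemma ranking_exists:
  assumes S: "S \<subseteq> {..<p}" and \<theta>: "\<And>j. j < p \<Longrightarrow> j \<notin> S \<Longrightarrow> \<theta> j = 0"
  shows "\<exists>js. is_ranking p S \<theta> h js"
proof -
  define A B where "A = sort_key (\<lambda>j. - \<bar>\<theta> j\<bar>) (sorted_list_of_set S)"
    and "B = sort_key (\<lambda>j. - \<bar>h j\<bar>) (sorted_list_of_set ({..<p} - S))"
  have fS: "finite S" using S finite_subset by blast
  have A: "distinct A" "set A = S" "length A = card S" unfolding A_def using fS by auto
  have B: "distinct B" "set B = {..<p} - S" unfolding B_def by auto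
  have lB: "length A + length B = p"
    using distinct_card[OF B(1)] card_mono[of "{..<p}", OF _ S] A(3) S by (simp add: B(2) card_Diff_subset fS)
  have sA: "sorted_wrt (\<ge>) (map (\<lambda>j. \<bar>\<theta> j\<bar>) A)"
    using sorted_sort_key[of "\<lambda>j. - \<bar>\<theta> j\<bar>" "sorted_list_of_set S", folded A_def] by (simp add: sorted_wrt_map)
  have sB: "sorted_wrt (\<lambda>x y. \<bar>h x\<bar> \<ge> \<bar>h y\<bar>) B"
    using sorted_sort_key[of "\<lambda>j. - \<bar>h j\<bar>" "sorted_list_of_set ({..<p} - S)", folded B_def] by (simp add: sorted_wrt_map)
  have \<theta>B: "\<theta> j = 0" if "j \<in> set B" for j using that B \<theta> by auto
  then have "sorted_wrt (\<ge>) (map (\<lambda>j. \<bar>\<theta> j\<bar>) B)"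
    by (simp add: sorted_wrt_map sorted_wrt_iff_nth_less)
  then have "sorted_wrt (\<ge>) (map (\<lambda>j. \<bar>\<theta> j\<bar>) (A @ B))"
    using sA \<theta>B by (auto simp: sorted_wrt_append)
  moreover have "(A @ B) ! i \<in> S \<longleftrightarrow> i < card S" if "i < p" for i
  proof (cases "i < card S")
    case True then show ?thesis using A by (auto simp: nth_append)
  next
    case False
    then have "B ! (i - card S) \<in> set B" using that lB A by (intro nth_mem) auto
    then show ?thesis using False A B by (auto simp: nth_append)
  qed
  moreover have "\<bar>h ((A @ B) ! i')\<bar> \<le> \<bar>h ((A @ B) ! i)\<bar>" if "card S \<le> i" "i \<le> i'" "i' < p" for i i'
    using that sB lB A by (cases "i = i'") (auto simp: nth_append sorted_wrt_iff_nth_less)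
  ultimately have "is_ranking p S \<theta> h (A @ B)"
    unfolding is_ranking_def using A B lB S by auto
  then show ?thesis ..
qed

lemma ranking_index:
  assumes "is_ranking p S \<theta> h js" "j < p"
  obtains i where "i < p" "js ! i = j"
proof -
  have "j \<in> set js" using assms unfolding is_ranking_def by blast
  then obtain i where "i < length js" "js ! i = j" unfolding in_set_conv_nth by blast
  moreover have "length js = p" using assms(1) unfolding is_ranking_def by blast
  ultimately show thesis using that by blast
qed

lemma ranking_nth_less:
  assumes "is_ranking p S \<theta> h js" "i < p"
  shows "js ! i < p"
proof -
  have js: "set js = {..<p}" "length js = p" using assms(1) unfolding is_ranking_def by blast+
  have "js ! i \<in> set js" by (rule nth_mem) (simp add: js assms(2))
  then show ?thesis unfolding js by simp
qed

lemma ranking_sum: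
  assumes "is_ranking p S \<theta> h js"
  shows "(\<Sum>j<p. f j) = (\<Sum>i<p. f (js ! i))"
proof -
  have js: "distinct js" "set js = {..<p}" "length js = p" using assms unfolding is_ranking_def by blast+
  have "bij_betw ((!) js) {..<p} {..<p}" by (rule bij_betw_nth) (simp_all add: js)
  then show ?thesis by (rule sum.reindex_bij_betw[symmetric])
qed

text \<open>The slope norm is a maximum over rankings, attained at \<open>\<theta>\<close> by the given one.\<close>

lemma slope_norm_cone:
  assumes js: "is_ranking p S \<theta> h js" and S: "S \<subseteq> {..<p}" and \<theta>: "\<And>j. j < p \<Longrightarrow> j \<notin> S \<Longrightarrow> \<theta> j = 0"
    and h: "\<And>j. j < p \<Longrightarrow> h j = \<theta> j - t j" and c: "c \<ge> 0" "p \<ge> 1"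
    and w: "\<And>i. i < p \<Longrightarrow> w (js ! i) = slope_weight n p c (Suc i)"
  shows "slope_norm n p c \<theta> + (\<Sum>j\<in>{..<p} - S. w j * \<bar>h j\<bar>) \<le> slope_norm n p c t + (\<Sum>j\<in>S. w j * \<bar>h j\<bar>)"
proof -
  have js': "length js = p" "sorted_wrt (\<ge>) (map (\<lambda>j. \<bar>\<theta> j\<bar>) js)" using js unfolding is_ranking_def by blast+
  have "distinct js" "set js = {..<p}" using js unfolding is_ranking_def by blast+
  then have "mset js = mset [0..<p]"
    using set_eq_iff_mset_eq_distinct[of js "[0..<p]"] by (simp add: lessThan_atLeast0)
  then have ms: "mset (map f js) = mset (map f [0..<p])" for f :: "nat \<Rightarrow> real"
    by (simp only: mset_map)
  let ?lam = "\<lambda>i. slope_weight n p c (Suc i)"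
  have w0: "w j \<ge> 0" if j: "j < p" for j
  proof -
    obtain i where i: "i < p" "js ! i = j" using ranking_index[OF js j] .
    have "ln (2 * real p / real (Suc i)) \<ge> 0" using i by (intro ln_ge_zero) (simp add: field_simps)
    then show ?thesis using w[OF i(1)] i(2) c by (simp add: slope_weight_def)
  qed
  have "slope_norm n p c \<theta> = (\<Sum>i<p. ?lam i * map (\<lambda>j. \<bar>\<theta> j\<bar>) js ! i)"
    unfolding slope_norm_eq sort_desc_eq(1)[OF ms js'(2)] ..
  also have "\<dots> = (\<Sum>j<p. w j * \<bar>\<theta> j\<bar>)"
    by (subst ranking_sum[OF js, of "\<lambda>j. w j * \<bar>\<theta> j\<bar>"], rule sum.cong) (use w js' in auto)
  \<comment> \<open>On S this is the triangle inequality. Outside S both sides are 0, since \<theta>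
    vanishes and |t| = |h|.\<close>
  also have "\<dots> \<le> (\<Sum>j<p. w j * \<bar>t j\<bar> + (if j \<in> S then w j * \<bar>h j\<bar> else - (w j * \<bar>h j\<bar>)))"
  proof (rule sum_mono)
    fix j assume "j \<in> {..<p}"
    then have j: "j < p" by simp
    have "w j * \<bar>\<theta> j\<bar> \<le> w j * (\<bar>t j\<bar> + (if j \<in> S then \<bar>h j\<bar> else - \<bar>h j\<bar>))"
      using h[OF j] \<theta>[OF j] by (intro mult_left_mono w0[OF j]) auto
    then show "w j * \<bar>\<theta> j\<bar> \<le> w j * \<bar>t j\<bar> + (if j \<in> S then w j * \<bar>h j\<bar> else - (w j * \<bar>h j\<bar>))"
      by (auto simp: distrib_left split: if_splits)
  qed
  also have "\<dots> = (\<Sum>j<p. w j * \<bar>t j\<bar>) + ((\<Sum>j\<in>S. w j * \<bar>h j\<bar>) - (\<Sum>j\<in>{..<p} - S. w j * \<bar>h j\<bar>))"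
  proof -
    have "{..<p} \<inter> S = S" "{..<p} \<inter> - S = {..<p} - S" using S by auto
    then show ?thesis by (simp add: sum.distrib sum.If_cases sum_negf)
  qed
  also have "(\<Sum>j<p. w j * \<bar>t j\<bar>) = (\<Sum>i<length (map (\<lambda>j. \<bar>t j\<bar>) js). ?lam i * map (\<lambda>j. \<bar>t j\<bar>) js ! i)"
    by (subst ranking_sum[OF js, of "\<lambda>j. w j * \<bar>t j\<bar>"], rule sum.cong) (use w js' in auto)
  \<comment> \<open>The list need not sort |t|; by rearrangement its weighted sum is still a lower
    bound for the Slope norm of t.\<close>
  also have "\<dots> \<le> (\<Sum>i<length (map (\<lambda>j. \<bar>t j\<bar>) js). ?lam i * sort_key uminus (map (\<lambda>j. \<bar>t j\<bar>) js) ! i)"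
    by (rule weighted_sum_le_sort_desc[OF slope_weight_antimono[OF c]])
  also have "\<dots> = slope_norm n p c t"
  proof -
    have "sorted (map uminus (sort_key uminus (map (\<lambda>j. \<bar>t j\<bar>) js)))" by (rule sorted_sort_key)
    then have "sort_key uminus (map (\<lambda>j. \<bar>t j\<bar>) [0..<p]) = sort_key uminus (map (\<lambda>j. \<bar>t j\<bar>) js)"
      using ms by (intro sort_desc_eq(1)) (auto simp: sorted_wrt_map)
    then show ?thesis unfolding slope_norm_eq using js' by simp
  qed
  finally show ?thesis by simp
qed

text \<open>The square root bounds the normalized residual at the true vector in units of \<sigma>;
  the additional 1 is room for inexact minimization.\<close>

definition noise_bound :: "real \<Rightarrow> real" where
  "noise_bound K = 1 + sqrt (col_bound K)"

text \<open>The penalty of the error is at most 4/3 * \<open>noise_bound\<close> times the error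
  norm. With this factor the weighted l1 norm takes one third of the cone, including a factor 2 lost
  by rounding the levels to integers.\<close>

definition slope_const :: "real \<Rightarrow> real" where
  "slope_const K = 8 * noise_bound K / cone_bound K"

text \<open>For \<kappa>0 below this value the penalty of the support is at most a sixth of the
  error norm, and the noise coordinate uses at most a third of the cone.\<close>

definition kappa_bar :: "real \<Rightarrow> real" where
  "kappa_bar K = (cone_bound K / (144 * noise_bound K))\<^sup>2"

lemma pilot_constants:
  assumes "K > 0"
  shows "noise_bound K \<ge> 1" "slope_const K > 0" "kappa_bar K > 0" "kappa_bar K \<le> 1/100"
proof -
  note c = re_constants_pos[OF assms]
  show a: "noise_bound K \<ge> 1" unfolding noise_bound_def using c(2) by simp
  show "slope_const K > 0" unfolding slope_const_def using a c(4) by simp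
  show "kappa_bar K > 0" unfolding kappa_bar_def using a c(4) by simp
  have "cone_bound K / (144 * noise_bound K) \<le> (1/10) / 144" using a c(4,5) by (intro frac_le) auto
  then have "kappa_bar K \<le> ((1/10) / 144)\<^sup>2"
    unfolding kappa_bar_def using a c(4) by (intro power_mono) auto
  then show "kappa_bar K \<le> 1/100" by (simp add: power2_eq_square)
qed

text \<open>For s <= sqrt p the number 2*p is at most (e*p/s)^2, so log(2*p) <= 2*log(e*p/s): even
  the largest Slope weight is controlled by the sparsity assumption.\<close>

lemma sparsity_log_bounds:
  assumes s: "1 \<le> s" "real s \<le> sqrt (real p)" and k: "real s * ln (exp 1 * real p / real s) \<le> 3 * real n * \<kappa>0"
  shows "p \<ge> 1" "s \<le> p" "real s \<le> 3 * real n * \<kappa>0" "ln (2 * real p) \<le> 6 * real n * \<kappa>0"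
    "real s * ln (2 * real p) \<le> 6 * real n * \<kappa>0" "ln (1 + real p / (real s)\<^sup>2) \<le> 3 * real n * \<kappa>0"
proof -
  have "1 \<le> sqrt (real p)" using s by linarith
  then have p1: "1 \<le> real p" by simp
  then show "p \<ge> 1" by simp
  have s2: "(real s)\<^sup>2 \<le> real p" using power_mono[OF s(2), of 2] by simp
  have "real s \<le> (real s)\<^sup>2" using s(1) by (simp add: power2_eq_square)
  then have sp: "real s \<le> real p" using s2 by linarith
  then show "s \<le> p" by simp
  have pos: "exp 1 * real p / real s > 0" using s p1 by simp
  define l where "l = ln (exp 1 * real p / real s)"
  have "exp 1 * 1 \<le> exp 1 * (real p / real s)" using sp s by (intro mult_left_mono) auto
  then have "ln (exp 1) \<le> l" unfolding l_def using pos by (subst ln_le_cancel_iff) auto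
  then have l1: "1 \<le> l" by simp
  have "real s * 1 \<le> real s * l" using l1 by (intro mult_left_mono) auto
  then show "real s \<le> 3 * real n * \<kappa>0" using k unfolding l_def by linarith
  have e2: "exp 1 \<ge> (2 :: real)" using exp_ge_add_one_self[of 1] by simp
  have lp: "ln (2 * real p) \<le> 2 * l"
  proof -
    have "2 * real p * (real s)\<^sup>2 \<le> (exp 1)\<^sup>2 * real p * real p"
    proof (rule mult_mono)
      have "(2 :: real) * 2 \<le> exp 1 * exp 1" using e2 by (intro mult_mono) auto
      then have "2 \<le> (exp (1::real))\<^sup>2" by (simp add: power2_eq_square)
      then show "2 * real p \<le> (exp 1)\<^sup>2 * real p" by (intro mult_right_mono) auto
    qed (use s2 in auto)
    then have "2 * real p \<le> (exp 1 * real p / real s)\<^sup>2"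
      using s by (simp add: field_simps power2_eq_square)
    then have "ln (2 * real p) \<le> ln ((exp 1 * real p / real s)\<^sup>2)"
      using p1 pos s(1) by (subst ln_le_cancel_iff) auto
    also have "\<dots> = 2 * l" using pos unfolding l_def by (simp add: ln_realpow)
    finally show ?thesis .
  qed
  have "l \<le> real s * l" using s(1) l1 by simp
  then have ln: "l \<le> 3 * real n * \<kappa>0" using k unfolding l_def by linarith
  then show "ln (2 * real p) \<le> 6 * real n * \<kappa>0" using lp by linarith
  have "real s * ln (2 * real p) \<le> real s * (2 * l)" using lp by (intro mult_left_mono) auto
  then show "real s * ln (2 * real p) \<le> 6 * real n * \<kappa>0" using k unfolding l_def by linarith
  have "1 + real p / (real s)\<^sup>2 \<le> exp 1 * real p / real s"
  proof -
    have "1 \<le> real p / real s" "real p / (real s)\<^sup>2 \<le> real p / real s"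
      using s sp \<open>real s \<le> (real s)\<^sup>2\<close> p1 by (auto intro!: divide_left_mono)
    then have "1 + real p / (real s)\<^sup>2 \<le> 2 * (real p / real s)" by linarith
    also have "\<dots> \<le> exp 1 * (real p / real s)" using e2 by (intro mult_right_mono) auto
    finally show ?thesis by simp
  qed
  moreover have "0 < 1 + real p / (real s)\<^sup>2" by (intro add_pos_nonneg) auto
  ultimately have "ln (1 + real p / (real s)\<^sup>2) \<le> l" unfolding l_def using pos by (subst ln_le_cancel_iff)
  then show "ln (1 + real p / (real s)\<^sup>2) \<le> 3 * real n * \<kappa>0" using ln by linarith
qed

text \<open>
  The last coordinate of \<open>v\<close> is the noise level, so that restricted eigenvalues bound the residual
  from below by the noise and no interpolation can occur.
\<close>

lemma pilot_error_bound:
  assumes K: "K > 0" and reg: "regular_design n (Suc p) K z" and n: "n \<ge> 1"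
    and S: "S \<subseteq> {..<p}" "card S \<le> s" and s: "1 \<le> s" "real s \<le> sqrt (real p)"
    and k: "real s * ln (exp 1 * real p / real s) \<le> 3 * real n * \<kappa>0" "\<kappa>0 \<le> kappa_bar K"
    and js: "is_ranking p S \<theta> h js" and h: "\<And>j. j < p \<Longrightarrow> v j = h j" and \<sigma>: "v p = \<sigma>" "\<sigma> > 0"
    and w: "\<And>i. i < p \<Longrightarrow> slope_weight n p (slope_const K) (Suc i) \<le> w (js ! i)"
    and w': "\<And>j. j < p \<Longrightarrow> w j \<le> slope_const K * sqrt (ln (2 * real p) / real n)"
    and cone: "sqrt (quad_form n (Suc p) z v / real n) / 2 + (\<Sum>j\<in>{..<p} - S. w j * \<bar>v j\<bar>)
        \<le> \<sigma> * noise_bound K + (\<Sum>j\<in>S. w j * \<bar>v j\<bar>)"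
  shows "sqrt (dot (Suc p) v v) \<le> 6 * noise_bound K * \<sigma>"
    and "\<sigma> / 2 \<le> sqrt (quad_form n (Suc p) z v / real n)"
    and "sqrt (quad_form n (Suc p) z v / real n) \<le> 4 * noise_bound K * \<sigma>"
proof -
  define a cr c where "a = noise_bound K" and "cr = cone_bound K" and "c = slope_const K"
  define \<rho> where "\<rho> = sqrt (dot (Suc p) v v)"
  define sg where "sg = sqrt (quad_form n (Suc p) z v / real n)"
  have a: "a \<ge> 1" and cr: "0 < cr" "cr \<le> 1/10" and c: "c > 0"
    using pilot_constants[OF K] re_constants_pos[OF K] unfolding a_def cr_def c_def by auto
  have c_eq: "c = 8 * a / cr" unfolding c_def slope_const_def a_def cr_def ..
  note lb = sparsity_log_bounds[OF s k(1)]
  have \<kappa>0: "\<kappa>0 \<ge> 0" using lb(3) n s(1) by (smt (verit) mult_nonneg_nonneg mult_pos_neg of_nat_0_le_iff of_nat_0_less_iff of_nat_1_eq_iff of_nat_mono real_of_nat_ge_one_iff)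
  define q where "q = sqrt \<kappa>0"
  have q: "0 \<le> q" "q\<^sup>2 = \<kappa>0" unfolding q_def using \<kappa>0 by auto
  have q1: "q \<le> cr / (144 * a)"
  proof -
    have "q \<le> sqrt ((cr / (144 * a))\<^sup>2)" unfolding q_def using k(2) unfolding kappa_bar_def a_def cr_def by (rule real_sqrt_le_mono)
    then show ?thesis using cr a by simp
  qed
  have q2: "q \<le> cr / 144"
  proof -
    have "cr / (144 * a) \<le> cr / 144" using cr a by (intro divide_left_mono) auto
    then show ?thesis using q1 by linarith
  qed
  have cq: "c * q \<le> 1 / 18"
  proof -
    have "c * q \<le> c * (cr / (144 * a))" using q1 c by (intro mult_left_mono) auto
    also have "\<dots> = 1 / 18" unfolding c_eq using cr a by simp
    finally show ?thesis .
  qed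
  have \<kappa>s: "\<kappa>0 \<le> 1/100" using k(2) pilot_constants(4)[OF K] by linarith
  have p: "p \<ge> 1" by (rule lb(1))
  have dotS: "dot (Suc p) v v = (\<Sum>j<p. (v j)\<^sup>2) + \<sigma>\<^sup>2"
    unfolding dot_def by (simp add: power2_eq_square \<sigma>)
  have \<rho>: "\<sigma> \<le> \<rho>" "\<rho> > 0"
  proof -
    have "\<sigma>\<^sup>2 \<le> dot (Suc p) v v" unfolding dotS by (simp add: sum_nonneg)
    then show "\<sigma> \<le> \<rho>" unfolding \<rho>_def by (rule real_le_rsqrt)
    then show "\<rho> > 0" using \<sigma> by linarith
  qed
  have w0: "0 \<le> w j" if j: "j < p" for j
  proof -
    obtain i where i: "i < p" "js ! i = j" using ranking_index[OF js j] .
    have "ln (2 * real p / real (Suc i)) \<ge> 0" using i by (intro ln_ge_zero) (simp add: field_simps)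
    then have "0 \<le> slope_weight n p c (Suc i)" unfolding slope_weight_def using c by simp
    then show ?thesis using w[OF i(1)] i(2) unfolding c_def by simp
  qed
  have fS: "finite S" using S(1) finite_subset by blast
  \<comment> \<open>Cauchy-Schwarz with the largest weight on all of S; relaxing 6*\<kappa>0 to
    9*\<kappa>0 gives a perfect square.\<close>
  have WS: "(\<Sum>j\<in>S. w j * \<bar>v j\<bar>) \<le> 3 * (c * q) * \<rho>"
  proof -
    have "(\<Sum>j\<in>S. w j * \<bar>v j\<bar>) = (\<Sum>j\<in>S. \<bar>w j\<bar> * \<bar>v j\<bar>)" using w0 S(1) by (intro sum.cong) auto
    also have "\<dots> \<le> L2_set w S * L2_set v S" by (rule L2_set_mult_ineq)
    also have "\<dots> \<le> (c * (3 * q)) * \<rho>"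
    proof (intro mult_mono)
      have "(\<Sum>j\<in>S. (w j)\<^sup>2) \<le> (\<Sum>j\<in>S. (c * sqrt (ln (2 * real p) / real n))\<^sup>2)"
        using w' w0 S(1) unfolding c_def by (intro sum_mono power_mono) auto
      also have "\<dots> = real (card S) * (c\<^sup>2 * (ln (2 * real p) / real n))" using p n by (simp add: power_mult_distrib)
      also have "\<dots> \<le> real s * (c\<^sup>2 * (ln (2 * real p) / real n))" using S(2) p by (intro mult_right_mono) auto
      also have "\<dots> = c\<^sup>2 * (real s * ln (2 * real p) / real n)" by simp
      also have "\<dots> \<le> c\<^sup>2 * (9 * \<kappa>0)"
      proof (intro mult_left_mono)
        have "real s * ln (2 * real p) / real n \<le> 6 * real n * \<kappa>0 / real n" using lb(5) by (intro divide_right_mono) auto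
        then show "real s * ln (2 * real p) / real n \<le> 9 * \<kappa>0" using n \<kappa>0 by simp
      qed auto
      also have "\<dots> = (c * (3 * q))\<^sup>2" using q(2) by (simp add: power_mult_distrib)
      finally show "L2_set w S \<le> c * (3 * q)" unfolding L2_set_def using c q by (intro real_le_lsqrt) (auto intro!: sum_nonneg)
      have "(\<Sum>j\<in>S. (v j)\<^sup>2) \<le> (\<Sum>j<p. (v j)\<^sup>2)" using S by (intro sum_mono2) auto
      then show "L2_set v S \<le> \<rho>" unfolding L2_set_def \<rho>_def dotS by (intro real_sqrt_le_mono) (simp add: add_increasing2)
    qed (use c q in \<open>auto simp: L2_set_nonneg\<close>)
    finally show ?thesis by (simp add: mult_ac)
  qed
  have cq\<rho>: "3 * (c * q) * \<rho> \<le> \<rho> / 6" using mult_right_mono[OF cq, of "3 * \<rho>"] \<rho> by (simp add: mult_ac)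
  have sg0: "sg \<ge> 0" unfolding sg_def quad_form_def by (auto intro!: divide_nonneg_nonneg sum_nonneg)
  \<comment> \<open>The noise is a coordinate of v, so \<sigma> is at most the norm \<rho>, and the
    cone condition becomes homogeneous in v.\<close>
  have T: "(\<Sum>j<p. w j * \<bar>v j\<bar>) \<le> 4 / 3 * a * \<rho>"
  proof -
    have "(\<Sum>j<p. w j * \<bar>v j\<bar>) = (\<Sum>j\<in>{..<p} - S. w j * \<bar>v j\<bar>) + (\<Sum>j\<in>S. w j * \<bar>v j\<bar>)"
      using S fS by (intro sum.subset_diff) auto
    also have "\<dots> \<le> \<sigma> * a + 2 * (\<rho> / 6)"
      using cone WS cq\<rho> sg0 unfolding sg_def a_def by linarith
    also have "\<dots> \<le> \<rho> * a + 1 / 3 * (a * \<rho>)"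
    proof (intro add_mono)
      have "1 * \<rho> \<le> a * \<rho>" using a \<rho> by (intro mult_right_mono) auto
      then show "2 * (\<rho> / 6) \<le> 1 / 3 * (a * \<rho>)" by simp
    qed (use \<rho> a in \<open>auto intro: mult_right_mono\<close>)
    finally show ?thesis by (simp add: algebra_simps)
  qed
  have "\<exists>i. i < p \<and> js ! i = j" if "j < p" for j
    using ranking_index[OF js that] by blast
  then obtain ix where ix: "ix j < p" "js ! ix j = j" if "j < p" for j
    by metis
  define m where "m j = real (Suc (ix j))" for j
  \<comment> \<open>Up to the factor c^2/n the levels are the squared Slope weights, rounded up to
    integers. Positions start at 0, hence the \<open>Suc\<close>; the noise coordinate p is given
    the level of rank 1.\<close>
  define l where "l j = (if j < p then nat \<lceil>ln (2 * real p / m j)\<rceil> else nat \<lceil>ln (2 * real p)\<rceil>)" for j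
  have ln2: "ln (2::real) \<ge> 1/2" using ln2_ge_two_thirds by linarith
  have lnm: "ln 2 \<le> ln (2 * real p / m j)" "ln (2 * real p / m j) \<le> ln (2 * real p)" "m j > 0" "m j \<le> real p" if "j < p" for j
  proof -
    show m: "m j > 0" "m j \<le> real p" unfolding m_def using ix[OF that] by auto
    have "1 \<le> real p / m j" using m by simp
    then have "2 \<le> 2 * real p / m j" by simp
    then show "ln 2 \<le> ln (2 * real p / m j)" by (intro ln_mono) auto
    have "2 * real p / m j \<le> 2 * real p" using m p unfolding m_def by (simp add: field_simps)
    then show "ln (2 * real p / m j) \<le> ln (2 * real p)" using m p by (intro ln_mono) auto
  qed
  have lnp: "ln 2 \<le> ln (2 * real p)" using p by (intro ln_mono) auto
  have ln: "ln (2 * real p) + 1 \<le> 9 * real n * \<kappa>0"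
  proof -
    have "1 \<le> 3 * real n * \<kappa>0" using lb(3) s(1) by linarith
    then show ?thesis using lb(4) by linarith
  qed
  have "9 * real n * \<kappa>0 \<le> 9 * real n * (1/100)" using \<kappa>s by (intro mult_left_mono) auto
  then have lnn: "ln (2 * real p) + 1 \<le> real n" using ln by linarith
  have lr: "ln (2 * real p / m j) \<le> real (l j)" "real (l j) \<le> ln (2 * real p / m j) + 1" if "j < p" for j
    using lnm[OF that] ln2 that unfolding l_def by (auto simp: of_nat_nat ceiling_correct, (linarith+)?)
  have lp: "ln (2 * real p) \<le> real (l p)" "real (l p) \<le> ln (2 * real p) + 1"
    using lnp ln2 unfolding l_def by (auto simp: of_nat_nat ceiling_correct, (linarith+)?)
  have l1: "1 \<le> l j \<and> l j \<le> n" if "j < Suc p" for j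
  proof -
    have "0 < real (l j) \<and> real (l j) \<le> real n"
    proof (cases "j < p")
      case True
      then show ?thesis using lr[OF True] lnm[OF True] lnn ln2 by linarith
    next
      case False
      then have "j = p" using that by simp
      then show ?thesis unfolding \<open>j = p\<close> using lp lnp lnn ln2 by linarith
    qed
    then show ?thesis by simp
  qed
  have lw: "c * sqrt (real (l j) / real n) \<le> 2 * w j" if j: "j < p" for j
  proof -
    \<comment> \<open>Rounding up adds at most 1, which is at most three times the logarithm because
      the logarithm is at least 1/2.\<close>
    have "real (l j) \<le> 4 * ln (2 * real p / m j)" using lr[OF j] lnm[OF j] ln2 by linarith
    then have "sqrt (real (l j) / real n) \<le> sqrt (4 * (ln (2 * real p / m j) / real n))"
      by (intro real_sqrt_le_mono) (simp add: divide_right_mono)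
    also have "\<dots> = 2 * sqrt (ln (2 * real p / m j) / real n)" unfolding real_sqrt_mult by simp
    finally have "c * sqrt (real (l j) / real n) \<le> c * (2 * sqrt (ln (2 * real p / m j) / real n))"
      using c by (intro mult_left_mono) auto
    also have "\<dots> = 2 * slope_weight n p c (Suc (ix j))" unfolding slope_weight_def m_def by simp
    also have "\<dots> \<le> 2 * w j" using w[OF ix(1)[OF j]] ix(2)[OF j] unfolding c_def by simp
    finally show ?thesis .
  qed
  have Tc: "(\<Sum>j<p. sqrt (real (l j) / real n) * \<bar>v j\<bar>) \<le> cr / 3 * \<rho>"
  proof -
    have "c * (\<Sum>j<p. sqrt (real (l j) / real n) * \<bar>v j\<bar>) \<le> 2 * (\<Sum>j<p. w j * \<bar>v j\<bar>)"
      unfolding sum_distrib_left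
    proof (rule sum_mono)
      fix j assume "j \<in> {..<p}"
      then have "c * sqrt (real (l j) / real n) * \<bar>v j\<bar> \<le> 2 * w j * \<bar>v j\<bar>" by (intro mult_right_mono lw) auto
      then show "c * (sqrt (real (l j) / real n) * \<bar>v j\<bar>) \<le> 2 * (w j * \<bar>v j\<bar>)" by (simp add: mult_ac)
    qed
    also have "\<dots> \<le> 2 * (4 / 3 * a * \<rho>)" using T by linarith
    also have "\<dots> = c * (cr / 3 * \<rho>)" unfolding c_eq using cr by (simp add: field_simps)
    finally show ?thesis using c by simp
  qed
  define u where "u j = v j / \<rho>" for j
  have "real n / 2 \<le> quad_form n (Suc p) z u"
  proof (rule reg[unfolded regular_design_def, THEN conjunct2, rule_format, of _ l])
    show "dot (Suc p) u u = 1"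
    proof -
      have "dot (Suc p) u u = dot (Suc p) v v / \<rho>\<^sup>2"
        unfolding dot_def u_def sum_divide_distrib by (simp add: power2_eq_square)
      also have "\<rho>\<^sup>2 = dot (Suc p) v v" unfolding \<rho>_def using dot_self_nonneg by simp
      finally show ?thesis using \<rho>(2) unfolding \<rho>_def by simp
    qed
    show "1 \<le> l j \<and> l j \<le> n" if "j < Suc p" for j by (rule l1[OF that])
    show "(\<Sum>j<Suc p. sqrt (real (l j) / real n) * \<bar>u j\<bar>) \<le> cone_bound K"
    proof -
      have "(\<Sum>j<p. sqrt (real (l j) / real n) * \<bar>u j\<bar>) = (\<Sum>j<p. sqrt (real (l j) / real n) * \<bar>v j\<bar>) / \<rho>"
        unfolding u_def sum_divide_distrib using \<rho> by simp
      also have "\<dots> \<le> cr / 3" using Tc \<rho> by (simp add: field_simps)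
      finally have 1: "(\<Sum>j<p. sqrt (real (l j) / real n) * \<bar>u j\<bar>) \<le> cr / 3" .
      have "sqrt (real (l p) / real n) \<le> sqrt (9 * \<kappa>0)"
      proof (intro real_sqrt_le_mono)
        have "real (l p) / real n \<le> 9 * real n * \<kappa>0 / real n" using lp(2) ln by (intro divide_right_mono) auto
        then show "real (l p) / real n \<le> 9 * \<kappa>0" using n by simp
      qed
      also have "\<dots> = 3 * q" unfolding q_def real_sqrt_mult by simp
      finally have 2: "sqrt (real (l p) / real n) \<le> cr / 3" using q2 cr by linarith
      have "\<bar>u p\<bar> \<le> 1" unfolding u_def using \<sigma> \<rho> by simp
      then have "sqrt (real (l p) / real n) * \<bar>u p\<bar> \<le> sqrt (real (l p) / real n) * 1" by (intro mult_left_mono) auto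
      then show ?thesis using 1 2 cr unfolding cr_def by simp
    qed
    show "min 1 (\<bar>u j\<bar> * sqrt (real n)) \<le> 8 * real n / real (Suc p) * exp (real (l j))" if j: "j < Suc p" for j
    proof (cases "j < p")
      case False
      then have jp: "j = p" using j by simp
      have "2 * real p = exp (ln (2 * real p))" using p by simp
      also have "\<dots> \<le> exp (real (l p))" using lp(1) by simp
      finally have "8 * real n / real (Suc p) * (2 * real p) \<le> 8 * real n / real (Suc p) * exp (real (l p))"
        by (intro mult_left_mono) auto
      moreover have "1 \<le> 8 * real n / real (Suc p) * (2 * real p)"
      proof -
        have "1 * real (Suc p) \<le> (8 * real n) * (2 * real p)" using n p by (intro mult_mono) auto
        then show ?thesis by (simp add: field_simps)
      qed
      ultimately show ?thesis unfolding jp by linarith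
    next
      case True
      have "2 * real p / m j = exp (ln (2 * real p / m j))" using p lnm(3)[OF True] by simp
      also have "\<dots> \<le> exp (real (l j))" using lr(1)[OF True] by simp
      finally have e: "2 * real p / m j \<le> exp (real (l j))" .
      have "8 * real n / m j \<le> 8 * real n / real (Suc p) * (2 * real p / m j)"
      proof -
        have "8 * real n / m j * 1 \<le> 8 * real n / m j * (2 * real p / real (Suc p))"
          using p lnm(3)[OF True] by (intro mult_left_mono) auto
        then show ?thesis by (simp add: mult_ac)
      qed
      also have "\<dots> \<le> 8 * real n / real (Suc p) * exp (real (l j))" using e by (intro mult_left_mono) auto
      finally have main: "8 * real n / m j \<le> 8 * real n / real (Suc p) * exp (real (l j))" .
      have "min 1 (\<bar>u j\<bar> * sqrt (real n)) \<le> 8 * real n / m j"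
      proof (cases "m j \<le> 8 * real n")
        case mj: True
        have "1 \<le> 8 * real n / m j" using mj lnm(3)[OF True] by simp
        then show ?thesis by linarith
      next
        case False
        \<comment> \<open>A late position. S has at most 3*n elements and the rank m of j exceeds
          8*n, so at least m/2 positions up to j lie outside S. Their errors are no smaller than |v
          j| and their weights are at least c/(2*sqrt n). As the total penalty is bounded by T, |v
          j|*sqrt n is of order n/m times the error norm.\<close>
        let ?b = "c / 2 / sqrt (real n)"
        have "3 * real n * \<kappa>0 \<le> 3 * real n * 1" using \<kappa>s by (intro mult_left_mono) auto
        then have sn: "real (card S) \<le> 3 * real n" using lb(3) S(2) by simp
        have "(\<Sum>i\<in>{card S..ix j}. ?b * \<bar>v j\<bar>) \<le> (\<Sum>i\<in>{card S..ix j}. w (js ! i) * \<bar>v (js ! i)\<bar>)"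
        proof (intro sum_mono mult_mono)
          fix i assume i: "i \<in> {card S..ix j}"
          then have ip: "i < p" using ix(1)[OF True] by simp
          have "js ! i < p" by (rule ranking_nth_less[OF js ip])
          moreover have "\<bar>h (js ! ix j)\<bar> \<le> \<bar>h (js ! i)\<bar>"
            using js i ix(1)[OF True] unfolding is_ranking_def by simp
          ultimately show "\<bar>v j\<bar> \<le> \<bar>v (js ! i)\<bar>"
            using ix(2)[OF True] h[OF True] h[of "js ! i"] by simp
          have "1/4 \<le> ln (2 * real p / real (Suc i))"
          proof -
            have "2 \<le> 2 * real p / real (Suc i)" using ip by (simp add: field_simps)
            then have "ln 2 \<le> ln (2 * real p / real (Suc i))" by (intro ln_mono) auto
            then show ?thesis using ln2 by linarith
          qed
          then have "1/2 \<le> sqrt (ln (2 * real p / real (Suc i)))"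
            by (intro real_le_rsqrt) (simp add: power2_eq_square)
          then have "1/2 / sqrt (real n) \<le> sqrt (ln (2 * real p / real (Suc i)) / real n)"
            unfolding real_sqrt_divide by (rule divide_right_mono) simp
          then have "c * (1/2 / sqrt (real n)) \<le> slope_weight n p c (Suc i)"
            unfolding slope_weight_def using c by (intro mult_left_mono) auto
          then show "?b \<le> w (js ! i)" using w[OF ip] unfolding c_def by simp
          moreover have "0 \<le> ?b" using c by simp
          ultimately show "0 \<le> w (js ! i)" by linarith
        qed auto
        also have "\<dots> \<le> (\<Sum>i<p. w (js ! i) * \<bar>v (js ! i)\<bar>)"
        proof (intro sum_mono2)
          fix i assume "i \<in> {..<p} - {card S..ix j}"
          then have "js ! i < p" using ranking_nth_less[OF js] by blast
          then show "0 \<le> w (js ! i) * \<bar>v (js ! i)\<bar>" using w0 by simp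
        qed (use ix(1)[OF True] in auto)
        also have "\<dots> = (\<Sum>j<p. w j * \<bar>v j\<bar>)" by (rule ranking_sum[OF js, symmetric])
        also have "\<dots> \<le> 4 / 3 * a * \<rho>" by (rule T)
        finally have "real (card {card S..ix j}) * (?b * \<bar>v j\<bar>) \<le> 4 / 3 * a * \<rho>" by simp
        moreover have "m j / 2 \<le> real (card {card S..ix j})"
          using False sn unfolding m_def by simp
        moreover have "0 \<le> ?b * \<bar>v j\<bar>" using c by simp
        ultimately have "m j / 2 * (?b * \<bar>v j\<bar>) \<le> 4 / 3 * a * \<rho>"
          by (meson mult_right_mono order_trans)
        then have "m j * (c * \<bar>v j\<bar>) \<le> (16 / 3 * a * \<rho>) * sqrt (real n)"
          using n by (simp add: field_simps)
        also have "\<dots> = c * (2 / 3 * cr * \<rho> * sqrt (real n))" unfolding c_eq using cr by (simp add: field_simps)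
        finally have "c * (m j * \<bar>v j\<bar>) \<le> c * (2 / 3 * cr * \<rho> * sqrt (real n))" by (simp only: mult.left_commute)
        then have "m j * \<bar>v j\<bar> \<le> 2 / 3 * cr * \<rho> * sqrt (real n)" using c by simp
        also have "\<dots> \<le> 8 * \<rho> * sqrt (real n)" using cr \<rho> by (intro mult_right_mono) auto
        finally have "m j * \<bar>v j\<bar> * sqrt (real n) \<le> 8 * \<rho> * sqrt (real n) * sqrt (real n)" by (intro mult_right_mono) auto
        also have "\<dots> = 8 * \<rho> * real n" by simp
        finally have "\<bar>u j\<bar> * sqrt (real n) \<le> 8 * real n / m j"
          unfolding u_def using \<rho> lnm(3)[OF True] by (simp add: field_simps)
        then show ?thesis by linarith
      qed
      then show ?thesis using main by linarith
    qed
  qed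
  also have "quad_form n (Suc p) z u = quad_form n (Suc p) z v / \<rho>\<^sup>2"
    unfolding quad_form_def u_def by (simp add: sum_divide_distrib[symmetric] power_divide)
  finally have "\<rho>\<^sup>2 / 2 \<le> quad_form n (Suc p) z v / real n"
    using \<rho> n by (simp add: field_simps)
  moreover have "(2 / 3 * \<rho>)\<^sup>2 \<le> \<rho>\<^sup>2 / 2" by (simp add: power2_eq_square)
  ultimately have "(2 / 3 * \<rho>)\<^sup>2 \<le> quad_form n (Suc p) z v / real n" by linarith
  then have sg: "2 / 3 * \<rho> \<le> sg" unfolding sg_def by (rule real_le_rsqrt)
  have "0 \<le> (\<Sum>j\<in>{..<p} - S. w j * \<bar>v j\<bar>)" using w0 by (intro sum_nonneg) auto
  \<comment> \<open>The residual scale is at least 2/3 of \<rho>, and half of it is at most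
    a*\<sigma> plus a sixth of \<rho>; solving for \<rho> gives the factor 6.\<close>
  then have up: "sg / 2 \<le> \<sigma> * a + \<rho> / 6" using cone WS cq\<rho> unfolding sg_def a_def by linarith
  then show 1: "sqrt (dot (Suc p) v v) \<le> 6 * noise_bound K * \<sigma>"
    using sg unfolding \<rho>_def[symmetric] a_def[symmetric] by (simp add: mult.commute)
  show "\<sigma> / 2 \<le> sqrt (quad_form n (Suc p) z v / real n)" using sg \<rho> \<sigma> unfolding sg_def by linarith
  show "sqrt (quad_form n (Suc p) z v / real n) \<le> 4 * noise_bound K * \<sigma>"
    using up 1 unfolding \<rho>_def[symmetric] a_def[symmetric] sg_def[symmetric] by (simp add: mult.commute)
qed

section \<open>The three subsamples\<close>

lemma (in prob_space) indep_vars_reindex_inj: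
  assumes "indep_vars (\<lambda>_. N) X I" and inj: "inj_on f J" and J: "\<And>j. j \<in> J \<Longrightarrow> f j \<in> I"
  shows "indep_vars (\<lambda>_. N) (\<lambda>j. X (f j)) J"
proof -
  have "indep_vars (\<lambda>j. PiM {f j} (\<lambda>_. N)) (\<lambda>j \<omega>. restrict (\<lambda>i. X i \<omega>) {f j}) J"
    by (rule indep_vars_restrict[OF assms(1)]) (use inj J in \<open>auto simp: disjoint_family_on_def inj_on_def\<close>)
  then have "indep_vars (\<lambda>_. N) (\<lambda>j \<omega>. (\<lambda>x. x (f j)) (restrict (\<lambda>i. X i \<omega>) {f j})) J"
    by (rule indep_vars_compose2) (rule measurable_component_singleton, simp)
  then show ?thesis by simp
qed

text \<open>Conditioning on X by Fubini: a bound for every fixed x in G passes to the random X, as X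
  and Y are independent. All conditional arguments on the subsamples rest on this.\<close>

lemma (in prob_space) indep_section_bound:
  assumes ind: "indep_var S X T Y" and A: "A \<in> sets (S \<Otimes>\<^sub>M T)" and G: "G \<in> sets S" and "\<epsilon> \<ge> 0"
    and le: "\<And>x. x \<in> G \<Longrightarrow> prob {\<omega> \<in> space M. (x, Y \<omega>) \<in> A} \<le> \<epsilon>"
  shows "prob {\<omega> \<in> space M. X \<omega> \<in> G \<and> (X \<omega>, Y \<omega>) \<in> A} \<le> \<epsilon>"
proof -
  have X [measurable]: "X \<in> M \<rightarrow>\<^sub>M S" and Y [measurable]: "Y \<in> M \<rightarrow>\<^sub>M T"
    and eq: "distr M S X \<Otimes>\<^sub>M distr M T Y = distr M (S \<Otimes>\<^sub>M T) (\<lambda>x. (X x, Y x))"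
    using ind unfolding indep_var_distribution_eq by auto
  interpret X: prob_space "distr M S X" by (rule prob_space_distr) (rule X)
  interpret Y: prob_space "distr M T Y" by (rule prob_space_distr) (rule Y)
  let ?A = "A \<inter> (G \<times> space T)"
  have A' [measurable]: "?A \<in> sets (S \<Otimes>\<^sub>M T)" using A G by auto
  have set: "{\<omega> \<in> space M. X \<omega> \<in> G \<and> (X \<omega>, Y \<omega>) \<in> A} = (\<lambda>x. (X x, Y x)) -` ?A \<inter> space M"
    using measurable_space[OF Y] by auto
  have "emeasure M {\<omega> \<in> space M. X \<omega> \<in> G \<and> (X \<omega>, Y \<omega>) \<in> A} = emeasure (distr M (S \<Otimes>\<^sub>M T) (\<lambda>x. (X x, Y x))) ?A"
    unfolding set by (rule emeasure_distr[symmetric]) (use A' in auto)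
  also have "\<dots> = (\<integral>\<^sup>+x. emeasure (distr M T Y) (Pair x -` ?A) \<partial>distr M S X)"
    unfolding eq[symmetric] by (rule Y.emeasure_pair_measure_alt) (use A' in simp)
  also have "\<dots> \<le> (\<integral>\<^sup>+x. ennreal \<epsilon> \<partial>distr M S X)"
  proof (rule nn_integral_mono)
    fix x assume "x \<in> space (distr M S X)"
    then have x: "x \<in> space S" by simp
    show "emeasure (distr M T Y) (Pair x -` ?A) \<le> ennreal \<epsilon>"
    proof (cases "x \<in> G")
      case True
      have P: "Pair x -` ?A \<in> sets T" using A' by (rule sets_Pair1)
      have "emeasure (distr M T Y) (Pair x -` ?A) = emeasure M (Y -` (Pair x -` ?A) \<inter> space M)"
        by (rule emeasure_distr[OF Y P])
      also have "Y -` (Pair x -` ?A) \<inter> space M = {\<omega> \<in> space M. (x, Y \<omega>) \<in> A}"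
        using True measurable_space[OF Y] by auto
      also have "emeasure M \<dots> \<le> ennreal \<epsilon>"
        unfolding emeasure_eq_measure using le[OF True] by (rule ennreal_leI)
      finally show ?thesis .
    next
      case False
      then have "Pair x -` ?A = {}" by auto
      then show ?thesis by simp
    qed
  qed
  also have "\<dots> = ennreal \<epsilon>" using X.emeasure_space_1 by simp
  finally show ?thesis unfolding emeasure_eq_measure using \<open>\<epsilon> \<ge> 0\<close> by simp
qed

text \<open>Column \<open>p\<close> of the array of a block is the noise, so the residuals are linear in the rows.\<close>

definition block_entry :: "nat \<Rightarrow> nat \<Rightarrow> nat \<Rightarrow> nat \<times> nat \<Rightarrow> mtx \<times> vec \<Rightarrow> real" where
  "block_entry n p b = (\<lambda>(k, j) \<omega>. if j < p then fst \<omega> (b * n + k, j) else snd \<omega> (b * n + k))"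

definition pilot_err :: "nat \<Rightarrow> vec \<Rightarrow> real \<Rightarrow> vec \<Rightarrow> vec" where
  "pilot_err p \<theta> \<sigma> t j = (if j < p then \<theta> j - t j else \<sigma>)"

definition block_obs :: "nat \<Rightarrow> nat \<Rightarrow> vec \<Rightarrow> real \<Rightarrow> nat \<Rightarrow> mtx \<times> vec \<Rightarrow> mtx \<times> vec" where
  "block_obs n p \<theta> \<sigma> b \<omega> = subsample n p b (observe (3 * n) p \<theta> \<sigma> \<omega>)"

lemma block_row_less:
  fixes n :: nat
  assumes "b < 3" "k < n"
  shows "b * n + k < 3 * n"
proof -
  have "b * n + k < b * n + n" using assms(2) by simp
  also have "\<dots> = Suc b * n" by simp
  also have "\<dots> \<le> 3 * n" using assms(1) by (intro mult_le_mono1) simp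
  finally show ?thesis .
qed

lemma subg_array_block:
  assumes R: "model_law (3 * n) p R" and K: "K > 0" "L\<^sup>2 \<le> K\<^sup>2" "M\<^sup>2 \<le> K\<^sup>2" and b: "b < 3"
    and \<xi>: "\<forall>i<3 * n. subgaussian R L (model_var (Inr i))"
    and X: "\<forall>i<3 * n. \<forall>j<p. subgaussian R M (model_var (Inl (i, j)))"
  shows "subg_array R n (Suc p) K (block_entry n p b)"
proof -
  interpret prob_space R using R unfolding model_law_def by blast
  let ?I = "({..<3 * n} \<times> {..<p}) <+> {..<3 * n}"
  let ?f = "\<lambda>(k, j). if j < p then Inl (b * n + k, j) else Inr (b * n + k)"
  have entry: "block_entry n p b i = model_var (?f i)" for i
    unfolding block_entry_def by (auto simp: fun_eq_iff split: prod.splits)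
  have f: "?f i \<in> ?I" if "i \<in> {..<n} \<times> {..<Suc p}" for i
    using that block_row_less[OF b] by (auto split: prod.splits)
  have inj: "inj_on ?f ({..<n} \<times> {..<Suc p})"
    by (auto simp: inj_on_def split: if_splits)
  have ind: "indep_vars (\<lambda>_. borel) model_var ?I" using R unfolding model_law_def by blast
  have mv: "expectation (model_var v) = 0 \<and> variance (model_var v) = 1" if "v \<in> ?I" for v
    using R that unfolding model_law_def by blast
  have sg: "subgaussian R K (model_var v)" if "v \<in> ?I" for v
    using that
  proof (rule PlusE)
    fix x assume "x \<in> {..<3 * n} \<times> {..<p}" "v = Inl x"
    then show ?thesis using X K(3) by (auto intro: subgaussian_mono)
  next
    fix i assume "i \<in> {..<3 * n}" "v = Inr i"
    then show ?thesis using \<xi> K(2) by (auto intro: subgaussian_mono)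
  qed
  show ?thesis
  proof
    show "indep_vars (\<lambda>_. borel) (block_entry n p b) ({..<n} \<times> {..<Suc p})"
      unfolding entry[abs_def] by (rule indep_vars_reindex_inj[OF ind inj f])
    show "expectation (block_entry n p b i) = 0" "variance (block_entry n p b i) = 1"
      "subgaussian R K (block_entry n p b i)" if "i \<in> {..<n} \<times> {..<Suc p}" for i
      unfolding entry using mv[OF f[OF that]] sg[OF f[OF that]] by blast+
  qed (rule K(1))
qed

lemma fst_sample_measurable [measurable]:
  assumes "k < n" "j < p"
  shows "(\<lambda>x. fst x (k, j)) \<in> borel_measurable (sample_space n p)"
proof -
  have "(\<lambda>y. y (k, j)) \<in> borel_measurable (mtx_space n p)"
    unfolding mtx_space_def using assms by (intro measurable_component_singleton) auto
  then show ?thesis unfolding sample_space_def by measurable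
qed

lemma snd_sample_measurable [measurable]:
  assumes "k < n"
  shows "(\<lambda>x. snd x k) \<in> borel_measurable (sample_space n p)"
proof -
  have "(\<lambda>y. y k) \<in> borel_measurable (vec_space n)"
    unfolding vec_space_def using assms by (intro measurable_component_singleton) auto
  then show ?thesis unfolding sample_space_def by measurable
qed

lemma vec_component_measurable [measurable]:
  assumes "j < p"
  shows "(\<lambda>t. t j) \<in> borel_measurable (vec_space p)"
  unfolding vec_space_def using assms by (intro measurable_component_singleton) auto

lemma sample_space_measurableI:
  assumes "\<And>k j. k < n \<Longrightarrow> j < p \<Longrightarrow> (\<lambda>\<omega>. X \<omega> (k, j)) \<in> borel_measurable M"
    and "\<And>k. k < n \<Longrightarrow> (\<lambda>\<omega>. Y \<omega> k) \<in> borel_measurable M"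
  shows "(\<lambda>\<omega>. (\<lambda>kj\<in>{..<n} \<times> {..<p}. X \<omega> kj, \<lambda>k\<in>{..<n}. Y \<omega> k)) \<in> M \<rightarrow>\<^sub>M sample_space n p"
  unfolding sample_space_def mtx_space_def vec_space_def
  by (intro measurable_Pair measurable_restrict) (use assms in auto)

lemma subsample_measurable [measurable]:
  assumes "b < 3"
  shows "subsample n p b \<in> sample_space (3 * n) p \<rightarrow>\<^sub>M sample_space n p"
proof -
  have "(\<lambda>D. (\<lambda>kj\<in>{..<n} \<times> {..<p}. (\<lambda>(k, j). fst D (b * n + k, j)) kj, \<lambda>k\<in>{..<n}. snd D (b * n + k)))
      \<in> sample_space (3 * n) p \<rightarrow>\<^sub>M sample_space n p"
    by (rule sample_space_measurableI) (use block_row_less[OF assms] in auto)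
  moreover have "subsample n p b = (\<lambda>D. (\<lambda>kj\<in>{..<n} \<times> {..<p}. (\<lambda>(k, j). fst D (b * n + k, j)) kj, \<lambda>k\<in>{..<n}. snd D (b * n + k)))"
    by (simp add: fun_eq_iff subsample_def restrict_def split: prod.splits)
  ultimately show ?thesis by simp
qed

lemma observe_measurable [measurable]:
  "observe N p \<theta> \<sigma> \<in> sample_space N p \<rightarrow>\<^sub>M sample_space N p"
proof -
  have "(\<lambda>\<omega>. \<lambda>i\<in>{..<N}. (\<Sum>j<p. fst \<omega> (i, j) * \<theta> j) + \<sigma> * snd \<omega> i) \<in> sample_space N p \<rightarrow>\<^sub>M vec_space N"
    unfolding vec_space_def by (intro measurable_restrict borel_measurable_add borel_measurable_sum borel_measurable_times) auto
  moreover have "fst \<in> sample_space N p \<rightarrow>\<^sub>M mtx_space N p" unfolding sample_space_def by simp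
  ultimately have "(\<lambda>\<omega>. (fst \<omega>, \<lambda>i\<in>{..<N}. (\<Sum>j<p. fst \<omega> (i, j) * \<theta> j) + \<sigma> * snd \<omega> i))
      \<in> sample_space N p \<rightarrow>\<^sub>M mtx_space N p \<Otimes>\<^sub>M vec_space N" by (rule measurable_Pair[rotated])
  then show ?thesis unfolding observe_def sample_space_def by (simp add: case_prod_beta')
qed

lemma block_obs_fst:
  assumes "b < 3" "k < n" "j < p"
  shows "fst (block_obs n p \<theta> \<sigma> b \<omega>) (k, j) = block_entry n p b (k, j) \<omega>"
  using assms by (simp add: block_obs_def subsample_def observe_def block_entry_def split: prod.splits)

lemma block_obs_snd:
  assumes "b < 3" "k < n"
  shows "snd (block_obs n p \<theta> \<sigma> b \<omega>) k
    = (\<Sum>j<p. block_entry n p b (k, j) \<omega> * \<theta> j) + \<sigma> * block_entry n p b (k, p) \<omega>"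
  using assms block_row_less[OF assms]
  by (simp add: block_obs_def subsample_def observe_def block_entry_def split: prod.splits)

lemma block_obs_indep:
  assumes R: "model_law (3 * n) p R"
  shows "prob_space.indep_vars R (\<lambda>_. sample_space n p) (block_obs n p \<theta> \<sigma>) {..<3}"
proof -
  interpret prob_space R using R unfolding model_law_def by blast
  let ?I = "({..<3 * n} \<times> {..<p}) <+> {..<3 * n}"
  let ?r = "\<lambda>b. {b * n..<b * n + n}"
  let ?J = "\<lambda>b. (?r b \<times> {..<p}) <+> ?r b"
  have ind: "indep_vars (\<lambda>_. borel) model_var ?I" using R unfolding model_law_def by blast
  have r: "?r b \<subseteq> {..<3 * n}" if b: "b < 3" for b
  proof
    fix i assume "i \<in> ?r b"
    then show "i \<in> {..<3 * n}" using block_row_less[OF b, of "i - b * n" n] by auto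
  qed
  have dr: "?r a \<inter> ?r b = {}" if "a \<noteq> b" for a b
  proof -
    have "?r a \<inter> ?r b = {}" if "a < b" for a b
    proof -
      have "Suc a * n \<le> b * n" using that by (intro mult_le_mono1) simp
      then show ?thesis by auto
    qed
    then show ?thesis using \<open>a \<noteq> b\<close> by (cases "a < b") (auto simp: Int_commute not_less)
  qed
  let ?g = "\<lambda>b x. (\<lambda>kj\<in>{..<n} \<times> {..<p}. x (Inl (b * n + fst kj, snd kj)),
      \<lambda>k\<in>{..<n}. (\<Sum>j<p. x (Inl (b * n + k, j)) * \<theta> j) + \<sigma> * x (Inr (b * n + k)))"
  have "indep_vars (\<lambda>b. PiM (?J b) (\<lambda>_. borel)) (\<lambda>b \<omega>. restrict (\<lambda>i. model_var i \<omega>) (?J b)) {..<3}"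
  proof (rule indep_vars_restrict[OF ind])
    show "?J b \<subseteq> ?I" if "b \<in> {..<3}" for b using r[of b] that by auto
    show "disjoint_family_on ?J {..<3}"
      unfolding disjoint_family_on_def using dr by blast
  qed
  then have "indep_vars (\<lambda>_. sample_space n p) (\<lambda>b \<omega>. ?g b (restrict (\<lambda>i. model_var i \<omega>) (?J b))) {..<3}"
  proof (rule indep_vars_compose2)
    fix b :: nat
    show "?g b \<in> PiM (?J b) (\<lambda>_. borel) \<rightarrow>\<^sub>M sample_space n p"
      by (intro sample_space_measurableI borel_measurable_add borel_measurable_sum borel_measurable_times
        measurable_component_singleton) auto
  qed
  moreover have "?g b (restrict (\<lambda>i. model_var i \<omega>) (?J b)) = block_obs n p \<theta> \<sigma> b \<omega>" if "b < 3" for b \<omega>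
    using block_row_less[OF that]
    by (auto simp: block_obs_def subsample_def observe_def fun_eq_iff restrict_def InlI InrI split: prod.splits)
  ultimately show ?thesis
    by (subst indep_vars_cong[OF refl _ refl]) (auto intro!: ext)
qed

lemma block_resid:
  assumes "b < 3" "k < n"
  shows "resid p (block_obs n p \<theta> \<sigma> b \<omega>) t k = (\<Sum>j<Suc p. block_entry n p b (k, j) \<omega> * pilot_err p \<theta> \<sigma> t j)"
proof -
  have "(\<Sum>j<p. fst (block_obs n p \<theta> \<sigma> b \<omega>) (k, j) * t j) = (\<Sum>j<p. block_entry n p b (k, j) \<omega> * t j)"
    using assms by (intro sum.cong) (simp_all add: block_obs_fst)
  then have "resid p (block_obs n p \<theta> \<sigma> b \<omega>) t k
      = (\<Sum>j<p. block_entry n p b (k, j) \<omega> * (\<theta> j - t j)) + \<sigma> * block_entry n p b (k, p) \<omega>"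
    unfolding resid_def block_obs_snd[OF assms] by (simp add: right_diff_distrib sum_subtractf)
  then show ?thesis by (simp add: pilot_err_def mult.commute)
qed

section \<open>Tail bounds for a fixed pilot and a fixed selection\<close>

context subg_array
begin

lemma square_tail:
  assumes [measurable]: "f \<in> borel_measurable M" and i: "integrable M (\<lambda>\<omega>. (f \<omega>)\<^sup>2 :: real)"
    and le: "expectation (\<lambda>\<omega>. (f \<omega>)\<^sup>2) \<le> \<epsilon> * c\<^sup>2" and c: "c > 0"
  shows "prob {\<omega> \<in> space M. \<bar>f \<omega>\<bar> > c} \<le> \<epsilon>"
proof -
  have "prob {\<omega> \<in> space M. \<bar>f \<omega>\<bar> > c} \<le> prob {\<omega> \<in> space M. (f \<omega>)\<^sup>2 \<ge> c\<^sup>2}"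
  proof (rule finite_measure_mono)
    show "{\<omega> \<in> space M. \<bar>f \<omega>\<bar> > c} \<subseteq> {\<omega> \<in> space M. (f \<omega>)\<^sup>2 \<ge> c\<^sup>2}"
      using c by (auto simp: abs_le_square_iff[symmetric])
  qed measurable
  also have "\<dots> \<le> expectation (\<lambda>\<omega>. (f \<omega>)\<^sup>2) / c\<^sup>2"
    using c by (intro integral_Markov_inequality_measure[where A = "{}"] i) auto
  also have "\<dots> \<le> \<epsilon>" using le c by (simp add: field_simps)
  finally show ?thesis .
qed

abbreviation unit_vec :: "nat \<Rightarrow> vec" where "unit_vec j \<equiv> \<lambda>i. of_bool (i = j)"

text \<open>Chebyshev for each of two parts: the linear terms collapse into one \<open>usum\<close>
  in the direction of \<theta> restricted to A, the double sums into one \<open>ustat\<close>. T and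
  m enter the Chebyshev thresholds and must be positive, so they dominate the norm and the
  cardinality instead of equalling them.\<close>

lemma selected_error_tail:
  assumes A: "A \<subseteq> {..<P}" and n: "n \<ge> 2" and r: "dot P v v \<le> r\<^sup>2" "r > 0"
    and T: "(\<Sum>j\<in>A. (\<theta> j)\<^sup>2) \<le> T\<^sup>2" "T > 0" and m: "real (card A) \<le> m" "m > 0" and \<epsilon>: "\<epsilon> > 0"
  shows "prob {\<omega> \<in> space M. \<bar>\<Sum>j\<in>A. 2 * \<theta> j / real n * usum (unit_vec j) v n \<omega> + 1 / (real n * (real n - 1)) *
      (\<Sum>k<n. \<Sum>l\<in>{..<n} - {k}. uprod (unit_vec j) v k \<omega> * uprod (unit_vec j) v l \<omega>)\<bar>
      > 2 / sqrt (real n) * sqrt (B4 / \<epsilon>) * r * T + 4 / real n * B4 * r\<^sup>2 * sqrt (m / \<epsilon>)} \<le> 2 * \<epsilon>"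
    (is "prob ?E \<le> _")
proof -
  have fA: "finite A" using A finite_subset by blast
  let ?a = "\<lambda>j. if j \<in> A then \<theta> j else 0"
  let ?c1 = "sqrt (real n) * sqrt (B4 / \<epsilon>) * r * T" and ?c2 = "real n * B4 * r\<^sup>2 * sqrt (m / \<epsilon>)"
  have n0: "real n \<ge> 2" using n by simp
  have eq: "(\<Sum>j\<in>A. 2 * \<theta> j / real n * usum (unit_vec j) v n \<omega> + 1 / (real n * (real n - 1)) *
      (\<Sum>k<n. \<Sum>l\<in>{..<n} - {k}. uprod (unit_vec j) v k \<omega> * uprod (unit_vec j) v l \<omega>))
    = 2 / real n * usum ?a v n \<omega> + 2 / (real n * (real n - 1)) * ustat A v n \<omega>" for \<omega>
  proof -
    have "(\<Sum>j\<in>A. 2 * \<theta> j / real n * usum (unit_vec j) v n \<omega>) = 2 / real n * (\<Sum>j\<in>A. \<Sum>k<n. \<theta> j * uprod (unit_vec j) v k \<omega>)"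
      unfolding usum_def sum_distrib_left by (intro sum.cong refl) simp
    also have "(\<Sum>j\<in>A. \<Sum>k<n. \<theta> j * uprod (unit_vec j) v k \<omega>) = (\<Sum>k<n. \<Sum>j\<in>A. \<theta> j * uprod (unit_vec j) v k \<omega>)"
      by (rule sum.swap)
    also have "\<dots> = usum ?a v n \<omega>" unfolding usum_def sum_uprod_unit[OF A] ..
    finally have 1: "(\<Sum>j\<in>A. 2 * \<theta> j / real n * usum (unit_vec j) v n \<omega>) = 2 / real n * usum ?a v n \<omega>" .
    have "(\<Sum>j\<in>A. \<Sum>k<n. \<Sum>l\<in>{..<n} - {k}. uprod (unit_vec j) v k \<omega> * uprod (unit_vec j) v l \<omega>)
        = (\<Sum>k<n. \<Sum>j\<in>A. \<Sum>l\<in>{..<n} - {k}. uprod (unit_vec j) v k \<omega> * uprod (unit_vec j) v l \<omega>)"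
      by (rule sum.swap)
    also have "\<dots> = (\<Sum>k<n. \<Sum>l\<in>{..<n} - {k}. \<Sum>j\<in>A. uprod (unit_vec j) v k \<omega> * uprod (unit_vec j) v l \<omega>)"
      by (intro sum.cong refl sum.swap)
    also have "\<dots> = 2 * ustat A v n \<omega>" by (rule ustat_double_sum)
    finally have 2: "(\<Sum>j\<in>A. \<Sum>k<n. \<Sum>l\<in>{..<n} - {k}. uprod (unit_vec j) v k \<omega> * uprod (unit_vec j) v l \<omega>) = 2 * ustat A v n \<omega>" .
    define X where "X j = (\<Sum>k<n. \<Sum>l\<in>{..<n} - {k}. uprod (unit_vec j) v k \<omega> * uprod (unit_vec j) v l \<omega>)" for j
    have "(\<Sum>j\<in>A. 1 / (real n * (real n - 1)) * X j) = 1 / (real n * (real n - 1)) * (2 * ustat A v n \<omega>)"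
      unfolding sum_distrib_left[symmetric] 2[folded X_def] ..
    then show ?thesis unfolding sum.distrib 1 X_def[symmetric] by simp
  qed
  have dr: "0 \<le> dot P v v" by (rule dot_self_nonneg)
  have p1: "prob {\<omega> \<in> space M. \<bar>usum ?a v n \<omega>\<bar> > ?c1} \<le> \<epsilon>"
  proof (rule square_tail)
    show "usum ?a v n \<in> borel_measurable M" by measurable
    show "integrable M (\<lambda>\<omega>. (usum ?a v n \<omega>)\<^sup>2)" by (rule usum_square_integrable) simp
    show "?c1 > 0" using n0 B4_pos \<epsilon> r T by simp
    have "expectation (\<lambda>\<omega>. (usum ?a v n \<omega>)\<^sup>2) \<le> real n * (B4 * dot P ?a ?a * dot P v v)"
      by (rule usum_square) simp
    also have "dot P ?a ?a = (\<Sum>j\<in>A. (\<theta> j)\<^sup>2)" by (rule sum_of_bool_mult[OF A])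
    also have "real n * (B4 * (\<Sum>j\<in>A. (\<theta> j)\<^sup>2) * dot P v v) \<le> real n * (B4 * T\<^sup>2 * r\<^sup>2)"
      using T r dr B4_pos by (intro mult_left_mono mult_mono) auto
    also have "\<dots> = \<epsilon> * ?c1\<^sup>2" using \<epsilon> B4_pos by (simp add: power_mult_distrib)
    finally show "expectation (\<lambda>\<omega>. (usum ?a v n \<omega>)\<^sup>2) \<le> \<epsilon> * ?c1\<^sup>2" .
  qed
  have p2: "prob {\<omega> \<in> space M. \<bar>ustat A v n \<omega>\<bar> > ?c2} \<le> \<epsilon>"
  proof (rule square_tail)
    note us = ustat_square[OF A order_refl, of v]
    show "ustat A v n \<in> borel_measurable M" by measurable
    show "integrable M (\<lambda>\<omega>. (ustat A v n \<omega>)\<^sup>2)" using us by blast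
    show "?c2 > 0" using n0 B4_pos \<epsilon> r m by simp
    have "expectation (\<lambda>\<omega>. (ustat A v n \<omega>)\<^sup>2) \<le> (B4 * dot P v v)\<^sup>2 * real (card A) * (real n * (real n - 1) / 2)"
      using us by blast
    also have "\<dots> \<le> (B4 * r\<^sup>2)\<^sup>2 * m * (real n)\<^sup>2"
    proof (intro mult_mono power_mono)
      have "real n * (real n - 1) \<le> real n * real n" by (intro mult_left_mono) auto
      moreover have "0 \<le> real n * real n" by simp
      ultimately show "real n * (real n - 1) / 2 \<le> (real n)\<^sup>2" unfolding power2_eq_square by linarith
    qed (use n0 B4_pos r dr m in auto)
    also have "\<dots> = \<epsilon> * ?c2\<^sup>2" using \<epsilon> m by (simp add: power_mult_distrib)
    finally show "expectation (\<lambda>\<omega>. (ustat A v n \<omega>)\<^sup>2) \<le> \<epsilon> * ?c2\<^sup>2" .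
  qed
  have "prob ?E \<le> prob ({\<omega> \<in> space M. \<bar>usum ?a v n \<omega>\<bar> > ?c1} \<union> {\<omega> \<in> space M. \<bar>ustat A v n \<omega>\<bar> > ?c2})"
  proof (rule finite_measure_mono)
    show "?E \<subseteq> {\<omega> \<in> space M. \<bar>usum ?a v n \<omega>\<bar> > ?c1} \<union> {\<omega> \<in> space M. \<bar>ustat A v n \<omega>\<bar> > ?c2}"
    proof
      fix \<omega> assume w: "\<omega> \<in> ?E"
      show "\<omega> \<in> {\<omega> \<in> space M. \<bar>usum ?a v n \<omega>\<bar> > ?c1} \<union> {\<omega> \<in> space M. \<bar>ustat A v n \<omega>\<bar> > ?c2}"
      proof (rule ccontr)
        assume "\<not> ?thesis"
        then have le: "\<bar>usum ?a v n \<omega>\<bar> \<le> ?c1" "\<bar>ustat A v n \<omega>\<bar> \<le> ?c2" using w by auto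
        have c2: "?c2 \<ge> 0" using B4_pos m \<epsilon> by simp
        have "\<bar>2 / real n * usum ?a v n \<omega> + 2 / (real n * (real n - 1)) * ustat A v n \<omega>\<bar>
            \<le> 2 / real n * \<bar>usum ?a v n \<omega>\<bar> + 2 / (real n * (real n - 1)) * \<bar>ustat A v n \<omega>\<bar>"
          using n0 by (intro order_trans[OF abs_triangle_ineq]) (simp add: abs_mult)
        also have "\<dots> \<le> 2 / real n * ?c1 + 4 / (real n * real n) * ?c2"
        proof (intro add_mono mult_mono le)
          \<comment> \<open>From n >= 2 one has n - 1 >= n/2.\<close>
          have "real n * real n \<le> real n * (2 * (real n - 1))" using n0 by (intro mult_left_mono) auto
          then show "2 / (real n * (real n - 1)) \<le> 4 / (real n * real n)"
            using n0 by (simp add: field_simps)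
        qed (use n0 c2 in auto)
        also have "2 / real n * ?c1 = 2 / sqrt (real n) * sqrt (B4 / \<epsilon>) * r * T"
        proof -
          have "2 / real n * sqrt (real n) = 2 / sqrt (real n)" using n0 by (simp add: field_simps)
          then show ?thesis by (simp only: mult.assoc[symmetric])
        qed
        also have "4 / (real n * real n) * ?c2 = 4 / real n * B4 * r\<^sup>2 * sqrt (m / \<epsilon>)" using n0 by simp
        finally show False using w unfolding eq by simp
      qed
    qed
  qed measurable
  also have "\<dots> \<le> prob {\<omega> \<in> space M. \<bar>usum ?a v n \<omega>\<bar> > ?c1} + prob {\<omega> \<in> space M. \<bar>ustat A v n \<omega>\<bar> > ?c2}"
    by (rule measure_Un_le) measurable
  also have "\<dots> \<le> 2 * \<epsilon>" using p1 p2 by linarith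
  finally show ?thesis .
qed

text \<open>Markov's inequality for the number of exceedances instead of a union bound: a failure
  probability of order s^2/p per coordinate is then enough, and this is what a threshold based on
  log(1+p/s^2) delivers.\<close>

lemma false_selection_tail:
  assumes J: "J \<subseteq> {..<P}" and n: "n \<ge> 1" and v: "dot P v v > 0" "dot P v v \<le> r\<^sup>2" "r \<ge> 0"
    and x: "0 \<le> x" "x \<le> real n" and \<tau>: "tail_const * r * sqrt (x / real n) \<le> \<tau>" and m: "m > 0"
  shows "prob {\<omega> \<in> space M. (\<Sum>j\<in>J. of_bool (\<bar>usum (unit_vec j) v n \<omega> / real n\<bar> > \<tau>)) \<ge> m} \<le> real (card J) * (2 * exp (- x)) / m"
proof -
  let ?F = "\<lambda>j. {\<omega> \<in> space M. \<bar>usum (unit_vec j) v n \<omega> / real n\<bar> > \<tau>}"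
  let ?f = "\<lambda>\<omega>. \<Sum>j\<in>J. indicator (?F j) \<omega> :: real"
  have [measurable]: "?F j \<in> events" for j by measurable
  have pF: "prob (?F j) \<le> 2 * exp (- x)" if "j \<in> J" for j
  proof -
    have j: "j < P" using J that by auto
    have "prob (?F j) \<le> prob {\<omega> \<in> space M. \<bar>usum (unit_vec j) v n \<omega>\<bar> \<ge> tail_const * sqrt (dot P v v) * sqrt (x * real n)}"
    proof (rule finite_measure_mono)
      have "tail_const * sqrt (dot P v v) * sqrt (x * real n) \<le> real n * \<tau>"
      proof -
        have tc: "tail_const \<ge> 0" using Csq_gt unfolding tail_const_def by simp
        have sq: "sqrt (x * real n) = real n * sqrt (x / real n)"
        proof -
          have "x * real n = (real n)\<^sup>2 * (x / real n)" using n by (simp add: power2_eq_square)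
          then have "sqrt (x * real n) = sqrt ((real n)\<^sup>2 * (x / real n))" by (simp only:)
          then show ?thesis by (simp only: real_sqrt_mult real_sqrt_abs abs_of_nat)
        qed
        have "sqrt (dot P v v) \<le> r" using v by (intro real_le_lsqrt) auto
        then have "tail_const * sqrt (dot P v v) * sqrt (x * real n) \<le> tail_const * r * sqrt (x * real n)"
          using tc x by (intro mult_right_mono mult_left_mono) auto
        also have "\<dots> = real n * (tail_const * r * sqrt (x / real n))" unfolding sq by simp
        also have "\<dots> \<le> real n * \<tau>" using \<tau> by (intro mult_left_mono) auto
        finally show ?thesis .
      qed
      then show "?F j \<subseteq> {\<omega> \<in> space M. \<bar>usum (unit_vec j) v n \<omega>\<bar> \<ge> tail_const * sqrt (dot P v v) * sqrt (x * real n)}"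
        using n by (auto simp: field_simps)
    qed measurable
    also have "\<dots> \<le> 2 * exp (- x)"
      by (rule usum_tail[OF n _ v(1) x]) (use dot_unit[OF j, of "unit_vec j"] in simp)
    finally show ?thesis .
  qed
  have int: "integrable M ?f"
    by (intro Bochner_Integration.integrable_sum) (simp add: less_top[symmetric])
  have "prob {\<omega> \<in> space M. ?f \<omega> \<ge> m} \<le> expectation ?f / m"
    by (rule integral_Markov_inequality_measure[where A = "{}", OF int]) (use m in \<open>auto intro!: sum_nonneg\<close>)
  also have "expectation ?f = (\<Sum>j\<in>J. prob (?F j))"
    by (subst Bochner_Integration.integral_sum) (auto simp: less_top[symmetric])
  also have "\<dots> / m \<le> (\<Sum>j\<in>J. 2 * exp (- x)) / m" using pF m by (intro divide_right_mono sum_mono) auto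
  finally have "prob {\<omega> \<in> space M. ?f \<omega> \<ge> m} \<le> real (card J) * (2 * exp (- x)) / m" by simp
  moreover have "?f \<omega> = (\<Sum>j\<in>J. of_bool (\<bar>usum (unit_vec j) v n \<omega> / real n\<bar> > \<tau>))" if "\<omega> \<in> space M" for \<omega>
    using that by (intro sum.cong refl) (auto simp: indicator_def)
  ultimately show ?thesis by (simp cong: conj_cong)
qed

text \<open>The total squared noise on the support, of order s/n; it is charged to the coordinates
  that the threshold misses.\<close>

lemma support_noise_tail:
  assumes S: "S \<subseteq> {..<P}" "card S \<le> s" and n: "n \<ge> 1" and v: "dot P v v \<le> r\<^sup>2" and r: "r > 0" and s: "s \<ge> 1" and \<epsilon>: "\<epsilon> > 0"
  shows "prob {\<omega> \<in> space M. (\<Sum>j\<in>S. (usum (unit_vec j) v n \<omega> / real n)\<^sup>2) \<ge> real s * B4 * r\<^sup>2 / (real n * \<epsilon>)} \<le> \<epsilon>"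
proof -
  let ?f = "\<lambda>\<omega>. \<Sum>j\<in>S. (usum (unit_vec j) v n \<omega> / real n)\<^sup>2" and ?m = "real s * B4 * r\<^sup>2 / (real n * \<epsilon>)"
  have m: "?m > 0" using n s B4_pos r \<epsilon> by simp
  have i: "integrable M (\<lambda>\<omega>. (usum (unit_vec j) v n \<omega> / real n)\<^sup>2)" for j
    unfolding power_divide by (intro Bochner_Integration.integrable_divide usum_square_integrable) simp
  have int: "integrable M ?f" by (intro Bochner_Integration.integrable_sum i)
  have "expectation ?f = (\<Sum>j\<in>S. expectation (\<lambda>\<omega>. (usum (unit_vec j) v n \<omega> / real n)\<^sup>2))"
    by (intro Bochner_Integration.integral_sum i)
  also have "\<dots> \<le> (\<Sum>j\<in>S. B4 * r\<^sup>2 / real n)"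
  proof (rule sum_mono)
    fix j assume "j \<in> S"
    then have j: "j < P" using S by auto
    have "expectation (\<lambda>\<omega>. (usum (unit_vec j) v n \<omega>)\<^sup>2) \<le> real n * (B4 * dot P (unit_vec j) (unit_vec j) * dot P v v)"
      by (rule usum_square) simp
    also have "dot P (unit_vec j) (unit_vec j) = 1" using dot_unit[OF j, of "unit_vec j"] by simp
    also have "real n * (B4 * 1 * dot P v v) \<le> real n * (B4 * 1 * r\<^sup>2)" using v B4_pos by (intro mult_left_mono) auto
    finally have "expectation (\<lambda>\<omega>. (usum (unit_vec j) v n \<omega>)\<^sup>2) / (real n)\<^sup>2 \<le> real n * (B4 * r\<^sup>2) / (real n)\<^sup>2"
      by (intro divide_right_mono) auto
    then show "expectation (\<lambda>\<omega>. (usum (unit_vec j) v n \<omega> / real n)\<^sup>2) \<le> B4 * r\<^sup>2 / real n"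
      unfolding power_divide using n by (simp add: power2_eq_square)
  qed
  also have "(\<Sum>j\<in>S. B4 * r\<^sup>2 / real n) \<le> real s * (B4 * r\<^sup>2 / real n)"
    using S(2) B4_pos by (simp add: mult_right_mono divide_right_mono)
  finally have E: "expectation ?f \<le> real s * (B4 * r\<^sup>2 / real n)" .
  have "prob {\<omega> \<in> space M. ?f \<omega> \<ge> ?m} \<le> expectation ?f / ?m"
    by (rule integral_Markov_inequality_measure[where A = "{}", OF int]) (use m in \<open>auto intro!: sum_nonneg\<close>)
  also have "\<dots> \<le> real s * (B4 * r\<^sup>2 / real n) / ?m" using E m by (intro divide_right_mono) auto
  also have "real s * (B4 * r\<^sup>2 / real n) / ?m = \<epsilon>" using m n s B4_pos r \<epsilon> by (simp add: field_simps)
  finally show ?thesis .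
qed

end

text \<open>Hoeffding decomposition of a_j about v, the mean of x*r. The linear part of the double
  sum is 2*v*U/n and combines with 2*t*U/n into 2*\<theta>*U/n, so the pilot value t cancels from
  the coefficient; the constants add up to (t + v)^2.\<close>

lemma centred_double_sum:
  fixes x r :: "nat \<Rightarrow> real"
  assumes n: "n \<ge> 2" and u: "\<And>k. k < n \<Longrightarrow> u k = x k * r k - v" and \<theta>: "\<theta> = t + v"
  shows "t\<^sup>2 + 2 * t / real n * (\<Sum>k<n. x k * r k)
      + 1 / (real n * (real n - 1)) * (\<Sum>k<n. \<Sum>l\<in>{..<n} - {k}. x k * x l * r k * r l)
    = \<theta>\<^sup>2 + (2 * \<theta> / real n * (\<Sum>k<n. u k) + 1 / (real n * (real n - 1)) * (\<Sum>k<n. \<Sum>l\<in>{..<n} - {k}. u k * u l))"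
proof -
  define U W where "U = (\<Sum>k<n. u k)" and "W = (\<Sum>k<n. \<Sum>l\<in>{..<n} - {k}. u k * u l)"
  have n0: "real n > 0" "real n - 1 > 0" using n by auto
  have xr: "(\<Sum>k<n. x k * r k) = U + real n * v"
  proof -
    have "(\<Sum>k<n. x k * r k) = (\<Sum>k<n. u k + v)" using u by (intro sum.cong) auto
    then show ?thesis unfolding U_def by (simp add: sum.distrib)
  qed
  have "(\<Sum>k<n. \<Sum>l\<in>{..<n} - {k}. x k * x l * r k * r l) = (\<Sum>k<n. \<Sum>l\<in>{..<n} - {k}. u k * u l + v * u k + v * u l + v\<^sup>2)"
  proof (intro sum.cong refl)
    fix k l assume "k \<in> {..<n}" "l \<in> {..<n} - {k}"
    then have kl: "x k * r k = u k + v" "x l * r l = u l + v" using u by auto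
    have "x k * x l * r k * r l = (x k * r k) * (x l * r l)" by simp
    also have "\<dots> = u k * u l + v * u k + v * u l + v\<^sup>2" unfolding kl by (simp add: algebra_simps power2_eq_square)
    finally show "x k * x l * r k * r l = u k * u l + v * u k + v * u l + v\<^sup>2" .
  qed
  also have "\<dots> = (\<Sum>k<n. (\<Sum>l\<in>{..<n} - {k}. u k * u l) + (real n - 2) * v * u k + v * U + (real n - 1) * v\<^sup>2)"
  proof (intro sum.cong refl)
    fix k assume k: "k \<in> {..<n}"
    have 1: "(\<Sum>l\<in>{..<n} - {k}. v * u l) = v * (U - u k)"
      unfolding U_def using k by (simp add: sum_distrib_left[symmetric] sum_diff1)
    have 2: "real (card ({..<n} - {k})) = real n - 1" using k n by simp
    show "(\<Sum>l\<in>{..<n} - {k}. u k * u l + v * u k + v * u l + v\<^sup>2)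
        = (\<Sum>l\<in>{..<n} - {k}. u k * u l) + (real n - 2) * v * u k + v * U + (real n - 1) * v\<^sup>2"
      unfolding sum.distrib sum_constant 1 2 by (simp add: algebra_simps)
  qed
  also have "\<dots> = W + (real n - 2) * v * U + real n * (v * U) + real n * ((real n - 1) * v\<^sup>2)"
    unfolding sum.distrib W_def U_def sum_distrib_left[symmetric] by simp
  also have "\<dots> = W + 2 * ((real n - 1) * (v * U)) + real n * (real n - 1) * v\<^sup>2"
    by (simp add: algebra_simps)
  finally have dbl: "(\<Sum>k<n. \<Sum>l\<in>{..<n} - {k}. x k * x l * r k * r l) = W + 2 * ((real n - 1) * (v * U)) + real n * (real n - 1) * v\<^sup>2" .
  show ?thesis
    unfolding dbl xr \<theta> U_def[symmetric] W_def[symmetric] using n0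
    by (simp add: field_simps power2_eq_square)
qed

section \<open>The thresholded estimator\<close>

text \<open>The statistics as functions of one block and of a value of the pilot, so that either
  argument can be frozen when conditioning.\<close>

definition debias :: "nat \<Rightarrow> nat \<Rightarrow> mtx \<times> vec \<Rightarrow> vec \<Rightarrow> nat \<Rightarrow> real" where
  "debias n p y t j = t j + (\<Sum>k<n. fst y (k, j) * resid p y t k) / real n"

definition a_block :: "nat \<Rightarrow> nat \<Rightarrow> mtx \<times> vec \<Rightarrow> vec \<Rightarrow> nat \<Rightarrow> real" where
  "a_block n p w t j = (t j)\<^sup>2 + 2 * t j / real n * (\<Sum>k<n. fst w (k, j) * resid p w t k)
     + 1 / (real n * (real n - 1)) *
       (\<Sum>k<n. \<Sum>l\<in>{..<n} - {k}. fst w (k, j) * fst w (l, j) * resid p w t k * resid p w t l)"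

definition resid_scale :: "nat \<Rightarrow> nat \<Rightarrow> mtx \<times> vec \<Rightarrow> vec \<Rightarrow> real" where
  "resid_scale n p x t = L2_set (resid p x t) {..<n} / sqrt (real n)"

definition selected :: "nat \<Rightarrow> nat \<Rightarrow> nat \<Rightarrow> real \<Rightarrow> (mtx \<times> vec \<Rightarrow> vec) \<Rightarrow> mtx \<times> vec \<Rightarrow> mtx \<times> vec \<Rightarrow> nat \<Rightarrow> bool" where
  "selected n p s \<alpha> th x y j \<longleftrightarrow> \<bar>debias n p y (th x) j\<bar>
     > \<alpha> * resid_scale n p x (th x) * sqrt (2 * ln (1 + real p / (real s)\<^sup>2) / real n)"

lemma Q_HD_blocks:
  "Q_HD n p s \<alpha> th D = (\<Sum>j<p. a_block n p (subsample n p 1 D) (th (subsample n p 0 D)) j *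
     of_bool (selected n p s \<alpha> th (subsample n p 0 D) (subsample n p 2 D) j))"
  unfolding Q_HD_def a_stat_def theta_debiased_def sigma_srs_def theta_srs_def a_block_def selected_def debias_def
    resid_scale_def Let_def ..

section \<open>Measurability of the block statistics\<close>

lemma resid_measurable [measurable (raw)]:
  assumes f: "f \<in> M \<rightarrow>\<^sub>M sample_space n p" and t: "\<And>j. j < p \<Longrightarrow> (\<lambda>\<omega>. t \<omega> j) \<in> borel_measurable M" and k: "k < n"
  shows "(\<lambda>\<omega>. resid p (f \<omega>) (t \<omega>) k) \<in> borel_measurable M"
  unfolding resid_def
  by (intro borel_measurable_diff borel_measurable_sum borel_measurable_times t
      measurable_compose[OF f fst_sample_measurable] measurable_compose[OF f snd_sample_measurable]) (use k in auto)

lemma debias_measurable: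
  assumes f: "f \<in> M \<rightarrow>\<^sub>M sample_space n p" and t: "\<And>j. j < p \<Longrightarrow> (\<lambda>\<omega>. t \<omega> j) \<in> borel_measurable M" and j: "j < p"
  shows "(\<lambda>\<omega>. debias n p (f \<omega>) (t \<omega>) j) \<in> borel_measurable M"
  unfolding debias_def
  by (intro borel_measurable_add borel_measurable_divide borel_measurable_sum borel_measurable_times t
      resid_measurable[OF f] measurable_compose[OF f fst_sample_measurable] borel_measurable_const) (use j in auto)

lemma a_block_measurable:
  assumes f: "f \<in> M \<rightarrow>\<^sub>M sample_space n p" and t: "\<And>j. j < p \<Longrightarrow> (\<lambda>\<omega>. t \<omega> j) \<in> borel_measurable M" and j: "j < p"
  shows "(\<lambda>\<omega>. a_block n p (f \<omega>) (t \<omega>) j) \<in> borel_measurable M"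
  unfolding a_block_def
  by (intro borel_measurable_add borel_measurable_divide borel_measurable_sum borel_measurable_times borel_measurable_power t
      resid_measurable[OF f] measurable_compose[OF f fst_sample_measurable] borel_measurable_const) (use j in auto)

lemma resid_scale_measurable:
  assumes f: "f \<in> M \<rightarrow>\<^sub>M sample_space n p" and t: "\<And>j. j < p \<Longrightarrow> (\<lambda>\<omega>. t \<omega> j) \<in> borel_measurable M"
  shows "(\<lambda>\<omega>. resid_scale n p (f \<omega>) (t \<omega>)) \<in> borel_measurable M"
proof -
  have "(\<lambda>\<omega>. \<Sum>k<n. (resid p (f \<omega>) (t \<omega>) k)\<^sup>2) \<in> borel_measurable M"
    by (intro borel_measurable_sum borel_measurable_power resid_measurable[OF f] t) auto
  then show ?thesis unfolding resid_scale_def L2_set_def by measurable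
qed

lemma th_component_measurable:
  assumes "th \<in> N \<rightarrow>\<^sub>M vec_space p" "f \<in> M \<rightarrow>\<^sub>M N" "j < p"
  shows "(\<lambda>\<omega>. th (f \<omega>) j) \<in> borel_measurable M"
  by (rule measurable_compose[OF measurable_compose[OF assms(2,1)] vec_component_measurable[OF assms(3)]])

lemma selected_measurable:
  assumes th: "th \<in> sample_space n p \<rightarrow>\<^sub>M vec_space p" and f: "f \<in> M \<rightarrow>\<^sub>M sample_space n p" and g: "g \<in> M \<rightarrow>\<^sub>M sample_space n p"
    and j: "j < p"
  shows "Measurable.pred M (\<lambda>\<omega>. selected n p s \<alpha> th (f \<omega>) (g \<omega>) j)"
proof -
  have [measurable]: "(\<lambda>\<omega>. debias n p (g \<omega>) (th (f \<omega>)) j) \<in> borel_measurable M"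
    by (rule debias_measurable[OF g th_component_measurable[OF th f] j])
  have [measurable]: "(\<lambda>\<omega>. resid_scale n p (f \<omega>) (th (f \<omega>))) \<in> borel_measurable M"
    by (rule resid_scale_measurable[OF f th_component_measurable[OF th f]])
  show ?thesis unfolding selected_def by measurable
qed

lemma of_bool_measurable:
  assumes "Measurable.pred M Q"
  shows "(\<lambda>\<omega>. of_bool (Q \<omega>) :: real) \<in> borel_measurable M"
  unfolding of_bool_def using assms by measurable

section \<open>The block statistics in terms of centred products\<close>

lemma block_uprod:
  assumes A: "subg_array R n (Suc p) K (block_entry n p b)" and b: "b < 3" and k: "k < n" and j: "j < p"
  shows "subg_array.uprod (Suc p) (block_entry n p b) (\<lambda>i. of_bool (i = j)) (pilot_err p \<theta> \<sigma> t) k \<omega>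
    = fst (block_obs n p \<theta> \<sigma> b \<omega>) (k, j) * resid p (block_obs n p \<theta> \<sigma> b \<omega>) t k - (\<theta> j - t j)"
proof -
  interpret A: subg_array R n "Suc p" K "block_entry n p b" by (rule A)
  have "A.lin (pilot_err p \<theta> \<sigma> t) k \<omega> = resid p (block_obs n p \<theta> \<sigma> b \<omega>) t k"
    unfolding A.lin_eq block_resid[OF b k] by (intro sum.cong) auto
  then show ?thesis
    unfolding A.uprod_eq using j by (simp add: A.lin_unit A.dot_unit block_obs_fst[OF b k j] pilot_err_def)
qed

lemma debias_block:
  assumes A: "subg_array R n (Suc p) K (block_entry n p b)" and b: "b < 3" and n: "n \<ge> 1" and j: "j < p"
  shows "debias n p (block_obs n p \<theta> \<sigma> b \<omega>) t j
    = \<theta> j + subg_array.usum (Suc p) (block_entry n p b) (\<lambda>i. of_bool (i = j)) (pilot_err p \<theta> \<sigma> t) n \<omega> / real n"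
proof -
  interpret A: subg_array R n "Suc p" K "block_entry n p b" by (rule A)
  have "A.usum (\<lambda>i. of_bool (i = j)) (pilot_err p \<theta> \<sigma> t) n \<omega>
      = (\<Sum>k<n. fst (block_obs n p \<theta> \<sigma> b \<omega>) (k, j) * resid p (block_obs n p \<theta> \<sigma> b \<omega>) t k - (\<theta> j - t j))"
    unfolding A.usum_def using block_uprod[OF A b _ j] by (intro sum.cong) auto
  also have "\<dots> = (\<Sum>k<n. fst (block_obs n p \<theta> \<sigma> b \<omega>) (k, j) * resid p (block_obs n p \<theta> \<sigma> b \<omega>) t k) - real n * (\<theta> j - t j)"
    by (simp only: sum_subtractf sum_constant card_lessThan right_diff_distrib)
  finally show ?thesis unfolding debias_def using n by (simp add: field_simps)
qed

lemma a_block_error: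
  fixes \<theta> t :: vec and \<sigma> :: real
  assumes A: "subg_array R n (Suc p) K (block_entry n p b)" and b: "b < 3" and n: "n \<ge> 2" and j: "j < p"
  defines "u \<equiv> subg_array.uprod (Suc p) (block_entry n p b) (\<lambda>i. of_bool (i = j)) (pilot_err p \<theta> \<sigma> t)"
  shows "a_block n p (block_obs n p \<theta> \<sigma> b \<omega>) t j - (\<theta> j)\<^sup>2
    = 2 * \<theta> j / real n * subg_array.usum (Suc p) (block_entry n p b) (\<lambda>i. of_bool (i = j)) (pilot_err p \<theta> \<sigma> t) n \<omega>
      + 1 / (real n * (real n - 1)) * (\<Sum>k<n. \<Sum>l\<in>{..<n} - {k}. u k \<omega> * u l \<omega>)"
proof -
  interpret A: subg_array R n "Suc p" K "block_entry n p b" by (rule A)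
  let ?x = "\<lambda>k. fst (block_obs n p \<theta> \<sigma> b \<omega>) (k, j)" and ?r = "resid p (block_obs n p \<theta> \<sigma> b \<omega>) t"
  have u: "u k \<omega> = ?x k * ?r k - (\<theta> j - t j)" if "k < n" for k
    unfolding u_def by (rule block_uprod[OF A b that j])
  have us: "A.usum (\<lambda>i. of_bool (i = j)) (pilot_err p \<theta> \<sigma> t) n \<omega> = (\<Sum>k<n. u k \<omega>)"
    unfolding A.usum_def u_def ..
  have "\<theta> j = t j + (\<theta> j - t j)" by simp
  from centred_double_sum[of n "\<lambda>k. u k \<omega>" ?x ?r "\<theta> j - t j", OF n u this]
  show ?thesis unfolding a_block_def us by simp
qed

text \<open>Twice 6 * \<open>noise_bound\<close> times the tail constant: the 6 comes from the pilot
  error bound, the 2 compensates for an estimated noise level that may be as small as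
  \<sigma>/2.\<close>

definition selection_const :: "real \<Rightarrow> real" where
  "selection_const K = 12 * noise_bound K * (16 * K\<^sup>2 * (Csq + 1))"

text \<open>Coefficients collected in \<open>total_error_le\<close>: 72 from the linear term, 2160 =
  1728 + 432 from the U-statistic and from the noise on the support, 384 from the threshold.\<close>

definition Q_const :: "real \<Rightarrow> real \<Rightarrow> real" where
  "Q_const K \<epsilon> = (let B = 128 * K ^ 4 * Csq; a = noise_bound K in
     72 * a * sqrt (B / \<epsilon>) + 2160 * B * a\<^sup>2 / \<epsilon> + 384 * (selection_const K)\<^sup>2 * a\<^sup>2)"

text \<open>With u = sqrt p / s, the inequality 1 + u^2 <= (1 + u)^2 compares the two logarithms up
  to a factor 2; a further factor 3 comes from N = 3*n.\<close>

lemma rate_bounds: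
  assumes n: "n \<ge> 1" and s: "1 \<le> s" "real s \<le> sqrt (real p)"
  defines "\<psi> \<equiv> real s * ln (1 + sqrt (real p) / real s) / real (3 * n)"
  shows "real s * ln (1 + real p / (real s)\<^sup>2) / real n \<le> 6 * \<psi>" "real s / real n \<le> 6 * \<psi>" "1 / real n \<le> 6 * \<psi>"
    "1 / sqrt (real n) \<le> 2 / sqrt (real (3 * n))" "\<psi> > 0"
proof -
  let ?u = "sqrt (real p) / real s"
  have u: "?u \<ge> 1" using s by (simp add: field_simps)
  have "1 + real p / (real s)\<^sup>2 \<le> (1 + ?u)\<^sup>2"
  proof -
    have "?u\<^sup>2 = real p / (real s)\<^sup>2" by (simp add: power_divide)
    then show ?thesis using u by (simp add: power2_sum)
  qed
  moreover have "0 < 1 + real p / (real s)\<^sup>2" by (intro add_pos_nonneg) auto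
  ultimately have "ln (1 + real p / (real s)\<^sup>2) \<le> ln ((1 + ?u)\<^sup>2)" by (intro ln_mono)
  also have "\<dots> = 2 * ln (1 + ?u)" using u by (simp add: ln_realpow)
  finally have "real s * ln (1 + real p / (real s)\<^sup>2) / real n \<le> real s * (2 * ln (1 + ?u)) / real n"
    by (intro divide_right_mono mult_left_mono) auto
  also have "\<dots> = 6 * \<psi>" unfolding \<psi>_def using n by (simp add: field_simps)
  finally show "real s * ln (1 + real p / (real s)\<^sup>2) / real n \<le> 6 * \<psi>" .
  have "ln 2 \<le> ln (1 + ?u)" using u by (intro ln_mono) auto
  then have l: "1/2 \<le> ln (1 + ?u)" using ln2_ge_two_thirds by linarith
  have "real s / real n = 6 * (real s * (1/2) / real (3 * n))" using n by (simp add: field_simps)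
  also have "\<dots> \<le> 6 * \<psi>" unfolding \<psi>_def using l by (intro mult_left_mono divide_right_mono) auto
  finally show 2: "real s / real n \<le> 6 * \<psi>" .
  have "1 / real n \<le> real s / real n" using s by (intro divide_right_mono) auto
  then show "1 / real n \<le> 6 * \<psi>" using 2 by linarith
  moreover have "1 / real n > 0" using n by simp
  ultimately show "\<psi> > 0" by linarith
  have "sqrt (real (3 * n)) \<le> sqrt (4 * real n)" by (intro real_sqrt_le_mono) simp
  also have "\<dots> = 2 * sqrt (real n)" unfolding real_sqrt_mult by simp
  finally show "1 / sqrt (real n) \<le> 2 / sqrt (real (3 * n))" using n by (simp add: field_simps)
qed

text \<open>The deterministic part. A false selection carries no bias, as \<theta> vanishes there. A
  missed coordinate of the support has \<theta>^2 at most 2*\<tau>^2 plus twice its squared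
  noise.\<close>

lemma thresholding_error:
  fixes \<theta> a d :: "nat \<Rightarrow> real"
  assumes S: "S \<subseteq> {..<p}" "card S \<le> s" and \<theta>: "\<And>j. j < p \<Longrightarrow> j \<notin> S \<Longrightarrow> \<theta> j = 0"
    and sel: "\<And>j. sel j \<longleftrightarrow> \<bar>d j\<bar> > \<tau>" and "\<tau> \<ge> 0"
    and noise: "(\<Sum>j\<in>S. (d j - \<theta> j)\<^sup>2) \<le> b"
    and c: "\<bar>\<Sum>j<p. (a j - (\<theta> j)\<^sup>2) * of_bool (sel j)\<bar> \<le> c"
  shows "\<bar>(\<Sum>j<p. a j * of_bool (sel j)) - (\<Sum>j<p. (\<theta> j)\<^sup>2)\<bar> \<le> c + 2 * real s * \<tau>\<^sup>2 + 2 * b"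
proof -
  have miss: "(\<Sum>j<p. (\<theta> j)\<^sup>2 * of_bool (\<not> sel j)) \<le> 2 * real s * \<tau>\<^sup>2 + 2 * b"
  proof -
    have "(\<Sum>j<p. (\<theta> j)\<^sup>2 * of_bool (\<not> sel j)) = (\<Sum>j\<in>S. (\<theta> j)\<^sup>2 * of_bool (\<not> sel j))"
      using S \<theta> by (intro sum.mono_neutral_right) auto
    also have "\<dots> \<le> (\<Sum>j\<in>S. 2 * \<tau>\<^sup>2 + 2 * (d j - \<theta> j)\<^sup>2)"
    proof (rule sum_mono)
      fix j
      show "(\<theta> j)\<^sup>2 * of_bool (\<not> sel j) \<le> 2 * \<tau>\<^sup>2 + 2 * (d j - \<theta> j)\<^sup>2"
      proof (cases "sel j")
        case False
        then have "\<bar>d j\<bar> \<le> \<tau>" using sel by simp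
        then have "(d j)\<^sup>2 \<le> \<tau>\<^sup>2" by (simp add: abs_le_square_iff[symmetric] \<open>\<tau> \<ge> 0\<close>)
        moreover have "0 \<le> (2 * d j - \<theta> j)\<^sup>2" by simp
        then have "(\<theta> j)\<^sup>2 \<le> 2 * (d j)\<^sup>2 + 2 * (d j - \<theta> j)\<^sup>2" by (simp add: power2_eq_square algebra_simps)
        ultimately show ?thesis using False by simp
      qed simp
    qed
    also have "\<dots> = real (card S) * (2 * \<tau>\<^sup>2) + 2 * (\<Sum>j\<in>S. (d j - \<theta> j)\<^sup>2)"
      by (simp add: sum.distrib sum_distrib_left)
    also have "\<dots> \<le> real s * (2 * \<tau>\<^sup>2) + 2 * b" using S(2) noise by (intro add_mono mult_right_mono) auto
    finally show ?thesis by simp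
  qed
  have "(\<Sum>j<p. a j * of_bool (sel j)) - (\<Sum>j<p. (\<theta> j)\<^sup>2)
      = (\<Sum>j<p. (a j - (\<theta> j)\<^sup>2) * of_bool (sel j)) - (\<Sum>j<p. (\<theta> j)\<^sup>2 * of_bool (\<not> sel j))"
    unfolding sum_subtractf[symmetric] by (intro sum.cong) (auto simp: of_bool_def)
  moreover have "0 \<le> (\<Sum>j<p. (\<theta> j)\<^sup>2 * of_bool (\<not> sel j))" by (intro sum_nonneg) auto
  ultimately show ?thesis using c miss by linarith
qed

text \<open>T exceeds the norm l by \<sigma>/sqrt n in order to stay positive at \<theta> = 0. The
  excess contributes a term of order \<sigma>^2/n, which is below the rate \<sigma>^2*\<psi> up to a
  constant.\<close>

lemma total_error_le:
  fixes \<sigma> l sg B :: real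
  assumes n: "n \<ge> 1" and s: "1 \<le> s" "real s \<le> sqrt (real p)" and \<sigma>: "\<sigma> > 0" and l: "l \<ge> 0" and \<epsilon>: "0 < \<epsilon>" "\<epsilon> < 1"
    and K: "K > 0" and sg: "0 \<le> sg" "sg \<le> 4 * noise_bound K * \<sigma>"
  defines "\<psi> \<equiv> real s * ln (1 + sqrt (real p) / real s) / real (3 * n)"
    and "r \<equiv> 6 * noise_bound K * \<sigma>" and "B \<equiv> 128 * K ^ 4 * Csq" and "T \<equiv> l + \<sigma> / sqrt (real n)"
    and "\<tau> \<equiv> selection_const K * sg * sqrt (2 * ln (1 + real p / (real s)\<^sup>2) / real n)"
  shows "2 / sqrt (real n) * sqrt (B / \<epsilon>) * r * T + 4 / real n * B * r\<^sup>2 * sqrt (3 * (real s)\<^sup>2 / \<epsilon> / \<epsilon>)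
      + 2 * real s * \<tau>\<^sup>2 + 2 * (real s * B * r\<^sup>2 / (real n * \<epsilon>))
    \<le> Q_const K \<epsilon> * (\<sigma>\<^sup>2 * \<psi> + \<sigma> * l / sqrt (real (3 * n)))"
proof -
  note rb = rate_bounds[OF n s, folded \<psi>_def]
  define a q al x where "a = noise_bound K" and "q = sqrt (B / \<epsilon>)" and "al = selection_const K" and "x = ln (1 + real p / (real s)\<^sup>2)"
  have a: "a \<ge> 1" unfolding a_def by (rule pilot_constants(1)[OF K])
  have B: "B > 0" unfolding B_def using K Csq_gt by simp
  have q: "q \<ge> 0" unfolding q_def using B \<epsilon> by simp
  have x: "x \<ge> 0" unfolding x_def by (rule ln_ge_zero) simp
  define e where "e = \<sigma> * l / sqrt (real (3 * n))"
  have e0: "e \<ge> 0" unfolding e_def using \<sigma> l by simp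
  have n0: "real n > 0" using n by simp
  have t1: "2 / sqrt (real n) * q * r * l \<le> 24 * a * q * e"
  proof -
    have "2 / sqrt (real n) * q * r * l = (12 * a * q * \<sigma> * l) * (1 / sqrt (real n))" unfolding r_def a_def by simp
    also have "\<dots> \<le> (12 * a * q * \<sigma> * l) * (2 / sqrt (real (3 * n)))" using rb(4) a q \<sigma> l by (intro mult_left_mono) auto
    also have "\<dots> = 24 * a * q * e" unfolding e_def by simp
    finally show ?thesis .
  qed
  have t2: "2 / sqrt (real n) * q * r * (\<sigma> / sqrt (real n)) \<le> 72 * a * q * (\<sigma>\<^sup>2 * \<psi>)"
  proof -
    have "2 / sqrt (real n) * q * r * (\<sigma> / sqrt (real n)) = (12 * a * q * \<sigma>\<^sup>2) * (1 / (sqrt (real n) * sqrt (real n)))"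
      unfolding r_def a_def power2_eq_square by simp
    also have "sqrt (real n) * sqrt (real n) = real n" by simp
    also have "(12 * a * q * \<sigma>\<^sup>2) * (1 / real n) \<le> (12 * a * q * \<sigma>\<^sup>2) * (6 * \<psi>)" using rb(3) a q by (intro mult_left_mono) auto
    finally show ?thesis by simp
  qed
  have t3: "4 / real n * B * r\<^sup>2 * sqrt (3 * (real s)\<^sup>2 / \<epsilon> / \<epsilon>) \<le> 1728 * B * a\<^sup>2 / \<epsilon> * (\<sigma>\<^sup>2 * \<psi>)"
  proof -
    have "3 * (real s)\<^sup>2 / \<epsilon> / \<epsilon> \<le> (2 * real s / \<epsilon>)\<^sup>2" using \<epsilon> by (simp add: power2_eq_square divide_right_mono)
    then have "sqrt (3 * (real s)\<^sup>2 / \<epsilon> / \<epsilon>) \<le> sqrt ((2 * real s / \<epsilon>)\<^sup>2)" by (rule real_sqrt_le_mono)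
    also have "\<dots> = 2 * real s / \<epsilon>" using \<epsilon> by simp
    finally have "4 / real n * B * r\<^sup>2 * sqrt (3 * (real s)\<^sup>2 / \<epsilon> / \<epsilon>) \<le> 4 / real n * B * r\<^sup>2 * (2 * real s / \<epsilon>)"
      using B by (intro mult_left_mono) auto
    also have "\<dots> = 288 * B * a\<^sup>2 / \<epsilon> * \<sigma>\<^sup>2 * (real s / real n)" unfolding r_def a_def by (simp add: power_mult_distrib field_simps)
    also have "\<dots> \<le> 288 * B * a\<^sup>2 / \<epsilon> * \<sigma>\<^sup>2 * (6 * \<psi>)" using rb(2) B \<epsilon> by (intro mult_left_mono) auto
    finally show ?thesis by simp
  qed
  have t4: "2 * real s * \<tau>\<^sup>2 \<le> 384 * al\<^sup>2 * a\<^sup>2 * (\<sigma>\<^sup>2 * \<psi>)"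
  proof -
    have "\<tau>\<^sup>2 = al\<^sup>2 * sg\<^sup>2 * (2 * x / real n)" unfolding \<tau>_def al_def[symmetric] x_def[symmetric] using x by (simp add: power_mult_distrib)
    also have "\<dots> \<le> al\<^sup>2 * (4 * a * \<sigma>)\<^sup>2 * (2 * x / real n)"
      using sg x unfolding a_def by (intro mult_right_mono mult_left_mono power_mono) auto
    finally have "2 * real s * \<tau>\<^sup>2 \<le> 2 * real s * (al\<^sup>2 * (4 * a * \<sigma>)\<^sup>2 * (2 * x / real n))" by (intro mult_left_mono) auto
    also have "\<dots> = 64 * al\<^sup>2 * a\<^sup>2 * \<sigma>\<^sup>2 * (real s * x / real n)" by (simp add: power_mult_distrib)
    also have "\<dots> \<le> 64 * al\<^sup>2 * a\<^sup>2 * \<sigma>\<^sup>2 * (6 * \<psi>)" using rb(1) unfolding x_def by (intro mult_left_mono) auto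
    finally show ?thesis by simp
  qed
  have t5: "2 * (real s * B * r\<^sup>2 / (real n * \<epsilon>)) \<le> 432 * B * a\<^sup>2 / \<epsilon> * (\<sigma>\<^sup>2 * \<psi>)"
  proof -
    have "2 * (real s * B * r\<^sup>2 / (real n * \<epsilon>)) = 72 * B * a\<^sup>2 / \<epsilon> * \<sigma>\<^sup>2 * (real s / real n)"
      unfolding r_def a_def by (simp add: power_mult_distrib field_simps)
    also have "\<dots> \<le> 72 * B * a\<^sup>2 / \<epsilon> * \<sigma>\<^sup>2 * (6 * \<psi>)" using rb(2) B \<epsilon> by (intro mult_left_mono) auto
    finally show ?thesis by simp
  qed
  have Q: "Q_const K \<epsilon> = 72 * a * q + 2160 * B * a\<^sup>2 / \<epsilon> + 384 * al\<^sup>2 * a\<^sup>2"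
    unfolding Q_const_def Let_def a_def q_def al_def B_def ..
  define U where "U = B * a\<^sup>2 / \<epsilon>"
  have U: "1728 * B * a\<^sup>2 / \<epsilon> = 1728 * U" "432 * B * a\<^sup>2 / \<epsilon> = 432 * U" "2160 * B * a\<^sup>2 / \<epsilon> = 2160 * U"
    unfolding U_def by simp_all
  have pos: "0 \<le> 48 * a * q * e" "0 \<le> 2160 * U * e" "0 \<le> 384 * al\<^sup>2 * a\<^sup>2 * e"
    using a q e0 B \<epsilon> unfolding U_def by auto
  have sp: "2 / sqrt (real n) * q * r * T = 2 / sqrt (real n) * q * r * l + 2 / sqrt (real n) * q * r * (\<sigma> / sqrt (real n))"
    unfolding T_def by (rule distrib_left)
  have "2 / sqrt (real n) * q * r * T + 4 / real n * B * r\<^sup>2 * sqrt (3 * (real s)\<^sup>2 / \<epsilon> / \<epsilon>)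
      + 2 * real s * \<tau>\<^sup>2 + 2 * (real s * B * r\<^sup>2 / (real n * \<epsilon>))
    \<le> 24 * a * q * e + 72 * a * q * (\<sigma>\<^sup>2 * \<psi>) + 1728 * B * a\<^sup>2 / \<epsilon> * (\<sigma>\<^sup>2 * \<psi>) + 384 * al\<^sup>2 * a\<^sup>2 * (\<sigma>\<^sup>2 * \<psi>)
      + 432 * B * a\<^sup>2 / \<epsilon> * (\<sigma>\<^sup>2 * \<psi>)"
    using t1 t2 t3 t4 t5 sp by linarith
  also have "\<dots> \<le> Q_const K \<epsilon> * (\<sigma>\<^sup>2 * \<psi> + e)"
    unfolding Q U using pos by (simp add: algebra_simps)
  finally show ?thesis unfolding q_def e_def .
qed

text \<open>All that the later steps use about the value of a pilot, so that the Slope and the Lasso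
  pilot share one analysis. The error norm includes the noise coordinate.\<close>

definition good_pilot :: "nat \<Rightarrow> nat \<Rightarrow> real \<Rightarrow> vec \<Rightarrow> real \<Rightarrow> mtx \<times> vec \<Rightarrow> vec \<Rightarrow> bool" where
  "good_pilot n p K \<theta> \<sigma> x t \<longleftrightarrow>
     dot (Suc p) (pilot_err p \<theta> \<sigma> t) (pilot_err p \<theta> \<sigma> t) \<le> (6 * noise_bound K * \<sigma>)\<^sup>2 \<and>
     \<sigma> / 2 \<le> resid_scale n p x t \<and> resid_scale n p x t \<le> 4 * noise_bound K * \<sigma>"

text \<open>Independence of the blocks is stated for families indexed by block numbers, whereas
  conditioning uses the pair of blocks 0 and 2 against block 1; the maps f and g translate.\<close>

lemma (in prob_space) indep_section_bound_compose:
  assumes ind: "indep_var S X T Y" and [measurable]: "f \<in> S \<rightarrow>\<^sub>M S'" "g \<in> T \<rightarrow>\<^sub>M T'"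
    and [measurable]: "A \<in> sets (S' \<Otimes>\<^sub>M T')" "G \<in> sets S'" and "\<epsilon> \<ge> 0"
    and le: "\<And>x. x \<in> G \<Longrightarrow> prob {\<omega> \<in> space M. (x, g (Y \<omega>)) \<in> A} \<le> \<epsilon>"
  shows "prob {\<omega> \<in> space M. f (X \<omega>) \<in> G \<and> (f (X \<omega>), g (Y \<omega>)) \<in> A} \<le> \<epsilon>"
proof -
  have X: "X \<in> M \<rightarrow>\<^sub>M S" and Y: "Y \<in> M \<rightarrow>\<^sub>M T" using indep_var_rv1[OF ind] indep_var_rv2[OF ind] by auto
  let ?A = "{z \<in> space (S \<Otimes>\<^sub>M T). (f (fst z), g (snd z)) \<in> A}" and ?G = "{x \<in> space S. f x \<in> G}"
  have "prob {\<omega> \<in> space M. X \<omega> \<in> ?G \<and> (X \<omega>, Y \<omega>) \<in> ?A} \<le> \<epsilon>"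
  proof (rule indep_section_bound[OF ind _ _ \<open>\<epsilon> \<ge> 0\<close>])
    show "?A \<in> sets (S \<Otimes>\<^sub>M T)" "?G \<in> sets S" by measurable
    fix x assume x: "x \<in> ?G"
    then have "{\<omega> \<in> space M. (x, Y \<omega>) \<in> ?A} = {\<omega> \<in> space M. (f x, g (Y \<omega>)) \<in> A}"
      using measurable_space[OF Y] by (auto simp: space_pair_measure)
    then show "prob {\<omega> \<in> space M. (x, Y \<omega>) \<in> ?A} \<le> \<epsilon>" using le[of "f x"] x by simp
  qed
  moreover have "{\<omega> \<in> space M. X \<omega> \<in> ?G \<and> (X \<omega>, Y \<omega>) \<in> ?A} = {\<omega> \<in> space M. f (X \<omega>) \<in> G \<and> (f (X \<omega>), g (Y \<omega>)) \<in> A}"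
    using measurable_space[OF X] measurable_space[OF Y] by (auto simp: space_pair_measure)
  ultimately show ?thesis by simp
qed

text \<open>The failure probability 5*\<epsilon> consists of one \<epsilon> for the design of block
  0, two for block 2 (false selections, noise on the support) and two for block 1 (linear part,
  U-statistic).\<close>

lemma Q_HD_error_prob:
  assumes R: "model_law (3 * n) p R" and K: "K > 0" "L\<^sup>2 \<le> K\<^sup>2" "M\<^sup>2 \<le> K\<^sup>2"
    and \<xi>: "\<forall>i<3 * n. subgaussian R L (model_var (Inr i))"
    and X: "\<forall>i<3 * n. \<forall>j<p. subgaussian R M (model_var (Inl (i, j)))"
    and n: "n \<ge> 2" and s: "1 \<le> s" "real s \<le> sqrt (real p)"
    and k: "real s * ln (exp 1 * real p / real s) \<le> 3 * real n * \<kappa>0" "\<kappa>0 \<le> kappa_bar K"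
    and \<epsilon>: "0 < \<epsilon>" "\<epsilon> < 1" "ln (2 / \<epsilon>) \<le> re_step K * real n / 32" "ln (2 / \<epsilon>) \<le> real n"
    and th: "th \<in> sample_space n p \<rightarrow>\<^sub>M vec_space p" and \<theta>: "\<theta> \<in> B0 p s" and \<sigma>: "\<sigma> > 0"
    and pilot: "\<And>\<omega>. regular_design n (Suc p) K (\<lambda>k j. block_entry n p 0 (k, j) \<omega>) \<Longrightarrow>
      good_pilot n p K \<theta> \<sigma> (block_obs n p \<theta> \<sigma> 0 \<omega>) (th (block_obs n p \<theta> \<sigma> 0 \<omega>))"
  defines "\<psi> \<equiv> real s * ln (1 + sqrt (real p) / real s) / real (3 * n)"
  shows "\<exists>E\<in>sets R. measure R E \<ge> 1 - 5 * \<epsilon> \<and> (\<forall>\<omega>\<in>E. let D = observe (3 * n) p \<theta> \<sigma> \<omega> in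
      \<bar>Q_HD n p s (selection_const K) th D - (L2_set \<theta> {..<p})\<^sup>2\<bar>
        \<le> Q_const K \<epsilon> * (\<sigma>\<^sup>2 * \<psi> + \<sigma> * L2_set \<theta> {..<p} / sqrt (real (3 * n))) \<and>
      \<sigma> / 2 \<le> sigma_srs n p th D \<and> sigma_srs n p th D \<le> 4 * noise_bound K * \<sigma>)"
proof -
  interpret prob_space R using R unfolding model_law_def by blast
  note blk = subg_array_block[OF R K _ \<xi> X]
  interpret A0: subg_array R n "Suc p" K "block_entry n p 0" by (rule blk) simp
  interpret A1: subg_array R n "Suc p" K "block_entry n p 1" by (rule blk) simp
  interpret A2: subg_array R n "Suc p" K "block_entry n p 2" by (rule blk) simp
  let ?Sp = "sample_space n p" and ?B = "block_obs n p \<theta> \<sigma>" and ?al = "selection_const K"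
  let ?sel = "selected n p s ?al th" and ?v = "\<lambda>x. pilot_err p \<theta> \<sigma> (th x)"
  define r where "r = 6 * noise_bound K * \<sigma>"
  define B where "B = 128 * K ^ 4 * Csq"
  define lx where "lx = ln (1 + real p / (real s)\<^sup>2)"
  define T where "T = L2_set \<theta> {..<p} + \<sigma> / sqrt (real n)"
  \<comment> \<open>Markov level: the mean number of false selections is at most 2*s^2, because
    exp(-lx) = s^2/(s^2 + p).\<close>
  define m0 where "m0 = 2 * (real s)\<^sup>2 / \<epsilon>"
  define b2 where "b2 = real s * B * r\<^sup>2 / (real n * \<epsilon>)"
  define c3 where "c3 = 2 / sqrt (real n) * sqrt (B / \<epsilon>) * r * T + 4 / real n * B * r\<^sup>2 * sqrt (3 * (real s)\<^sup>2 / \<epsilon> / \<epsilon>)"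
  define S where "S = {j \<in> {..<p}. \<theta> j \<noteq> 0}"
  have S: "S \<subseteq> {..<p}" "card S \<le> s" "finite S" using \<theta> unfolding S_def B0_def by auto
  have \<theta>0: "\<theta> j = 0" if "j < p" "j \<notin> S" for j using that unfolding S_def by auto
  have a: "noise_bound K \<ge> 1" by (rule pilot_constants(1)[OF K(1)])
  have r: "r > 0" unfolding r_def using a \<sigma> by simp
  have B: "B > 0" unfolding B_def using K Csq_gt by simp
  have BA: "A1.B4 = B" "A2.B4 = B" unfolding A1.B4_def A2.B4_def B_def by auto
  have n1: "n \<ge> 1" "real n > 0" using n by auto
  have T: "T > 0" unfolding T_def using \<sigma> n1 by (intro add_nonneg_pos) auto
  have s0: "real s > 0" "(real s)\<^sup>2 \<ge> 1" using s(1) by auto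
  note lb = sparsity_log_bounds[OF s k(1)]
  have kb: "\<kappa>0 \<le> 1/100" using k(2) pilot_constants(4)[OF K(1)] by linarith
  have nk: "real n * \<kappa>0 \<le> real n / 100" using mult_left_mono[OF kb, of "real n"] by simp
  have lx: "0 \<le> lx" "lx \<le> real n"
  proof -
    show "0 \<le> lx" unfolding lx_def by (rule ln_ge_zero) simp
    show "lx \<le> real n" using lb(6) nk n1 unfolding lx_def by linarith
  qed
  have l2: "L2_set \<theta> {..<p} \<ge> 0" by (rule L2_set_nonneg)

  have ind: "indep_vars (\<lambda>_. ?Sp) ?B {..<3}" by (rule block_obs_indep[OF R])
  have Bm [measurable]: "?B b \<in> R \<rightarrow>\<^sub>M ?Sp" if "b < 3" for b
    using ind that unfolding indep_vars_def by auto
  have i02: "indep_var ?Sp (?B 0) ?Sp (?B 2)"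
  proof -
    have "indep_var (PiM {0} (\<lambda>_. ?Sp)) (\<lambda>\<omega>. \<lambda>b\<in>{0}. ?B b \<omega>) (PiM {2} (\<lambda>_. ?Sp)) (\<lambda>\<omega>. \<lambda>b\<in>{2}. ?B b \<omega>)"
      by (rule indep_var_restrict[OF ind]) auto
    then have "indep_var ?Sp ((\<lambda>f. f 0) \<circ> (\<lambda>\<omega>. \<lambda>b\<in>{0}. ?B b \<omega>)) ?Sp ((\<lambda>f. f 2) \<circ> (\<lambda>\<omega>. \<lambda>b\<in>{2}. ?B b \<omega>))"
      by (rule indep_var_compose) (rule measurable_component_singleton, simp)+
    then show ?thesis by (simp add: comp_def)
  qed
  have i021: "indep_var (PiM {0, 2} (\<lambda>_. ?Sp)) (\<lambda>\<omega>. \<lambda>b\<in>{0, 2}. ?B b \<omega>) (PiM {1} (\<lambda>_. ?Sp)) (\<lambda>\<omega>. \<lambda>b\<in>{1}. ?B b \<omega>)"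
    by (rule indep_var_restrict[OF ind]) auto
  have pr02: "(\<lambda>f. (f 0, f 2)) \<in> PiM {0, 2} (\<lambda>_. ?Sp) \<rightarrow>\<^sub>M ?Sp \<Otimes>\<^sub>M ?Sp"
    by (intro measurable_Pair measurable_component_singleton) auto
  have pr1: "(\<lambda>f. f 1) \<in> PiM {1} (\<lambda>_. ?Sp) \<rightarrow>\<^sub>M ?Sp" by (rule measurable_component_singleton) simp

  define G where "G = {x \<in> space ?Sp. good_pilot n p K \<theta> \<sigma> x (th x)}"
  have id: "(\<lambda>x. x) \<in> ?Sp \<rightarrow>\<^sub>M ?Sp" by simp
  have G: "G \<in> sets ?Sp"
  proof -
    have [measurable]: "(\<lambda>x. resid_scale n p x (th x)) \<in> borel_measurable ?Sp"
      by (rule resid_scale_measurable[OF id th_component_measurable[OF th id]])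
    have vm: "(\<lambda>x. ?v x j) \<in> borel_measurable ?Sp" for j
    proof (cases "j < p")
      case True
      then show ?thesis unfolding pilot_err_def
        using borel_measurable_diff[OF borel_measurable_const th_component_measurable[OF th id True], of "\<theta> j"] by simp
    qed (simp add: pilot_err_def)
    have [measurable]: "(\<lambda>x. dot (Suc p) (?v x) (?v x)) \<in> borel_measurable ?Sp"
      unfolding dot_def by (intro borel_measurable_sum borel_measurable_times vm)
    show ?thesis unfolding G_def good_pilot_def by measurable
  qed
  have p0: "prob {\<omega> \<in> space R. ?B 0 \<omega> \<notin> G} \<le> \<epsilon>"
  proof -
    have "real p \<ge> 1" using lb(1) by simp
    then have "real (Suc p) \<le> 2 * real p" by simp
    also have "\<dots> = exp (ln (2 * real p))" using \<open>real p \<ge> 1\<close> by simp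
    also have "\<dots> \<le> exp (real n)" unfolding exp_le_cancel_iff using lb(4) nk n1 by linarith
    finally have Pn: "real (Suc p) \<le> exp (real n)" .
    obtain E where E: "E \<in> sets R" "prob E \<ge> 1 - \<epsilon>"
      "\<And>\<omega>. \<omega> \<in> E \<Longrightarrow> regular_design n (Suc p) K (\<lambda>k j. block_entry n p 0 (k, j) \<omega>)"
      using A0.regular_design_prob[OF n1(1) _ Pn \<epsilon>] by auto
    have "prob {\<omega> \<in> space R. ?B 0 \<omega> \<notin> G} \<le> prob (space R - E)"
    proof (rule finite_measure_mono)
      show "{\<omega> \<in> space R. ?B 0 \<omega> \<notin> G} \<subseteq> space R - E"
        using pilot[OF E(3)] measurable_space[OF Bm[of 0]] unfolding G_def by auto
    qed (use E(1) in auto)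
    also have "\<dots> = 1 - prob E" by (rule prob_compl[OF E(1)])
    finally show ?thesis using E(2) by linarith
  qed

  \<comment> \<open>The bad pairs of blocks 0 and 2. For each first component frozen in G they have
    small probability over the second.\<close>
  define N2 where "N2 = {z \<in> space (?Sp \<Otimes>\<^sub>M ?Sp). (\<Sum>j\<in>{..<p} - S. of_bool (?sel (fst z) (snd z) j)) \<ge> m0 \<or>
    (\<Sum>j\<in>S. (debias n p (snd z) (th (fst z)) j - \<theta> j)\<^sup>2) \<ge> b2}"
  have N2: "N2 \<in> sets (?Sp \<Otimes>\<^sub>M ?Sp)"
  proof -
    have [measurable]: "(\<lambda>z. \<Sum>j\<in>{..<p} - S. of_bool (?sel (fst z) (snd z) j) :: real) \<in> borel_measurable (?Sp \<Otimes>\<^sub>M ?Sp)"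
      by (intro borel_measurable_sum of_bool_measurable selected_measurable[OF th] measurable_fst measurable_snd) auto
    have [measurable]: "(\<lambda>z. \<Sum>j\<in>S. (debias n p (snd z) (th (fst z)) j - \<theta> j)\<^sup>2) \<in> borel_measurable (?Sp \<Otimes>\<^sub>M ?Sp)"
      using S(1) by (intro borel_measurable_sum borel_measurable_power borel_measurable_diff borel_measurable_const
        debias_measurable[OF measurable_snd th_component_measurable[OF th measurable_fst]]) auto
    show ?thesis unfolding N2_def by measurable
  qed
  have p2: "prob {\<omega> \<in> space R. ?B 0 \<omega> \<in> G \<and> (?B 0 \<omega>, ?B 2 \<omega>) \<in> N2} \<le> 2 * \<epsilon>"
  proof (rule indep_section_bound[OF i02 N2 G])
    fix x assume x: "x \<in> G"
    define v \<tau> where "v = ?v x" and "\<tau> = ?al * resid_scale n p x (th x) * sqrt (2 * lx / real n)"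
    have vr: "dot (Suc p) v v \<le> r\<^sup>2" and sg: "\<sigma> / 2 \<le> resid_scale n p x (th x)"
      using x unfolding G_def good_pilot_def v_def r_def by auto
    have "\<sigma>\<^sup>2 \<le> dot (Suc p) v v" unfolding dot_def v_def pilot_err_def by (simp add: power2_eq_square sum_nonneg)
    then have vp: "dot (Suc p) v v > 0" using \<sigma> by (smt (verit) zero_less_power)
    have deb: "debias n p (?B 2 \<omega>) (th x) j - \<theta> j = A2.usum (\<lambda>i. of_bool (i = j)) v n \<omega> / real n" if "j < p" for j \<omega>
      unfolding v_def using debias_block[OF A2.subg_array_axioms _ n1(1) that, of \<theta> \<sigma> \<omega> "th x"] by simp
    \<comment> \<open>The data-driven threshold dominates the tail level at the true \<sigma>, since
      the residual scale is at least \<sigma>/2.\<close>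
    have \<tau>: "A2.tail_const * r * sqrt (lx / real n) \<le> \<tau>"
    proof -
      have tc: "A2.tail_const \<ge> 0" unfolding A2.tail_const_def using Csq_gt by simp
      have "sqrt (lx / real n) \<le> sqrt (2 * lx / real n)" using lx by (intro real_sqrt_le_mono divide_right_mono) auto
      then have "A2.tail_const * r * sqrt (lx / real n) \<le> A2.tail_const * r * sqrt (2 * lx / real n)"
        using tc r by (intro mult_left_mono) auto
      also have "\<dots> = ?al * (\<sigma> / 2) * sqrt (2 * lx / real n)"
        unfolding selection_const_def A2.tail_const_def r_def by simp
      also have "?al * (\<sigma> / 2) * sqrt (2 * lx / real n) \<le> \<tau>"
        unfolding \<tau>_def using sg lx a Csq_gt by (intro mult_right_mono mult_left_mono) (auto simp: selection_const_def)
      finally show ?thesis .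
    qed
    have m0: "m0 > 0" unfolding m0_def using s0 \<epsilon> by simp
    let ?F1 = "{\<omega> \<in> space R. (\<Sum>j\<in>{..<p} - S. of_bool (\<bar>A2.usum (\<lambda>i. of_bool (i = j)) v n \<omega> / real n\<bar> > \<tau>)) \<ge> m0}"
    let ?F2 = "{\<omega> \<in> space R. (\<Sum>j\<in>S. (A2.usum (\<lambda>i. of_bool (i = j)) v n \<omega> / real n)\<^sup>2) \<ge> b2}"
    have "prob ?F1 \<le> real (card ({..<p} - S)) * (2 * exp (- lx)) / m0"
      by (rule A2.false_selection_tail[OF _ n1(1) vp vr _ lx \<tau> m0]) (use r in auto)
    also have "\<dots> \<le> real p * (2 * exp (- lx)) / m0"
      using m0 card_mono[of "{..<p}" "{..<p} - S"] by (intro divide_right_mono mult_right_mono) auto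
    also have "\<dots> \<le> \<epsilon>"
    proof -
      have "0 < 1 + real p / (real s)\<^sup>2" by (intro add_pos_nonneg) auto
      then have "exp (- lx) = 1 / (1 + real p / (real s)\<^sup>2)" unfolding lx_def by (simp add: exp_minus inverse_eq_divide)
      also have "\<dots> = (real s)\<^sup>2 / ((real s)\<^sup>2 + real p)" using s0 by (simp add: field_simps)
      finally have ex: "exp (- lx) = (real s)\<^sup>2 / ((real s)\<^sup>2 + real p)" .
      have "real p * (2 * exp (- lx)) / m0 = \<epsilon> * (real p / ((real s)\<^sup>2 + real p))"
        unfolding ex m0_def using s0 \<epsilon> by simp
      also have "\<dots> \<le> \<epsilon> * 1"
      proof (rule mult_left_mono)
        have "(real s)\<^sup>2 + real p > 0" using s0 by linarith
        then show "real p / ((real s)\<^sup>2 + real p) \<le> 1" by (simp add: divide_le_eq_1)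
      qed (use \<epsilon> in simp)
      finally show ?thesis by simp
    qed
    finally have q1: "prob ?F1 \<le> \<epsilon>" .
    have q2: "prob ?F2 \<le> \<epsilon>"
      unfolding b2_def BA(2)[symmetric]
      by (rule A2.support_noise_tail[OF _ S(2) n1(1) vr r s(1) \<epsilon>(1)]) (use S(1) in auto)
    have us [measurable]: "A2.usum u v n \<in> borel_measurable R" for u by measurable
    have F1m: "?F1 \<in> events" unfolding of_bool_def by measurable
    have F2m: "?F2 \<in> events" by measurable
    have "prob {\<omega> \<in> space R. (x, ?B 2 \<omega>) \<in> N2} \<le> prob (?F1 \<union> ?F2)"
    proof (rule finite_measure_mono)
      have e1: "(\<Sum>j\<in>{..<p} - S. of_bool (?sel x (?B 2 \<omega>) j) :: real)
          = (\<Sum>j\<in>{..<p} - S. of_bool (\<bar>A2.usum (\<lambda>i. of_bool (i = j)) v n \<omega> / real n\<bar> > \<tau>))" for \<omega>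
      proof (intro sum.cong refl)
        fix j assume j: "j \<in> {..<p} - S"
        then have "debias n p (?B 2 \<omega>) (th x) j = A2.usum (\<lambda>i. of_bool (i = j)) v n \<omega> / real n"
          using deb[of j \<omega>] \<theta>0[of j] by simp
        then show "of_bool (?sel x (?B 2 \<omega>) j) = (of_bool (\<bar>A2.usum (\<lambda>i. of_bool (i = j)) v n \<omega> / real n\<bar> > \<tau>) :: real)"
          unfolding selected_def \<tau>_def lx_def by simp
      qed
      have e2: "(\<Sum>j\<in>S. (debias n p (?B 2 \<omega>) (th x) j - \<theta> j)\<^sup>2)
          = (\<Sum>j\<in>S. (A2.usum (\<lambda>i. of_bool (i = j)) v n \<omega> / real n)\<^sup>2)" for \<omega>
      proof (intro sum.cong refl)
        fix j assume "j \<in> S"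
        then have "j < p" using S(1) by auto
        then show "(debias n p (?B 2 \<omega>) (th x) j - \<theta> j)\<^sup>2 = (A2.usum (\<lambda>i. of_bool (i = j)) v n \<omega> / real n)\<^sup>2"
          by (simp only: deb)
      qed
      show "{\<omega> \<in> space R. (x, ?B 2 \<omega>) \<in> N2} \<subseteq> ?F1 \<union> ?F2"
        unfolding N2_def mem_Collect_eq fst_conv snd_conv e1 e2 by blast
    qed (use F1m F2m in auto)
    also have "\<dots> \<le> prob ?F1 + prob ?F2" by (rule measure_Un_le[OF F1m F2m])
    also have "\<dots> \<le> 2 * \<epsilon>" using q1 q2 by linarith
    finally show "prob {\<omega> \<in> space R. (x, ?B 2 \<omega>) \<in> N2} \<le> 2 * \<epsilon>" .
  qed (use \<epsilon> in simp)

  \<comment> \<open>For a pair frozen in G2 both the pilot and the selected set are fixed, and the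
    set has at most 3*s^2/\<epsilon> elements.\<close>
  define G2 where "G2 = {z \<in> space (?Sp \<Otimes>\<^sub>M ?Sp). fst z \<in> G} - N2"
  have G2: "G2 \<in> sets (?Sp \<Otimes>\<^sub>M ?Sp)" unfolding G2_def using G N2 by measurable
  define N3 where "N3 = {zw \<in> space ((?Sp \<Otimes>\<^sub>M ?Sp) \<Otimes>\<^sub>M ?Sp).
    \<bar>\<Sum>j<p. (a_block n p (snd zw) (th (fst (fst zw))) j - (\<theta> j)\<^sup>2) * of_bool (?sel (fst (fst zw)) (snd (fst zw)) j)\<bar> > c3}"
  have N3: "N3 \<in> sets ((?Sp \<Otimes>\<^sub>M ?Sp) \<Otimes>\<^sub>M ?Sp)"
  proof -
    have f: "(\<lambda>zw. fst (fst zw)) \<in> (?Sp \<Otimes>\<^sub>M ?Sp) \<Otimes>\<^sub>M ?Sp \<rightarrow>\<^sub>M ?Sp" "(\<lambda>zw. snd (fst zw)) \<in> (?Sp \<Otimes>\<^sub>M ?Sp) \<Otimes>\<^sub>M ?Sp \<rightarrow>\<^sub>M ?Sp"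
      by measurable
    have [measurable]: "(\<lambda>zw. \<Sum>j<p. (a_block n p (snd zw) (th (fst (fst zw))) j - (\<theta> j)\<^sup>2) *
        of_bool (?sel (fst (fst zw)) (snd (fst zw)) j)) \<in> borel_measurable ((?Sp \<Otimes>\<^sub>M ?Sp) \<Otimes>\<^sub>M ?Sp)"
      by (intro borel_measurable_sum borel_measurable_times borel_measurable_diff borel_measurable_const of_bool_measurable
        selected_measurable[OF th f] a_block_measurable[OF measurable_snd th_component_measurable[OF th f(1)]]) auto
    show ?thesis unfolding N3_def by measurable
  qed
  have le3: "prob {\<omega> \<in> space R. (z, ?B 1 \<omega>) \<in> N3} \<le> 2 * \<epsilon>" if z: "z \<in> G2" for z
  proof -
    define A where "A = {j \<in> {..<p}. ?sel (fst z) (snd z) j}"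
    define v where "v = ?v (fst z)"
    have vr: "dot (Suc p) v v \<le> r\<^sup>2" using z unfolding G2_def G_def good_pilot_def v_def r_def by auto
    have Ap: "A \<subseteq> {..<p}" unfolding A_def by auto
    have fA: "finite A" using Ap finite_subset by blast
    have cA: "real (card A) \<le> 3 * (real s)\<^sup>2 / \<epsilon>"
    proof -
      have lt: "(\<Sum>j\<in>{..<p} - S. of_bool (?sel (fst z) (snd z) j)) < m0"
        using z unfolding G2_def N2_def by auto
      have "(\<Sum>j\<in>{..<p} - S. of_bool (?sel (fst z) (snd z) j) :: real) = real (card (A - S))"
      proof -
        have "({..<p} - S) \<inter> {j. ?sel (fst z) (snd z) j} = A - S" unfolding A_def by auto
        then show ?thesis by (simp add: sum_of_bool_eq)
      qed
      then have c1: "real (card (A - S)) \<le> m0" using lt by linarith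
      have "card A \<le> card ((A - S) \<union> S)" using fA S(3) by (intro card_mono) auto
      also have "\<dots> \<le> card (A - S) + card S" by (rule card_Un_le)
      finally have "card A \<le> card (A - S) + card S" .
      then have c2: "real (card A) \<le> m0 + real s" using c1 S(2) by linarith
      have "real s \<le> (real s)\<^sup>2 / \<epsilon>"
      proof -
        have "real s * \<epsilon> \<le> real s * real s" using \<epsilon> s0 s(1) by (intro mult_left_mono) auto
        then show ?thesis using \<epsilon> by (simp add: field_simps power2_eq_square)
      qed
      then have "real (card A) \<le> 2 * (real s)\<^sup>2 / \<epsilon> + (real s)\<^sup>2 / \<epsilon>" using c2 unfolding m0_def by linarith
      then show ?thesis by (simp add: field_simps)
    qed
    have TT: "(\<Sum>j\<in>A. (\<theta> j)\<^sup>2) \<le> T\<^sup>2"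
    proof -
      have "(\<Sum>j\<in>A. (\<theta> j)\<^sup>2) \<le> (\<Sum>j<p. (\<theta> j)\<^sup>2)" using Ap by (intro sum_mono2) auto
      also have "\<dots> = (L2_set \<theta> {..<p})\<^sup>2" unfolding L2_set_def by (simp add: sum_nonneg)
      also have "\<dots> \<le> T\<^sup>2" unfolding T_def using l2 \<sigma> by (intro power_mono) auto
      finally show ?thesis .
    qed
    let ?F = "{\<omega> \<in> space R. \<bar>\<Sum>j\<in>A. 2 * \<theta> j / real n * A1.usum (\<lambda>i. of_bool (i = j)) v n \<omega> + 1 / (real n * (real n - 1)) *
      (\<Sum>k<n. \<Sum>l\<in>{..<n} - {k}. A1.uprod (\<lambda>i. of_bool (i = j)) v k \<omega> * A1.uprod (\<lambda>i. of_bool (i = j)) v l \<omega>)\<bar> > c3}"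
    have eF: "(\<Sum>j<p. (a_block n p (?B 1 \<omega>) (th (fst z)) j - (\<theta> j)\<^sup>2) * of_bool (?sel (fst z) (snd z) j))
        = (\<Sum>j\<in>A. 2 * \<theta> j / real n * A1.usum (\<lambda>i. of_bool (i = j)) v n \<omega> + 1 / (real n * (real n - 1)) *
      (\<Sum>k<n. \<Sum>l\<in>{..<n} - {k}. A1.uprod (\<lambda>i. of_bool (i = j)) v k \<omega> * A1.uprod (\<lambda>i. of_bool (i = j)) v l \<omega>))" for \<omega>
    proof -
      have "(\<Sum>j<p. (a_block n p (?B 1 \<omega>) (th (fst z)) j - (\<theta> j)\<^sup>2) * of_bool (?sel (fst z) (snd z) j))
          = (\<Sum>j\<in>A. (a_block n p (?B 1 \<omega>) (th (fst z)) j - (\<theta> j)\<^sup>2) * of_bool (?sel (fst z) (snd z) j))"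
        unfolding A_def by (intro sum.mono_neutral_right) auto
      also have "\<dots> = (\<Sum>j\<in>A. a_block n p (?B 1 \<omega>) (th (fst z)) j - (\<theta> j)\<^sup>2)"
        unfolding A_def by (intro sum.cong) auto
      also have "\<dots> = (\<Sum>j\<in>A. 2 * \<theta> j / real n * A1.usum (\<lambda>i. of_bool (i = j)) v n \<omega> + 1 / (real n * (real n - 1)) *
      (\<Sum>k<n. \<Sum>l\<in>{..<n} - {k}. A1.uprod (\<lambda>i. of_bool (i = j)) v k \<omega> * A1.uprod (\<lambda>i. of_bool (i = j)) v l \<omega>))"
        unfolding v_def using Ap by (intro sum.cong refl a_block_error[OF A1.subg_array_axioms _ n]) auto
      finally show ?thesis .
    qed
    have sub: "{\<omega> \<in> space R. (z, ?B 1 \<omega>) \<in> N3} \<subseteq> ?F"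
      unfolding N3_def mem_Collect_eq fst_conv snd_conv eF by blast
    have us [measurable]: "A1.usum u v n \<in> borel_measurable R" for u by measurable
    have up [measurable]: "A1.uprod u v i \<in> borel_measurable R" if "i < n" for u i using that by measurable
    have Fm: "?F \<in> events"
    proof -
      have [measurable]: "(\<lambda>\<omega>. \<Sum>j\<in>A. 2 * \<theta> j / real n * A1.usum (\<lambda>i. of_bool (i = j)) v n \<omega> + 1 / (real n * (real n - 1)) *
      (\<Sum>k<n. \<Sum>l\<in>{..<n} - {k}. A1.uprod (\<lambda>i. of_bool (i = j)) v k \<omega> * A1.uprod (\<lambda>i. of_bool (i = j)) v l \<omega>)) \<in> borel_measurable R"
        by (intro borel_measurable_sum borel_measurable_add borel_measurable_times borel_measurable_const us up) auto
      show ?thesis by measurable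
    qed
    have "prob {\<omega> \<in> space R. (z, ?B 1 \<omega>) \<in> N3} \<le> prob ?F" by (rule finite_measure_mono[OF sub Fm])
    also have "\<dots> \<le> 2 * \<epsilon>"
      unfolding c3_def BA(1)[symmetric]
      by (rule A1.selected_error_tail[OF _ n vr r TT T cA _ \<epsilon>(1)]) (use Ap s0 \<epsilon> in auto)
    finally show ?thesis .
  qed
  have p3: "prob {\<omega> \<in> space R. (?B 0 \<omega>, ?B 2 \<omega>) \<in> G2 \<and> ((?B 0 \<omega>, ?B 2 \<omega>), ?B 1 \<omega>) \<in> N3} \<le> 2 * \<epsilon>"
    using indep_section_bound_compose[OF i021 pr02 pr1 N3 G2, of "2 * \<epsilon>"] le3 \<epsilon>(1) by simp

  let ?E1 = "{\<omega> \<in> space R. ?B 0 \<omega> \<notin> G}" and ?E2 = "{\<omega> \<in> space R. ?B 0 \<omega> \<in> G \<and> (?B 0 \<omega>, ?B 2 \<omega>) \<in> N2}"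
    and ?E3 = "{\<omega> \<in> space R. (?B 0 \<omega>, ?B 2 \<omega>) \<in> G2 \<and> ((?B 0 \<omega>, ?B 2 \<omega>), ?B 1 \<omega>) \<in> N3}"
  have b012: "?B 0 \<in> R \<rightarrow>\<^sub>M ?Sp" "?B 1 \<in> R \<rightarrow>\<^sub>M ?Sp" "?B 2 \<in> R \<rightarrow>\<^sub>M ?Sp" using Bm by auto
  have Em: "?E1 \<in> events" "?E2 \<in> events" "?E3 \<in> events"
    using G N2 G2 N3 b012 by measurable
  define E where "E = space R - (?E1 \<union> (?E2 \<union> ?E3))"
  have "prob (?E1 \<union> (?E2 \<union> ?E3)) \<le> prob ?E1 + prob (?E2 \<union> ?E3)" using Em by (intro measure_Un_le) auto
  moreover have "prob (?E2 \<union> ?E3) \<le> prob ?E2 + prob ?E3" using Em by (intro measure_Un_le) auto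
  ultimately have "prob (?E1 \<union> (?E2 \<union> ?E3)) \<le> 5 * \<epsilon>" using p0 p2 p3 by linarith
  then have PE: "prob E \<ge> 1 - 5 * \<epsilon>" unfolding E_def using Em by (subst prob_compl) auto
  have EE: "E \<in> events" unfolding E_def using Em by auto
  show ?thesis
  proof (intro bexI[OF _ EE] conjI ballI PE)
    fix \<omega> assume w: "\<omega> \<in> E"
    let ?D = "observe (3 * n) p \<theta> \<sigma> \<omega>"
    define x y u where "x = ?B 0 \<omega>" and "y = ?B 2 \<omega>" and "u = ?B 1 \<omega>"
    have wR: "\<omega> \<in> space R" using w unfolding E_def by auto
    have sp: "x \<in> space ?Sp" "y \<in> space ?Sp" "u \<in> space ?Sp"
      unfolding x_def y_def u_def using b012[THEN measurable_space, OF wR] by auto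
    have xG: "x \<in> G" and xy: "(x, y) \<notin> N2" using w wR unfolding E_def x_def y_def by auto
    have "(x, y) \<in> G2" unfolding G2_def using xG xy sp by (auto simp: space_pair_measure)
    then have xyu: "((x, y), u) \<notin> N3" using w wR unfolding E_def x_def y_def u_def by auto
    have gp: "good_pilot n p K \<theta> \<sigma> x (th x)" using xG unfolding G_def by auto
    define \<tau> where "\<tau> = ?al * resid_scale n p x (th x) * sqrt (2 * lx / real n)"
    have al: "?al \<ge> 0" unfolding selection_const_def using a Csq_gt by simp
    have rs: "0 \<le> resid_scale n p x (th x)" unfolding resid_scale_def by (simp add: L2_set_nonneg)
    have "\<bar>(\<Sum>j<p. a_block n p u (th x) j * of_bool (?sel x y j)) - (\<Sum>j<p. (\<theta> j)\<^sup>2)\<bar> \<le> c3 + 2 * real s * \<tau>\<^sup>2 + 2 * b2"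
    proof (rule thresholding_error[OF S(1,2) \<theta>0])
      show "?sel x y j \<longleftrightarrow> \<bar>debias n p y (th x) j\<bar> > \<tau>" for j unfolding selected_def \<tau>_def lx_def ..
      show "0 \<le> \<tau>" unfolding \<tau>_def using al rs lx by simp
      show "(\<Sum>j\<in>S. (debias n p y (th x) j - \<theta> j)\<^sup>2) \<le> b2" using xy sp unfolding N2_def by (auto simp: space_pair_measure)
      show "\<bar>\<Sum>j<p. (a_block n p u (th x) j - (\<theta> j)\<^sup>2) * of_bool (?sel x y j)\<bar> \<le> c3"
        using xyu sp unfolding N3_def by (auto simp: space_pair_measure)
    qed auto
    also have "c3 + 2 * real s * \<tau>\<^sup>2 + 2 * b2 \<le> Q_const K \<epsilon> * (\<sigma>\<^sup>2 * \<psi> + \<sigma> * L2_set \<theta> {..<p} / sqrt (real (3 * n)))"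
      unfolding c3_def \<tau>_def b2_def B_def r_def T_def lx_def \<psi>_def
      by (rule total_error_le[OF n1(1) s \<sigma> l2 \<epsilon>(1,2) K(1) rs]) (use gp in \<open>simp add: good_pilot_def\<close>)
    also have "(\<Sum>j<p. a_block n p u (th x) j * of_bool (?sel x y j)) = Q_HD n p s ?al th ?D"
      unfolding Q_HD_blocks x_def y_def u_def block_obs_def ..
    also have "(\<Sum>j<p. (\<theta> j)\<^sup>2) = (L2_set \<theta> {..<p})\<^sup>2" unfolding L2_set_def by (simp add: sum_nonneg)
    finally have 1: "\<bar>Q_HD n p s ?al th ?D - (L2_set \<theta> {..<p})\<^sup>2\<bar>
      \<le> Q_const K \<epsilon> * (\<sigma>\<^sup>2 * \<psi> + \<sigma> * L2_set \<theta> {..<p} / sqrt (real (3 * n)))" .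
    have "sigma_srs n p th ?D = resid_scale n p x (th x)"
      unfolding sigma_srs_def theta_srs_def resid_scale_def x_def block_obs_def ..
    then show "let D = ?D in \<bar>Q_HD n p s ?al th D - (L2_set \<theta> {..<p})\<^sup>2\<bar>
        \<le> Q_const K \<epsilon> * (\<sigma>\<^sup>2 * \<psi> + \<sigma> * L2_set \<theta> {..<p} / sqrt (real (3 * n))) \<and>
      \<sigma> / 2 \<le> sigma_srs n p th D \<and> sigma_srs n p th D \<le> 4 * noise_bound K * \<sigma>"
      unfolding Let_def using 1 gp unfolding good_pilot_def by simp
  qed
qed

section \<open>Square-root Slope and Lasso pilots\<close>

lemma block_obs_space: "block_obs n p \<theta> \<sigma> b \<omega> \<in> space (sample_space n p)"
  by (auto simp: block_obs_def subsample_def sample_space_def mtx_space_def vec_space_def space_pair_measure space_PiM)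

lemma B0_support:
  assumes "\<theta> \<in> B0 p s"
  obtains S where "S \<subseteq> {..<p}" "card S \<le> s" "\<And>j. j < p \<Longrightarrow> j \<notin> S \<Longrightarrow> \<theta> j = 0"
proof (rule that)
  show "card {j \<in> {..<p}. \<theta> j \<noteq> 0} \<le> s" using assms unfolding B0_def by blast
qed auto

lemma resid_scale_block:
  assumes "b < 3"
  shows "resid_scale n p (block_obs n p \<theta> \<sigma> b \<omega>) t
    = sqrt (quad_form n (Suc p) (\<lambda>k j. block_entry n p b (k, j) \<omega>) (pilot_err p \<theta> \<sigma> t) / real n)"
proof -
  have "(\<Sum>k<n. (resid p (block_obs n p \<theta> \<sigma> b \<omega>) t k)\<^sup>2)
      = quad_form n (Suc p) (\<lambda>k j. block_entry n p b (k, j) \<omega>) (pilot_err p \<theta> \<sigma> t)"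
    unfolding quad_form_def using block_resid[OF assms] by (intro sum.cong refl) simp
  then show ?thesis unfolding resid_scale_def L2_set_def real_sqrt_divide by simp
qed

text \<open>At t = \<theta> the error vector has only its noise coordinate, so the residual is
  \<sigma> times one column of the array.\<close>

lemma resid_scale_truth:
  assumes reg: "regular_design n (Suc p) K (\<lambda>k j. block_entry n p b (k, j) \<omega>)" and b: "b < 3" and n: "n \<ge> 1" and \<sigma>: "\<sigma> > 0"
  shows "resid_scale n p (block_obs n p \<theta> \<sigma> b \<omega>) \<theta> + \<sigma> \<le> \<sigma> * noise_bound K"
proof -
  have "quad_form n (Suc p) (\<lambda>k j. block_entry n p b (k, j) \<omega>) (pilot_err p \<theta> \<sigma> \<theta>) = \<sigma>\<^sup>2 * (\<Sum>k<n. (block_entry n p b (k, p) \<omega>)\<^sup>2)"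
    unfolding quad_form_def pilot_err_def by (simp add: power_mult_distrib sum_distrib_left mult.commute)
  also have "\<dots> \<le> \<sigma>\<^sup>2 * (col_bound K * real n)"
    using reg unfolding regular_design_def by (intro mult_left_mono) auto
  finally have "quad_form n (Suc p) (\<lambda>k j. block_entry n p b (k, j) \<omega>) (pilot_err p \<theta> \<sigma> \<theta>) / real n \<le> \<sigma>\<^sup>2 * (col_bound K * real n) / real n"
    by (intro divide_right_mono) auto
  then have "quad_form n (Suc p) (\<lambda>k j. block_entry n p b (k, j) \<omega>) (pilot_err p \<theta> \<sigma> \<theta>) / real n \<le> \<sigma>\<^sup>2 * col_bound K"
    using n by simp
  then have "resid_scale n p (block_obs n p \<theta> \<sigma> b \<omega>) \<theta> \<le> sqrt (\<sigma>\<^sup>2 * col_bound K)"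
    unfolding resid_scale_block[OF b] by (rule real_sqrt_le_mono)
  also have "\<dots> = \<sigma> * sqrt (col_bound K)" using \<sigma> by (simp add: real_sqrt_mult)
  finally show ?thesis unfolding noise_bound_def by (simp add: algebra_simps)
qed

text \<open>The halved residual and the slack \<sigma> are there for the approximate Lasso
  minimizer; an exact Slope minimizer satisfies the condition a fortiori.\<close>

lemma good_pilot_of_cone:
  fixes \<theta> t :: vec and \<sigma> :: real and \<omega> :: "mtx \<times> vec"
  assumes K: "K > 0" and reg: "regular_design n (Suc p) K (\<lambda>k j. block_entry n p 0 (k, j) \<omega>)" and n: "n \<ge> 1"
    and s: "1 \<le> s" "real s \<le> sqrt (real p)"
    and k: "real s * ln (exp 1 * real p / real s) \<le> 3 * real n * \<kappa>0" "\<kappa>0 \<le> kappa_bar K" and \<sigma>: "\<sigma> > 0"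
    and S: "S \<subseteq> {..<p}" "card S \<le> s" and js: "is_ranking p S \<theta> (pilot_err p \<theta> \<sigma> t) js"
    and w: "\<And>i. i < p \<Longrightarrow> slope_weight n p (slope_const K) (Suc i) \<le> w (js ! i)"
    and w': "\<And>j. j < p \<Longrightarrow> w j \<le> slope_const K * sqrt (ln (2 * real p) / real n)"
  defines "x \<equiv> block_obs n p \<theta> \<sigma> 0 \<omega>"
  assumes cone: "resid_scale n p x t / 2 + (\<Sum>j\<in>{..<p} - S. w j * \<bar>\<theta> j - t j\<bar>)
      \<le> resid_scale n p x \<theta> + (\<Sum>j\<in>S. w j * \<bar>\<theta> j - t j\<bar>) + \<sigma>"
  shows "good_pilot n p K \<theta> \<sigma> x t"
proof -
  let ?z = "\<lambda>k j. block_entry n p 0 (k, j) \<omega>" and ?v = "pilot_err p \<theta> \<sigma> t"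
  have rs: "resid_scale n p x t = sqrt (quad_form n (Suc p) ?z ?v / real n)"
    unfolding x_def by (rule resid_scale_block) simp
  have sums: "(\<Sum>j\<in>A. w j * \<bar>\<theta> j - t j\<bar>) = (\<Sum>j\<in>A. w j * \<bar>?v j\<bar>)" if "A \<subseteq> {..<p}" for A
    using that by (intro sum.cong refl) (auto simp: pilot_err_def)
  have c: "sqrt (quad_form n (Suc p) ?z ?v / real n) / 2 + (\<Sum>j\<in>{..<p} - S. w j * \<bar>?v j\<bar>)
        \<le> \<sigma> * noise_bound K + (\<Sum>j\<in>S. w j * \<bar>?v j\<bar>)"
  proof -
    have "resid_scale n p x \<theta> + \<sigma> \<le> \<sigma> * noise_bound K"
      unfolding x_def by (rule resid_scale_truth[OF reg _ n \<sigma>]) simp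
    then show ?thesis using cone[unfolded rs sums[OF S(1)] sums[OF Diff_subset]] by linarith
  qed
  have vp: "?v p = \<sigma>" by (simp add: pilot_err_def)
  note b = pilot_error_bound[OF K reg n S s k js refl vp \<sigma> w w' c]
  show ?thesis unfolding good_pilot_def rs using b sqrt_le_D[OF b(1)] by auto
qed

text \<open>Minimality against \<theta> gives the basic inequality, and
  \<open>slope_norm_cone\<close> replaces the difference of the Slope norms by weighted l1 norms of
  the error.\<close>

lemma srs_good_pilot:
  assumes K: "K > 0" and reg: "regular_design n (Suc p) K (\<lambda>k j. block_entry n p 0 (k, j) \<omega>)" and n: "n \<ge> 1"
    and s: "1 \<le> s" "real s \<le> sqrt (real p)"
    and k: "real s * ln (exp 1 * real p / real s) \<le> 3 * real n * \<kappa>0" "\<kappa>0 \<le> kappa_bar K" and \<sigma>: "\<sigma> > 0"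
    and \<theta>: "\<theta> \<in> B0 p s" and th: "srs_estimator n p (slope_const K) th"
  shows "good_pilot n p K \<theta> \<sigma> (block_obs n p \<theta> \<sigma> 0 \<omega>) (th (block_obs n p \<theta> \<sigma> 0 \<omega>))"
proof -
  define x where "x = block_obs n p \<theta> \<sigma> 0 \<omega>"
  define t where "t = th x"
  have c: "slope_const K \<ge> 0" using pilot_constants(2)[OF K] by simp
  have p: "p \<ge> 1" by (rule sparsity_log_bounds(1)[OF s k(1)])
  obtain S where S: "S \<subseteq> {..<p}" "card S \<le> s" "\<And>j. j < p \<Longrightarrow> j \<notin> S \<Longrightarrow> \<theta> j = 0" using B0_support[OF \<theta>] by blast
  have "\<exists>js. is_ranking p S \<theta> (pilot_err p \<theta> \<sigma> t) js" by (rule ranking_exists[OF S(1)]) (rule S(3))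
  then obtain js where js: "is_ranking p S \<theta> (pilot_err p \<theta> \<sigma> t) js" ..
  have "\<exists>i. i < p \<and> js ! i = j" if j: "j < p" for j
    using ranking_index[OF js j] by blast
  then obtain ix where ix: "ix j < p" "js ! ix j = j" if "j < p" for j by metis
  \<comment> \<open>Each coordinate gets the weight of its position in the list, which depends on
    the error itself.\<close>
  define w where "w j = slope_weight n p (slope_const K) (Suc (ix j))" for j
  have w: "w (js ! i) = slope_weight n p (slope_const K) (Suc i)" if i: "i < p" for i
  proof -
    have d: "distinct js" "length js = p" using js unfolding is_ranking_def by blast+
    have "js ! i < p" by (rule ranking_nth_less[OF js i])
    then have "ix (js ! i) = i" using ix[of "js ! i"] i d nth_eq_iff_index_eq[of js "ix (js ! i)" i] by simp
    then show ?thesis unfolding w_def by simp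
  qed
  have w': "w j \<le> slope_const K * sqrt (ln (2 * real p) / real n)" for j
  proof -
    have "w j \<le> slope_weight n p (slope_const K) (Suc 0)"
      unfolding w_def using antimonoD[OF slope_weight_antimono[OF c p], of 0 "ix j"] by simp
    then show ?thesis unfolding slope_weight_def by simp
  qed
  have "srs_objective n p (slope_const K) x t \<le> srs_objective n p (slope_const K) x \<theta>"
    using th \<theta> block_obs_space[of n p \<theta> \<sigma> 0 \<omega>] unfolding srs_estimator_def is_arg_min_def t_def x_def B0_def
    by (auto simp: not_less)
  then have opt: "resid_scale n p x t + slope_norm n p (slope_const K) t \<le> resid_scale n p x \<theta> + slope_norm n p (slope_const K) \<theta>"
    unfolding srs_objective_def resid_scale_def .
  have cone: "slope_norm n p (slope_const K) \<theta> + (\<Sum>j\<in>{..<p} - S. w j * \<bar>pilot_err p \<theta> \<sigma> t j\<bar>)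
      \<le> slope_norm n p (slope_const K) t + (\<Sum>j\<in>S. w j * \<bar>pilot_err p \<theta> \<sigma> t j\<bar>)"
    by (rule slope_norm_cone[OF js S(1,3) _ c p w]) (simp_all add: pilot_err_def)
  have sums: "(\<Sum>j\<in>A. w j * \<bar>pilot_err p \<theta> \<sigma> t j\<bar>) = (\<Sum>j\<in>A. w j * \<bar>\<theta> j - t j\<bar>)" if "A \<subseteq> {..<p}" for A
    using that by (intro sum.cong refl) (auto simp: pilot_err_def)
  have "0 \<le> resid_scale n p x t" unfolding resid_scale_def by (simp add: L2_set_nonneg)
  then have "resid_scale n p x t / 2 + (\<Sum>j\<in>{..<p} - S. w j * \<bar>\<theta> j - t j\<bar>)
      \<le> resid_scale n p x \<theta> + (\<Sum>j\<in>S. w j * \<bar>\<theta> j - t j\<bar>) + \<sigma>"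
    using opt cone[unfolded sums[OF S(1)] sums[OF Diff_subset]] \<sigma> by linarith
  then show ?thesis
    unfolding x_def[symmetric] t_def[symmetric] unfolding x_def
    by (intro good_pilot_of_cone[OF K reg n s k \<sigma> S(1,2) js _ w']) (simp_all add: w)
qed

section \<open>The Lasso pilot over rational vectors\<close>

definition lasso_penalty :: "nat \<Rightarrow> nat \<Rightarrow> real \<Rightarrow> vec \<Rightarrow> real" where
  "lasso_penalty n p c t = (\<Sum>j<p. c * sqrt (ln (2 * real p) / real n) * \<bar>t j\<bar>)"

definition rational_grid :: "nat \<Rightarrow> nat \<Rightarrow> vec" where
  "rational_grid p = from_nat_into ({..<p} \<rightarrow>\<^sub>E \<rat>)"

text \<open>
  An approximate minimizer of the square-root Lasso criterion over rational vectors, which is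
  measurable by construction. Halving the residual term makes the condition satisfiable
  whenever the residual of a near-minimizer is bounded away from 0.
\<close>

definition near_minimizer :: "nat \<Rightarrow> nat \<Rightarrow> real \<Rightarrow> mtx \<times> vec \<Rightarrow> nat \<Rightarrow> bool" where
  "near_minimizer n p c x i \<longleftrightarrow> (\<forall>i'. resid_scale n p x (rational_grid p i) / 2 + lasso_penalty n p c (rational_grid p i)
     \<le> resid_scale n p x (rational_grid p i') + lasso_penalty n p c (rational_grid p i'))"

text \<open>If no index qualifies, \<open>LEAST\<close> is unspecified. The proof of
  \<open>lasso_good_pilot\<close> shows that this cannot happen on a regular design.\<close>

definition lasso_pilot :: "nat \<Rightarrow> nat \<Rightarrow> real \<Rightarrow> mtx \<times> vec \<Rightarrow> vec" where
  "lasso_pilot n p c x = rational_grid p (LEAST i. near_minimizer n p c x i)"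

lemma rational_grid_range: "range (rational_grid p) = {..<p} \<rightarrow>\<^sub>E \<rat>"
proof -
  have "countable ({..<p} \<rightarrow>\<^sub>E (\<rat> :: real set))" by (intro countable_PiE countable_rat) auto
  moreover
  have "(\<lambda>j\<in>{..<p}. 0 :: real) \<in> {..<p} \<rightarrow>\<^sub>E \<rat>" by auto
  then have "{..<p} \<rightarrow>\<^sub>E (\<rat> :: real set) \<noteq> {}" by blast
  ultimately show ?thesis unfolding rational_grid_def by (intro range_from_nat_into)
qed

text \<open>The condition on an index is a countable conjunction of measurable inequalities, so the
  least index is measurable.\<close>

lemma lasso_pilot_measurable:
  "lasso_pilot n p c \<in> sample_space n p \<rightarrow>\<^sub>M vec_space p"
proof -
  have [measurable]: "(\<lambda>x. resid_scale n p x t) \<in> borel_measurable (sample_space n p)" for t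
    by (rule resid_scale_measurable) auto
  have "(\<lambda>x. LEAST i. near_minimizer n p c x i) \<in> sample_space n p \<rightarrow>\<^sub>M count_space UNIV"
    unfolding near_minimizer_def by measurable
  moreover have "rational_grid p \<in> count_space UNIV \<rightarrow>\<^sub>M vec_space p"
  proof (rule measurableI)
    fix i
    have "rational_grid p i \<in> {..<p} \<rightarrow>\<^sub>E \<rat>" using rational_grid_range by blast
    then show "rational_grid p i \<in> space (vec_space p)" unfolding vec_space_def by (auto simp: space_PiM PiE_def)
  qed simp
  ultimately show ?thesis unfolding lasso_pilot_def by (rule measurable_compose)
qed

text \<open>The criterion is Lipschitz in the maximum norm with the explicit constant C, and
  rational vectors are dense. The summand 1 keeps C positive.\<close>

lemma rational_grid_approx:
  assumes "\<epsilon> > 0" "n \<ge> 1"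
  shows "\<exists>i. resid_scale n p x (rational_grid p i) + lasso_penalty n p c (rational_grid p i)
    \<le> resid_scale n p x \<theta> + lasso_penalty n p c \<theta> + \<epsilon>"
proof -
  let ?w = "c * sqrt (ln (2 * real p) / real n)"
  define C where "C = (\<Sum>k<n. \<Sum>j<p. \<bar>fst x (k, j)\<bar>) + real p * \<bar>?w\<bar> + 1"
  have C: "C > 0" unfolding C_def by (intro add_nonneg_pos add_nonneg_nonneg sum_nonneg mult_nonneg_nonneg) auto
  define \<eta> where "\<eta> = \<epsilon> / C"
  have \<eta>: "\<eta> > 0" unfolding \<eta>_def using assms C by simp
  have "\<exists>q\<in>\<rat>. \<theta> j - \<eta> < q \<and> q < \<theta> j + \<eta>" for j using Rats_dense_in_real[of "\<theta> j - \<eta>" "\<theta> j + \<eta>"] \<eta> by simp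
  then obtain q where q: "q j \<in> \<rat>" "\<theta> j - \<eta> < q j" "q j < \<theta> j + \<eta>" for j by metis
  have "restrict q {..<p} \<in> {..<p} \<rightarrow>\<^sub>E \<rat>" using q(1) by auto
  then obtain i where i: "rational_grid p i = restrict q {..<p}" using rational_grid_range by (metis (no_types, lifting) imageE)
  define t where "t = rational_grid p i"
  have t: "\<bar>\<theta> j - t j\<bar> \<le> \<eta>" if "j < p" for j using q(2,3)[of j] that unfolding t_def i by simp
  have r1: "1 \<le> sqrt (real n)" using assms(2) by simp
  have "L2_set (resid p x t) {..<n} \<le> L2_set (resid p x \<theta>) {..<n} + L2_set (\<lambda>k. \<Sum>j<p. fst x (k, j) * (\<theta> j - t j)) {..<n}"
  proof -
    have "resid p x t = (\<lambda>k. resid p x \<theta> k + (\<Sum>j<p. fst x (k, j) * (\<theta> j - t j)))"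
      unfolding resid_def by (simp add: fun_eq_iff right_diff_distrib sum_subtractf)
    then show ?thesis using L2_set_triangle_ineq[of "resid p x \<theta>" "\<lambda>k. \<Sum>j<p. fst x (k, j) * (\<theta> j - t j)" "{..<n}"] by simp
  qed
  also have "L2_set (\<lambda>k. \<Sum>j<p. fst x (k, j) * (\<theta> j - t j)) {..<n} \<le> (\<Sum>k<n. \<bar>\<Sum>j<p. fst x (k, j) * (\<theta> j - t j)\<bar>)"
    by (rule L2_set_le_sum_abs)
  also have "\<dots> \<le> (\<Sum>k<n. \<Sum>j<p. \<bar>fst x (k, j)\<bar> * \<eta>)"
  proof (intro sum_mono order_trans[OF sum_abs])
    fix k j assume "j \<in> {..<p}"
    then show "\<bar>fst x (k, j) * (\<theta> j - t j)\<bar> \<le> \<bar>fst x (k, j)\<bar> * \<eta>"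
      unfolding abs_mult by (intro mult_left_mono t) auto
  qed
  also have "\<dots> = (\<Sum>k<n. \<Sum>j<p. \<bar>fst x (k, j)\<bar>) * \<eta>" by (simp add: sum_distrib_right)
  finally have "L2_set (resid p x t) {..<n} / sqrt (real n) \<le> (L2_set (resid p x \<theta>) {..<n} + (\<Sum>k<n. \<Sum>j<p. \<bar>fst x (k, j)\<bar>) * \<eta>) / sqrt (real n)"
    by (intro divide_right_mono) auto
  also have "\<dots> \<le> resid_scale n p x \<theta> + (\<Sum>k<n. \<Sum>j<p. \<bar>fst x (k, j)\<bar>) * \<eta>"
  proof -
    have "(\<Sum>k<n. \<Sum>j<p. \<bar>fst x (k, j)\<bar>) * \<eta> / sqrt (real n) \<le> (\<Sum>k<n. \<Sum>j<p. \<bar>fst x (k, j)\<bar>) * \<eta> / 1"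
      using r1 \<eta> by (intro divide_left_mono mult_nonneg_nonneg sum_nonneg) auto
    then show ?thesis unfolding resid_scale_def by (simp add: add_divide_distrib)
  qed
  finally have 1: "resid_scale n p x t \<le> resid_scale n p x \<theta> + (\<Sum>k<n. \<Sum>j<p. \<bar>fst x (k, j)\<bar>) * \<eta>"
    unfolding resid_scale_def .
  have "lasso_penalty n p c t \<le> (\<Sum>j<p. ?w * \<bar>\<theta> j\<bar> + \<bar>?w\<bar> * \<eta>)"
    unfolding lasso_penalty_def
  proof (rule sum_mono)
    fix j assume "j \<in> {..<p}"
    then have "\<bar>\<bar>t j\<bar> - \<bar>\<theta> j\<bar>\<bar> \<le> \<eta>" using t[of j] by auto
    then have "\<bar>?w\<bar> * \<bar>\<bar>t j\<bar> - \<bar>\<theta> j\<bar>\<bar> \<le> \<bar>?w\<bar> * \<eta>" by (intro mult_left_mono) auto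
    moreover have "?w * (\<bar>t j\<bar> - \<bar>\<theta> j\<bar>) \<le> \<bar>?w\<bar> * \<bar>\<bar>t j\<bar> - \<bar>\<theta> j\<bar>\<bar>" unfolding abs_mult[symmetric] by (rule abs_ge_self)
    ultimately show "?w * \<bar>t j\<bar> \<le> ?w * \<bar>\<theta> j\<bar> + \<bar>?w\<bar> * \<eta>" by (simp add: right_diff_distrib)
  qed
  also have "\<dots> = lasso_penalty n p c \<theta> + real p * \<bar>?w\<bar> * \<eta>" unfolding lasso_penalty_def by (simp add: sum.distrib)
  finally have 2: "lasso_penalty n p c t \<le> lasso_penalty n p c \<theta> + real p * \<bar>?w\<bar> * \<eta>" .
  have "(\<Sum>k<n. \<Sum>j<p. \<bar>fst x (k, j)\<bar>) * \<eta> + real p * \<bar>?w\<bar> * \<eta> \<le> C * \<eta>"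
    unfolding C_def distrib_right using \<eta> by simp
  also have "C * \<eta> = \<epsilon>" unfolding \<eta>_def using C by simp
  finally show ?thesis using 1 2 unfolding t_def by (intro exI[of _ i]) linarith
qed

text \<open>Existence of a near-minimizer is bootstrapped from the error bound: a vector within
  \<sigma>/8 of the infimum already satisfies the cone condition, so its residual is at least
  \<sigma>/2. Halving the residual term then gains \<sigma>/4, more than the gap \<sigma>/8.\<close>

lemma lasso_good_pilot:
  assumes K: "K > 0" and reg: "regular_design n (Suc p) K (\<lambda>k j. block_entry n p 0 (k, j) \<omega>)" and n: "n \<ge> 1"
    and s: "1 \<le> s" "real s \<le> sqrt (real p)"
    and k: "real s * ln (exp 1 * real p / real s) \<le> 3 * real n * \<kappa>0" "\<kappa>0 \<le> kappa_bar K" and \<sigma>: "\<sigma> > 0"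
    and \<theta>: "\<theta> \<in> B0 p s"
  defines "x \<equiv> block_obs n p \<theta> \<sigma> 0 \<omega>"
  shows "good_pilot n p K \<theta> \<sigma> x (lasso_pilot n p (slope_const K) x)"
proof -
  let ?c = "slope_const K"
  let ?w = "?c * sqrt (ln (2 * real p) / real n)"
  let ?F = "\<lambda>t. resid_scale n p x t + lasso_penalty n p ?c t"
  have c: "?c \<ge> 0" using pilot_constants(2)[OF K] by simp
  have p: "p \<ge> 1" by (rule sparsity_log_bounds(1)[OF s k(1)])
  have w0: "?w \<ge> 0" using c p by simp
  obtain S where S: "S \<subseteq> {..<p}" "card S \<le> s" "\<And>j. j < p \<Longrightarrow> j \<notin> S \<Longrightarrow> \<theta> j = 0" using B0_support[OF \<theta>] by blast
  have good: "good_pilot n p K \<theta> \<sigma> x t" if opt: "resid_scale n p x t / 2 + lasso_penalty n p ?c t \<le> ?F \<theta> + \<sigma>" for t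
  proof -
    have "\<exists>js. is_ranking p S \<theta> (pilot_err p \<theta> \<sigma> t) js" by (rule ranking_exists[OF S(1)]) (rule S(3))
  then obtain js where js: "is_ranking p S \<theta> (pilot_err p \<theta> \<sigma> t) js" ..
    have split: "(\<Sum>j<p. f j) = (\<Sum>j\<in>{..<p} - S. f j) + (\<Sum>j\<in>S. f j)" for f :: "nat \<Rightarrow> real"
      using S(1) by (intro sum.subset_diff) auto
    have "(\<Sum>j<p. ?w * \<bar>\<theta> j\<bar>) + (\<Sum>j\<in>{..<p} - S. ?w * \<bar>\<theta> j - t j\<bar>) \<le> (\<Sum>j<p. ?w * \<bar>t j\<bar>) + (\<Sum>j\<in>S. ?w * \<bar>\<theta> j - t j\<bar>)"
    proof -
      have "(\<Sum>j\<in>S. ?w * \<bar>\<theta> j\<bar>) \<le> (\<Sum>j\<in>S. ?w * \<bar>t j\<bar> + ?w * \<bar>\<theta> j - t j\<bar>)"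
        unfolding distrib_left[symmetric] using w0 by (intro sum_mono mult_left_mono) auto
      moreover have "(\<Sum>j\<in>{..<p} - S. ?w * \<bar>\<theta> j\<bar>) = 0" using S(3) by (intro sum.neutral) auto
      moreover have "(\<Sum>j\<in>{..<p} - S. ?w * \<bar>\<theta> j - t j\<bar>) = (\<Sum>j\<in>{..<p} - S. ?w * \<bar>t j\<bar>)"
        using S(3) by (intro sum.cong) auto
      ultimately show ?thesis unfolding split[of "\<lambda>j. ?w * \<bar>\<theta> j\<bar>"] split[of "\<lambda>j. ?w * \<bar>t j\<bar>"] sum.distrib by linarith
    qed
    then have "resid_scale n p x t / 2 + (\<Sum>j\<in>{..<p} - S. ?w * \<bar>\<theta> j - t j\<bar>)
        \<le> resid_scale n p x \<theta> + (\<Sum>j\<in>S. ?w * \<bar>\<theta> j - t j\<bar>) + \<sigma>"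
      using opt unfolding lasso_penalty_def by linarith
    then show ?thesis
      unfolding x_def
    proof (rule good_pilot_of_cone[OF K reg n s k \<sigma> S(1,2) js, rotated -1])
      \<comment> \<open>All Lasso weights equal the largest Slope weight, the one of rank 1.\<close>
      show "slope_weight n p ?c (Suc i) \<le> ?w" for i
        using antimonoD[OF slope_weight_antimono[OF c p], of 0 i n] unfolding slope_weight_def by simp
    qed simp
  qed
  let ?g = "rational_grid p"
  define m where "m = (INF i. ?F (?g i))"
  have F0: "?F t \<ge> 0" for t
    unfolding resid_scale_def lasso_penalty_def using w0 by (intro add_nonneg_nonneg sum_nonneg divide_nonneg_nonneg) (auto simp: L2_set_nonneg)
  have bdd: "bdd_below (range (\<lambda>i. ?F (?g i)))" using F0 by (intro bdd_belowI2[of _ 0])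
  have mle: "m \<le> ?F (?g i)" for i unfolding m_def by (rule cINF_lower[OF bdd]) simp
  have "\<exists>i. near_minimizer n p ?c x i"
  proof -
    obtain i where i: "?F (?g i) < m + \<sigma> / 8"
      using cINF_less_iff[OF _ bdd, of "m + \<sigma> / 8"] \<sigma> unfolding m_def by auto
    obtain i1 where "?F (?g i1) \<le> ?F \<theta> + \<sigma> / 8" using rational_grid_approx[of "\<sigma> / 8" n p x ?c \<theta>] \<sigma> n by auto
    then have "?F (?g i) \<le> ?F \<theta> + \<sigma>" using i mle[of i1] \<sigma> by linarith
    moreover have "0 \<le> resid_scale n p x (?g i)" unfolding resid_scale_def by (simp add: L2_set_nonneg)
    ultimately have "good_pilot n p K \<theta> \<sigma> x (?g i)" by (intro good) linarith
    then have "\<sigma> / 2 \<le> resid_scale n p x (?g i)" unfolding good_pilot_def by blast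
    then have "resid_scale n p x (?g i) / 2 + lasso_penalty n p ?c (?g i) \<le> m" using i \<sigma> by linarith
    then have "near_minimizer n p ?c x i" unfolding near_minimizer_def using mle order_trans by blast
    then show ?thesis ..
  qed
  then have "near_minimizer n p ?c x (LEAST i. near_minimizer n p ?c x i)" by (rule LeastI_ex)
  moreover obtain i1 where "?F (?g i1) \<le> ?F \<theta> + \<sigma>" using rational_grid_approx[of \<sigma> n p x ?c \<theta>] \<sigma> n by auto
  ultimately show ?thesis
    unfolding lasso_pilot_def near_minimizer_def by (intro good) (meson order_trans)
qed

section \<open>Risk bounds\<close>

lemma data_law_prob_le:
  assumes R: "model_law N p R" and E: "E \<in> sets R" "measure R E \<ge> 1 - \<delta>" and "\<delta> \<ge> 0"
    and out: "\<And>\<omega>. \<omega> \<in> E \<Longrightarrow> \<not> \<Phi> (observe N p \<theta> \<sigma> \<omega>)"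
  shows "\<P>(D in data_law N p R \<theta> \<sigma>. \<Phi> D) \<le> \<delta>"
proof -
  interpret prob_space R using R unfolding model_law_def by blast
  have sR: "sets R = sets (sample_space N p)" using R unfolding model_law_def by blast
  have obs: "observe N p \<theta> \<sigma> \<in> R \<rightarrow>\<^sub>M sample_space N p"
    using observe_measurable measurable_cong_sets[OF sR refl] by blast
  let ?A = "{D \<in> space (data_law N p R \<theta> \<sigma>). \<Phi> D}"
  show ?thesis
  proof (cases "?A \<in> sets (sample_space N p)")
    case True
    have "measure (data_law N p R \<theta> \<sigma>) ?A = prob (observe N p \<theta> \<sigma> -` ?A \<inter> space R)"
      using True unfolding data_law_def by (intro measure_distr[OF obs]) auto
    also have "\<dots> \<le> prob (space R - E)" using out E(1) by (intro finite_measure_mono) auto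
    also have "\<dots> \<le> \<delta>" using E prob_compl[OF E(1)] by linarith
    finally show ?thesis .
  next
    case False
    \<comment> \<open>A set outside the sigma-algebra has measure 0 by convention.\<close>
    then show ?thesis using \<open>\<delta> \<ge> 0\<close> by (simp add: data_law_def measure_notin_sets)
  qed
qed

lemma data_law_prob_bounds:
  assumes R: "model_law N p R"
  shows "\<P>(D in data_law N p R \<theta> \<sigma>. \<Phi> D) \<le> 1" "0 \<le> \<P>(D in data_law N p R \<theta> \<sigma>. \<Phi> D)"
proof -
  interpret prob_space R using R unfolding model_law_def by blast
  have sR: "sets R = sets (sample_space N p)" using R unfolding model_law_def by blast
  have obs: "observe N p \<theta> \<sigma> \<in> R \<rightarrow>\<^sub>M sample_space N p"
    using observe_measurable measurable_cong_sets[OF sR refl] by blast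
  interpret D: prob_space "data_law N p R \<theta> \<sigma>" unfolding data_law_def by (rule prob_space_distr[OF obs])
  show "\<P>(D in data_law N p R \<theta> \<sigma>. \<Phi> D) \<le> 1" by (rule D.prob_le_1)
qed simp

section \<open>Suprema and infima of risks\<close>

lemma SUP_SUP_le:
  fixes g :: "'b \<Rightarrow> 'c \<Rightarrow> real"
  assumes "A \<noteq> {}" "B \<noteq> {}" "\<And>a b. a \<in> A \<Longrightarrow> b \<in> B \<Longrightarrow> g a b \<le> \<delta>"
  shows "(SUP a\<in>A. SUP b\<in>B. g a b) \<le> \<delta>"
  using assms by (intro cSUP_least) auto

text \<open>Suprema and infima are taken in the reals, where they are meaningful only for nonempty
  bounded sets; that probabilities lie between 0 and 1 supplies the bounds, here the lower bound for
  the infimum over estimators.\<close>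

lemma SUP_SUP_nonneg:
  fixes g :: "'b \<Rightarrow> 'c \<Rightarrow> real"
  assumes "A \<noteq> {}" "B \<noteq> {}" "\<And>a b. 0 \<le> g a b" "\<And>a b. g a b \<le> 1"
  shows "0 \<le> (SUP a\<in>A. SUP b\<in>B. g a b)"
proof -
  obtain a0 b0 where ab: "a0 \<in> A" "b0 \<in> B" using assms by auto
  have b1: "bdd_above (g a ` B)" for a using assms(4) by (intro bdd_aboveI2[of _ _ 1])
  have i0: "0 \<le> (SUP b\<in>B. g a b)" for a
    by (rule cSUP_upper2[OF b1 ab(2) assms(3)])
  have "(SUP b\<in>B. g a b) \<le> 1" for a using assms by (intro cSUP_least) auto
  then have "bdd_above ((\<lambda>a. SUP b\<in>B. g a b) ` A)" by (intro bdd_aboveI2[of _ _ 1])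
  then show ?thesis by (rule cSUP_upper2[OF _ ab(1) i0])
qed

lemma INF_estimators_le:
  fixes g :: "(mtx \<times> vec \<Rightarrow> real) \<Rightarrow> real \<Rightarrow> vec \<Rightarrow> real"
  assumes "T \<in> estimators N p" "B \<noteq> {}" "\<And>T \<sigma> \<theta>. 0 \<le> g T \<sigma> \<theta>" "\<And>T \<sigma> \<theta>. g T \<sigma> \<theta> \<le> 1"
    and le: "\<And>\<sigma> \<theta>. \<sigma> > 0 \<Longrightarrow> \<theta> \<in> B \<Longrightarrow> g T \<sigma> \<theta> \<le> \<delta>"
  shows "(INF T\<in>estimators N p. SUP \<sigma>\<in>{0<..}. SUP \<theta>\<in>B. g T \<sigma> \<theta>) \<le> \<delta>"
proof (rule cINF_lower2[OF _ assms(1)])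
  have ne: "{0::real<..} \<noteq> {}" using zero_less_one by blast
  show "bdd_below ((\<lambda>T. SUP \<sigma>\<in>{0<..}. SUP \<theta>\<in>B. g T \<sigma> \<theta>) ` estimators N p)"
    using assms(2,3,4) ne by (intro bdd_belowI2[of _ 0] SUP_SUP_nonneg) auto
  show "(SUP \<sigma>\<in>{0<..}. SUP \<theta>\<in>B. g T \<sigma> \<theta>) \<le> \<delta>" by (rule SUP_SUP_le[OF ne assms(2) le]) auto
qed

section \<open>From quadratic errors to norm errors and truncation\<close>

lemma inv_sqrt_le_rate:
  assumes n: "n \<ge> 1" and s: "1 \<le> s" "real s \<le> sqrt (real p)"
  defines "\<psi> \<equiv> real s * ln (1 + sqrt (real p) / real s) / real (3 * n)"
  shows "1 / sqrt (real (3 * n)) \<le> 2 * sqrt \<psi>"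
proof -
  note rb = rate_bounds[OF n s, folded \<psi>_def]
  have "1 / real (3 * n) = (1 / real n) / 3" by simp
  then have "1 / real (3 * n) \<le> 2 * \<psi>" using rb(3) by linarith
  then have "1 / real (3 * n) \<le> 4 * \<psi>" using rb(5) by linarith
  then have "sqrt (1 / real (3 * n)) \<le> sqrt (4 * \<psi>)" by (rule real_sqrt_le_mono)
  then show ?thesis by (simp add: real_sqrt_mult real_sqrt_divide)
qed

text \<open>With u = \<sigma>*sqrt \<psi> the error becomes a combination of u^2 and u*l, the form
  in which norm error and truncation can be treated by comparing l with u.\<close>

lemma quadratic_error_le:
  fixes l \<sigma> Cb \<psi> e :: real
  assumes "Cb \<ge> 1" "\<sigma> > 0" "\<psi> > 0" "l \<ge> 0" and N: "1 / sqrt N \<le> 2 * sqrt \<psi>"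
  shows "Cb * (\<sigma>\<^sup>2 * \<psi> + \<sigma> * l / sqrt N) \<le> Cb * ((\<sigma> * sqrt \<psi>)\<^sup>2 + 2 * (\<sigma> * sqrt \<psi>) * l)"
proof (rule mult_left_mono)
  have "\<sigma> * l * (1 / sqrt N) \<le> \<sigma> * l * (2 * sqrt \<psi>)" using N assms by (intro mult_left_mono) auto
  then show "\<sigma>\<^sup>2 * \<psi> + \<sigma> * l / sqrt N \<le> (\<sigma> * sqrt \<psi>)\<^sup>2 + 2 * (\<sigma> * sqrt \<psi>) * l"
    using assms(3) by (simp add: power_mult_distrib mult_ac)
qed (use assms in simp)

text \<open>With q the square root, |q^2 - l^2| = |q - l|*(q + l). For l >= u one divides by l; for
  l < u one uses |q - l| <= q + l and takes a square root.\<close>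

lemma norm_error_of_quadratic_error:
  fixes Q l u Cb :: real
  assumes Cb: "Cb \<ge> 1" and u: "u > 0" and l: "l \<ge> 0" and Q: "\<bar>Q - l\<^sup>2\<bar> \<le> Cb * (u\<^sup>2 + 2 * u * l)"
  shows "\<bar>sqrt \<bar>Q\<bar> - l\<bar> \<le> 3 * Cb * u"
proof -
  let ?q = "sqrt \<bar>Q\<bar>"
  have q: "?q \<ge> 0" "?q\<^sup>2 = \<bar>Q\<bar>" by auto
  have "\<bar>?q\<^sup>2 - l\<^sup>2\<bar> \<le> \<bar>Q - l\<^sup>2\<bar>" unfolding q(2) using zero_le_power2[of l] by linarith
  then have d: "\<bar>?q\<^sup>2 - l\<^sup>2\<bar> \<le> Cb * (u\<^sup>2 + 2 * u * l)" using Q by linarith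
  have f: "\<bar>?q\<^sup>2 - l\<^sup>2\<bar> = \<bar>?q - l\<bar> * (?q + l)"
  proof -
    have "?q\<^sup>2 - l\<^sup>2 = (?q - l) * (?q + l)" by (simp add: power2_eq_square algebra_simps)
    then show ?thesis using q l by (simp add: abs_mult)
  qed
  show ?thesis
  proof (cases "l \<ge> u")
    case True
    have "\<bar>?q - l\<bar> * l \<le> \<bar>?q - l\<bar> * (?q + l)" using q by (intro mult_left_mono) auto
    also have "\<dots> \<le> Cb * (u\<^sup>2 + 2 * u * l)" using d f by linarith
    also have "\<dots> \<le> Cb * (u * l + 2 * u * l)"
      using True u Cb by (intro mult_left_mono) (auto simp: power2_eq_square)
    also have "\<dots> = 3 * Cb * u * l" by simp
    finally show ?thesis using True u by (simp add: mult_le_cancel_right)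
  next
    case False
    have "\<bar>?q - l\<bar>\<^sup>2 = \<bar>?q - l\<bar> * \<bar>?q - l\<bar>" by (simp add: power2_eq_square)
    also have "\<dots> \<le> \<bar>?q - l\<bar> * (?q + l)"
    proof (rule mult_left_mono)
      show "\<bar>?q - l\<bar> \<le> ?q + l" unfolding abs_le_iff using q(1) l by linarith
    qed simp
    also have "\<dots> \<le> Cb * (u\<^sup>2 + 2 * u * l)" using d f by linarith
    also have "\<dots> \<le> Cb * (u * u + 2 * u * u)"
      using False u Cb by (intro mult_left_mono add_mono) (auto simp: power2_eq_square)
    also have "\<dots> \<le> (3 * Cb * u)\<^sup>2"
    proof -
      have "Cb * (3 * (u * u)) \<le> (9 * Cb * Cb) * (u * u)"
      proof -
        have "3 * Cb \<le> 9 * Cb * Cb" using Cb by (intro mult_right_mono) auto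
        then have "3 * Cb * (u * u) \<le> (9 * Cb * Cb) * (u * u)" by (rule mult_right_mono) simp
        then show ?thesis by simp
      qed
      then show ?thesis by (simp add: power2_eq_square)
    qed
    finally have "sqrt (\<bar>?q - l\<bar>\<^sup>2) \<le> sqrt ((3 * Cb * u)\<^sup>2)" by (rule real_sqrt_le_mono)
    then show ?thesis using Cb u by simp
  qed
qed

text \<open>
  Setting the estimator to 0 below the detection level \<open>u\<close> yields the minimum with
  $\|\theta\|_2^2$: above that level the error bound is smaller than the signal.
\<close>

lemma truncated_error:
  fixes Q l u Cb e g w :: real
  assumes Cb: "Cb \<ge> 1" and u: "u > 0" and l: "l \<ge> 0" and Q: "\<bar>Q - l\<^sup>2\<bar> \<le> e" and e: "e \<le> Cb * (u\<^sup>2 + 2 * u * l)"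
    and w: "18 * Cb\<^sup>2 * u\<^sup>2 \<le> w" and g: "e + w \<le> g"
  shows "\<bar>Q * of_bool (\<bar>Q\<bar> > w) - l\<^sup>2\<bar> \<le> min g (l\<^sup>2)"
proof (cases "\<bar>Q\<bar> > w")
  case False
  \<comment> \<open>The truncated estimate is 0, and its error l^2 is at most |Q| + e <= w +
    e.\<close>
  have "l\<^sup>2 \<le> g" using False Q g by auto
  then show ?thesis using False by simp
next
  case True
  have w0: "0 \<le> w" using w by (smt (verit) zero_le_power2 mult_nonneg_nonneg)
  \<comment> \<open>Otherwise l is at most 4*Cb*u, hence e <= 9*Cb^2*u^2 <= w/2, and |Q| <= l^2 + e
    < 2*e <= w contradicts the case. The 18 in the hypothesis is twice this 9.\<close>
  have "e \<le> l\<^sup>2"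
  proof (rule ccontr)
    assume "\<not> e \<le> l\<^sup>2"
    then have lt: "l\<^sup>2 < e" by simp
    have l4: "l \<le> 4 * Cb * u"
    proof (rule ccontr)
      assume "\<not> l \<le> 4 * Cb * u"
      then have h: "4 * Cb * u < l" by simp
      have uC: "u \<le> Cb * u" using Cb u by (simp add: mult_le_cancel_right)
      then have "u \<le> l" using h u by linarith
      then have "Cb * (u\<^sup>2 + 2 * u * l) \<le> Cb * (u * l + 2 * u * l)"
        using u Cb by (intro mult_left_mono) (auto simp: power2_eq_square)
      also have "\<dots> = 3 * (Cb * u) * l" by simp
      also have "\<dots> \<le> l * l"
      proof (rule mult_right_mono)
        show "3 * (Cb * u) \<le> l" using h u uC by linarith
      qed (rule l)
      finally show False using lt e by (simp add: power2_eq_square)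
    qed
    have "e \<le> Cb * (u\<^sup>2 + 2 * u * (4 * Cb * u))"
      using e l4 u Cb by (smt (verit) mult_left_mono mult_nonneg_nonneg)
    also have "\<dots> = Cb * u\<^sup>2 + 8 * Cb\<^sup>2 * u\<^sup>2" by (simp add: power2_eq_square algebra_simps)
    also have "\<dots> \<le> 9 * Cb\<^sup>2 * u\<^sup>2"
    proof -
      have "Cb \<le> Cb\<^sup>2" using Cb by (simp add: power2_eq_square)
      then have "Cb * u\<^sup>2 \<le> Cb\<^sup>2 * u\<^sup>2" by (intro mult_right_mono) auto
      then show ?thesis by linarith
    qed
    finally have "2 * e \<le> w" using w by linarith
    then show False using True Q lt zero_le_power2[of l] by linarith
  qed
  then show ?thesis using True Q g w0 by simp
qed

text \<open>The error bound fails with probability at most 5*\<epsilon>, hence \<epsilon> =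
  \<delta>/5. The maximum with 1 is for the comparisons with the detection level.\<close>

definition Cb_const :: "real \<Rightarrow> real \<Rightarrow> real" where
  "Cb_const K \<delta> = max 1 (Q_const K (\<delta> / 5))"

text \<open>1152 = 72*16: the truncation level uses the estimated noise level, which is at most 4 *
  \<open>noise_bound\<close> * \<sigma>.\<close>

definition risk_const :: "real \<Rightarrow> real \<Rightarrow> real" where
  "risk_const K \<delta> = 1152 * (noise_bound K)\<^sup>2 * (Cb_const K \<delta>)\<^sup>2 + Cb_const K \<delta>"

lemma risk_const_bounds:
  assumes "K > 0"
  shows "Cb_const K \<delta> \<ge> 1" "3 * Cb_const K \<delta> \<le> risk_const K \<delta>" "risk_const K \<delta> > 0"
proof -
  let ?a = "noise_bound K" and ?C = "Cb_const K \<delta>"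
  show C: "?C \<ge> 1" unfolding Cb_const_def by simp
  have "1 \<le> ?a\<^sup>2" using pilot_constants(1)[OF assms] by simp
  then have "1 * ?C\<^sup>2 \<le> ?a\<^sup>2 * ?C\<^sup>2" by (intro mult_right_mono) auto
  moreover have "?C \<le> ?C\<^sup>2" using C by (simp add: power2_eq_square)
  ultimately show "3 * ?C \<le> risk_const K \<delta>" using C unfolding risk_const_def by linarith
  then show "risk_const K \<delta> > 0" using C by linarith
qed

section \<open>Risks under one fixed model\<close>

locale regression =
  fixes n p s :: nat and R :: "(mtx \<times> vec) measure" and K L M \<kappa>0 \<delta> :: real
  assumes R: "model_law (3 * n) p R" and K: "K > 0" "L\<^sup>2 \<le> K\<^sup>2" "M\<^sup>2 \<le> K\<^sup>2"
    and \<xi>: "\<forall>i<3 * n. subgaussian R L (model_var (Inr i))"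
    and X: "\<forall>i<3 * n. \<forall>j<p. subgaussian R M (model_var (Inl (i, j)))"
    and n: "n \<ge> 2" and s: "1 \<le> s" "real s \<le> sqrt (real p)"
    and k: "real s * ln (exp 1 * real p / real s) \<le> 3 * real n * \<kappa>0" "\<kappa>0 \<le> kappa_bar K"
    and \<delta>: "0 < \<delta>" "\<delta> < 1" "ln (2 / (\<delta> / 5)) \<le> re_step K * real n / 32" "ln (2 / (\<delta> / 5)) \<le> real n"
begin

definition rate :: real where
  "rate = real s * ln (1 + sqrt (real p) / real s) / real (3 * n)"

abbreviation "l2 \<theta> \<equiv> L2_set \<theta> {..<p}"

lemma n1: "n \<ge> 1" using n by simp

lemma rate_pos: "rate > 0"
  unfolding rate_def by (rule rate_bounds(5)[OF n1 s])

lemma Q_HD_event: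
  assumes th: "th \<in> sample_space n p \<rightarrow>\<^sub>M vec_space p" and \<theta>: "\<theta> \<in> B0 p s" and \<sigma>: "\<sigma> > 0"
    and pilot: "\<And>\<omega>. regular_design n (Suc p) K (\<lambda>k j. block_entry n p 0 (k, j) \<omega>) \<Longrightarrow>
      good_pilot n p K \<theta> \<sigma> (block_obs n p \<theta> \<sigma> 0 \<omega>) (th (block_obs n p \<theta> \<sigma> 0 \<omega>))"
  shows "\<exists>E\<in>sets R. measure R E \<ge> 1 - \<delta> \<and> (\<forall>\<omega>\<in>E. let D = observe (3 * n) p \<theta> \<sigma> \<omega> in
      \<bar>Q_HD n p s (selection_const K) th D - (l2 \<theta>)\<^sup>2\<bar> \<le> Cb_const K \<delta> * (\<sigma>\<^sup>2 * rate + \<sigma> * l2 \<theta> / sqrt (real (3 * n))) \<and>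
      \<sigma> / 2 \<le> sigma_srs n p th D \<and> sigma_srs n p th D \<le> 4 * noise_bound K * \<sigma>)"
proof -
  have e: "0 < \<delta> / 5" "\<delta> / 5 < 1" using \<delta> by auto
  obtain E where E: "E \<in> sets R" "measure R E \<ge> 1 - 5 * (\<delta> / 5)"
    "\<forall>\<omega>\<in>E. let D = observe (3 * n) p \<theta> \<sigma> \<omega> in
      \<bar>Q_HD n p s (selection_const K) th D - (l2 \<theta>)\<^sup>2\<bar> \<le> Q_const K (\<delta> / 5) * (\<sigma>\<^sup>2 * rate + \<sigma> * l2 \<theta> / sqrt (real (3 * n))) \<and>
      \<sigma> / 2 \<le> sigma_srs n p th D \<and> sigma_srs n p th D \<le> 4 * noise_bound K * \<sigma>"
    using Q_HD_error_prob[OF R K \<xi> X n s k e \<delta>(3,4) th \<theta> \<sigma> pilot] unfolding rate_def by blast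
  have "Q_const K (\<delta> / 5) * (\<sigma>\<^sup>2 * rate + \<sigma> * l2 \<theta> / sqrt (real (3 * n)))
      \<le> Cb_const K \<delta> * (\<sigma>\<^sup>2 * rate + \<sigma> * l2 \<theta> / sqrt (real (3 * n)))"
    unfolding Cb_const_def using \<sigma> rate_pos
    by (intro mult_right_mono add_nonneg_nonneg divide_nonneg_nonneg mult_nonneg_nonneg) (auto simp: L2_set_nonneg)
  then show ?thesis using E by (intro bexI[of _ E] conjI ballI) (auto simp: Let_def intro: order_trans)
qed

lemma error_le_level:
  assumes "\<sigma> > 0"
  shows "Cb_const K \<delta> * (\<sigma>\<^sup>2 * rate + \<sigma> * l2 \<theta> / sqrt (real (3 * n)))
    \<le> Cb_const K \<delta> * ((\<sigma> * sqrt rate)\<^sup>2 + 2 * (\<sigma> * sqrt rate) * l2 \<theta>)"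
proof -
  have N: "1 / sqrt (real (3 * n)) \<le> 2 * sqrt rate"
    unfolding rate_def by (rule inv_sqrt_le_rate[OF n1 s])
  show ?thesis
    by (rule quadratic_error_le[OF risk_const_bounds(1)[OF K(1)] assms rate_pos L2_set_nonneg N])
qed

lemma srs_risk:
  assumes th: "srs_estimator n p (slope_const K) th" and \<theta>: "\<theta> \<in> B0 p s" and \<sigma>: "\<sigma> > 0"
  shows "\<P>(D in data_law (3 * n) p R \<theta> \<sigma>. \<bar>Lambda_HD n p s (selection_const K) th D - l2 \<theta>\<bar> > risk_const K \<delta> * \<sigma> * sqrt rate) \<le> \<delta>"
    and "\<P>(D in data_law (3 * n) p R \<theta> \<sigma>. \<bar>Q_HD n p s (selection_const K) th D - (l2 \<theta>)\<^sup>2\<bar>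
      > risk_const K \<delta> * (\<sigma>\<^sup>2 * rate + \<sigma> * l2 \<theta> / sqrt (real (3 * n)))) \<le> \<delta>"
proof -
  have thmeas: "th \<in> sample_space n p \<rightarrow>\<^sub>M vec_space p" using th unfolding srs_estimator_def by blast
  have pil: "good_pilot n p K \<theta> \<sigma> (block_obs n p \<theta> \<sigma> 0 \<omega>) (th (block_obs n p \<theta> \<sigma> 0 \<omega>))"
    if "regular_design n (Suc p) K (\<lambda>k j. block_entry n p 0 (k, j) \<omega>)" for \<omega>
    by (rule srs_good_pilot[OF K(1) that n1 s k \<sigma> \<theta> th])
  obtain E where E: "E \<in> sets R" "measure R E \<ge> 1 - \<delta>"
    and Q: "\<And>\<omega>. \<omega> \<in> E \<Longrightarrow>
      \<bar>Q_HD n p s (selection_const K) th (observe (3 * n) p \<theta> \<sigma> \<omega>) - (l2 \<theta>)\<^sup>2\<bar> \<le> Cb_const K \<delta> * (\<sigma>\<^sup>2 * rate + \<sigma> * l2 \<theta> / sqrt (real (3 * n))) \<and>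
      \<sigma> / 2 \<le> sigma_srs n p th (observe (3 * n) p \<theta> \<sigma> \<omega>) \<and> sigma_srs n p th (observe (3 * n) p \<theta> \<sigma> \<omega>) \<le> 4 * noise_bound K * \<sigma>"
    using Q_HD_event[OF thmeas \<theta> \<sigma> pil] unfolding Let_def by blast
  note C = risk_const_bounds[OF K(1), of \<delta>]
  have u: "\<sigma> * sqrt rate > 0" using \<sigma> rate_pos by simp
  show "\<P>(D in data_law (3 * n) p R \<theta> \<sigma>. \<bar>Lambda_HD n p s (selection_const K) th D - l2 \<theta>\<bar> > risk_const K \<delta> * \<sigma> * sqrt rate) \<le> \<delta>"
  proof (rule data_law_prob_le[OF R E])
    fix \<omega> assume w: "\<omega> \<in> E"
    let ?D = "observe (3 * n) p \<theta> \<sigma> \<omega>"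
    have "\<bar>Q_HD n p s (selection_const K) th ?D - (l2 \<theta>)\<^sup>2\<bar> \<le> Cb_const K \<delta> * ((\<sigma> * sqrt rate)\<^sup>2 + 2 * (\<sigma> * sqrt rate) * l2 \<theta>)"
      using Q[OF w] error_le_level[OF \<sigma>, of \<theta>] by linarith
    from norm_error_of_quadratic_error[OF C(1) u L2_set_nonneg this]
    have "\<bar>Lambda_HD n p s (selection_const K) th ?D - l2 \<theta>\<bar> \<le> 3 * Cb_const K \<delta> * (\<sigma> * sqrt rate)"
      unfolding Lambda_HD_def .
    also have "\<dots> \<le> risk_const K \<delta> * (\<sigma> * sqrt rate)" using C(2) u by (intro mult_right_mono) auto
    finally show "\<not> \<bar>Lambda_HD n p s (selection_const K) th ?D - l2 \<theta>\<bar> > risk_const K \<delta> * \<sigma> * sqrt rate"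
      by (simp add: mult.assoc)
  qed (use \<delta> in simp)
  show "\<P>(D in data_law (3 * n) p R \<theta> \<sigma>. \<bar>Q_HD n p s (selection_const K) th D - (l2 \<theta>)\<^sup>2\<bar>
      > risk_const K \<delta> * (\<sigma>\<^sup>2 * rate + \<sigma> * l2 \<theta> / sqrt (real (3 * n)))) \<le> \<delta>"
  proof (rule data_law_prob_le[OF R E])
    fix \<omega> assume w: "\<omega> \<in> E"
    have "Cb_const K \<delta> * (\<sigma>\<^sup>2 * rate + \<sigma> * l2 \<theta> / sqrt (real (3 * n)))
        \<le> risk_const K \<delta> * (\<sigma>\<^sup>2 * rate + \<sigma> * l2 \<theta> / sqrt (real (3 * n)))"
      using C \<sigma> rate_pos
      by (intro mult_right_mono add_nonneg_nonneg divide_nonneg_nonneg mult_nonneg_nonneg) (auto simp: L2_set_nonneg)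
    then show "\<not> \<bar>Q_HD n p s (selection_const K) th (observe (3 * n) p \<theta> \<sigma> \<omega>) - (l2 \<theta>)\<^sup>2\<bar>
        > risk_const K \<delta> * (\<sigma>\<^sup>2 * rate + \<sigma> * l2 \<theta> / sqrt (real (3 * n)))"
      using Q[OF w] by linarith
  qed (use \<delta> in simp)
qed

text \<open>72 = 4*18: since the estimated noise level is at least \<sigma>/2, the cutoff reaches
  the level that \<open>truncated_error\<close> requires.\<close>

definition truncated_Q :: "mtx \<times> vec \<Rightarrow> real" where
  "truncated_Q D = (let th = lasso_pilot n p (slope_const K); Q = Q_HD n p s (selection_const K) th D
     in Q * of_bool (\<bar>Q\<bar> > 72 * (Cb_const K \<delta>)\<^sup>2 * (sigma_srs n p th D)\<^sup>2 * rate))"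

lemma truncated_Q_estimator: "truncated_Q \<in> estimators (3 * n) p"
proof -
  let ?th = "lasso_pilot n p (slope_const K)" and ?S = "sample_space (3 * n) p"
  note th = lasso_pilot_measurable[of n p "slope_const K"]
  have sub: "subsample n p b \<in> ?S \<rightarrow>\<^sub>M sample_space n p" if "b < 3" for b using that by (rule subsample_measurable)
  have sub0: "subsample n p 0 \<in> ?S \<rightarrow>\<^sub>M sample_space n p" and sub1: "subsample n p 1 \<in> ?S \<rightarrow>\<^sub>M sample_space n p"
    and sub2: "subsample n p 2 \<in> ?S \<rightarrow>\<^sub>M sample_space n p" by (rule sub; simp)+
  have [measurable]: "(\<lambda>D. Q_HD n p s (selection_const K) ?th D) \<in> borel_measurable ?S"
    unfolding Q_HD_blocks
    by (intro borel_measurable_sum borel_measurable_times of_bool_measurable selected_measurable[OF th sub0 sub2]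
      a_block_measurable[OF sub1 th_component_measurable[OF th sub0]]) auto
  have eq: "sigma_srs n p ?th D = resid_scale n p (subsample n p 0 D) (?th (subsample n p 0 D))" for D
    by (simp only: sigma_srs_def theta_srs_def resid_scale_def)
  have [measurable]: "(\<lambda>D. sigma_srs n p ?th D) \<in> borel_measurable ?S"
    unfolding eq by (rule resid_scale_measurable[OF sub0 th_component_measurable[OF th sub0]])
  show ?thesis unfolding estimators_def truncated_Q_def[abs_def] Let_def of_bool_def by measurable
qed

text \<open>One bound for both minimax statements: b is either the norm of \<theta> or the radius
  \<kappa>, and the minimum is increasing in b.\<close>

lemma truncated_Q_risk:
  assumes \<theta>: "\<theta> \<in> B0 p s" and \<sigma>: "\<sigma> > 0" and b: "l2 \<theta> \<le> b"
  shows "\<P>(D in data_law (3 * n) p R \<theta> \<sigma>. \<bar>truncated_Q D - (l2 \<theta>)\<^sup>2\<bar>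
      > min (risk_const K \<delta> * (\<sigma>\<^sup>2 * rate + \<sigma> * b / sqrt (real (3 * n)))) (b\<^sup>2)) \<le> \<delta>"
proof -
  let ?th = "lasso_pilot n p (slope_const K)" and ?C = "Cb_const K \<delta>" and ?a = "noise_bound K"
  have pil: "good_pilot n p K \<theta> \<sigma> (block_obs n p \<theta> \<sigma> 0 \<omega>) (?th (block_obs n p \<theta> \<sigma> 0 \<omega>))"
    if "regular_design n (Suc p) K (\<lambda>k j. block_entry n p 0 (k, j) \<omega>)" for \<omega>
    by (rule lasso_good_pilot[OF K(1) that n1 s k \<sigma> \<theta>])
  obtain E where E: "E \<in> sets R" "measure R E \<ge> 1 - \<delta>"
    and Q: "\<And>\<omega>. \<omega> \<in> E \<Longrightarrow>
      \<bar>Q_HD n p s (selection_const K) ?th (observe (3 * n) p \<theta> \<sigma> \<omega>) - (l2 \<theta>)\<^sup>2\<bar> \<le> Cb_const K \<delta> * (\<sigma>\<^sup>2 * rate + \<sigma> * l2 \<theta> / sqrt (real (3 * n))) \<and>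
      \<sigma> / 2 \<le> sigma_srs n p ?th (observe (3 * n) p \<theta> \<sigma> \<omega>) \<and> sigma_srs n p ?th (observe (3 * n) p \<theta> \<sigma> \<omega>) \<le> 4 * noise_bound K * \<sigma>"
    using Q_HD_event[OF lasso_pilot_measurable \<theta> \<sigma> pil] unfolding Let_def by blast
  note C = risk_const_bounds[OF K(1), of \<delta>]
  have u: "\<sigma> * sqrt rate > 0" using \<sigma> rate_pos by simp
  have u2: "(\<sigma> * sqrt rate)\<^sup>2 = \<sigma>\<^sup>2 * rate" using rate_pos by (simp add: power_mult_distrib)
  have l0: "l2 \<theta> \<ge> 0" by (rule L2_set_nonneg)
  have rp: "rate \<ge> 0" using rate_pos by simp
  show ?thesis
  proof (rule data_law_prob_le[OF R E])
    fix \<omega> assume w: "\<omega> \<in> E"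
    let ?D = "observe (3 * n) p \<theta> \<sigma> \<omega>"
    define sg where "sg = sigma_srs n p ?th ?D"
    have sg: "\<sigma> / 2 \<le> sg" "sg \<le> 4 * ?a * \<sigma>" using Q[OF w] unfolding sg_def by auto
    have "18 * ?C\<^sup>2 * (\<sigma> * sqrt rate)\<^sup>2 = 72 * ?C\<^sup>2 * (\<sigma> / 2)\<^sup>2 * rate" unfolding u2 by (simp add: power_divide)
    also have "\<dots> \<le> 72 * ?C\<^sup>2 * sg\<^sup>2 * rate" using sg \<sigma> rp by (intro mult_right_mono mult_left_mono power_mono) auto
    finally have lo: "18 * ?C\<^sup>2 * (\<sigma> * sqrt rate)\<^sup>2 \<le> 72 * ?C\<^sup>2 * sg\<^sup>2 * rate" .
    have "72 * ?C\<^sup>2 * sg\<^sup>2 * rate \<le> 72 * ?C\<^sup>2 * (4 * ?a * \<sigma>)\<^sup>2 * rate"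
      using sg \<sigma> rp by (intro mult_right_mono mult_left_mono power_mono) auto
    also have "\<dots> = 1152 * ?a\<^sup>2 * ?C\<^sup>2 * (\<sigma>\<^sup>2 * rate)" by (simp add: power_mult_distrib)
    also have "\<dots> \<le> 1152 * ?a\<^sup>2 * ?C\<^sup>2 * (\<sigma>\<^sup>2 * rate + \<sigma> * l2 \<theta> / sqrt (real (3 * n)))"
      using \<sigma> l0 by (intro mult_left_mono) auto
    finally have up: "?C * (\<sigma>\<^sup>2 * rate + \<sigma> * l2 \<theta> / sqrt (real (3 * n))) + 72 * ?C\<^sup>2 * sg\<^sup>2 * rate
        \<le> risk_const K \<delta> * (\<sigma>\<^sup>2 * rate + \<sigma> * l2 \<theta> / sqrt (real (3 * n)))"
      unfolding risk_const_def by (simp add: distrib_right)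
    have "\<bar>truncated_Q ?D - (l2 \<theta>)\<^sup>2\<bar> \<le> min (risk_const K \<delta> * (\<sigma>\<^sup>2 * rate + \<sigma> * l2 \<theta> / sqrt (real (3 * n)))) ((l2 \<theta>)\<^sup>2)"
      unfolding truncated_Q_def Let_def sg_def[symmetric]
      by (rule truncated_error[OF C(1) u l0 _ error_le_level[OF \<sigma>] lo up]) (use Q[OF w] in blast)
    also have "\<dots> \<le> min (risk_const K \<delta> * (\<sigma>\<^sup>2 * rate + \<sigma> * b / sqrt (real (3 * n)))) (b\<^sup>2)"
      using b l0 \<sigma> C(3) by (intro min.mono mult_left_mono add_left_mono divide_right_mono power_mono) auto
    finally show "\<not> \<bar>truncated_Q ?D - (l2 \<theta>)\<^sup>2\<bar> > min (risk_const K \<delta> * (\<sigma>\<^sup>2 * rate + \<sigma> * b / sqrt (real (3 * n)))) (b\<^sup>2)"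
      by (simp only: not_less)
  qed (use \<delta> in simp)
qed

end

theorem corollary5:
  fixes L M :: real
  assumes "L > 0" and "M > 0"
  shows "\<exists>\<kappa>bar>0. \<forall>\<kappa>0. 0 < \<kappa>0 \<and> \<kappa>0 \<le> \<kappa>bar \<longrightarrow>
    (\<exists>c>0. \<exists>\<alpha>>0. \<forall>\<gamma>>0. \<forall>\<delta>. 0 < \<delta> \<and> \<delta> < 1 \<longrightarrow>
    (\<exists>C>0. \<exists>N0::nat. \<forall>N n p s :: nat. \<forall>R :: (mtx \<times> vec) measure.
      N = 3 * n \<longrightarrow> N \<ge> N0 \<longrightarrow> p \<ge> 2 \<longrightarrow> real p \<ge> \<gamma> * real n \<longrightarrow>
      1 \<le> s \<longrightarrow> real s \<le> sqrt (real p) \<longrightarrow>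
      real s * ln (exp 1 * real p / real s) / real N \<le> \<kappa>0 \<longrightarrow>
      model_law N p R \<longrightarrow>
      (\<forall>i<N. subgaussian R L (model_var (Inr i))) \<longrightarrow>
      (\<forall>i<N. \<forall>j<p. subgaussian R M (model_var (Inl (i, j)))) \<longrightarrow>
      (let \<psi> = real s * ln (1 + sqrt (real p) / real s) / real N;
           l2 = (\<lambda>\<theta>. L2_set \<theta> {..<p});
           P = data_law N p R
       in
         (\<forall>th. srs_estimator n p c th \<longrightarrow>
            (SUP \<sigma>\<in>{0<..}. SUP \<theta>\<in>B0 p s.
               \<P>(D in P \<theta> \<sigma>. \<bar>Lambda_HD n p s \<alpha> th D - l2 \<theta>\<bar> > C * \<sigma> * sqrt \<psi>)) \<le> \<delta> \<and>
            (SUP \<sigma>\<in>{0<..}. SUP \<theta>\<in>B0 p s.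
               \<P>(D in P \<theta> \<sigma>. \<bar>Q_HD n p s \<alpha> th D - (l2 \<theta>)\<^sup>2\<bar>
                  > C * (\<sigma>\<^sup>2 * \<psi> + \<sigma> * l2 \<theta> / sqrt (real N)))) \<le> \<delta>) \<and>
         (INF T\<in>estimators N p. SUP \<sigma>\<in>{0<..}. SUP \<theta>\<in>B0 p s.
            \<P>(D in P \<theta> \<sigma>. \<bar>T D - (l2 \<theta>)\<^sup>2\<bar>
               > min (C * (\<sigma>\<^sup>2 * \<psi> + \<sigma> * l2 \<theta> / sqrt (real N))) ((l2 \<theta>)\<^sup>2))) \<le> \<delta> \<and>
         (\<forall>\<kappa>>0.
            (INF T\<in>estimators N p. SUP \<sigma>\<in>{0<..}. SUP \<theta>\<in>{\<theta> \<in> B0 p s. l2 \<theta> \<le> \<kappa>}.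
               \<P>(D in P \<theta> \<sigma>. \<bar>T D - (l2 \<theta>)\<^sup>2\<bar>
                  > min (C * (\<sigma>\<^sup>2 * \<psi> + \<sigma> * \<kappa> / sqrt (real N))) (\<kappa>\<^sup>2))) \<le> \<delta>))))"
proof -
  \<comment> \<open>One constant dominating both subGaussian constants; the 1 makes it positive at
    once.\<close>
  define K where "K = max 1 (max L M)"
  have K: "K > 0" "L\<^sup>2 \<le> K\<^sup>2" "M\<^sup>2 \<le> K\<^sup>2"
    unfolding K_def using assms by (auto intro!: power_mono)
  have al: "selection_const K > 0"
    unfolding selection_const_def using pilot_constants(1)[OF K(1)] Csq_gt K(1) by (intro mult_pos_pos) auto
  \<comment> \<open>The summand 2 gives n >= 2 for the U-statistic; the ceilings make the confidence
    terms small relative to n.\<close>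
  define n0 :: "real \<Rightarrow> nat" where
    "n0 \<delta> = 2 + nat \<lceil>32 * ln (2 / (\<delta> / 5)) / re_step K\<rceil> + nat \<lceil>ln (2 / (\<delta> / 5))\<rceil>" for \<delta>
  have main: "regression n p s R K L M \<kappa>0 \<delta>"
    if "3 * n \<ge> 3 * n0 \<delta>" "1 \<le> s" "real s \<le> sqrt (real p)"
      "real s * ln (exp 1 * real p / real s) / real (3 * n) \<le> \<kappa>0" "\<kappa>0 \<le> kappa_bar K" "0 < \<delta>" "\<delta> < 1"
      "model_law (3 * n) p R" "\<forall>i<3 * n. subgaussian R L (model_var (Inr i))"
      "\<forall>i<3 * n. \<forall>j<p. subgaussian R M (model_var (Inl (i, j)))" for n p s R \<kappa>0 \<delta>
  proof
    have n: "n \<ge> n0 \<delta>" using that(1) by simp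
    then show n2: "2 \<le> n" unfolding n0_def by simp
    have t: "re_step K > 0" by (rule re_constants_pos(1)[OF K(1)])
    have "real (nat \<lceil>32 * ln (2 / (\<delta> / 5)) / re_step K\<rceil>) \<le> real n" "real (nat \<lceil>ln (2 / (\<delta> / 5))\<rceil>) \<le> real n"
      using n unfolding n0_def by linarith+
    then have "32 * ln (2 / (\<delta> / 5)) / re_step K \<le> real n" and l: "ln (2 / (\<delta> / 5)) \<le> real n"
      using real_nat_ceiling_ge[of "32 * ln (2 / (\<delta> / 5)) / re_step K"] real_nat_ceiling_ge[of "ln (2 / (\<delta> / 5))"] by linarith+
    then show "ln (2 / (\<delta> / 5)) \<le> re_step K * real n / 32" using t by (simp add: field_simps)
    show "ln (2 / (\<delta> / 5)) \<le> real n" by (rule l)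
    show "real s * ln (exp 1 * real p / real s) \<le> 3 * real n * \<kappa>0"
      using that(4) n2 by (simp add: field_simps)
  qed (use that K in blast)+
  have ne: "{0::real<..} \<noteq> {}" using zero_less_one by blast
  \<comment> \<open>The zero vector makes all parameter sets nonempty, as the real suprema
    require.\<close>
  have zero: "(\<lambda>j\<in>{..<p}. 0) \<in> B0 p s" "L2_set (\<lambda>j\<in>{..<p}. 0 :: real) {..<p} = 0" for p s :: nat
    unfolding B0_def L2_set_def by auto
  show ?thesis
  proof (rule exI[of _ "kappa_bar K"], rule conjI[OF pilot_constants(3)[OF K(1)]], rule allI, rule impI,
      rule exI[of _ "slope_const K"], rule conjI[OF pilot_constants(2)[OF K(1)]],
      rule exI[of _ "selection_const K"], rule conjI[OF al], rule allI, rule impI, rule allI, rule impI,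
      rule exI[of _ "risk_const K _"], rule conjI[OF risk_const_bounds(3)[OF K(1)]],
      rule exI[of _ "3 * n0 _"], intro allI impI)
    fix \<kappa>0 \<gamma> \<delta> :: real and N n p s :: nat and R :: "(mtx \<times> vec) measure"
    assume \<kappa>0: "0 < \<kappa>0 \<and> \<kappa>0 \<le> kappa_bar K" and \<delta>: "0 < \<delta> \<and> \<delta> < 1" and N: "N = 3 * n" "3 * n0 \<delta> \<le> N"
      and s: "1 \<le> s" "real s \<le> sqrt (real p)" "real s * ln (exp 1 * real p / real s) / real N \<le> \<kappa>0"
      and R: "model_law N p R" "\<forall>i<N. subgaussian R L (model_var (Inr i))"
        "\<forall>i<N. \<forall>j<p. subgaussian R M (model_var (Inl (i, j)))"
    interpret regression n p s R K L M \<kappa>0 \<delta>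
      by (rule main) (use N s R \<kappa>0 \<delta> in auto)
    let ?P = "data_law (3 * n) p R"
    note pb = data_law_prob_bounds[OF R(1)[unfolded N(1)]]
    have BO: "B0 p s \<noteq> {}" using zero(1) by blast
    \<comment> \<open>Here b is a function of \<theta>, which covers the norm as well as a constant
      radius.\<close>
    have cd: "(INF T\<in>estimators (3 * n) p. SUP \<sigma>\<in>{0<..}. SUP \<theta>\<in>B.
        \<P>(D in ?P \<theta> \<sigma>. \<bar>T D - (l2 \<theta>)\<^sup>2\<bar> > min (risk_const K \<delta> * (\<sigma>\<^sup>2 * rate + \<sigma> * b \<theta> / sqrt (real (3 * n)))) ((b \<theta>)\<^sup>2))) \<le> \<delta>"
      if B: "B \<noteq> {}" "\<And>\<theta>. \<theta> \<in> B \<Longrightarrow> \<theta> \<in> B0 p s \<and> l2 \<theta> \<le> b \<theta>" for B b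
      by (rule INF_estimators_le[OF truncated_Q_estimator B(1) pb(2,1)]) (rule truncated_Q_risk; use B(2) in blast)
    show "let \<psi> = real s * ln (1 + sqrt (real p) / real s) / real N;
           l2 = (\<lambda>\<theta>. L2_set \<theta> {..<p});
           P = data_law N p R
       in
         (\<forall>th. srs_estimator n p (slope_const K) th \<longrightarrow>
            (SUP \<sigma>\<in>{0<..}. SUP \<theta>\<in>B0 p s.
               \<P>(D in P \<theta> \<sigma>. \<bar>Lambda_HD n p s (selection_const K) th D - l2 \<theta>\<bar> > risk_const K \<delta> * \<sigma> * sqrt \<psi>)) \<le> \<delta> \<and>
            (SUP \<sigma>\<in>{0<..}. SUP \<theta>\<in>B0 p s.
               \<P>(D in P \<theta> \<sigma>. \<bar>Q_HD n p s (selection_const K) th D - (l2 \<theta>)\<^sup>2\<bar>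
                  > risk_const K \<delta> * (\<sigma>\<^sup>2 * \<psi> + \<sigma> * l2 \<theta> / sqrt (real N)))) \<le> \<delta>) \<and>
         (INF T\<in>estimators N p. SUP \<sigma>\<in>{0<..}. SUP \<theta>\<in>B0 p s.
            \<P>(D in P \<theta> \<sigma>. \<bar>T D - (l2 \<theta>)\<^sup>2\<bar>
               > min (risk_const K \<delta> * (\<sigma>\<^sup>2 * \<psi> + \<sigma> * l2 \<theta> / sqrt (real N))) ((l2 \<theta>)\<^sup>2))) \<le> \<delta> \<and>
         (\<forall>\<kappa>>0.
            (INF T\<in>estimators N p. SUP \<sigma>\<in>{0<..}. SUP \<theta>\<in>{\<theta> \<in> B0 p s. l2 \<theta> \<le> \<kappa>}.
               \<P>(D in P \<theta> \<sigma>. \<bar>T D - (l2 \<theta>)\<^sup>2\<bar>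
                  > min (risk_const K \<delta> * (\<sigma>\<^sup>2 * \<psi> + \<sigma> * \<kappa> / sqrt (real N))) (\<kappa>\<^sup>2))) \<le> \<delta>)"
      unfolding Let_def N(1) rate_def[symmetric]
    proof (intro conjI allI impI)
      fix th assume th: "srs_estimator n p (slope_const K) th"
      show "(SUP \<sigma>\<in>{0<..}. SUP \<theta>\<in>B0 p s.
          \<P>(D in ?P \<theta> \<sigma>. \<bar>Lambda_HD n p s (selection_const K) th D - l2 \<theta>\<bar> > risk_const K \<delta> * \<sigma> * sqrt rate)) \<le> \<delta>"
        by (rule SUP_SUP_le[OF ne BO]) (rule srs_risk(1)[OF th], simp_all)
      show "(SUP \<sigma>\<in>{0<..}. SUP \<theta>\<in>B0 p s.
          \<P>(D in ?P \<theta> \<sigma>. \<bar>Q_HD n p s (selection_const K) th D - (l2 \<theta>)\<^sup>2\<bar>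
            > risk_const K \<delta> * (\<sigma>\<^sup>2 * rate + \<sigma> * l2 \<theta> / sqrt (real (3 * n))))) \<le> \<delta>"
        by (rule SUP_SUP_le[OF ne BO]) (rule srs_risk(2)[OF th], simp_all)
    next
      show "(INF T\<in>estimators (3 * n) p. SUP \<sigma>\<in>{0<..}. SUP \<theta>\<in>B0 p s.
          \<P>(D in ?P \<theta> \<sigma>. \<bar>T D - (l2 \<theta>)\<^sup>2\<bar>
            > min (risk_const K \<delta> * (\<sigma>\<^sup>2 * rate + \<sigma> * l2 \<theta> / sqrt (real (3 * n)))) ((l2 \<theta>)\<^sup>2))) \<le> \<delta>"
        by (rule cd[OF BO]) simp
    next
      fix \<kappa> :: real assume "\<kappa> > 0"
      then have "{\<theta> \<in> B0 p s. l2 \<theta> \<le> \<kappa>} \<noteq> {}" using zero(1)[of p s] zero(2)[of p] by force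
      then show "(INF T\<in>estimators (3 * n) p. SUP \<sigma>\<in>{0<..}. SUP \<theta>\<in>{\<theta> \<in> B0 p s. l2 \<theta> \<le> \<kappa>}.
          \<P>(D in ?P \<theta> \<sigma>. \<bar>T D - (l2 \<theta>)\<^sup>2\<bar>
            > min (risk_const K \<delta> * (\<sigma>\<^sup>2 * rate + \<sigma> * \<kappa> / sqrt (real (3 * n)))) (\<kappa>\<^sup>2))) \<le> \<delta>"
        by (rule cd) simp
    qed
  qed
qed

end
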